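(* The map $F^\epsilon:\mathcal{D}^\epsilon\to\mathbb{H}_2$, $(\tau_1,\tau_2,\epsilon)\mapsto\Omega^{(2)}(\tau_1,\tau_2,\epsilon)$, is equivariant with respect to the action of $G\cong(SL(2,\mathbb{Z})\times SL(2,\mathbb{Z}))\rtimes\mathbb{Z}_2$; that is, for all $\gamma\in G$ and $x\in\mathcal{D}^\epsilon$, $F^\epsilon(\gamma.x)=\gamma.F^\epsilon(x)$.
   Context: $\mathbb{H}_1$ is the upper half-plane, $\mathbb{H}_2$ the genus 2 Siegel upper half-space. $\Lambda_\tau$ is the lattice with basis $(2\pi i\tau,2\pi i)$, $D(\Lambda)=\min_{0\ne\lambda\in\Lambda}|\lambda|$, and $\mathcal{D}^\epsilon=\{(\tau_1,\tau_2,\epsilon)\in\mathbb{H}_1\times\mathbb{H}_1\times\mathbb{C}\mid|\epsilon|<\frac14D(\Lambda_{\tau_1})D(\Lambda_{\tau_2})\}$. The map $F^\epsilon$: $\Omega^{(2)}(\tau_1,\tau_2,\epsilon)$ is the period matrix of the genus two surface obtained from the tori $\mathcal{S}_a=\mathbb{C}/\Lambda_{\tau_a}$ (coordinate $z_a$ at the origin, $r_a<\frac12D(\Lambda_{\tau_a})$, $|\epsilon|\le r_1r_2$) by excising $|z_a|\le|\epsilon|/r_{\bar a}$ ($\bar1=2,\bar2=1$) and identifying the annuli $|\epsilon|/r_{\bar a}\le|z_a|\le r_a$ via $z_1z_2=\epsilon$, with homology basis inherited from the tori ($a_a$, $b_a$ having periods $2\pi i$, $2\pi i\tau_a$), $\Omega^{(2)}_{ij}=\frac1{2\pi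 i}\oint_{b_i}\nu_j$, $\oint_{a_i}\nu_j=2\pi i\delta_{ij}$. Explicitly, $$2\pi i\Omega_{11}^{(2)}=2\pi i\tau_1+\epsilon(A_2(I-A_1A_2)^{-1})(1,1),\quad2\pi i\Omega_{22}^{(2)}=2\pi i\tau_2+\epsilon(A_1(I-A_2A_1)^{-1})(1,1),\quad2\pi i\Omega_{12}^{(2)}=-\epsilon(I-A_1A_2)^{-1}(1,1),$$ where $A_a$ is the infinite matrix $A_a(k,l)=\frac{\epsilon^{(k+l)/2}}{\sqrt{kl}}(-1)^{k+1}\frac{(k+l-1)!}{(k-1)!(l-1)!}E_{k+l}(\tau_a)$, $k,l\ge1$, with $E_k=0$ for $k$ odd and $E_k(\tau)=-\frac{B_k}{k!}+\frac{2}{(k-1)!}\sum_{n\ge1}\sigma_{k-1}(n)e^{2\pi in\tau}$ for $k$ even, inverses being given by geometric series. The group $G$ is the subgroup of $Sp(4,\mathbb{Z})$ generated by $$\Gamma_1=\left\{\begin{pmatrix}a_1&0&b_1&0\\0&1&0&0\\c_1&0&d_1&0\\0&0&0&1\end{pmatrix}\right\},\quad\Gamma_2=\left\{\begin{pmatrix}1&0&0&0\\0&a_2&0&b_2\\0&0&1&0\\0&c_2&0&d_2\end{pmatrix}\right\},\quad\beta=\begin{pmatrix}0&1&0&0\\1&0&0&0\\0&0&0&1\\0&0&1&0\end{pmatrix},$$ with $\gamma_i=\begin{pmatrix}a_i&b_i\\c_i&d_i\end{pmatrix}\in SL(2,\mathbb{Z})$. It acts on $\mathbb{H}_2$ by $\begin{pmatrix}A&B\\C&D\end{pmatrix}.\Omega=(A\Omega+B)(C\Omega+D)^{-1}$,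 and on $\mathcal{D}^\epsilon$ (left action) by $$\gamma_1.(\tau_1,\tau_2,\epsilon)=\Big(\gamma_1\tau_1,\tau_2,\frac{\epsilon}{c_1\tau_1+d_1}\Big),\quad\gamma_2.(\tau_1,\tau_2,\epsilon)=\Big(\tau_1,\gamma_2\tau_2,\frac{\epsilon}{c_2\tau_2+d_2}\Big),\quad\beta.(\tau_1,\tau_2,\epsilon)=(\tau_2,\tau_1,\epsilon),$$ where $\gamma_i\tau_i=\frac{a_i\tau_i+b_i}{c_i\tau_i+d_i}$. *)

theory Defs
  imports
    "HOL-Complex_Analysis.Complex_Analysis"
    "HOL-Algebra.Group_Action"
    "HOL-Algebra.Generated_Groups"
    "HOL-Algebra.Elementary_Groups"
begin

(* the notation clashes with vec_nth *)
no_notation fps_nth (infixl \<open>$\<close> 75)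

section \<open>Lattices and the domain\<close>

definition upper_half_plane :: "complex set" where
  "upper_half_plane = {\<tau>. Im \<tau> > 0}"

definition torus_lattice :: "complex \<Rightarrow> complex set" where
  "torus_lattice \<tau> = {2 * of_real pi * \<i> * (of_int m * \<tau> + of_int n) | m n. True}"

text \<open>The infimum is a minimum, as the lattice is discrete.\<close>

definition lattice_min :: "complex \<Rightarrow> real" where
  "lattice_min \<tau> = Inf (norm ` (torus_lattice \<tau> - {0}))"

definition D_eps :: "(complex \<times> complex \<times> complex) set" where
  "D_eps = {(\<tau>1, \<tau>2, \<epsilon>). \<tau>1 \<in> upper_half_plane \<and> \<tau>2 \<in> upper_half_plane \<and>
              norm \<epsilon> < 1/4 * lattice_min \<tau>1 * lattice_min \<tau>2}"

definition siegel_H2 :: "(complex^2^2) set" where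
  "siegel_H2 = {\<Omega>. transpose \<Omega> = \<Omega> \<and>
      (\<forall>v::real^2. v \<noteq> 0 \<longrightarrow> v \<bullet> ((\<chi> i j. Im (\<Omega> $ i $ j)) *v v) > 0)}"


section \<open>The map to the Siegel upper half-space\<close>

definition bernoulli_number :: "nat \<Rightarrow> real" where
  "bernoulli_number k = fact k * fps_nth (fps_X / (fps_exp 1 - 1)) k"

definition sigma_div :: "nat \<Rightarrow> nat \<Rightarrow> nat" where
  "sigma_div s n = (\<Sum>d | d dvd n. d ^ s)"

definition eisenstein_E :: "nat \<Rightarrow> complex \<Rightarrow> complex" where
  "eisenstein_E k \<tau> =
     (if odd k then 0
      else - of_real (bernoulli_number k) / fact k +
           2 / fact (k - 1) *
           (\<Sum>n. of_nat (sigma_div (k - 1) (Suc n)) * exp (2 * of_real pi * \<i> * of_nat (Suc n) * \<tau>)))"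

text \<open>Infinite matrices are functions of two indices \<open>k, l \<ge> 1\<close>; values at index \<open>0\<close> are irrelevant.\<close>

type_synonym inf_mat = "nat \<Rightarrow> nat \<Rightarrow> complex"

definition inf_mat_mult :: "inf_mat \<Rightarrow> inf_mat \<Rightarrow> inf_mat" (infixl \<open>\<star>\<close> 70) where
  "(X \<star> Y) k l = (\<Sum>\<^sub>\<infinity>m\<in>{1..}. X k m * Y m l)"

definition inf_mat_one :: inf_mat where
  "inf_mat_one k l = (if k = l then 1 else 0)"

primrec inf_mat_power :: "inf_mat \<Rightarrow> nat \<Rightarrow> inf_mat" where
  "inf_mat_power X 0 = inf_mat_one"
| "inf_mat_power X (Suc n) = inf_mat_power X n \<star> X"

text \<open>The inverse of \<open>I - X\<close>, given by the entrywise geometric series.\<close>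

definition inv_one_minus :: "inf_mat \<Rightarrow> inf_mat" where
  "inv_one_minus X k l = (\<Sum>n. inf_mat_power X n k l)"

text \<open>The entries with \<open>k + l\<close> odd vanish, so only integral powers of \<open>\<epsilon>\<close> occur and no branch of the
  square root has to be chosen.\<close>

definition A_mat :: "complex \<Rightarrow> complex \<Rightarrow> inf_mat" where
  "A_mat \<epsilon> \<tau> k l =
     \<epsilon> ^ ((k + l) div 2) / of_real (sqrt (real k * real l)) * (-1) ^ (k + 1) *
     (fact (k + l - 1) / (fact (k - 1) * fact (l - 1))) * eisenstein_E (k + l) \<tau>"

text \<open>The explicit form of the period matrix of the sewn surface (\<open>sewn_period_matrix\<close> below). Unlike
  the latter it also makes sense at \<open>\<epsilon> = 0\<close>, where the surface degenerates and the value is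
  \<open>diag(\<tau>\<^sub>1, \<tau>\<^sub>2)\<close>.\<close>

definition F_eps :: "complex \<times> complex \<times> complex \<Rightarrow> complex^2^2" where
  "F_eps = (\<lambda>(\<tau>1, \<tau>2, \<epsilon>).
     let A1 = A_mat \<epsilon> \<tau>1;
         A2 = A_mat \<epsilon> \<tau>2;
         \<Omega>11 = \<tau>1 + \<epsilon> * (A2 \<star> inv_one_minus (A1 \<star> A2)) 1 1 / (2 * of_real pi * \<i>);
         \<Omega>22 = \<tau>2 + \<epsilon> * (A1 \<star> inv_one_minus (A2 \<star> A1)) 1 1 / (2 * of_real pi * \<i>);
         \<Omega>12 = - \<epsilon> * inv_one_minus (A1 \<star> A2) 1 1 / (2 * of_real pi * \<i>)
     in vector [vector [\<Omega>11, \<Omega>12], vector [\<Omega>12, \<Omega>22]])"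


section \<open>Period matrices of sewn tori\<close>

text \<open>The preimage in the complex plane of the torus with the disc \<open>|z| \<le> \<rho>\<close> excised.\<close>

definition punctured_plane :: "complex \<Rightarrow> real \<Rightarrow> complex set" where
  "punctured_plane \<tau> \<rho> = {z. \<forall>w\<in>torus_lattice \<tau>. norm (z - w) > \<rho>}"

text \<open>A holomorphic 1-form on the sewn surface is a pair of forms \<open>f 1 z\<^sub>1 dz\<^sub>1\<close>, \<open>f 2 z\<^sub>2 dz\<^sub>2\<close> on the two
  tori with discs excised (lifted to doubly periodic functions) which agree on the identified annuli.
  Since \<open>z\<^sub>2 = \<epsilon> / z\<^sub>1\<close> there, \<open>dz\<^sub>2 = - \<epsilon> / z\<^sub>1\<^sup>2 dz\<^sub>1\<close>. In all families below, the index type \<open>2\<close>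
  labels the tori.\<close>

definition sewn_form ::
  "(2 \<Rightarrow> complex) \<Rightarrow> complex \<Rightarrow> (2 \<Rightarrow> real) \<Rightarrow> (2 \<Rightarrow> complex \<Rightarrow> complex) \<Rightarrow> bool" where
  "sewn_form \<tau> \<epsilon> r f \<longleftrightarrow>
     f 1 holomorphic_on punctured_plane (\<tau> 1) (norm \<epsilon> / r 2) \<and>
     f 2 holomorphic_on punctured_plane (\<tau> 2) (norm \<epsilon> / r 1) \<and>
     (\<forall>w\<in>torus_lattice (\<tau> 1). \<forall>z\<in>punctured_plane (\<tau> 1) (norm \<epsilon> / r 2). f 1 (z + w) = f 1 z) \<and>
     (\<forall>w\<in>torus_lattice (\<tau> 2). \<forall>z\<in>punctured_plane (\<tau> 2) (norm \<epsilon> / r 1). f 2 (z + w) = f 2 z) \<and>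
     (\<forall>z. norm \<epsilon> / r 2 < norm z \<and> norm z < r 1 \<longrightarrow> f 1 z = f 2 (\<epsilon> / z) * (- \<epsilon> / z\<^sup>2))"

text \<open>A cycle of a torus of period \<open>\<omega>\<close>, represented off the excised disc, lifts to a path from some
  \<open>z\<^sub>0\<close> to \<open>z\<^sub>0 + \<omega>\<close>. Its class in the first homology of the torus minus a disc is determined by \<open>\<omega>\<close>,
  as the boundary of the disc is null-homologous there, so the choice of path does not matter.\<close>

definition has_period ::
  "(complex \<Rightarrow> complex) \<Rightarrow> complex set \<Rightarrow> complex \<Rightarrow> complex \<Rightarrow> bool" where
  "has_period f U \<omega> p \<longleftrightarrow>
     (\<exists>g. valid_path g \<and> path_image g \<subseteq> U \<and> pathfinish g = pathstart g + \<omega> \<and>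
          (f has_contour_integral p) g)"

definition sewn_period_matrix ::
  "(2 \<Rightarrow> complex) \<Rightarrow> complex \<Rightarrow> (2 \<Rightarrow> real) \<Rightarrow> complex^2^2 \<Rightarrow> bool" where
  "sewn_period_matrix \<tau> \<epsilon> r \<Omega> \<longleftrightarrow>
     (\<exists>\<nu> :: 2 \<Rightarrow> 2 \<Rightarrow> complex \<Rightarrow> complex.
        let U = (\<lambda>i. punctured_plane (\<tau> i) (norm \<epsilon> / r (if i = 1 then 2 else 1))) in
        \<forall>j. sewn_form \<tau> \<epsilon> r (\<nu> j) \<and>
            (\<forall>i. has_period (\<nu> j i) (U i) (2 * of_real pi * \<i>)
                   (if i = j then 2 * of_real pi * \<i> else 0) \<and>
                 has_period (\<nu> j i) (U i) (2 * of_real pi * \<i> * \<tau> i)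
                   (2 * of_real pi * \<i> * \<Omega> $ i $ j)))"


section \<open>The group\<close>

definition J4 :: "int^4^4" where
  "J4 = vector [vector [0, 0, 1, 0], vector [0, 0, 0, 1], vector [-1, 0, 0, 0], vector [0, -1, 0, 0]]"

definition Sp4Z :: "(int^4^4) monoid" where
  "Sp4Z = \<lparr>carrier = {M. transpose M ** J4 ** M = J4}, monoid.mult = (**), one = mat 1\<rparr>"

definition SL2Z :: "(int^2^2) monoid" where
  "SL2Z = \<lparr>carrier = {g. det g = 1}, monoid.mult = (**), one = mat 1\<rparr>"

definition sp_embed :: "int^2^2 \<Rightarrow> int^2^2 \<Rightarrow> int^4^4" where
  "sp_embed g h =
     vector [vector [g$1$1, 0, g$1$2, 0],
             vector [0, h$1$1, 0, h$1$2],
             vector [g$2$1, 0, g$2$2, 0],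
             vector [0, h$2$1, 0, h$2$2]]"

definition Gamma1 :: "(int^4^4) set" where
  "Gamma1 = {sp_embed g (mat 1) | g. g \<in> carrier SL2Z}"

definition Gamma2 :: "(int^4^4) set" where
  "Gamma2 = {sp_embed (mat 1) g | g. g \<in> carrier SL2Z}"

definition beta :: "int^4^4" where
  "beta = vector [vector [0, 1, 0, 0], vector [1, 0, 0, 0],
                  vector [0, 0, 0, 1], vector [0, 0, 1, 0]]"

definition G_eps :: "(int^4^4) monoid" where
  "G_eps = Sp4Z\<lparr>carrier := generate Sp4Z (Gamma1 \<union> Gamma2 \<union> {beta})\<rparr>"

definition semidirect_product ::
  "('a, 'c) monoid_scheme \<Rightarrow> ('b, 'd) monoid_scheme \<Rightarrow> ('b \<Rightarrow> 'a \<Rightarrow> 'a) \<Rightarrow> ('a \<times> 'b) monoid" where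
  "semidirect_product N H \<phi> =
     \<lparr>carrier = carrier N \<times> carrier H,
      monoid.mult = (\<lambda>(n, h) (n', h'). (n \<otimes>\<^bsub>N\<^esub> \<phi> h n', h \<otimes>\<^bsub>H\<^esub> h')),
      one = (\<one>\<^bsub>N\<^esub>, \<one>\<^bsub>H\<^esub>)\<rparr>"

definition SL2Z_wr_Z2 :: "(((int^2^2) \<times> (int^2^2)) \<times> int) monoid" where
  "SL2Z_wr_Z2 =
     semidirect_product (SL2Z \<times>\<times> SL2Z) (integer_mod_group 2)
       (\<lambda>s (g, h). if s = 0 then (g, h) else (h, g))"

fun wr_embed :: "((int^2^2) \<times> (int^2^2)) \<times> int \<Rightarrow> int^4^4" where
  "wr_embed ((g, h), s) = sp_embed g h ** (if s = 0 then mat 1 else beta)"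


section \<open>The actions\<close>

text \<open>\<open>siegel_lo\<close> and \<open>siegel_hi\<close> pick out the \<open>2 \<times> 2\<close> blocks of a \<open>4 \<times> 4\<close> matrix.\<close>

definition siegel_lo :: "2 \<Rightarrow> 4" where "siegel_lo i = (if i = 1 then 1 else 2)"

definition siegel_hi :: "2 \<Rightarrow> 4" where "siegel_hi i = (if i = 1 then 3 else 4)"

definition siegel_act :: "int^4^4 \<Rightarrow> complex^2^2 \<Rightarrow> complex^2^2" where
  "siegel_act M \<Omega> =
     (let A = (\<chi> i j. of_int (M $ siegel_lo i $ siegel_lo j));
          B = (\<chi> i j. of_int (M $ siegel_lo i $ siegel_hi j));
          C = (\<chi> i j. of_int (M $ siegel_hi i $ siegel_lo j));
          D = (\<chi> i j. of_int (M $ siegel_hi i $ siegel_hi j))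
      in (A ** \<Omega> + B) ** matrix_inv (C ** \<Omega> + D))"

definition aut_factor :: "int^2^2 \<Rightarrow> complex \<Rightarrow> complex" where
  "aut_factor g \<tau> = of_int (g$2$1) * \<tau> + of_int (g$2$2)"

definition moebius_act :: "int^2^2 \<Rightarrow> complex \<Rightarrow> complex" where
  "moebius_act g \<tau> = (of_int (g$1$1) * \<tau> + of_int (g$1$2)) / aut_factor g \<tau>"

text \<open>The left action of \<open>G_eps\<close> on \<open>D_eps\<close> prescribed on the generators (\<open>G_act_Gamma1\<close>,
  \<open>G_act_Gamma2\<close>, \<open>G_act_beta\<close> below), written out for a general element through the identification
  \<open>wr_embed\<close> of \<open>SL2Z_wr_Z2\<close> with \<open>G_eps\<close>; \<open>G_act_group_action\<close> shows that it is an action.\<close>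

fun wr_act ::
  "((int^2^2) \<times> (int^2^2)) \<times> int \<Rightarrow> complex \<times> complex \<times> complex \<Rightarrow> complex \<times> complex \<times> complex" where
  "wr_act ((g, h), s) (\<tau>1, \<tau>2, \<epsilon>) =
     (let \<tau>1' = (if s = 0 then \<tau>1 else \<tau>2);
          \<tau>2' = (if s = 0 then \<tau>2 else \<tau>1)
      in (moebius_act g \<tau>1', moebius_act h \<tau>2', \<epsilon> / (aut_factor g \<tau>1' * aut_factor h \<tau>2')))"

definition G_act ::
  "int^4^4 \<Rightarrow> complex \<times> complex \<times> complex \<Rightarrow> complex \<times> complex \<times> complex" where
  "G_act M = wr_act (inv_into (carrier SL2Z_wr_Z2) wr_embed M)"


lemma nth_vector_4:
  "(vector [a, b, c, d] :: 'a::zero^4) $ 1 = a" "(vector [a, b, c, d] :: 'a::zero^4) $ 2 = b"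
  "(vector [a, b, c, d] :: 'a::zero^4) $ 3 = c" "(vector [a, b, c, d] :: 'a::zero^4) $ 4 = d"
  by (simp_all add: vector_def)

lemmas mat_simps = vec_eq_iff forall_4 forall_2 sum_4 sum_2 matrix_matrix_mult_def nth_vector_4
  transpose_def mat_def

lemma Sp4Z_simps:
  "carrier Sp4Z = {M. transpose M ** J4 ** M = J4}" "monoid.mult Sp4Z = (**)" "one Sp4Z = mat 1"
  by (simp_all add: Sp4Z_def)

lemma int_left_inverse_imp_right_inverse:
  fixes A B :: "int^'n^'n"
  assumes "A ** B = mat 1"
  shows "B ** A = mat 1"
proof -
  let ?R = "\<lambda>A :: int^'n^'n. (\<chi> i j. real_of_int (A $ i $ j))"
  have mult: "?R (A ** B) = ?R A ** ?R B" for A B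
    by (simp add: matrix_matrix_mult_def vec_eq_iff)
  have one: "?R (mat 1) = mat 1" by (simp add: mat_def vec_eq_iff)
  have "?R A ** ?R B = mat 1" using assms mult one by metis
  then have "?R B ** ?R A = mat 1" using matrix_left_right_inverse by blast
  then have "?R (B ** A) = ?R (mat 1)" using mult one by simp
  then show ?thesis by (simp add: vec_eq_iff)
qed

lemma group_Sp4Z: "group Sp4Z"
proof (rule groupI)
  fix M assume "M \<in> carrier Sp4Z"
  then have M: "transpose M ** J4 ** M = J4" by (simp add: Sp4Z_simps)
  let ?N = "(- J4) ** transpose M ** J4"
  have "?N ** M = (- J4) ** (transpose M ** J4 ** M)" by (simp add: matrix_mul_assoc)
  also have "\<dots> = mat 1" unfolding M by (simp add: J4_def mat_simps)
  finally have 1: "?N ** M = mat 1" .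
  then have 2: "M ** ?N = mat 1" by (rule int_left_inverse_imp_right_inverse)
  then have 3: "transpose ?N ** transpose M = mat 1"
    by (metis matrix_transpose_mul transpose_mat)
  have "transpose ?N ** J4 ** ?N = transpose ?N ** (transpose M ** J4 ** M) ** ?N" by (simp add: M)
  also have "\<dots> = (transpose ?N ** transpose M) ** J4 ** (M ** ?N)" by (simp add: matrix_mul_assoc)
  also have "\<dots> = J4" unfolding 2 3 by simp
  finally have "?N \<in> carrier Sp4Z" by (simp add: Sp4Z_simps)
  with 1 show "\<exists>N\<in>carrier Sp4Z. N \<otimes>\<^bsub>Sp4Z\<^esub> M = \<one>\<^bsub>Sp4Z\<^esub>"
    unfolding Sp4Z_simps(2,3) by blast
next
  fix M N assume "M \<in> carrier Sp4Z" "N \<in> carrier Sp4Z"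
  then have M: "transpose M ** J4 ** M = J4" "transpose N ** J4 ** N = J4" by (simp_all add: Sp4Z_simps)
  have "transpose (M ** N) ** J4 ** (M ** N) = transpose N ** (transpose M ** J4 ** M) ** N"
    by (simp add: matrix_mul_assoc matrix_transpose_mul)
  then show "M \<otimes>\<^bsub>Sp4Z\<^esub> N \<in> carrier Sp4Z" by (simp add: Sp4Z_simps M)
qed (simp_all add: Sp4Z_simps matrix_mul_assoc transpose_mat)

lemma SL2Z_simps:
  "carrier SL2Z = {g. g$1$1 * g$2$2 - g$1$2 * g$2$1 = 1}" "monoid.mult SL2Z = (**)" "one SL2Z = mat 1"
  by (simp_all add: SL2Z_def det_2)

lemma group_SL2Z: "group SL2Z"
proof (rule groupI)
  fix g assume "g \<in> carrier SL2Z"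
  then have g: "g$1$1 * g$2$2 - g$1$2 * g$2$1 = 1" by (simp add: SL2Z_simps)
  define h :: "int^2^2" where "h = vector [vector [g$2$2, - g$1$2], vector [- g$2$1, g$1$1]]"
  have "h ** g = mat 1" using g by (simp add: h_def mat_simps algebra_simps)
  moreover have "h \<in> carrier SL2Z" using g by (simp add: h_def SL2Z_simps algebra_simps)
  ultimately show "\<exists>h\<in>carrier SL2Z. h \<otimes>\<^bsub>SL2Z\<^esub> g = \<one>\<^bsub>SL2Z\<^esub>" by (auto simp: SL2Z_simps)
next
  fix g h assume "g \<in> carrier SL2Z" "h \<in> carrier SL2Z"
  then have "det g = 1" "det h = 1" by (simp_all add: SL2Z_def)
  then show "g \<otimes>\<^bsub>SL2Z\<^esub> h \<in> carrier SL2Z" by (simp add: SL2Z_def det_mul)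
next
  show "\<one>\<^bsub>SL2Z\<^esub> \<in> carrier SL2Z" by (simp add: SL2Z_def)
qed (simp_all add: SL2Z_def matrix_mul_assoc)

lemma sp_embed_mult: "sp_embed g h ** sp_embed g' h' = sp_embed (g ** g') (h ** h')"
  by (simp add: sp_embed_def mat_simps)

lemma sp_embed_one: "sp_embed (mat 1) (mat 1) = mat 1"
  by (simp add: sp_embed_def mat_simps)

lemma beta_sp_embed: "beta ** sp_embed g h = sp_embed h g ** beta"
  by (simp add: sp_embed_def beta_def mat_simps)

lemma beta_beta: "beta ** beta = mat 1"
  by (simp add: beta_def mat_simps)

lemma sp_embed_in_Sp4Z:
  "g \<in> carrier SL2Z \<Longrightarrow> h \<in> carrier SL2Z \<Longrightarrow> sp_embed g h \<in> carrier Sp4Z"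
  by (simp add: sp_embed_def Sp4Z_simps SL2Z_simps J4_def mat_simps algebra_simps)

lemma beta_in_Sp4Z: "beta \<in> carrier Sp4Z"
  by (simp add: beta_def Sp4Z_simps J4_def mat_simps)

lemma SL2Z_wr_Z2_simps:
  "carrier SL2Z_wr_Z2 = (carrier SL2Z \<times> carrier SL2Z) \<times> {0, 1}"
  "((g, h), s) \<otimes>\<^bsub>SL2Z_wr_Z2\<^esub> ((g', h'), s') =
     ((if s = 0 then (g ** g', h ** h') else (g ** h', h ** g')), (s + s') mod 2)"
  "one SL2Z_wr_Z2 = ((mat 1, mat 1), 0)"
  by (auto simp: SL2Z_wr_Z2_def semidirect_product_def carrier_integer_mod_group DirProd_def SL2Z_simps)

lemma wr_embed_mult:
  assumes "x \<in> carrier SL2Z_wr_Z2" "y \<in> carrier SL2Z_wr_Z2"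
  shows "wr_embed (x \<otimes>\<^bsub>SL2Z_wr_Z2\<^esub> y) = wr_embed x ** wr_embed y"
proof -
  obtain g h s g' h' s' where [simp]: "x = ((g, h), s)" "y = ((g', h'), s')"
    by (metis surj_pair)
  have "s = 0 \<or> s = 1" "s' = 0 \<or> s' = 1" using assms by (auto simp: SL2Z_wr_Z2_simps)
  have *: "sp_embed g h ** beta ** sp_embed g' h' = sp_embed (g ** h') (h ** g') ** beta"
    by (metis beta_sp_embed matrix_mul_assoc sp_embed_mult)
  have **: "sp_embed g h ** beta ** (sp_embed g' h' ** beta) = sp_embed (g ** h') (h ** g')"
    by (simp only: matrix_mul_assoc *) (simp only: matrix_mul_assoc [symmetric] beta_beta matrix_mul_rid)
  show ?thesis using \<open>s = 0 \<or> s = 1\<close> \<open>s' = 0 \<or> s' = 1\<close>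
    by (elim disjE) (simp_all add: SL2Z_wr_Z2_simps sp_embed_mult matrix_mul_assoc * ** **[unfolded matrix_mul_assoc *])
qed

lemma group_SL2Z_wr_Z2: "group SL2Z_wr_Z2"
proof -
  interpret S: group SL2Z by (rule group_SL2Z)
  have cl: "g ** h \<in> carrier SL2Z" if "g \<in> carrier SL2Z" "h \<in> carrier SL2Z" for g h
    using S.m_closed[OF that] by (simp add: SL2Z_simps)
  have one: "mat 1 \<in> carrier SL2Z" using S.one_closed by (simp add: SL2Z_simps)
  have inv: "\<exists>h\<in>carrier SL2Z. h ** g = mat 1" if "g \<in> carrier SL2Z" for g
    using S.l_inv[OF that] S.inv_closed[OF that] by (auto simp: SL2Z_simps)
  show ?thesis
  proof (rule groupI)
    fix x y assume "x \<in> carrier SL2Z_wr_Z2" "y \<in> carrier SL2Z_wr_Z2"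
    then show "x \<otimes>\<^bsub>SL2Z_wr_Z2\<^esub> y \<in> carrier SL2Z_wr_Z2"
      by (cases x, cases y) (auto simp: SL2Z_wr_Z2_simps cl)
  next
    show "\<one>\<^bsub>SL2Z_wr_Z2\<^esub> \<in> carrier SL2Z_wr_Z2" by (simp add: SL2Z_wr_Z2_simps one)
  next
    fix x y z
    assume "x \<in> carrier SL2Z_wr_Z2" "y \<in> carrier SL2Z_wr_Z2" "z \<in> carrier SL2Z_wr_Z2"
    then show "x \<otimes>\<^bsub>SL2Z_wr_Z2\<^esub> y \<otimes>\<^bsub>SL2Z_wr_Z2\<^esub> z = x \<otimes>\<^bsub>SL2Z_wr_Z2\<^esub> (y \<otimes>\<^bsub>SL2Z_wr_Z2\<^esub> z)"
      by (cases x, cases y, cases z) (auto simp: SL2Z_wr_Z2_simps matrix_mul_assoc)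
  next
    fix x assume "x \<in> carrier SL2Z_wr_Z2"
    then show "\<one>\<^bsub>SL2Z_wr_Z2\<^esub> \<otimes>\<^bsub>SL2Z_wr_Z2\<^esub> x = x"
      by (cases x) (auto simp: SL2Z_wr_Z2_simps)
  next
    fix x assume x: "x \<in> carrier SL2Z_wr_Z2"
    obtain g h s where [simp]: "x = ((g, h), s)" by (metis surj_pair)
    have gh: "g \<in> carrier SL2Z" "h \<in> carrier SL2Z" "s = 0 \<or> s = 1"
      using x by (auto simp: SL2Z_wr_Z2_simps)
    obtain g' h' where gh': "g' \<in> carrier SL2Z" "h' \<in> carrier SL2Z" "g' ** g = mat 1" "h' ** h = mat 1"
      using inv gh by meson
    have "((if s = 0 then (g', h') else (h', g')), s) \<in> carrier SL2Z_wr_Z2"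
      using gh gh' by (auto simp: SL2Z_wr_Z2_simps)
    moreover have "((if s = 0 then (g', h') else (h', g')), s) \<otimes>\<^bsub>SL2Z_wr_Z2\<^esub> x = \<one>\<^bsub>SL2Z_wr_Z2\<^esub>"
      using gh gh' by (auto simp: SL2Z_wr_Z2_simps)
    ultimately show "\<exists>y\<in>carrier SL2Z_wr_Z2. y \<otimes>\<^bsub>SL2Z_wr_Z2\<^esub> x = \<one>\<^bsub>SL2Z_wr_Z2\<^esub>" by blast
  qed
qed

lemma wr_embed_inj: "inj_on wr_embed (carrier SL2Z_wr_Z2)"
proof (rule inj_onI)
  fix x y
  assume xy: "x \<in> carrier SL2Z_wr_Z2" "y \<in> carrier SL2Z_wr_Z2" "wr_embed x = wr_embed y"
  obtain g h s g' h' s' where [simp]: "x = ((g, h), s)" "y = ((g', h'), s')"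
    by (metis surj_pair)
  have "s = 0 \<or> s = 1" "s' = 0 \<or> s' = 1"
    and d: "g$1$1 * g$2$2 - g$1$2 * g$2$1 = 1" "g'$1$1 * g'$2$2 - g'$1$2 * g'$2$1 = 1"
    using xy by (auto simp: SL2Z_wr_Z2_simps SL2Z_simps)
  then show "x = y" using xy(3)
    by (elim disjE) (auto simp: sp_embed_def beta_def mat_simps)
qed

lemma wr_embed_image: "wr_embed ` carrier SL2Z_wr_Z2 = carrier G_eps"
proof
  interpret group Sp4Z by (rule group_Sp4Z)
  interpret W: group SL2Z_wr_Z2 by (rule group_SL2Z_wr_Z2)
  let ?S = "Gamma1 \<union> Gamma2 \<union> {beta}" and ?I = "wr_embed ` carrier SL2Z_wr_Z2"
  have one: "mat 1 \<in> carrier SL2Z" by (simp add: SL2Z_def)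
  have Gen: "carrier G_eps = generate Sp4Z ?S" by (simp add: G_eps_def)
  show "?I \<subseteq> carrier G_eps"
  proof
    fix M assume "M \<in> ?I"
    then obtain g h s where M: "M = wr_embed ((g, h), s)" and gh: "g \<in> carrier SL2Z" "h \<in> carrier SL2Z"
      by (metis (no_types, lifting) SL2Z_wr_Z2_simps(1) imageE mem_Sigma_iff surj_pair)
    have "sp_embed g (mat 1) \<in> generate Sp4Z ?S" "sp_embed (mat 1) h \<in> generate Sp4Z ?S"
      by (intro generate.incl; use gh in \<open>auto simp: Gamma1_def Gamma2_def\<close>)+
    from generate.eng[OF this] have 1: "sp_embed g h \<in> generate Sp4Z ?S"
      by (simp add: Sp4Z_simps sp_embed_mult)
    have 2: "(if s = 0 then mat 1 else beta) \<in> generate Sp4Z ?S"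
      using generate.one[of Sp4Z ?S] by (auto simp: Sp4Z_simps intro: generate.incl)
    show "M \<in> carrier G_eps" unfolding Gen M using generate.eng[OF 1 2] by (simp add: Sp4Z_simps)
  qed
  have sub: "?I \<subseteq> carrier Sp4Z"
  proof
    fix M assume "M \<in> ?I"
    then obtain g h s where M: "M = wr_embed ((g, h), s)" and gh: "g \<in> carrier SL2Z" "h \<in> carrier SL2Z"
      by (metis (no_types, lifting) SL2Z_wr_Z2_simps(1) imageE mem_Sigma_iff surj_pair)
    have "(if s = 0 then mat 1 else beta) \<in> carrier Sp4Z"
      using one_closed beta_in_Sp4Z by (simp add: Sp4Z_simps)
    from m_closed[OF sp_embed_in_Sp4Z[OF gh] this] show "M \<in> carrier Sp4Z" by (simp add: M Sp4Z_simps)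
  qed
  have S_I: "?S \<subseteq> ?I"
  proof -
    have "sp_embed g h \<in> ?I" if "g \<in> carrier SL2Z" "h \<in> carrier SL2Z" for g h
      by (rule image_eqI[of _ _ "((g, h), 0)"]) (use that in \<open>auto simp: SL2Z_wr_Z2_simps\<close>)
    moreover have "beta \<in> ?I"
      by (rule image_eqI[of _ _ "((mat 1, mat 1), 1)"])
        (use one in \<open>auto simp: SL2Z_wr_Z2_simps sp_embed_one\<close>)
    ultimately show ?thesis using one by (auto simp: Gamma1_def Gamma2_def)
  qed
  have hom: "wr_embed \<in> hom SL2Z_wr_Z2 Sp4Z"
    using sub by (auto simp: hom_def Sp4Z_simps wr_embed_mult)
  interpret h: group_hom SL2Z_wr_Z2 Sp4Z wr_embed
    using hom by unfold_locales
  have "subgroup ?I Sp4Z" by (rule h.img_is_subgroup)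
  from generate_subgroup_incl[OF S_I this] show "carrier G_eps \<subseteq> ?I" by (simp add: Gen)
qed

lemma wr_embed_iso: "wr_embed \<in> iso SL2Z_wr_Z2 G_eps"
proof -
  have "monoid.mult G_eps = (**)" by (simp add: G_eps_def Sp4Z_simps)
  then show ?thesis
    using wr_embed_inj wr_embed_image by (auto simp: iso_def hom_def bij_betw_def wr_embed_mult)
qed

lemma group_G_eps: "group G_eps"
proof -
  interpret group Sp4Z by (rule group_Sp4Z)
  have "Gamma1 \<union> Gamma2 \<union> {beta} \<subseteq> carrier Sp4Z"
    by (auto simp: Gamma1_def Gamma2_def SL2Z_def beta_in_Sp4Z intro!: sp_embed_in_Sp4Z)
  then have "subgroup (generate Sp4Z (Gamma1 \<union> Gamma2 \<union> {beta})) Sp4Z"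
    by (rule generate_is_subgroup)
  then show ?thesis unfolding G_eps_def by (rule subgroup_imp_group)
qed

lemma G_act_wr_embed: "x \<in> carrier SL2Z_wr_Z2 \<Longrightarrow> G_act (wr_embed x) = wr_act x"
  by (simp add: G_act_def inv_into_f_f[OF wr_embed_inj])

lemma moebius_one [simp]: "moebius_act (mat 1) \<tau> = \<tau>" and aut_factor_one [simp]: "aut_factor (mat 1) \<tau> = 1"
  by (simp_all add: moebius_act_def aut_factor_def mat_def)

lemma G_act_Gamma1:
  "g \<in> carrier SL2Z \<Longrightarrow>
     G_act (sp_embed g (mat 1)) (\<tau>1, \<tau>2, \<epsilon>) = (moebius_act g \<tau>1, \<tau>2, \<epsilon> / aut_factor g \<tau>1)"
  using G_act_wr_embed[of "((g, mat 1), 0)"] by (simp add: SL2Z_wr_Z2_simps SL2Z_def)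

lemma G_act_Gamma2:
  "g \<in> carrier SL2Z \<Longrightarrow>
     G_act (sp_embed (mat 1) g) (\<tau>1, \<tau>2, \<epsilon>) = (\<tau>1, moebius_act g \<tau>2, \<epsilon> / aut_factor g \<tau>2)"
  using G_act_wr_embed[of "((mat 1, g), 0)"] by (simp add: SL2Z_wr_Z2_simps SL2Z_def)

lemma G_act_beta: "G_act beta (\<tau>1, \<tau>2, \<epsilon>) = (\<tau>2, \<tau>1, \<epsilon>)"
  using G_act_wr_embed[of "((mat 1, mat 1), 1)"] by (simp add: SL2Z_wr_Z2_simps SL2Z_def sp_embed_one)

lemma aut_factor_nonzero:
  assumes "g \<in> carrier SL2Z" "\<tau> \<in> upper_half_plane"
  shows "aut_factor g \<tau> \<noteq> 0"
proof
  assume "aut_factor g \<tau> = 0"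
  then have 1: "Im (aut_factor g \<tau>) = 0" "Re (aut_factor g \<tau>) = 0" by simp_all
  then have "g$2$1 = 0" using assms(2) by (simp add: aut_factor_def upper_half_plane_def)
  with 1 have "g$2$2 = 0" by (simp add: aut_factor_def)
  with \<open>g$2$1 = 0\<close> assms(1) show False by (simp add: SL2Z_simps)
qed

lemma Im_moebius:
  assumes "g \<in> carrier SL2Z"
  shows "Im (moebius_act g \<tau>) = Im \<tau> / (norm (aut_factor g \<tau>))\<^sup>2"
proof -
  have d: "real_of_int (g$1$1) * of_int (g$2$2) - of_int (g$1$2) * of_int (g$2$1) = 1"
    using assms by (simp add: SL2Z_simps flip: of_int_mult of_int_diff)
  have "Im (moebius_act g \<tau>) =
      (of_int (g$1$1) * of_int (g$2$2) - of_int (g$1$2) * of_int (g$2$1)) * Im \<tau> / (norm (aut_factor g \<tau>))\<^sup>2"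
    unfolding moebius_act_def Im_divide cmod_power2 by (simp add: aut_factor_def algebra_simps)
  then show ?thesis by (simp add: d)
qed

lemma moebius_upper_half_plane:
  "g \<in> carrier SL2Z \<Longrightarrow> \<tau> \<in> upper_half_plane \<Longrightarrow> moebius_act g \<tau> \<in> upper_half_plane"
  using aut_factor_nonzero[of g \<tau>] by (simp add: upper_half_plane_def Im_moebius)

lemma aut_factor_mult:
  assumes "h \<in> carrier SL2Z" "\<tau> \<in> upper_half_plane"
  shows "aut_factor (g ** h) \<tau> = aut_factor g (moebius_act h \<tau>) * aut_factor h \<tau>"
  using aut_factor_nonzero[OF assms]
  by (simp add: aut_factor_def moebius_act_def mat_simps field_simps)

lemma moebius_mult:
  assumes "g \<in> carrier SL2Z" "h \<in> carrier SL2Z" "\<tau> \<in> upper_half_plane"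
  shows "moebius_act (g ** h) \<tau> = moebius_act g (moebius_act h \<tau>)"
proof -
  let ?j = "aut_factor h \<tau>" and ?t = "moebius_act h \<tau>"
  have j: "?j \<noteq> 0" by (rule aut_factor_nonzero[OF assms(2,3)])
  have t: "of_int (h$1$1) * \<tau> + of_int (h$1$2) = ?t * ?j" using j by (simp add: moebius_act_def)
  have "of_int ((g ** h)$1$1) * \<tau> + of_int ((g ** h)$1$2) =
      of_int (g$1$1) * (of_int (h$1$1) * \<tau> + of_int (h$1$2)) + of_int (g$1$2) * ?j"
    by (simp add: mat_simps aut_factor_def algebra_simps)
  also have "\<dots> = (of_int (g$1$1) * ?t + of_int (g$1$2)) * ?j" unfolding t by (simp add: algebra_simps)
  finally have 1: "of_int ((g ** h)$1$1) * \<tau> + of_int ((g ** h)$1$2) =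
      (of_int (g$1$1) * ?t + of_int (g$1$2)) * ?j" .
  show ?thesis using j
    unfolding moebius_act_def[of "g ** h"] 1 aut_factor_mult[OF assms(2,3)] moebius_act_def[of g] by simp
qed

lemma lattice_moebius_subset:
  assumes "g \<in> carrier SL2Z" "\<tau> \<in> upper_half_plane"
  shows "(\<lambda>w. w * aut_factor g \<tau>) ` torus_lattice (moebius_act g \<tau>) \<subseteq> torus_lattice \<tau>"
proof
  fix u assume "u \<in> (\<lambda>w. w * aut_factor g \<tau>) ` torus_lattice (moebius_act g \<tau>)"
  then obtain m n where u:
    "u = 2 * of_real pi * \<i> * (of_int m * moebius_act g \<tau> + of_int n) * aut_factor g \<tau>"
    by (auto simp: torus_lattice_def)
  have "moebius_act g \<tau> * aut_factor g \<tau> = of_int (g$1$1) * \<tau> + of_int (g$1$2)"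
    using aut_factor_nonzero[OF assms] by (simp add: moebius_act_def)
  then have "(of_int m * moebius_act g \<tau> + of_int n) * aut_factor g \<tau> =
      of_int m * (of_int (g$1$1) * \<tau> + of_int (g$1$2)) + of_int n * aut_factor g \<tau>"
    by (simp add: algebra_simps)
  also have "\<dots> = of_int (m * g$1$1 + n * g$2$1) * \<tau> + of_int (m * g$1$2 + n * g$2$2)"
    by (simp add: aut_factor_def algebra_simps)
  finally have "u = 2 * of_real pi * \<i> *
      (of_int (m * g$1$1 + n * g$2$1) * \<tau> + of_int (m * g$1$2 + n * g$2$2))"
    unfolding u by (simp only: mult.assoc)
  then show "u \<in> torus_lattice \<tau>" unfolding torus_lattice_def by blast
qed

lemma lattice_min_moebius:
  assumes g: "g \<in> carrier SL2Z" and t: "\<tau> \<in> upper_half_plane"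
  shows "lattice_min (moebius_act g \<tau>) = lattice_min \<tau> / norm (aut_factor g \<tau>)"
proof -
  interpret S: group SL2Z by (rule group_SL2Z)
  let ?j = "aut_factor g \<tau>" and ?L = "\<lambda>\<tau>. norm ` (torus_lattice \<tau> - {0})"
  have nz: "?L \<tau> \<noteq> {}" for \<tau>
  proof -
    have "2 * of_real pi * \<i> * (of_int 0 * \<tau> + of_int 1) \<in> torus_lattice \<tau>" unfolding torus_lattice_def by blast
    then show ?thesis by auto
  qed
  have bdd: "bdd_below (?L \<tau>)" for \<tau> by (rule bdd_belowI[of _ 0]) auto
  have le: "lattice_min \<tau> \<le> lattice_min (moebius_act g \<tau>) * norm (aut_factor g \<tau>)"
    if g: "g \<in> carrier SL2Z" and t: "\<tau> \<in> upper_half_plane" for g \<tau>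
  proof -
    have j: "aut_factor g \<tau> \<noteq> 0" by (rule aut_factor_nonzero[OF g t])
    have "lattice_min \<tau> / norm (aut_factor g \<tau>) \<le> lattice_min (moebius_act g \<tau>)"
      unfolding lattice_min_def[of "moebius_act g \<tau>"]
    proof (rule cInf_greatest[OF nz])
      fix x assume "x \<in> ?L (moebius_act g \<tau>)"
      then obtain w where w: "w \<in> torus_lattice (moebius_act g \<tau>)" "w \<noteq> 0" "x = norm w" by auto
      then have "w * aut_factor g \<tau> \<in> torus_lattice \<tau> - {0}" using lattice_moebius_subset[OF g t] j by auto
      then have "norm (w * aut_factor g \<tau>) \<in> ?L \<tau>" by (rule imageI)
      from cInf_lower[OF this bdd] show "lattice_min \<tau> / norm (aut_factor g \<tau>) \<le> x"
        using j by (simp add: lattice_min_def w norm_mult field_simps)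
    qed
    then show ?thesis using j by (simp add: field_simps)
  qed
  obtain h where h: "h \<in> carrier SL2Z" "h ** g = mat 1"
    using S.l_inv[OF g] S.inv_closed[OF g] by (auto simp: SL2Z_simps)
  have m: "moebius_act h (moebius_act g \<tau>) = \<tau>" using moebius_mult[OF h(1) g t] h by simp
  have a: "aut_factor h (moebius_act g \<tau>) * ?j = 1" using aut_factor_mult[OF g t, of h] h by simp
  then have a': "norm (aut_factor h (moebius_act g \<tau>)) * norm ?j = 1" by (metis norm_mult norm_one)
  have j: "norm ?j > 0" using aut_factor_nonzero[OF g t] by simp
  have "lattice_min (moebius_act g \<tau>) \<le> lattice_min \<tau> * norm (aut_factor h (moebius_act g \<tau>))"
    using le[OF h(1) moebius_upper_half_plane[OF g t]] m by simp
  then have "lattice_min (moebius_act g \<tau>) * norm ?j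
      \<le> lattice_min \<tau> * norm (aut_factor h (moebius_act g \<tau>)) * norm ?j"
    using j by (simp add: mult_right_mono)
  also have "\<dots> = lattice_min \<tau>" using a' by (simp add: mult.assoc)
  finally show ?thesis using le[OF g t] j by (simp add: field_simps)
qed

lemma wr_act_closed:
  assumes "x \<in> carrier SL2Z_wr_Z2" "y \<in> D_eps"
  shows "wr_act x y \<in> D_eps"
proof -
  obtain g h s \<tau>1 \<tau>2 \<epsilon> where [simp]: "x = ((g, h), s)" "y = (\<tau>1, \<tau>2, \<epsilon>)" by (metis surj_pair)
  have gh: "g \<in> carrier SL2Z" "h \<in> carrier SL2Z" using assms by (auto simp: SL2Z_wr_Z2_simps)
  have t: "\<tau>1 \<in> upper_half_plane" "\<tau>2 \<in> upper_half_plane"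
    and e: "norm \<epsilon> < 1/4 * lattice_min \<tau>1 * lattice_min \<tau>2" using assms by (auto simp: D_eps_def)
  have *: "(moebius_act g t1, moebius_act h t2, \<epsilon> / (aut_factor g t1 * aut_factor h t2)) \<in> D_eps"
    if "t1 \<in> upper_half_plane" "t2 \<in> upper_half_plane" "norm \<epsilon> < 1/4 * lattice_min t1 * lattice_min t2" for t1 t2
  proof -
    have "norm \<epsilon> / (norm (aut_factor g t1) * norm (aut_factor h t2))
       < (1/4 * lattice_min t1 * lattice_min t2) / (norm (aut_factor g t1) * norm (aut_factor h t2))"
      using that aut_factor_nonzero gh by (intro divide_strict_right_mono) auto
    then have "norm (\<epsilon> / (aut_factor g t1 * aut_factor h t2)) <
        1/4 * (lattice_min t1 / norm (aut_factor g t1)) * (lattice_min t2 / norm (aut_factor h t2))"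
      by (simp add: norm_divide norm_mult)
    then show ?thesis
      using that gh
      by (simp only: D_eps_def mem_Collect_eq prod.case moebius_upper_half_plane lattice_min_moebius simp_thms)
  qed
  have e': "norm \<epsilon> < 1/4 * lattice_min \<tau>2 * lattice_min \<tau>1" using e by (simp add: mult.commute)
  show ?thesis using *[OF t e] *[OF t(2,1) e'] by simp
qed

lemma wr_act_mult:
  assumes "x \<in> carrier SL2Z_wr_Z2" "x' \<in> carrier SL2Z_wr_Z2" "y \<in> D_eps"
  shows "wr_act (x \<otimes>\<^bsub>SL2Z_wr_Z2\<^esub> x') y = wr_act x (wr_act x' y)"
proof -
  obtain g h s g' h' s' \<tau>1 \<tau>2 \<epsilon> where [simp]: "x = ((g, h), s)" "x' = ((g', h'), s')" "y = (\<tau>1, \<tau>2, \<epsilon>)"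
    by (metis surj_pair)
  have "g \<in> carrier SL2Z" "h \<in> carrier SL2Z" "g' \<in> carrier SL2Z" "h' \<in> carrier SL2Z"
    "s = 0 \<or> s = 1" "s' = 0 \<or> s' = 1" "\<tau>1 \<in> upper_half_plane" "\<tau>2 \<in> upper_half_plane"
    using assms by (auto simp: SL2Z_wr_Z2_simps D_eps_def)
  then show ?thesis
    by (elim disjE) (simp_all add: SL2Z_wr_Z2_simps moebius_mult aut_factor_mult Let_def)
qed

lemma G_act_group_action: "group_action G_eps D_eps (\<lambda>M. restrict (G_act M) D_eps)"
proof -
  interpret G: group G_eps by (rule group_G_eps)
  interpret W: group SL2Z_wr_Z2 by (rule group_SL2Z_wr_Z2)
  have mult: "monoid.mult G_eps = (**)" by (simp add: G_eps_def Sp4Z_simps)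
  have one: "\<one>\<^bsub>G_eps\<^esub> = mat 1" by (simp add: G_eps_def Sp4Z_simps)
  have W: "\<exists>x\<in>carrier SL2Z_wr_Z2. M = wr_embed x" if "M \<in> carrier G_eps" for M
    using that wr_embed_image by blast
  have closed: "G_act M y \<in> D_eps" if "M \<in> carrier G_eps" "y \<in> D_eps" for M y
    using W[OF that(1)] wr_act_closed[OF _ that(2)] G_act_wr_embed by metis
  have act_mult: "G_act (M ** N) y = G_act M (G_act N y)"
    if MN: "M \<in> carrier G_eps" "N \<in> carrier G_eps" "y \<in> D_eps" for M N y
  proof -
    obtain u v where "u \<in> carrier SL2Z_wr_Z2" "v \<in> carrier SL2Z_wr_Z2" "M = wr_embed u" "N = wr_embed v"
      using W[OF MN(1)] W[OF MN(2)] by blast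
    then show ?thesis using MN(3) wr_act_mult[of u v y]
      by (simp add: G_act_wr_embed W.m_closed flip: wr_embed_mult)
  qed
  have act_one: "G_act (mat 1) y = y" for y
    using G_act_Gamma1[of "mat 1"] by (cases y) (simp add: sp_embed_one SL2Z_def)
  have bij: "bij_betw (G_act M) D_eps D_eps" if M: "M \<in> carrier G_eps" for M
  proof (rule bij_betw_byWitness[where f' = "G_act (inv\<^bsub>G_eps\<^esub> M)"])
    have I: "inv\<^bsub>G_eps\<^esub> M \<in> carrier G_eps" "inv\<^bsub>G_eps\<^esub> M ** M = mat 1" "M ** inv\<^bsub>G_eps\<^esub> M = mat 1"
      using M G.l_inv[OF M] G.r_inv[OF M] by (simp_all add: mult one)
    show "\<forall>a\<in>D_eps. G_act (inv\<^bsub>G_eps\<^esub> M) (G_act M a) = a"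
      using act_mult[OF I(1) M] by (simp add: I act_one)
    show "\<forall>a\<in>D_eps. G_act M (G_act (inv\<^bsub>G_eps\<^esub> M) a) = a"
      using act_mult[OF M I(1)] by (simp add: I act_one)
    show "G_act M ` D_eps \<subseteq> D_eps" "G_act (inv\<^bsub>G_eps\<^esub> M) ` D_eps \<subseteq> D_eps"
      using closed M I by auto
  qed
  have Bij: "restrict (G_act M) D_eps \<in> Bij D_eps" if "M \<in> carrier G_eps" for M
    using bij[OF that] by (simp add: Bij_def cong: bij_betw_cong)
  have "(\<lambda>M. restrict (G_act M) D_eps) \<in> hom G_eps (BijGroup D_eps)"
  proof (rule homI)
    fix M assume "M \<in> carrier G_eps"
    then show "restrict (G_act M) D_eps \<in> carrier (BijGroup D_eps)" by (simp add: BijGroup_def Bij)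
  next
    fix M N assume MN: "M \<in> carrier G_eps" "N \<in> carrier G_eps"
    have "restrict (G_act (M ** N)) D_eps =
        compose D_eps (restrict (G_act M) D_eps) (restrict (G_act N) D_eps)"
      using MN closed by (auto simp: compose_def act_mult fun_eq_iff)
    then show "restrict (G_act (M \<otimes>\<^bsub>G_eps\<^esub> N)) D_eps =
        restrict (G_act M) D_eps \<otimes>\<^bsub>BijGroup D_eps\<^esub> restrict (G_act N) D_eps"
      using MN by (simp add: BijGroup_def Bij mult)
  qed
  then show ?thesis
    by (intro group_action.intro group_hom.intro group_hom_axioms.intro G.is_group group_BijGroup)
qed

end

theory Submission
  imports Defs
begin

text \<open>On a torus, a function with poles at the lattice points only is determined up to a constant by
  its principal part and its additive periods along \<open>2 \<pi> \<i>\<close>; the matrices \<open>A\<^sub>a\<close> express its Taylor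
  coefficients by its polar ones. Put \<open>t = \<epsilon> / (r\<^sub>1 r\<^sub>2)\<close>. Up to conjugation by diagonal matrices,
  \<open>A\<^sub>1 A\<^sub>2\<close> is \<open>T B\<^sub>1 T B\<^sub>2\<close> with \<open>T = diag(t\<^sup>k)\<close>, where the nonnegativity of the Dirichlet integral over the
  torus minus the disc of radius \<open>r\<^sub>a\<close> says that \<open>B\<^sub>a\<close> is a contraction of the space of
  square-summable sequences. As \<open>|t| < 1\<close>, the geometric series converges; the same inequality for the
  1-forms on the sewn surface shows that the imaginary part of the period matrix is positive definite.

  Under \<open>\<Gamma>\<^sub>1\<close> the Eisenstein series are modular, except that \<open>E\<^sub>2\<close> acquires an additive term. So, up to
  conjugation by powers of \<open>j / |j|\<close> with \<open>j\<close> the automorphy factor, \<open>B\<^sub>1\<close> changes by a matrix with a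
  single nonzero entry, and the perturbed linear system is solved by a multiple of the original solution.
  The multiple is \<open>j / (c \<Omega>\<^sub>1\<^sub>1 + d)\<close>, from which the action on the period matrix is read off. Finally
  \<open>\<beta>\<close> exchanges the two tori, and conjugates \<open>\<Gamma>\<^sub>1\<close> to \<open>\<Gamma>\<^sub>2\<close>.\<close>

section \<open>Period lattices\<close>

lemma torus_lattice_0: "0 \<in> torus_lattice \<tau>"
  unfolding torus_lattice_def by (rule CollectI, rule exI[of _ 0], rule exI[of _ 0]) simp

lemma torus_lattice_add: "v \<in> torus_lattice \<tau> \<Longrightarrow> w \<in> torus_lattice \<tau> \<Longrightarrow> v + w \<in> torus_lattice \<tau>"
proof -
  assume "v \<in> torus_lattice \<tau>" "w \<in> torus_lattice \<tau>"
  then obtain a b c d where "v = 2 * of_real pi * \<i> * (of_int a * \<tau> + of_int b)"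
    "w = 2 * of_real pi * \<i> * (of_int c * \<tau> + of_int d)" unfolding torus_lattice_def by blast
  then have "v + w = 2 * of_real pi * \<i> * (of_int (a + c) * \<tau> + of_int (b + d))"
    by (simp add: algebra_simps)
  then show ?thesis unfolding torus_lattice_def by blast
qed

lemma torus_lattice_minus: "v \<in> torus_lattice \<tau> \<Longrightarrow> - v \<in> torus_lattice \<tau>"
proof -
  assume "v \<in> torus_lattice \<tau>"
  then obtain a b where "v = 2 * of_real pi * \<i> * (of_int a * \<tau> + of_int b)"
    unfolding torus_lattice_def by blast
  then have "- v = 2 * of_real pi * \<i> * (of_int (- a) * \<tau> + of_int (- b))"
    by (simp add: algebra_simps)
  then show ?thesis unfolding torus_lattice_def by blast
qed

lemma torus_lattice_diff: "v \<in> torus_lattice \<tau> \<Longrightarrow> w \<in> torus_lattice \<tau> \<Longrightarrow> v - w \<in> torus_lattice \<tau>"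
  using torus_lattice_add[of v \<tau> "- w"] torus_lattice_minus[of w \<tau>] by simp

lemma torus_lattice_2pi_i: "2 * of_real pi * \<i> \<in> torus_lattice \<tau>"
  unfolding torus_lattice_def by (rule CollectI, rule exI[of _ 0], rule exI[of _ 1]) simp

lemma torus_lattice_2pi_i_tau: "2 * of_real pi * \<i> * \<tau> \<in> torus_lattice \<tau>"
  unfolding torus_lattice_def by (rule CollectI, rule exI[of _ 1], rule exI[of _ 0]) simp

lemma torus_lattice_induct [consumes 1, case_names zero add1 diff1 add2 diff2]:
  assumes "w \<in> torus_lattice \<tau>" and 0: "P 0"
    and "\<And>w. w \<in> torus_lattice \<tau> \<Longrightarrow> P w \<Longrightarrow> P (w + 2 * of_real pi * \<i>)"
    and "\<And>w. w \<in> torus_lattice \<tau> \<Longrightarrow> P w \<Longrightarrow> P (w - 2 * of_real pi * \<i>)"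
    and "\<And>w. w \<in> torus_lattice \<tau> \<Longrightarrow> P w \<Longrightarrow> P (w + 2 * of_real pi * \<i> * \<tau>)"
    and "\<And>w. w \<in> torus_lattice \<tau> \<Longrightarrow> P w \<Longrightarrow> P (w - 2 * of_real pi * \<i> * \<tau>)"
  shows "P w"
proof -
  let ?w = "\<lambda>m n. 2 * of_real pi * \<i> * (of_int m * \<tau> + of_int n)"
  have in_lat: "?w m n \<in> torus_lattice \<tau>" for m n unfolding torus_lattice_def by blast
  have 1: "P (?w 0 n)" for n :: int
  proof (induction n rule: int_induct[where k = 0])
    case base then show ?case using 0 by simp
  next
    case (step1 i)
    then show ?case using assms(3)[OF in_lat step1(2)] by (simp add: algebra_simps)
  next
    case (step2 i)
    then show ?case using assms(4)[OF in_lat step2(2)] by (simp add: algebra_simps)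
  qed
  have "P (?w m n)" for m n :: int
  proof (induction m rule: int_induct[where k = 0])
    case base then show ?case by (rule 1)
  next
    case (step1 i)
    then show ?case using assms(5)[OF in_lat step1(2)] by (simp add: algebra_simps)
  next
    case (step2 i)
    then show ?case using assms(6)[OF in_lat step2(2)] by (simp add: algebra_simps)
  qed
  then show ?thesis using assms(1) unfolding torus_lattice_def by auto
qed

lemma norm_torus_lattice_ge:
  assumes "\<tau> \<in> upper_half_plane" "w \<in> torus_lattice \<tau>" "w \<noteq> 0"
  shows "norm w \<ge> min (2 * pi) (2 * pi * Im \<tau>)"
proof -
  obtain m n where w: "w = 2 * of_real pi * \<i> * (of_int m * \<tau> + of_int n)"
    using assms unfolding torus_lattice_def by blast
  have im: "Im \<tau> > 0" using assms by (simp add: upper_half_plane_def)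
  have nw: "norm w = 2 * pi * norm (of_int m * \<tau> + of_int n)" by (simp add: w norm_mult)
  show ?thesis
  proof (cases "m = 0")
    case True
    then have "n \<noteq> 0" using assms(3) w by auto
    then have "norm (of_int m * \<tau> + of_int n) \<ge> 1" using True by simp
    then have "2 * pi * 1 \<le> norm w" unfolding nw by (intro mult_left_mono) auto
    then show ?thesis by simp
  next
    case False
    have "Im \<tau> * 1 \<le> Im \<tau> * \<bar>of_int m\<bar>" using im False by (intro mult_left_mono) auto
    also have "\<dots> = \<bar>Im (of_int m * \<tau> + of_int n)\<bar>" using im by (simp add: abs_mult)
    also have "\<dots> \<le> norm (of_int m * \<tau> + of_int n)" by (rule abs_Im_le_cmod)
    finally have "2 * pi * Im \<tau> \<le> norm w" unfolding nw by simp
    then show ?thesis by simp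
  qed
qed

lemma lattice_min_le: "w \<in> torus_lattice \<tau> \<Longrightarrow> w \<noteq> 0 \<Longrightarrow> lattice_min \<tau> \<le> norm w"
  unfolding lattice_min_def by (rule cInf_lower) (auto intro!: bdd_belowI[of _ 0])

lemma lattice_min_pos:
  assumes "\<tau> \<in> upper_half_plane" shows "lattice_min \<tau> > 0"
proof -
  have "0 < min (2 * pi) (2 * pi * Im \<tau>)" using assms by (simp add: upper_half_plane_def)
  also have "\<dots> \<le> lattice_min \<tau>" unfolding lattice_min_def
    using norm_torus_lattice_ge[OF assms] torus_lattice_2pi_i[of \<tau>]
    by (intro cInf_greatest) (auto intro!: exI[of _ "2 * of_real pi * \<i>"])
  finally show ?thesis .
qed

lemma lattice_min_le_dist:
  assumes "v \<in> torus_lattice \<tau>" "w \<in> torus_lattice \<tau>" "v \<noteq> w"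
  shows "lattice_min \<tau> \<le> dist v w"
  using lattice_min_le[OF torus_lattice_diff[OF assms(1,2)]] assms(3) by (simp add: dist_norm)

locale torus =
  fixes \<tau> :: complex
  assumes tau: "\<tau> \<in> upper_half_plane"
begin

abbreviation "\<Lambda> \<equiv> torus_lattice \<tau>"
abbreviation "D \<equiv> lattice_min \<tau>"
abbreviation "\<omega>1 \<equiv> 2 * of_real pi * \<i> :: complex"
abbreviation "\<omega>2 \<equiv> 2 * of_real pi * \<i> * \<tau>"

lemma Im_tau: "Im \<tau> > 0" using tau by (simp add: upper_half_plane_def)

lemmas D_pos = lattice_min_pos[OF tau]

lemma closed_lattice: "closed \<Lambda>"
  by (rule discrete_imp_closed[of D]) (use D_pos lattice_min_le_dist dist_norm in \<open>force+\<close>)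

lemma nearest_lattice_point: "\<exists>w\<in>\<Lambda>. infdist z \<Lambda> = dist z w"
  using infdist_attains_inf[OF closed_lattice] torus_lattice_0 by (metis empty_iff)

lemma infdist_lattice_le: "w \<in> \<Lambda> \<Longrightarrow> infdist z \<Lambda> \<le> dist z w"
  by (rule infdist_le)

lemma punctured_plane_eq: "punctured_plane \<tau> \<rho> = {z. infdist z \<Lambda> > \<rho>}"
  unfolding punctured_plane_def
proof (intro Collect_cong iffI ballI)
  fix z assume "\<forall>w\<in>\<Lambda>. \<rho> < norm (z - w)"
  then show "infdist z \<Lambda> > \<rho>" using nearest_lattice_point[of z] by (auto simp: dist_norm)
next
  fix z w assume "infdist z \<Lambda> > \<rho>" "w \<in> \<Lambda>"
  then show "\<rho> < norm (z - w)" using infdist_lattice_le[of w z] by (simp add: dist_norm)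
qed

lemma open_punctured_plane: "open (punctured_plane \<tau> \<rho>)"
  unfolding punctured_plane_eq by (intro open_Collect_less continuous_intros)

lemma infdist_lattice_near:
  assumes "w \<in> \<Lambda>" "dist z w \<le> D / 2" shows "infdist z \<Lambda> = dist z w"
proof -
  obtain v where v: "v \<in> \<Lambda>" "infdist z \<Lambda> = dist z v" using nearest_lattice_point by blast
  have "dist z v \<ge> dist z w"
  proof (cases "v = w")
    case False
    have "D \<le> dist v w" using lattice_min_le_dist v assms False by auto
    also have "\<dots> \<le> dist z v + dist z w" by (metis dist_commute dist_triangle2)
    finally show ?thesis using assms by simp
  qed simp
  then show ?thesis using infdist_lattice_le[OF assms(1), of z] v by simp
qed

lemma infdist_lattice_add:
  assumes "w \<in> \<Lambda>" shows "infdist (z + w) \<Lambda> = infdist z \<Lambda>"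
proof -
  have le: "infdist (z + w) \<Lambda> \<le> infdist z \<Lambda>" if "w \<in> \<Lambda>" for z w
  proof -
    obtain v where v: "v \<in> \<Lambda>" "infdist z \<Lambda> = dist z v" using nearest_lattice_point by blast
    then show ?thesis using infdist_lattice_le[OF torus_lattice_add[OF v(1) that], of "z + w"] by simp
  qed
  show ?thesis using le[OF assms, of z] le[OF torus_lattice_minus[OF assms], of "z + w"] by simp
qed

lemma lattice_iff_infdist: "z \<in> \<Lambda> \<longleftrightarrow> infdist z \<Lambda> = 0"
  using in_closed_iff_infdist_zero[OF closed_lattice] torus_lattice_0 by blast

lemma countable_lattice: "countable \<Lambda>"
proof -
  have "\<Lambda> = (\<lambda>(m, n). 2 * of_real pi * \<i> * (of_int m * \<tau> + of_int n)) ` UNIV"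
    unfolding torus_lattice_def by auto
  then show ?thesis by simp
qed

definition near :: "complex \<Rightarrow> complex" where
  "near z = (SOME w. w \<in> \<Lambda> \<and> infdist z \<Lambda> = dist z w)"

definition red :: "complex \<Rightarrow> complex" where "red z = z - near z"

lemma near: "near z \<in> \<Lambda>" "dist z (near z) = infdist z \<Lambda>"
proof -
  have "\<exists>w. w \<in> \<Lambda> \<and> infdist z \<Lambda> = dist z w" using nearest_lattice_point by blast
  from someI_ex[OF this] show "near z \<in> \<Lambda>" "dist z (near z) = infdist z \<Lambda>"
    unfolding near_def by simp_all
qed

lemma norm_red: "norm (red z) = infdist z \<Lambda>"
  using near(2)[of z] by (simp add: red_def dist_norm)

lemma near_eq:
  assumes "w \<in> \<Lambda>" "dist z w < D / 2" shows "near z = w"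
proof (rule ccontr)
  assume "near z \<noteq> w"
  then have "D \<le> dist (near z) w" using lattice_min_le_dist near assms by auto
  also have "\<dots> \<le> dist z (near z) + dist z w" by (metis dist_commute dist_triangle2)
  finally show False using near(2)[of z] infdist_lattice_le[OF assms(1), of z] assms(2) by simp
qed

lemma red_eq: "w \<in> \<Lambda> \<Longrightarrow> dist z w < D / 2 \<Longrightarrow> red z = z - w"
  using near_eq by (simp add: red_def)

lemma red_add:
  assumes "w \<in> \<Lambda>" "norm (red z) < D / 2" shows "red (z + w) = red z"
proof -
  have "dist (z + w) (near z + w) < D / 2" using assms near(2)[of z] norm_red by simp
  from red_eq[OF torus_lattice_add[OF near(1) assms(1)] this] show ?thesis by (simp add: red_def)
qed

lemma norm_red_add: "w \<in> \<Lambda> \<Longrightarrow> norm (red (z + w)) = norm (red z)"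
  by (simp add: norm_red infdist_lattice_add)

lemma eventually_red:
  assumes "norm (red z) < D / 2"
  shows "eventually (\<lambda>y. red y = y - near z \<and> norm (red y) < D / 2) (nhds z)"
proof -
  have "eventually (\<lambda>y. y \<in> ball (near z) (D / 2)) (nhds z)"
    by (rule eventually_nhds_in_open) (use assms near[of z] norm_red[of z] in \<open>auto simp: dist_commute\<close>)
  then show ?thesis
  proof eventually_elim
    case (elim y)
    then have "dist y (near z) < D / 2" by (simp add: dist_commute)
    from red_eq[OF near(1) this] this show ?case by (simp add: dist_norm)
  qed
qed

lemma eventually_norm_red_gt:
  assumes "norm (red z) > R"
  shows "eventually (\<lambda>y. norm (red y) > R) (nhds z)"
proof -
  have "open {y. infdist y \<Lambda> > R}" by (intro open_Collect_less continuous_intros)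
  from eventually_nhds_in_open[OF this, of z] show ?thesis using assms by (simp add: norm_red)
qed

lemma connected_punctured_plane:
  assumes "\<rho> < D / 2" "w \<in> \<Lambda>"
  shows "\<exists>g. valid_path g \<and> path_image g \<subseteq> punctured_plane \<tau> \<rho> \<and> pathfinish g = pathstart g + w"
proof -
  obtain s where s: "\<rho> < s" "0 < s" "s < D / 2" using assms D_pos dense[of "max \<rho> 0" "D / 2"] by (metis half_gt_zero max_less_iff_conj)
  define ret where "ret z = z + of_real (max 0 (s / norm (red z) - 1)) * red z" for z
  have nz: "norm (red z) \<noteq> 0" if "z \<notin> \<Lambda>" for z using that lattice_iff_infdist norm_red by simp
  have "isCont ret z" if z: "z \<notin> \<Lambda>" for z
  proof (cases "norm (red z) > s")
    case True
    have "eventually (\<lambda>y. ret y = y) (nhds z)"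
      using eventually_norm_red_gt[OF True]
    proof eventually_elim
      case (elim y)
      then have "s / norm (red y) - 1 \<le> 0" using s by (simp add: divide_simps)
      then have "max 0 (s / norm (red y) - 1) = 0" by linarith
      then show ?case by (simp add: ret_def)
    qed
    from isCont_cong[OF this] show ?thesis by simp
  next
    case False
    then have "norm (red z) < D / 2" using s by simp
    from eventually_red[OF this]
    have "eventually (\<lambda>y. ret y = y + of_real (max 0 (s / norm (y - near z) - 1)) * (y - near z)) (nhds z)"
      by eventually_elim (simp add: ret_def)
    from isCont_cong[OF this] show ?thesis using nz[OF z]
      by (auto simp: red_def intro!: continuous_intros)
  qed
  then have "continuous_on (- \<Lambda>) ret" by (simp add: continuous_at_imp_continuous_on)
  moreover have "connected (- \<Lambda>)"
    by (intro path_connected_imp_connected path_connected_complement_countable countable_lattice) simp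
  ultimately have conn: "connected (ret ` (- \<Lambda>))" by (rule connected_continuous_image)
  have sub: "ret ` (- \<Lambda>) \<subseteq> punctured_plane \<tau> \<rho>"
  proof clarify
    fix z assume z: "z \<notin> \<Lambda>"
    show "ret z \<in> punctured_plane \<tau> \<rho>"
    proof (cases "norm (red z) > s")
      case True
      then have "s / norm (red z) - 1 \<le> 0" using s by (simp add: divide_simps)
      then have "max 0 (s / norm (red z) - 1) = 0" by linarith
      then show ?thesis using True s by (simp add: ret_def punctured_plane_eq norm_red)
    next
      case False
      then have "s / norm (red z) - 1 \<ge> 0" using nz[OF z] by (simp add: divide_simps)
      then have m: "max 0 (s / norm (red z) - 1) = s / norm (red z) - 1" by linarith
      have "ret z - near z = of_real (s / norm (red z)) * red z"
        unfolding ret_def m by (simp add: red_def algebra_simps)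
      then have "dist (ret z) (near z) = s" using s nz[OF z] by (simp add: dist_norm norm_mult norm_divide)
      with infdist_lattice_near[OF near(1), of "ret z" z] have "infdist (ret z) \<Lambda> = s" using s by simp
      then show ?thesis using s by (simp add: punctured_plane_eq)
    qed
  qed
  define z0 :: complex where "z0 = of_real s"
  have i0: "infdist z0 \<Lambda> = s" using infdist_lattice_near[OF torus_lattice_0, of z0] s by (simp add: z0_def)
  have ret_id: "ret z = z" "z \<notin> \<Lambda>" if "infdist z \<Lambda> = s" for z
    using that s lattice_iff_infdist[of z] by (simp_all add: ret_def norm_red)
  have mem: "z0 \<in> ret ` (- \<Lambda>)" "z0 + w \<in> ret ` (- \<Lambda>)"
    using ret_id[OF i0] ret_id[of "z0 + w"] infdist_lattice_add[OF assms(2), of z0] i0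
    by (metis ComplI imageI)+
  have "connected_component (punctured_plane \<tau> \<rho>) z0 (z0 + w)"
    using conn sub mem unfolding connected_component_def by blast
  then have "z0 + w \<in> connected_component_set (punctured_plane \<tau> \<rho>) z0" by simp
  moreover have "z0 \<in> connected_component_set (punctured_plane \<tau> \<rho>) z0"
    using sub mem by (simp add: connected_component_refl subset_iff)
  ultimately obtain g where g: "polynomial_function g"
      "path_image g \<subseteq> connected_component_set (punctured_plane \<tau> \<rho>) z0" "pathstart g = z0" "pathfinish g = z0 + w"
    using connected_open_polynomial_connected[OF open_connected_component[OF open_punctured_plane]
        connected_connected_component] by blast
  then have "path_image g \<subseteq> punctured_plane \<tau> \<rho>" using connected_component_subset by blast
  with g show ?thesis using valid_path_polynomial_function by metis
qed

end

section \<open>Quasi-periodic functions with a simple pole\<close>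

definition exp_pole :: "complex \<Rightarrow> complex" where "exp_pole w = 1 / (exp w - 1)"

lemma exp_pole_minus: "exp w \<noteq> 1 \<Longrightarrow> exp_pole (- w) = - 1 - exp_pole w"
  by (simp add: exp_pole_def exp_minus field_simps)

lemma norm_exp_pole_le:
  assumes "Re w \<ge> 1" shows "norm (exp_pole w) \<le> 2 * exp (- Re w)"
proof -
  have e: "exp (Re w) \<ge> 2" using exp_ge_add_one_self[of "Re w"] assms by linarith
  have "norm (exp w) - norm (1 :: complex) \<le> norm (exp w - 1)" by (rule norm_triangle_ineq2)
  then have "norm (exp w - 1) \<ge> exp (Re w) / 2" using e by simp
  moreover from this have "0 < norm (exp w - 1)" by (rule less_le_trans[rotated]) simp
  ultimately have "1 / norm (exp w - 1) \<le> 1 / (exp (Re w) / 2)" by (intro divide_left_mono) auto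
  then show ?thesis by (simp add: exp_pole_def norm_divide exp_minus field_simps)
qed

lemma exp_pole_geometric:
  assumes "Re w > 0" shows "(\<lambda>n. exp (- of_nat (Suc n) * w)) sums exp_pole w"
proof -
  have n: "norm (exp (- w)) < 1" using assms by simp
  have w: "exp w \<noteq> 1" using assms by (auto simp: exp_eq_1)
  have "(\<lambda>n. exp (- w) * exp (- w) ^ n) sums (exp (- w) * (1 / (1 - exp (- w))))"
    using n by (intro sums_mult geometric_sums)
  moreover have "exp (- w) * (1 / (1 - exp (- w))) = exp_pole w"
    using w by (simp add: exp_pole_def exp_minus field_simps)
  moreover have "exp (- w) * exp (- w) ^ n = exp (- of_nat (Suc n) * w)" for n
  proof -
    have "- of_nat (Suc n) * w = - w + of_nat n * - w" by (simp add: algebra_simps)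
    then show ?thesis by (simp only: exp_add exp_of_nat_mult)
  qed
  ultimately show ?thesis by simp
qed

context torus begin

definition P1_term :: "nat \<Rightarrow> complex \<Rightarrow> complex" where
  "P1_term m z = exp_pole (z - of_nat (Suc m) * \<omega>2) - exp_pole (- z - of_nat (Suc m) * \<omega>2)"

text \<open>The Weierstrass zeta function, minus the linear term that makes it \<open>2 \<pi> \<i>\<close>-periodic.\<close>

definition P1 :: "complex \<Rightarrow> complex" where
  "P1 z = exp_pole z + 1 / 2 + (\<Sum>m. P1_term m z)"

lemma exp_neq_1:
  assumes "z \<notin> \<Lambda>" shows "exp (z + of_int m * \<omega>2) \<noteq> 1"
proof
  assume "exp (z + of_int m * \<omega>2) = 1"
  then obtain n :: int where n: "Re (z + of_int m * \<omega>2) = 0" "Im (z + of_int m * \<omega>2) = of_int (2 * n) * pi"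
    unfolding exp_eq_1 by blast
  then have n: "z + of_int m * \<omega>2 = of_int (2 * n) * of_real pi * \<i>" by (intro complex_eqI) auto
  have "z = \<omega>1 * (of_int (- m) * \<tau> + of_int n)" using n by (simp add: algebra_simps)
  then show False using assms unfolding torus_lattice_def by blast
qed

lemma exp_neq_1':
  assumes "z \<notin> \<Lambda>"
  shows "exp z \<noteq> 1" "exp (z + of_nat m * \<omega>2) \<noteq> 1" "exp (z - of_nat m * \<omega>2) \<noteq> 1"
    "exp (- z - of_nat m * \<omega>2) \<noteq> 1"
  using exp_neq_1[OF assms, of 0] exp_neq_1[OF assms, of "int m"] exp_neq_1[OF assms, of "- int m"]
    exp_neq_1[of "- z" "- int m"] assms torus_lattice_minus[of "- z"] by auto

lemma P1_term_eq:
  assumes "z \<notin> \<Lambda>"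
  shows "P1_term m z = exp_pole (z - of_nat (Suc m) * \<omega>2) + exp_pole (z + of_nat (Suc m) * \<omega>2) + 1"
  unfolding P1_term_def using exp_pole_minus[OF exp_neq_1'(2)[OF assms, of "Suc m"]]
  by (simp add: algebra_simps)

lemma norm_P1_term_le:
  assumes "norm y \<le> K" "K + 1 \<le> 2 * pi * Im \<tau> * real (Suc m)"
  shows "norm (P1_term m y) \<le> 4 * exp K * exp (- 2 * pi * Im \<tau>) ^ Suc m"
proof -
  have "\<bar>Re y\<bar> \<le> K" using assms(1) abs_Re_le_cmod[of y] by simp
  have *: "norm (exp_pole (u - of_nat (Suc m) * \<omega>2)) \<le> 2 * (exp K * exp (- 2 * pi * Im \<tau>) ^ Suc m)"
    if "\<bar>Re u\<bar> \<le> K" for u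
  proof -
    have re: "Re (u - of_nat (Suc m) * \<omega>2) = Re u + 2 * pi * Im \<tau> * real (Suc m)"
      by (simp del: of_nat_Suc)
    have "norm (exp_pole (u - of_nat (Suc m) * \<omega>2)) \<le> 2 * exp (- (Re u + 2 * pi * Im \<tau> * real (Suc m)))"
      using norm_exp_pole_le[of "u - of_nat (Suc m) * \<omega>2"] that assms(2) unfolding re by simp
    also have "\<dots> \<le> 2 * exp (K + real (Suc m) * (- 2 * pi * Im \<tau>))"
      using that by (simp add: algebra_simps)
    also have "\<dots> = 2 * (exp K * exp (- 2 * pi * Im \<tau>) ^ Suc m)"
      by (simp only: exp_add exp_of_nat_mult)
    finally show ?thesis .
  qed
  have "norm (P1_term m y) \<le> norm (exp_pole (y - of_nat (Suc m) * \<omega>2)) + norm (exp_pole (- y - of_nat (Suc m) * \<omega>2))"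
    unfolding P1_term_def by (rule norm_triangle_ineq4)
  also have "\<dots> \<le> 2 * (exp K * exp (- 2 * pi * Im \<tau>) ^ Suc m) + 2 * (exp K * exp (- 2 * pi * Im \<tau>) ^ Suc m)"
    using *[of y] *[of "- y"] \<open>\<bar>Re y\<bar> \<le> K\<close> by (intro add_mono) simp_all
  finally show ?thesis by simp
qed

lemma eventually_Im_tau_ge: "eventually (\<lambda>m. C \<le> 2 * pi * Im \<tau> * real (Suc m)) sequentially"
proof -
  have "filterlim (\<lambda>m. 2 * pi * Im \<tau> * real (Suc m)) at_top sequentially"
    using Im_tau by (intro filterlim_tendsto_pos_mult_at_top[OF tendsto_const]
        filterlim_compose[OF filterlim_real_sequentially filterlim_Suc]) auto
  then show ?thesis by (simp add: filterlim_at_top)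
qed

lemma P1_sums_and_deriv:
  "\<exists>g'. \<forall>z\<in>- \<Lambda>. (\<lambda>m. P1_term m z) sums (\<Sum>m. P1_term m z) \<and> (P1 has_field_derivative g' z) (at z)"
proof -
  have op: "open (- \<Lambda>)" using closed_lattice by (simp add: open_Compl)
  define e' where "e' w = - exp w / (exp w - 1)\<^sup>2" for w :: complex
  have e': "(exp_pole has_field_derivative e' w) (at w)" if "exp w \<noteq> 1" for w
    unfolding exp_pole_def e'_def
    by (rule derivative_eq_intros refl | use that in \<open>force simp: power2_eq_square\<close>)+
  have d: "(P1_term m has_field_derivative e' (z - of_nat (Suc m) * \<omega>2) + e' (- z - of_nat (Suc m) * \<omega>2)) (at z)"
    if "z \<in> - \<Lambda>" for m z
  proof -
    have "((\<lambda>z. exp_pole (z - of_nat (Suc m) * \<omega>2)) has_field_derivative e' (z - of_nat (Suc m) * \<omega>2) * 1) (at z)"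
      by (rule DERIV_chain2[OF e']) (use that exp_neq_1'(3)[of z "Suc m"] in \<open>auto intro!: derivative_eq_intros\<close>)
    moreover have "((\<lambda>z. exp_pole (- z - of_nat (Suc m) * \<omega>2)) has_field_derivative e' (- z - of_nat (Suc m) * \<omega>2) * -1) (at z)"
      by (rule DERIV_chain2[OF e']) (use that exp_neq_1'(4)[of z "Suc m"] in \<open>auto intro!: derivative_eq_intros\<close>)
    ultimately have "((\<lambda>z. exp_pole (z - of_nat (Suc m) * \<omega>2) - exp_pole (- z - of_nat (Suc m) * \<omega>2))
        has_field_derivative e' (z - of_nat (Suc m) * \<omega>2) * 1 - e' (- z - of_nat (Suc m) * \<omega>2) * -1) (at z)"
      by (rule DERIV_diff)
    then show ?thesis by (simp add: P1_term_def[abs_def])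
  qed
  have "\<exists>g g'. \<forall>z\<in>- \<Lambda>. ((\<lambda>m. P1_term m z) sums g z) \<and>
      ((\<lambda>m. e' (z - of_nat (Suc m) * \<omega>2) + e' (- z - of_nat (Suc m) * \<omega>2)) sums g' z) \<and>
      (g has_field_derivative g' z) (at z)"
  proof (rule series_and_derivative_comparison_local[OF op d])
    fix x :: complex
    let ?h = "\<lambda>m. 4 * exp (norm x + 1) * exp (- 2 * pi * Im \<tau>) ^ Suc m"
    have "summable (\<lambda>m. 4 * exp (norm x + 1) * exp (- 2 * pi * Im \<tau>) * exp (- 2 * pi * Im \<tau>) ^ m)"
      using Im_tau by (intro summable_mult summable_geometric) simp
    then have "summable ?h" by (simp add: mult.assoc)
    moreover have "eventually (\<lambda>m. \<forall>y\<in>ball x 1 \<inter> - \<Lambda>. norm (P1_term m y) \<le> ?h m) sequentially"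
      using eventually_Im_tau_ge[of "norm x + 1 + 1"]
    proof eventually_elim
      case (elim m)
      show ?case
      proof
        fix y assume "y \<in> ball x 1 \<inter> - \<Lambda>"
        then have "norm y \<le> norm x + 1"
          using norm_triangle_ineq2[of y x] by (simp add: dist_norm norm_minus_commute)
        from norm_P1_term_le[OF this elim] show "norm (P1_term m y) \<le> ?h m" .
      qed
    qed
    ultimately show "\<exists>d h. 0 < d \<and> summable h \<and>
        (\<forall>\<^sub>F n in sequentially. \<forall>y\<in>ball x d \<inter> - \<Lambda>. norm (P1_term n y) \<le> h n)"
      using zero_less_one by blast
  qed auto
  then obtain g g' where g: "\<And>z. z \<in> - \<Lambda> \<Longrightarrow> (\<lambda>m. P1_term m z) sums g z"
    "\<And>z. z \<in> - \<Lambda> \<Longrightarrow> (g has_field_derivative g' z) (at z)" by blast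
  have "(P1 has_field_derivative e' z + g' z) (at z)" if "z \<in> - \<Lambda>" for z
  proof (rule has_field_derivative_transform_within_open[OF _ op that])
    show "((\<lambda>z. exp_pole z + 1 / 2 + g z) has_field_derivative e' z + g' z) (at z)"
      using that exp_neq_1'(1)[of z] by (auto intro!: derivative_eq_intros e' g(2))
    show "exp_pole w + 1 / 2 + g w = P1 w" if "w \<in> - \<Lambda>" for w
      using sums_unique[OF g(1)[OF that]] by (simp add: P1_def)
  qed
  moreover have "(\<lambda>m. P1_term m z) sums (\<Sum>m. P1_term m z)" if "z \<in> - \<Lambda>" for z
    using sums_unique[OF g(1)[OF that]] g(1)[OF that] by simp
  ultimately show ?thesis by (intro exI[of _ "\<lambda>z. e' z + g' z"]) blast
qed

lemma P1_sums: "z \<notin> \<Lambda> \<Longrightarrow> (\<lambda>m. P1_term m z) sums (P1 z - exp_pole z - 1 / 2)"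
  using P1_sums_and_deriv by (simp add: P1_def) blast

lemma P1_holomorphic: "P1 holomorphic_on - \<Lambda>"
  using P1_sums_and_deriv closed_lattice
  by (subst holomorphic_on_open) (auto simp: open_Compl)

lemma lattice_add_iff: "w \<in> \<Lambda> \<Longrightarrow> z + w \<in> \<Lambda> \<longleftrightarrow> z \<in> \<Lambda>"
  using torus_lattice_diff[of "z + w" \<tau> w] torus_lattice_add[of z \<tau> w] by auto

lemma exp_add_omega1: "exp (z + \<omega>1) = exp z"
  using exp_two_pi_i by (simp add: exp_add mult.commute mult.left_commute)

lemma P1_add_omega1: "P1 (z + \<omega>1) = P1 z"
proof -
  have "z + \<omega>1 - w = z - w + \<omega>1" "- z - w = - (z + \<omega>1) - w + \<omega>1" for w by simp_all
  then have "exp_pole (z + \<omega>1 - w) = exp_pole (z - w)" "exp_pole (- (z + \<omega>1) - w) = exp_pole (- z - w)" for w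
    unfolding exp_pole_def by (metis exp_add_omega1)+
  from this this[of 0] show ?thesis unfolding P1_def P1_term_def by simp
qed

lemma P1_minus: "z \<notin> \<Lambda> \<Longrightarrow> P1 (- z) = - P1 z"
proof -
  assume z: "z \<notin> \<Lambda>"
  then have z': "- z \<notin> \<Lambda>" using torus_lattice_minus by fastforce
  have "P1_term m (- z) = - P1_term m z" for m by (simp add: P1_term_def)
  then have "(\<lambda>m. P1_term m z) sums - (P1 (- z) - exp_pole (- z) - 1 / 2)"
    using sums_minus[OF P1_sums[OF z']] by simp
  from sums_unique2[OF this P1_sums[OF z]] exp_pole_minus[OF exp_neq_1'(1)[OF z]]
  have "- P1 (- z) = P1 z" by (simp add: algebra_simps)
  then show ?thesis by (metis minus_minus)
qed

lemma exp_pole_tendsto_0: "(\<lambda>m. exp_pole (z - of_nat m * \<omega>2)) \<longlonglongrightarrow> 0"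
proof (rule Lim_null_comparison)
  show "eventually (\<lambda>m. norm (exp_pole (z - of_nat m * \<omega>2)) \<le> 2 * (exp (- Re z) * exp (- 2 * pi * Im \<tau>) ^ m)) sequentially"
  proof -
    have "filterlim (\<lambda>m. 2 * pi * Im \<tau> * real m) at_top sequentially"
      using Im_tau by (intro filterlim_tendsto_pos_mult_at_top[OF tendsto_const] filterlim_real_sequentially) auto
    then have "eventually (\<lambda>m. 1 - Re z \<le> 2 * pi * Im \<tau> * real m) sequentially"
      by (simp add: filterlim_at_top)
    then show ?thesis
    proof eventually_elim
      case (elim m)
      have re: "Re (z - of_nat m * \<omega>2) = Re z + 2 * pi * Im \<tau> * real m" by simp
      have "norm (exp_pole (z - of_nat m * \<omega>2)) \<le> 2 * exp (- Re (z - of_nat m * \<omega>2))"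
        by (intro norm_exp_pole_le, unfold re) (use elim in linarith)
      also have "\<dots> = 2 * exp (- Re z + real m * (- 2 * pi * Im \<tau>))" unfolding re by (simp add: algebra_simps)
      also have "\<dots> = 2 * (exp (- Re z) * exp (- 2 * pi * Im \<tau>) ^ m)" by (simp only: exp_add exp_of_nat_mult)
      finally show ?case .
    qed
  qed
  have "(\<lambda>m. exp (- 2 * pi * Im \<tau>) ^ m) \<longlonglongrightarrow> 0" using Im_tau by (intro LIMSEQ_power_zero) simp
  from tendsto_mult[OF tendsto_const tendsto_mult[OF tendsto_const this]]
  show "(\<lambda>m. 2 * (exp (- Re z) * exp (- 2 * pi * Im \<tau>) ^ m)) \<longlonglongrightarrow> 0" by fastforce
qed

lemma P1_add_omega2:
  assumes z: "z \<notin> \<Lambda>" shows "P1 (z + \<omega>2) = P1 z - 1"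
proof -
  have z': "z + \<omega>2 \<notin> \<Lambda>" using z lattice_add_iff torus_lattice_2pi_i_tau by blast
  let ?S = "\<lambda>N z. exp_pole z + 1 / 2 + (\<Sum>m<N. P1_term m z)"
  have S: "?S N (z + \<omega>2) = ?S N z + exp_pole (z + of_nat (Suc N) * \<omega>2) - exp_pole (z - of_nat N * \<omega>2)" for N
  proof (induction N)
    case (Suc N)
    have "P1_term N (z + \<omega>2) - P1_term N z = exp_pole (z - of_nat N * \<omega>2) + exp_pole (z + of_nat (Suc (Suc N)) * \<omega>2)
       - exp_pole (z - of_nat (Suc N) * \<omega>2) - exp_pole (z + of_nat (Suc N) * \<omega>2)"
    proof -
      have eqs: "z + \<omega>2 - of_nat (Suc N) * \<omega>2 = z - of_nat N * \<omega>2"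
        "z + \<omega>2 + of_nat (Suc N) * \<omega>2 = z + of_nat (Suc (Suc N)) * \<omega>2" by (simp_all add: algebra_simps)
      show ?thesis unfolding P1_term_eq[OF z] P1_term_eq[OF z'] eqs by simp
    qed
    then have "P1_term N (z + \<omega>2) = P1_term N z + (exp_pole (z - of_nat N * \<omega>2) + exp_pole (z + of_nat (Suc (Suc N)) * \<omega>2)
       - exp_pole (z - of_nat (Suc N) * \<omega>2) - exp_pole (z + of_nat (Suc N) * \<omega>2))"
      by (simp only: diff_eq_eq add.commute)
    then have "?S (Suc N) (z + \<omega>2) = ?S N (z + \<omega>2) + (P1_term N z + (exp_pole (z - of_nat N * \<omega>2) + exp_pole (z + of_nat (Suc (Suc N)) * \<omega>2)
       - exp_pole (z - of_nat (Suc N) * \<omega>2) - exp_pole (z + of_nat (Suc N) * \<omega>2)))"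
      by (simp only: sum.lessThan_Suc add.assoc)
    then show ?case unfolding Suc by (simp del: of_nat_Suc)
  qed simp
  have lim: "(\<lambda>N. ?S N z) \<longlonglongrightarrow> P1 z" if "z \<notin> \<Lambda>" for z
    using tendsto_add[OF tendsto_const P1_sums[OF that, unfolded sums_def], of "exp_pole z + 1/2"] by simp
  have "(\<lambda>N. exp_pole (- z - of_nat (Suc N) * \<omega>2)) \<longlonglongrightarrow> 0"
    using exp_pole_tendsto_0 by (rule LIMSEQ_Suc)
  then have "(\<lambda>N. - 1 - exp_pole (- z - of_nat (Suc N) * \<omega>2)) \<longlonglongrightarrow> - 1 - 0" by (intro tendsto_intros)
  moreover have "- 1 - exp_pole (- z - of_nat (Suc N) * \<omega>2) = exp_pole (z + of_nat (Suc N) * \<omega>2)" for N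
    using exp_pole_minus[OF exp_neq_1'(2)[OF z, of "Suc N"]] by (simp add: algebra_simps)
  ultimately have "(\<lambda>N. exp_pole (z + of_nat (Suc N) * \<omega>2)) \<longlonglongrightarrow> - 1" by simp
  from tendsto_diff[OF tendsto_add[OF lim[OF z] this] exp_pole_tendsto_0[of z]]
  have "(\<lambda>N. ?S N (z + \<omega>2)) \<longlonglongrightarrow> P1 z - 1" unfolding S by simp
  from LIMSEQ_unique[OF lim[OF z'] this] show ?thesis .
qed

end

lemma fps_exp_minus_1_complex:
  "subdegree (fps_exp 1 - 1 :: 'a :: field_char_0 fps) = 1" "fps_exp 1 - 1 \<noteq> (0 :: 'a fps)"
proof -
  have 1: "fps_nth (fps_exp 1 - 1 :: 'a fps) 1 = 1" by simp
  show "subdegree (fps_exp 1 - 1 :: 'a fps) = 1" by (rule subdegreeI) (use 1 in auto)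
  show "fps_exp 1 - 1 \<noteq> (0 :: 'a fps)" using 1 by (metis fps_zero_nth zero_neq_one)
qed

lemma bernoulli_fps_mult:
  "(fps_X / (fps_exp 1 - 1)) * (fps_exp 1 - 1) = (fps_X :: 'a :: field_char_0 fps)"
  using fps_exp_minus_1_complex[where 'a = 'a] by (intro dvd_div_mult_self) (simp add: fps_dvd_iff)

lemma bernoulli_fps_of_real:
  "fps_nth (fps_X / (fps_exp 1 - 1) :: complex fps) k = of_real (bernoulli_number k / fact k)"
proof -
  let ?F = "fps_X / (fps_exp 1 - 1) :: real fps"
  let ?G = "Abs_fps (\<lambda>k. of_real (fps_nth ?F k)) :: complex fps"
  have "?G * (fps_exp 1 - 1) = fps_X"
  proof (rule fps_ext)
    fix n
    have "fps_nth (?G * (fps_exp 1 - 1)) n = of_real (fps_nth (?F * (fps_exp 1 - 1)) n)"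
      unfolding fps_mult_nth of_real_sum
      by (intro sum.cong refl) (simp add: fps_one_nth)
    then show "fps_nth (?G * (fps_exp 1 - 1)) n = fps_nth fps_X n"
      unfolding bernoulli_fps_mult by (simp add: fps_X_def)
  qed
  then have "fps_X / (fps_exp 1 - 1) = ?G"
    using fps_exp_minus_1_complex(2)[where 'a = complex] by (metis nonzero_mult_div_cancel_right)
  then show ?thesis by (simp add: bernoulli_number_def)
qed

lemma bernoulli_number_0_1: "bernoulli_number 0 = 1" "bernoulli_number 1 = - 1 / 2"
proof -
  let ?F = "fps_X / (fps_exp 1 - 1) :: real fps"
  have 1: "fps_nth (?F * (fps_exp 1 - 1)) 1 = 1" unfolding bernoulli_fps_mult by simp
  then have F0: "fps_nth ?F 0 = 1" by (simp add: fps_mult_nth fps_one_nth)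
  have 2: "fps_nth (?F * (fps_exp 1 - 1)) 2 = 0" unfolding bernoulli_fps_mult by simp
  have "{0..2} = {0, 1, 2 :: nat}" by auto
  then have "fps_nth ?F 1 + fps_nth ?F 0 / 2 = 0"
    using 2 by (simp add: fps_mult_nth fps_one_nth fact_2)
  with F0 show "bernoulli_number 0 = 1" "bernoulli_number 1 = - 1 / 2"
    by (simp_all add: bernoulli_number_def)
qed

lemma exp_pole_expansion:
  "\<exists>\<delta>>0. \<forall>z. z \<noteq> 0 \<and> norm z < \<delta> \<longrightarrow>
     (\<lambda>n. of_real (bernoulli_number (Suc n) / fact (Suc n)) * z ^ n) sums (exp_pole z - 1 / z)"
proof -
  have "(\<lambda>z :: complex. if z = 0 then 1 else z / (exp (1 * z) - 1)) has_fps_expansion (fps_X / (fps_exp 1 - 1))"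
    by (rule has_fps_expansion_divide)
      (use fps_exp_minus_1_complex[where 'a = complex] in \<open>auto intro!: fps_expansion_intros\<close>)
  then have "fps_conv_radius (fps_X / (fps_exp 1 - 1) :: complex fps) > 0"
    and ev: "eventually (\<lambda>z. eval_fps (fps_X / (fps_exp 1 - 1)) z = (if z = 0 then 1 else z / (exp (1 * z) - 1))) (nhds (0 :: complex))"
    by (simp_all add: has_fps_expansion_def)
  then obtain r where r: "0 < ereal r" "ereal r < fps_conv_radius (fps_X / (fps_exp 1 - 1) :: complex fps)"
    using ereal_dense2[of 0] by blast
  obtain e where e: "e > 0" "\<And>z :: complex. dist z 0 < e \<Longrightarrow> eval_fps (fps_X / (fps_exp 1 - 1)) z = (if z = 0 then 1 else z / (exp (1 * z) - 1))"
    using ev unfolding eventually_nhds_metric by blast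
  show ?thesis
  proof (intro exI[of _ "min r e"] conjI allI impI)
    fix z :: complex assume z: "z \<noteq> 0 \<and> norm z < min r e"
    have "ereal (norm z) < fps_conv_radius (fps_X / (fps_exp 1 - 1) :: complex fps)"
      using z r by (metis ereal_less(3) less_ereal.simps(1) min_less_iff_conj order.strict_trans)
    from sums_eval_fps[OF this]
    have "(\<lambda>n. of_real (bernoulli_number n / fact n) * z ^ n) sums (z / (exp z - 1))"
      using e(2)[of z] z by (simp add: bernoulli_fps_of_real)
    then have "(\<lambda>n. of_real (bernoulli_number (Suc n) / fact (Suc n)) * z ^ Suc n) sums (z / (exp z - 1) - 1)"
      using bernoulli_number_0_1 by (subst sums_Suc_iff) simp
    moreover have "c * z ^ Suc n / z = c * z ^ n" for c n using z by simp
    moreover have "(z / (exp z - 1) - 1) / z = exp_pole z - 1 / z"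
      using z by (simp add: exp_pole_def diff_divide_distrib)
    ultimately show "(\<lambda>n. of_real (bernoulli_number (Suc n) / fact (Suc n)) * z ^ n) sums (exp_pole z - 1 / z)"
      by (metis (no_types, lifting) sums_cong sums_divide)
  qed (use r e in auto)
qed

lemma summable_has_sum: "f summable_on UNIV \<Longrightarrow> f sums S \<Longrightarrow> (f has_sum S) (UNIV :: nat set)"
  for f :: "nat \<Rightarrow> 'a :: {topological_comm_monoid_add, t2_space}"
  by (metis has_sum_imp_sums has_sum_infsum sums_unique2)

lemma summable_on_Sigma_section:
  fixes f :: "_ \<Rightarrow> complex"
  shows "f summable_on Sigma A B \<Longrightarrow> x \<in> A \<Longrightarrow> (\<lambda>y. f (x, y)) summable_on B x"
  using summable_on_SigmaD1[of "\<lambda>x y. f (x, y)" A B x] by simp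

lemma bij_betw_divisor_pairs:
  "bij_betw (\<lambda>(j, d). (Suc j div d - 1, d - 1)) (SIGMA j:UNIV. {d. d dvd Suc j}) (UNIV \<times> UNIV)"
proof (rule bij_betwI[where g = "\<lambda>(m, n). (Suc m * Suc n - 1, Suc n)"])
  show "(\<lambda>(j, d). (Suc j div d - 1, d - 1)) \<in> (SIGMA j:UNIV. {d. d dvd Suc j}) \<rightarrow> UNIV \<times> UNIV" by auto
  show "(\<lambda>(m, n). (Suc m * Suc n - 1, Suc n)) \<in> UNIV \<times> UNIV \<rightarrow> (SIGMA j:UNIV. {d. d dvd Suc j})"
  proof (rule funcsetI)
    fix x :: "nat \<times> nat"
    obtain m n where x: "x = (m, n)" by (cases x)
    have "Suc (Suc m * Suc n - 1) = Suc m * Suc n" by simp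
    then have "Suc n dvd Suc (Suc m * Suc n - 1)" by (metis dvd_triv_right)
    then show "(\<lambda>(m, n). (Suc m * Suc n - 1, Suc n)) x \<in> (SIGMA j:UNIV. {d. d dvd Suc j})"
      by (simp only: x prod.case mem_Sigma_iff UNIV_I mem_Collect_eq simp_thms)
  qed
next
  fix x assume "x \<in> (SIGMA j:UNIV. {d. d dvd Suc j})"
  then obtain j d where x: "x = (j, d)" "d dvd Suc j" by auto
  then obtain k where k: "Suc j = d * k" by blast
  then have "d > 0" "k > 0" using gr0I by fastforce+
  moreover from this have "Suc j div d = k" "k * d - 1 = j"
    using k by (simp, metis diff_Suc_1 mult.commute)
  ultimately show "(\<lambda>(m, n). (Suc m * Suc n - 1, Suc n)) ((\<lambda>(j, d). (Suc j div d - 1, d - 1)) x) = x"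
    by (simp add: x del: mult_Suc mult_Suc_right)
next
  fix x :: "nat \<times> nat"
  obtain m n where x: "x = (m, n)" by (cases x)
  have "Suc (Suc m * Suc n - 1) = Suc n * Suc m" by simp
  then show "(\<lambda>(j, d). (Suc j div d - 1, d - 1)) ((\<lambda>(m, n). (Suc m * Suc n - 1, Suc n)) x) = x"
    by (simp only: x prod.case nonzero_mult_div_cancel_left) simp
qed

context torus begin

lemma P1_tail_expansion:
  "\<exists>\<delta>>0. \<forall>z. z \<noteq> 0 \<and> norm z < \<delta> \<longrightarrow>
     (\<lambda>n. ((-1) ^ n - 1) / fact n *
        (\<Sum>j. of_nat (sigma_div n (Suc j)) * exp (2 * of_real pi * \<i> * of_nat (Suc j) * \<tau>)) * z ^ n)
     sums (P1 z - exp_pole z - 1 / 2)"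
proof -
  define q where "q = exp \<omega>2"
  have q_eq: "exp (2 * of_real pi * \<i> * of_nat k * \<tau>) = q ^ k" for k
    unfolding q_def exp_of_nat_mult[symmetric] by (simp add: algebra_simps)
  have nq: "norm q = exp (- 2 * pi * Im \<tau>)" by (simp add: q_def)
  define \<delta> where "\<delta> = min (D / 2) (pi * Im \<tau>)"
  have \<delta>: "\<delta> > 0" using D_pos Im_tau by (simp add: \<delta>_def)
  define \<rho> where "\<rho> = norm q * exp \<delta>"
  have \<rho>: "\<rho> < 1" "\<rho> > 0"
  proof -
    have "\<rho> = exp (- 2 * pi * Im \<tau> + \<delta>)" by (simp add: \<rho>_def nq flip: exp_add)
    also have "\<dots> < 1" using Im_tau \<delta>_def by (simp add: min_def) (smt (verit) mult_pos_pos pi_gt_zero)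
    finally show "\<rho> < 1" .
    show "\<rho> > 0" by (simp add: \<rho>_def nq)
  qed
  show ?thesis
  proof (intro exI[of _ \<delta>] conjI allI impI \<delta>)
    fix z :: complex assume z: "z \<noteq> 0 \<and> norm z < \<delta>"
    then have zL: "z \<notin> \<Lambda>" using lattice_min_le[of z \<tau>] \<delta>_def D_pos by auto
    define f where "f = (\<lambda>((m, N), n). q ^ (Suc N * Suc m) * (((-1) ^ n - 1) / fact n * (of_nat (Suc N) * z) ^ n))"
    define F where "F = (\<lambda>((m, N), n). 2 * (norm q ^ (Suc N * Suc m) * ((real (Suc N) * norm z) ^ n / fact n)))"
    have nonneg: "F x \<ge> 0" for x by (cases x rule: prod.exhaust) (auto simp: F_def split_beta)
    have "F summable_on (UNIV \<times> UNIV) \<times> UNIV"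
    proof (rule summable_on_SigmaI)
      fix x :: "nat \<times> nat"
      obtain m N where x: "x = (m, N)" by (cases x)
      have "(\<lambda>n. (real (Suc N) * norm z) ^ n / fact n) sums exp (real (Suc N) * norm z)"
        using exp_converges[of "real (Suc N) * norm z"] by (simp add: divide_inverse mult.commute)
      from sums_mult[OF sums_mult[OF this]]
      have "(\<lambda>n. F (x, n)) sums (2 * (norm q ^ (Suc N * Suc m) * exp (real (Suc N) * norm z)))"
        by (simp add: F_def x)
      then show "((\<lambda>n. F (x, n)) has_sum (\<lambda>(m, N). 2 * (norm q ^ (Suc N * Suc m) * exp (real (Suc N) * norm z))) x) UNIV"
        unfolding x prod.case using nonneg by (intro sums_nonneg_imp_has_sum) auto
    next
      have geo: "((\<lambda>N. \<rho> ^ N) has_sum (1 / (1 - \<rho>))) UNIV"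
        using \<rho> by (intro sums_nonneg_imp_has_sum geometric_sums) auto
      have "(\<lambda>(m, N). 2 * \<rho> * \<rho> ^ m * \<rho> ^ N) summable_on (UNIV \<times> UNIV :: (nat \<times> nat) set)"
      proof (rule summable_on_SigmaI)
        show "((\<lambda>N. case (m, N) of (m, N) \<Rightarrow> 2 * \<rho> * \<rho> ^ m * \<rho> ^ N) has_sum (2 * \<rho> * \<rho> ^ m * (1 / (1 - \<rho>)))) UNIV" for m
          unfolding prod.case by (intro has_sum_cmult_right geo)
        show "(\<lambda>m. 2 * \<rho> * \<rho> ^ m * (1 / (1 - \<rho>))) summable_on UNIV"
          using geo by (intro summable_on_cmult_left summable_on_cmult_right) (auto simp: summable_on_def)
      qed (use \<rho> in auto)
      then show "(\<lambda>(m, N). 2 * (norm q ^ (Suc N * Suc m) * exp (real (Suc N) * norm z))) summable_on UNIV \<times> UNIV"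
      proof (rule summable_on_comparison_test, goal_cases)
        case (1 x)
        obtain m N where x: "x = (m, N)" by (cases x)
        have "exp (real (Suc N) * norm z) \<le> exp (real (Suc N * Suc m) * \<delta>)"
        proof -
          have "real (Suc N) * norm z \<le> real (Suc N) * \<delta>" using z by (intro mult_left_mono) auto
          also have "\<dots> \<le> real (Suc N * Suc m) * \<delta>" using \<delta> by (intro mult_right_mono) auto
          finally show ?thesis by simp
        qed
        then have "norm q ^ (Suc N * Suc m) * exp (real (Suc N) * norm z) \<le> norm q ^ (Suc N * Suc m) * exp \<delta> ^ (Suc N * Suc m)"
          by (intro mult_left_mono) (simp_all only: exp_of_nat_mult zero_le_power norm_ge_zero)
        also have "\<dots> = \<rho> ^ (Suc N * Suc m)" by (simp only: \<rho>_def power_mult_distrib)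
        also have "\<dots> \<le> \<rho> ^ Suc (m + N)" using \<rho> by (intro power_decreasing) auto
        finally show ?case by (simp add: x power_add mult.assoc mult.left_commute)
      qed auto
    qed (use nonneg in auto)
    then have "(\<lambda>x. norm (f x)) summable_on (UNIV \<times> UNIV) \<times> UNIV"
    proof (rule summable_on_comparison_test, goal_cases)
      case (1 x)
      obtain m N n where x: "x = ((m, N), n)" by (metis surj_pair)
      have "norm ((-1) ^ n - 1 :: complex) \<le> 2" using norm_triangle_ineq4[of "(-1) ^ n :: complex" 1] by (simp add: norm_power)
      then have "norm (((-1) ^ n - 1 :: complex) * (q ^ (Suc N * Suc m) * (of_nat (Suc N) * z) ^ n / fact n)) \<le> 
        2 * norm (q ^ (Suc N * Suc m) * (of_nat (Suc N) * z) ^ n / fact n)"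
        unfolding norm_mult by (intro mult_right_mono) auto
      then show ?case
        by (simp add: x f_def F_def norm_mult norm_power norm_divide power_mult_distrib mult_ac del: of_nat_Suc power_Suc mult_Suc mult_Suc_right)
    qed auto
    then have fs: "f summable_on (UNIV \<times> UNIV) \<times> UNIV" by (rule abs_summable_summable)
    then obtain S where S: "(f has_sum S) ((UNIV \<times> UNIV) \<times> UNIV)" by (auto simp: summable_on_def)
    have "((\<lambda>n. f ((m, N), n)) has_sum (q ^ (Suc N * Suc m) * (exp (- of_nat (Suc N) * z) - exp (of_nat (Suc N) * z)))) UNIV" for m N
    proof (rule summable_has_sum)
      show "(\<lambda>n. f ((m, N), n)) summable_on UNIV" using summable_on_Sigma_section[OF fs, of "(m, N)"] by simp
      have "(\<lambda>n. (- (of_nat (Suc N) * z)) ^ n /\<^sub>R fact n - (of_nat (Suc N) * z) ^ n /\<^sub>R fact n) sums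
          (exp (- of_nat (Suc N) * z) - exp (of_nat (Suc N) * z))"
        unfolding minus_mult_left[symmetric] by (intro sums_diff exp_converges)
      from sums_mult[OF this, of "q ^ (Suc N * Suc m)"]
      show "(\<lambda>n. f ((m, N), n)) sums (q ^ (Suc N * Suc m) * (exp (- of_nat (Suc N) * z) - exp (of_nat (Suc N) * z)))"
      proof (rule sums_cong[THEN iffD1, rotated])
        fix n
        show "q ^ (Suc N * Suc m) * ((- (of_nat (Suc N) * z)) ^ n /\<^sub>R fact n - (of_nat (Suc N) * z) ^ n /\<^sub>R fact n) = f ((m, N), n)"
          unfolding f_def prod.case power_minus[of "of_nat (Suc N) * z"]
          by (simp add: scaleR_conv_of_real field_simps del: of_nat_Suc power_Suc)
      qed
    qed
    from has_sum_SigmaD[OF S, of "\<lambda>(m, N). q ^ (Suc N * Suc m) * (exp (- of_nat (Suc N) * z) - exp (of_nat (Suc N) * z))"] this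
    have S1: "((\<lambda>(m, N). q ^ (Suc N * Suc m) * (exp (- of_nat (Suc N) * z) - exp (of_nat (Suc N) * z))) has_sum S) (UNIV \<times> UNIV)"
      by auto
    have "((\<lambda>N. q ^ (Suc N * Suc m) * (exp (- of_nat (Suc N) * z) - exp (of_nat (Suc N) * z))) has_sum P1_term m z) UNIV" for m
    proof (rule summable_has_sum)
      show "(\<lambda>N. q ^ (Suc N * Suc m) * (exp (- of_nat (Suc N) * z) - exp (of_nat (Suc N) * z))) summable_on UNIV"
        using summable_on_Sigma_section[OF has_sum_imp_summable[OF S1], of m] by simp
      have *: "(\<lambda>N. q ^ (Suc N * Suc m) * exp (- of_nat (Suc N) * u)) sums exp_pole (u - of_nat (Suc m) * \<omega>2)"
        if "norm u < \<delta>" for u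
      proof -
        have "\<bar>Re u\<bar> < pi * Im \<tau>" using that abs_Re_le_cmod[of u] by (simp add: \<delta>_def)
        moreover have "1 * (pi * Im \<tau>) \<le> (2 * real (Suc m)) * (pi * Im \<tau>)"
          using Im_tau by (intro mult_right_mono) auto
        moreover have "Re (u - of_nat (Suc m) * \<omega>2) = Re u + (2 * real (Suc m)) * (pi * Im \<tau>)"
          by (simp del: of_nat_Suc)
        ultimately have "Re (u - of_nat (Suc m) * \<omega>2) > 0" by linarith
        from exp_pole_geometric[OF this] show ?thesis
        proof (rule sums_cong[THEN iffD1, rotated])
          fix N
          have "- of_nat (Suc N) * (u - of_nat (Suc m) * \<omega>2) = of_nat (Suc N * Suc m) * \<omega>2 + - of_nat (Suc N) * u"
            by (simp add: algebra_simps)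
          then show "exp (- of_nat (Suc N) * (u - of_nat (Suc m) * \<omega>2)) = q ^ (Suc N * Suc m) * exp (- of_nat (Suc N) * u)"
            by (simp only: exp_add exp_of_nat_mult q_def)
        qed
      qed
      from sums_diff[OF *[of z] *[of "- z"]] z
      show "(\<lambda>N. q ^ (Suc N * Suc m) * (exp (- of_nat (Suc N) * z) - exp (of_nat (Suc N) * z))) sums P1_term m z"
        unfolding P1_term_def by (simp add: right_diff_distrib del: of_nat_Suc)
    qed
    from has_sum_SigmaD[OF S1, of "\<lambda>m. P1_term m z"] this have "((\<lambda>m. P1_term m z) has_sum S) UNIV" by simp
    from sums_unique2[OF has_sum_imp_sums[OF this] P1_sums[OF zL]] have S_eq: "S = P1 z - exp_pole z - 1 / 2" .
    have S2: "((\<lambda>(n, x). f (x, n)) has_sum S) (UNIV \<times> UNIV \<times> UNIV)"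
      using has_sum_swap[of f, THEN iffD1, OF S] by (simp add: case_prod_unfold)
    have "((\<lambda>x. f (x, n)) has_sum (((-1) ^ n - 1) / fact n *
        (\<Sum>j. of_nat (sigma_div n (Suc j)) * q ^ Suc j) * z ^ n)) (UNIV \<times> UNIV)" for n
    proof (cases "even n")
      case True
      then show ?thesis by (auto simp: f_def case_prod_unfold)
    next
      case False
      let ?c = "((-1) ^ n - 1) / fact n * z ^ n"
      have c: "?c \<noteq> 0" using False z by simp
      have f_eq: "(\<lambda>x. f (x, n)) = (\<lambda>x. ?c * (case x of (m, N) \<Rightarrow> of_nat (Suc N) ^ n * q ^ (Suc N * Suc m)))"
        by (auto simp: f_def power_mult_distrib mult_ac)
      have "(\<lambda>x. f (x, n)) summable_on UNIV \<times> UNIV"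
        using summable_on_Sigma_section[OF has_sum_imp_summable[OF S2], of n] by simp
      then have "(\<lambda>(m, N). of_nat (Suc N) ^ n * q ^ (Suc N * Suc m)) summable_on UNIV \<times> UNIV"
        unfolding f_eq using c by (subst (asm) summable_on_cmult_right') auto
      then obtain L where L: "((\<lambda>(m, N). of_nat (Suc N) ^ n * q ^ (Suc N * Suc m)) has_sum L) (UNIV \<times> UNIV)"
        by (auto simp: summable_on_def)
      have "((\<lambda>x. case case x of (j, d) \<Rightarrow> (Suc j div d - 1, d - 1) of (m, N) \<Rightarrow> of_nat (Suc N) ^ n * q ^ (Suc N * Suc m)) has_sum L)
          (SIGMA j:UNIV. {d. d dvd Suc j})"
        using L by (subst has_sum_reindex_bij_betw[OF bij_betw_divisor_pairs])
      moreover have "(case case x of (j, d) \<Rightarrow> (Suc j div d - 1, d - 1) of (m, N) \<Rightarrow> of_nat (Suc N) ^ n * q ^ (Suc N * Suc m))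
          = (\<lambda>(j, d). of_nat d ^ n * q ^ Suc j) x" if x_in: "x \<in> (SIGMA j:UNIV. {d. d dvd Suc j})" for x
      proof -
        obtain j d where x: "x = (j, d)" "d dvd Suc j" using x_in by auto
        then obtain k where k: "Suc j = d * k" by blast
        then have "d > 0" "k > 0" using gr0I by fastforce+
        then show ?thesis using k by (simp add: x del: power_Suc mult_Suc mult_Suc_right)
      qed
      ultimately have L2: "((\<lambda>(j, d). of_nat d ^ n * q ^ Suc j) has_sum L) (SIGMA j:UNIV. {d. d dvd Suc j})"
        by (subst has_sum_cong[symmetric])
      have "((\<lambda>d. of_nat d ^ n * q ^ Suc j) has_sum (of_nat (sigma_div n (Suc j)) * q ^ Suc j)) {d. d dvd Suc j}" for j
      proof -
        have "finite {d. d dvd Suc j}" by simp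
        from has_sum_finite[OF this, of "\<lambda>d. of_nat d ^ n * q ^ Suc j"] show ?thesis
          by (simp add: sigma_div_def sum_distrib_right del: power_Suc)
      qed
      from has_sum_SigmaD[OF L2, of "\<lambda>j. of_nat (sigma_div n (Suc j)) * q ^ Suc j"] this
      have "((\<lambda>j. of_nat (sigma_div n (Suc j)) * q ^ Suc j) has_sum L) UNIV" by simp
      then have "L = (\<Sum>j. of_nat (sigma_div n (Suc j)) * q ^ Suc j)" using has_sum_imp_sums sums_unique by blast
      with has_sum_cmult_right[OF L, of ?c] show ?thesis unfolding f_eq by (simp add: mult_ac)
    qed
    from has_sum_SigmaD[OF S2, of "\<lambda>n. ((-1) ^ n - 1) / fact n * (\<Sum>j. of_nat (sigma_div n (Suc j)) * q ^ Suc j) * z ^ n"] this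
    have "((\<lambda>n. ((-1) ^ n - 1) / fact n * (\<Sum>j. of_nat (sigma_div n (Suc j)) * q ^ Suc j) * z ^ n) has_sum S) UNIV"
      by simp
    from has_sum_imp_sums[OF this] show "(\<lambda>n. ((-1) ^ n - 1) / fact n *
        (\<Sum>j. of_nat (sigma_div n (Suc j)) * exp (2 * of_real pi * \<i> * of_nat (Suc j) * \<tau>)) * z ^ n)
     sums (P1 z - exp_pole z - 1 / 2)"
      unfolding q_eq S_eq .
  qed
qed

definition P1_reg :: "complex \<Rightarrow> complex" where "P1_reg z = (if z = 0 then 0 else P1 z - 1 / z)"

lemma P1_reg_expansion: "P1_reg has_fps_expansion Abs_fps (\<lambda>n. - eisenstein_E (Suc n) \<tau>)"
proof -
  define T where "T n = (\<Sum>j. of_nat (sigma_div n (Suc j)) * exp (2 * of_real pi * \<i> * of_nat (Suc j) * \<tau>))" for n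
  define a where "a n = of_real (bernoulli_number (Suc n) / fact (Suc n)) + (if n = 0 then 1 / 2 else 0)
     + ((-1) ^ n - 1) / fact n * T n" for n
  have a0: "a 0 = 0" using bernoulli_number_0_1 by (simp add: a_def)
  obtain d1 where d1: "d1 > 0"
    "\<And>z :: complex. z \<noteq> 0 \<Longrightarrow> norm z < d1 \<Longrightarrow> (\<lambda>n. of_real (bernoulli_number (Suc n) / fact (Suc n)) * z ^ n) sums (exp_pole z - 1 / z)"
    using exp_pole_expansion by blast
  obtain d2 where d2: "d2 > 0"
    "\<And>z. z \<noteq> 0 \<Longrightarrow> norm z < d2 \<Longrightarrow> (\<lambda>n. ((-1) ^ n - 1) / fact n * T n * z ^ n) sums (P1 z - exp_pole z - 1 / 2)"
    using P1_tail_expansion[folded T_def] by blast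
  define \<delta> where "\<delta> = Min {d1, d2, D}"
  have \<delta>: "\<delta> > 0" "\<delta> \<le> d1" "\<delta> \<le> d2" "\<delta> \<le> D" using d1 d2 D_pos by (simp_all add: \<delta>_def)
  have sums: "(\<lambda>n. a n * z ^ n) sums P1_reg z" if z: "norm z < \<delta>" for z
  proof (cases "z = 0")
    case True
    have "(\<lambda>n. a n * 0 ^ n) sums (a 0)" by (rule powser_sums_zero)
    then show ?thesis using True a0 by (simp add: P1_reg_def)
  next
    case False
    have "(\<lambda>n. (if n = 0 then 1 / 2 else 0) * z ^ n) sums (1 / 2 * z ^ 0)"
      using sums_single[of 0 "\<lambda>n. 1 / 2 * z ^ n"] by (rule sums_cong[THEN iffD1, rotated]) auto
    from sums_add[OF sums_add[OF d1(2)[of z] this] d2(2)[of z]] False z \<delta>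
    have "(\<lambda>n. a n * z ^ n) sums (exp_pole z - 1 / z + 1 / 2 * z ^ 0 + (P1 z - exp_pole z - 1 / 2))"
      unfolding a_def by (simp add: algebra_simps)
    then show ?thesis using False by (simp add: P1_reg_def)
  qed
  have exp1: "P1_reg has_fps_expansion Abs_fps a"
    by (rule has_fps_expansionI) (use sums \<delta> in \<open>auto simp: eventually_nhds_metric intro!: exI[of _ \<delta>]\<close>)
  have odd: "P1_reg (- z) = - P1_reg z" if "norm z < \<delta>" for z
  proof (cases "z = 0")
    case False
    then have "z \<notin> \<Lambda>" using lattice_min_le[of z \<tau>] that \<delta> by auto
    then show ?thesis by (simp add: P1_reg_def P1_minus)
  qed (simp add: P1_reg_def)
  have "(\<lambda>z. - P1_reg z) has_fps_expansion Abs_fps (\<lambda>n. a n * (-1) ^ n)"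
  proof (rule has_fps_expansionI)
    have "(\<lambda>n. a n * (-1) ^ n * z ^ n) sums (- P1_reg z)" if "norm z < \<delta>" for z
    proof -
      have "a n * (- z) ^ n = a n * (-1) ^ n * z ^ n" for n by (subst power_minus) simp
      then show ?thesis using sums[of "- z"] that unfolding odd[OF that] by (metis (no_types, lifting) norm_minus_cancel sums_cong)
    qed
    then show "eventually (\<lambda>u. (\<lambda>n. fps_nth (Abs_fps (\<lambda>n. a n * (-1) ^ n)) n * u ^ n) sums (- P1_reg u)) (nhds 0)"
      using \<delta> by (auto simp: eventually_nhds_metric intro!: exI[of _ \<delta>])
  qed
  moreover have "(\<lambda>z. - P1_reg z) has_fps_expansion - Abs_fps a" using exp1 by (rule fps_expansion_intros)
  ultimately have "Abs_fps (\<lambda>n. a n * (-1) ^ n) = - Abs_fps a" by (rule fps_expansion_unique_complex)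
  then have par: "a n * (-1) ^ n = - a n" for n by (simp add: fps_eq_iff)
  have "a n = - eisenstein_E (Suc n) \<tau>" for n
  proof (cases "even n")
    case True
    then show ?thesis using par[of n] by (simp add: eisenstein_E_def)
  next
    case False
    then have "n \<noteq> 0" by (metis even_zero)
    with False show ?thesis by (simp add: a_def eisenstein_E_def T_def[of n] del: fact_Suc)
  qed
  then have "a = (\<lambda>n. - eisenstein_E (Suc n) \<tau>)" by (rule ext)
  with exp1 show ?thesis by simp
qed

lemma P1_reg_holomorphic: "P1_reg holomorphic_on ball 0 D"
proof -
  obtain s where s: "open s" "0 \<in> s" "P1_reg holomorphic_on s"
    using has_fps_expansion_imp_holomorphic[OF P1_reg_expansion] by metis
  have "P1_reg holomorphic_on ball 0 D - {0}"
  proof (rule holomorphic_transform)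
    have "ball 0 D - {0} \<subseteq> - \<Lambda>" using lattice_min_le[of _ \<tau>] by force
    then show "(\<lambda>z. P1 z - 1 / z) holomorphic_on ball 0 D - {0}"
      by (intro holomorphic_intros holomorphic_on_subset[OF P1_holomorphic]) auto
  qed (simp add: P1_reg_def)
  with s have "P1_reg holomorphic_on s \<union> (ball 0 D - {0})"
    by (intro holomorphic_on_Un) auto
  then show ?thesis by (rule holomorphic_on_subset) (use s in auto)
qed

lemma P1_reg_deriv: "(deriv ^^ n) P1_reg 0 / fact n = - eisenstein_E (Suc n) \<tau>"
  using fps_nth_fps_expansion[OF P1_reg_expansion, of n] by simp

lemma P1_eq: "z \<noteq> 0 \<Longrightarrow> P1 z = 1 / z + P1_reg z"
  by (simp add: P1_reg_def)

end

section \<open>The area inequality\<close>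

definition wirtinger :: "(complex \<Rightarrow> complex) \<Rightarrow> complex \<Rightarrow> complex \<Rightarrow> complex \<Rightarrow> bool" where
  "wirtinger f a b z \<longleftrightarrow> (f has_derivative (\<lambda>h. a * h + b * cnj h)) (at z)"

lemma wirtinger_eq: "wirtinger f a b z \<Longrightarrow> a = a' \<Longrightarrow> b = b' \<Longrightarrow> wirtinger f a' b' z"
  by simp

lemma wirtinger_field_derivative: "(f has_field_derivative d) (at z) \<Longrightarrow> wirtinger f d 0 z"
  by (simp add: wirtinger_def has_field_derivative_def)

lemma wirtinger_const: "wirtinger (\<lambda>_. c) 0 0 z"
  by (simp add: wirtinger_def)

lemma wirtinger_ident: "wirtinger (\<lambda>z. z) 1 0 z"
  by (simp add: wirtinger_def)

lemma wirtinger_cnj: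
  assumes "wirtinger f a b z" shows "wirtinger (\<lambda>z. cnj (f z)) (cnj b) (cnj a) z"
proof -
  have "((\<lambda>z. cnj (f z)) has_derivative (\<lambda>h. cnj (a * h + b * cnj h))) (at z)"
    using assms unfolding wirtinger_def by (rule has_derivative_cnj)
  moreover have "(\<lambda>h. cnj (a * h + b * cnj h)) = (\<lambda>h. cnj b * h + cnj a * cnj h)"
    by (simp add: fun_eq_iff)
  ultimately show ?thesis by (simp add: wirtinger_def)
qed

lemma wirtinger_add:
  assumes "wirtinger f a b z" "wirtinger g c d z"
  shows "wirtinger (\<lambda>z. f z + g z) (a + c) (b + d) z"
proof -
  have "((\<lambda>z. f z + g z) has_derivative (\<lambda>h. (a * h + b * cnj h) + (c * h + d * cnj h))) (at z)"
    using assms unfolding wirtinger_def by (rule has_derivative_add)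
  moreover have "(\<lambda>h. (a * h + b * cnj h) + (c * h + d * cnj h)) = (\<lambda>h. (a + c) * h + (b + d) * cnj h)"
    by (simp add: fun_eq_iff algebra_simps)
  ultimately show ?thesis by (simp add: wirtinger_def)
qed

lemma wirtinger_mult:
  assumes "wirtinger f a b z" "wirtinger g c d z"
  shows "wirtinger (\<lambda>z. f z * g z) (a * g z + f z * c) (b * g z + f z * d) z"
proof -
  have "((\<lambda>z. f z * g z) has_derivative (\<lambda>h. f z * (c * h + d * cnj h) + (a * h + b * cnj h) * g z)) (at z)"
    using assms unfolding wirtinger_def by (rule has_derivative_mult)
  moreover have "(\<lambda>h. f z * (c * h + d * cnj h) + (a * h + b * cnj h) * g z) =
      (\<lambda>h. (a * g z + f z * c) * h + (b * g z + f z * d) * cnj h)"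
    by (simp add: fun_eq_iff algebra_simps)
  ultimately show ?thesis by (simp add: wirtinger_def)
qed

lemma wirtinger_diff:
  assumes "wirtinger f a b z" "wirtinger g c d z"
  shows "wirtinger (\<lambda>z. f z - g z) (a - c) (b - d) z"
  using wirtinger_add[OF assms(1) wirtinger_mult[OF wirtinger_const[of "-1"] assms(2)]] by simp

lemma wirtinger_radial:
  assumes "(H has_real_derivative d) (at ((norm z)\<^sup>2))"
  shows "wirtinger (\<lambda>z. of_real (H ((norm z)\<^sup>2))) (of_real d * cnj z) (of_real d * z) z"
proof -
  have n: "((\<lambda>z :: complex. (norm z)\<^sup>2) has_derivative (\<lambda>h. 2 * (z \<bullet> h))) (at z)"
    unfolding power2_norm_eq_inner by (rule derivative_eq_intros refl)+ (simp add: inner_commute)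
  have "((\<lambda>z. H ((norm z)\<^sup>2)) has_derivative (\<lambda>h. d * (2 * (z \<bullet> h)))) (at z)"
    using diff_chain_at[OF n, of H "\<lambda>h. d * h"] assms
    by (simp add: has_field_derivative_def o_def)
  from has_derivative_of_real[OF this]
  have "((\<lambda>z. complex_of_real (H ((norm z)\<^sup>2))) has_derivative (\<lambda>h. of_real (d * (2 * (z \<bullet> h))))) (at z)" .
  moreover have "(\<lambda>h. of_real (d * (2 * (z \<bullet> h)))) = (\<lambda>h. of_real d * cnj z * h + of_real d * z * cnj h)"
    by (auto simp: fun_eq_iff complex_eq_iff inner_complex_def algebra_simps)
  ultimately show ?thesis by (simp add: wirtinger_def)
qed

lemma wirtinger_shift:
  assumes "wirtinger f a b (z - w)" shows "wirtinger (\<lambda>z. f (z - w)) a b z"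
proof -
  have "((\<lambda>z. z - w) has_derivative (\<lambda>h. h)) (at z)" by (auto intro!: derivative_eq_intros)
  from diff_chain_at[OF this assms[unfolded wirtinger_def]] show ?thesis
    by (simp add: wirtinger_def o_def)
qed

lemma wirtinger_cong_ev:
  assumes "eventually (\<lambda>y. f y = g y) (nhds z)" "wirtinger g a b z" shows "wirtinger f a b z"
  using assms unfolding wirtinger_def
  by (intro has_derivative_transform_eventually[of g _ z UNIV f])
    (auto simp: eventually_at_filter eq_commute dest: eventually_nhds_x_imp_x elim: eventually_mono)

lemma wirtinger_imp_isCont: "wirtinger f a b z \<Longrightarrow> isCont f z"
  unfolding wirtinger_def by (rule has_derivative_continuous)

context torus begin

definition mean :: "(complex \<Rightarrow> complex) \<Rightarrow> complex" where
  "mean \<Psi> = integral {0..1} (\<lambda>y. integral {0..1} (\<lambda>x. \<Psi> (of_real x * \<omega>1 + of_real y * \<omega>2)))"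

lemma mean_cont:
  fixes \<Psi> :: "complex \<Rightarrow> complex"
  assumes "continuous_on UNIV \<Psi>"
  shows "continuous_on {0..1} (\<lambda>x. \<Psi> (of_real x * \<omega>1 + of_real y * \<omega>2))"
    "continuous_on {0..1} (\<lambda>y. integral {0..1} (\<lambda>x. \<Psi> (of_real x * \<omega>1 + of_real y * \<omega>2)))"
    "continuous_on S (\<lambda>(x, y). \<Psi> (of_real x * \<omega>1 + of_real y * \<omega>2))"
    "continuous_on S (\<lambda>(y, x). \<Psi> (of_real x * \<omega>1 + of_real y * \<omega>2))"
proof -
  have c: "continuous_on S (\<lambda>x. \<Psi> (g x))" if "continuous_on S g" for g and S :: "'b :: topological_space set"
    by (rule continuous_on_compose2[OF assms that]) simp
  show "continuous_on {0..1} (\<lambda>x. \<Psi> (of_real x * \<omega>1 + of_real y * \<omega>2))"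
    by (intro c continuous_intros)
  show "continuous_on S (\<lambda>(x, y). \<Psi> (of_real x * \<omega>1 + of_real y * \<omega>2))" for S
    unfolding case_prod_unfold by (intro c continuous_intros)
  show 2: "continuous_on S (\<lambda>(y, x). \<Psi> (of_real x * \<omega>1 + of_real y * \<omega>2))" for S
    unfolding case_prod_unfold by (intro c continuous_intros)
  show "continuous_on {0..1} (\<lambda>y. integral {0..1} (\<lambda>x. \<Psi> (of_real x * \<omega>1 + of_real y * \<omega>2)))"
    using integral_continuous_on_param[of "{0..1}" 0 1 "\<lambda>y x. \<Psi> (of_real x * \<omega>1 + of_real y * \<omega>2)", OF 2] by simp
qed

lemma mean_linear:
  assumes c: "continuous_on UNIV \<Psi>" and h: "bounded_linear h"
  shows "mean (\<lambda>z. h (\<Psi> z)) = h (mean \<Psi>)"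
proof -
  have 1: "integral {0..1} (\<lambda>x. h (\<Psi> (of_real x * \<omega>1 + of_real y * \<omega>2))) =
      h (integral {0..1} (\<lambda>x. \<Psi> (of_real x * \<omega>1 + of_real y * \<omega>2)))" for y :: real
    using integral_linear[OF integrable_continuous_real[OF mean_cont(1)[OF c]] h] by (simp add: o_def)
  show ?thesis unfolding mean_def 1
    using integral_linear[OF integrable_continuous_real[OF mean_cont(2)[OF c]] h] by (simp add: o_def)
qed

lemma mean_cmult: "continuous_on UNIV \<Psi> \<Longrightarrow> mean (\<lambda>z. k * \<Psi> z) = k * mean \<Psi>"
  by (rule mean_linear[OF _ bounded_linear_mult_right])

lemma mean_cnj: "continuous_on UNIV \<Psi> \<Longrightarrow> mean (\<lambda>z. cnj (\<Psi> z)) = cnj (mean \<Psi>)"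
  by (rule mean_linear[OF _ bounded_linear_cnj])

lemma mean_add:
  assumes "continuous_on UNIV f" "continuous_on UNIV g"
  shows "mean (\<lambda>z. f z + g z) = mean f + mean g"
proof -
  have 1: "integral {0..1} (\<lambda>x. f (of_real x * \<omega>1 + of_real y * \<omega>2) + g (of_real x * \<omega>1 + of_real y * \<omega>2)) =
      integral {0..1} (\<lambda>x. f (of_real x * \<omega>1 + of_real y * \<omega>2)) + integral {0..1} (\<lambda>x. g (of_real x * \<omega>1 + of_real y * \<omega>2))" for y :: real
    by (intro integral_add integrable_continuous_real mean_cont assms)
  show ?thesis unfolding mean_def 1
    by (intro integral_add integrable_continuous_real mean_cont assms)
qed

lemma mean_diff:
  assumes "continuous_on UNIV f" "continuous_on UNIV g"
  shows "mean (\<lambda>z. f z - g z) = mean f - mean g"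
  using mean_add[OF assms(1), of "\<lambda>z. - 1 * g z"] mean_cmult[OF assms(2), of "- 1"] assms(2)
  by (simp add: continuous_on_minus)

lemma mean_const: "mean (\<lambda>_. k) = k"
  by (simp add: mean_def)

lemma mean_sum:
  assumes "finite I" "\<And>i. i \<in> I \<Longrightarrow> continuous_on UNIV (f i)"
  shows "mean (\<lambda>z. \<Sum>i\<in>I. f i z) = (\<Sum>i\<in>I. mean (f i))"
  using assms
proof (induction I rule: finite_induct)
  case (insert i I)
  then have "mean (\<lambda>z. f i z + (\<Sum>i\<in>I. f i z)) = mean (f i) + mean (\<lambda>z. \<Sum>i\<in>I. f i z)"
    by (intro mean_add continuous_on_sum) auto
  with insert show ?case by simp
qed (simp add: mean_const)

lemma mean_Re_nonneg:
  assumes c: "continuous_on UNIV \<Psi>" and h: "\<And>z. Re (\<Psi> z) \<ge> 0"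
  shows "Re (mean \<Psi>) \<ge> 0"
proof -
  have 1: "Re (integral {0..1} (\<lambda>x. \<Psi> (of_real x * \<omega>1 + of_real y * \<omega>2))) \<ge> 0" for y :: real
    using integral_linear[OF integrable_continuous_real[OF mean_cont(1)[OF c]] bounded_linear_Re, of y]
      integral_nonneg[OF integrable_linear[OF integrable_continuous_real[OF mean_cont(1)[OF c]] bounded_linear_Re], of y] h
    by (simp add: o_def)
  then show ?thesis unfolding mean_def
    using integral_linear[OF integrable_continuous_real[OF mean_cont(2)[OF c]] bounded_linear_Re]
      integral_nonneg[OF integrable_linear[OF integrable_continuous_real[OF mean_cont(2)[OF c]] bounded_linear_Re]]
    by (simp add: o_def)
qed

lemma mean_stokes:
  assumes w: "\<And>z. wirtinger \<Psi> (A z) (B z) z" and c: "continuous_on UNIV A" "continuous_on UNIV B"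
    and p: "\<And>z. \<Psi> (z + \<omega>1) = \<Psi> z" "\<And>z. \<Psi> (z + \<omega>2) = \<Psi> z"
  shows "mean A = 0" "mean B = 0"
proof -
  have d: "((\<lambda>x. \<Psi> (of_real x * w + v)) has_vector_derivative (A (of_real x * w + v) * w + B (of_real x * w + v) * cnj w)) (at x within {0..1})" for x :: real and w v
  proof -
    have "((\<lambda>x. of_real x * w + v) has_derivative (\<lambda>h. of_real h * w)) (at x within {0..1})"
      by (auto intro!: derivative_eq_intros)
    from diff_chain_within[OF this has_derivative_at_withinI[OF assms(1)[unfolded wirtinger_def]]]
    show ?thesis unfolding has_vector_derivative_def o_def
      by (rule has_derivative_eq_rhs) (simp add: fun_eq_iff scaleR_conv_of_real algebra_simps)
  qed
  have i0: "integral {0..1} (\<lambda>x. A (of_real x * w + v) * w + B (of_real x * w + v) * cnj w) = 0"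
    if "\<And>z. \<Psi> (z + w) = \<Psi> z" for w v
    using integral_unique[OF fundamental_theorem_of_calculus[OF zero_le_one d, of w v]] that[of v]
    by (simp add: add.commute)
  have cc: "continuous_on UNIV (\<lambda>z. A z * w + B z * cnj w)" for w
    by (intro continuous_intros c)
  have split: "mean (\<lambda>z. A z * w + B z * cnj w) = w * mean A + cnj w * mean B" for w
  proof -
    have "(\<lambda>z. A z * w + B z * cnj w) = (\<lambda>z. w * A z + cnj w * B z)" by (simp add: mult.commute)
    then show ?thesis
      using mean_add[OF continuous_on_mult_left[OF c(1), of w] continuous_on_mult_left[OF c(2), of "cnj w"]]
      by (simp add: mean_cmult c)
  qed
  have "mean (\<lambda>z. A z * \<omega>1 + B z * cnj \<omega>1) = 0" unfolding mean_def
    by (subst i0[OF p(1)]) simp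
  then have 1: "\<omega>1 * mean A + cnj \<omega>1 * mean B = 0" unfolding split .
  have "mean (\<lambda>z. A z * \<omega>2 + B z * cnj \<omega>2) =
      integral {0..1} (\<lambda>x. integral {0..1} (\<lambda>y. A (of_real y * \<omega>2 + of_real x * \<omega>1) * \<omega>2 + B (of_real y * \<omega>2 + of_real x * \<omega>1) * cnj \<omega>2))"
    unfolding mean_def
    using integral_swap_continuous[OF mean_cont(4)[OF cc, of "cbox (0, 0) (1, 1)" \<omega>2]]
    by (simp add: add.commute)
  also have "\<dots> = 0" by (subst i0[OF p(2)]) simp
  finally have 2: "\<omega>2 * mean A + cnj \<omega>2 * mean B = 0" unfolding split .
  have "mean A = mean B" using 1 by simp
  with 2 have "(\<tau> - cnj \<tau>) * mean A = 0" by (simp add: algebra_simps)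
  moreover have "\<tau> - cnj \<tau> \<noteq> 0" using Im_tau by (simp add: complex_eq_iff)
  ultimately show "mean A = 0" by simp
  with \<open>mean A = mean B\<close> show "mean B = 0" by simp
qed

lemma continuous_on_red:
  assumes "R < D / 2" "\<And>z. norm z \<ge> R \<Longrightarrow> g z = 0" "continuous_on UNIV g"
  shows "continuous_on UNIV (\<lambda>z. g (red z) :: complex)"
proof (intro continuous_at_imp_continuous_on ballI)
  fix z
  show "isCont (\<lambda>z. g (red z)) z"
  proof (cases "norm (red z) > R")
    case True
    from eventually_norm_red_gt[OF this] have "eventually (\<lambda>y. g (red y) = 0) (nhds z)"
      by eventually_elim (simp add: assms)
    from isCont_cong[OF this] show ?thesis by simp
  next
    case False
    with assms have "norm (red z) < D / 2" by simp
    from eventually_red[OF this] have "eventually (\<lambda>y. g (red y) = g (y - near z)) (nhds z)"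
      by eventually_elim simp
    from isCont_cong[OF this] show ?thesis
      using continuous_on_compose2[OF assms(3), of UNIV "\<lambda>y. y - near z"]
      by (simp add: continuous_on_eq_continuous_at continuous_intros)
  qed
qed

lemma mean_stokes_red:
  assumes R: "R < D / 2" and w: "\<And>z. wirtinger \<psi> (A z) (B z) z"
    and c: "continuous_on UNIV A" "continuous_on UNIV B"
    and 0: "\<And>z. norm z \<ge> R \<Longrightarrow> \<psi> z = 0" "\<And>z. norm z \<ge> R \<Longrightarrow> A z = 0" "\<And>z. norm z \<ge> R \<Longrightarrow> B z = 0"
  shows "mean (\<lambda>z. A (red z)) = 0" "mean (\<lambda>z. B (red z)) = 0"
proof -
  have w: "wirtinger (\<lambda>z. \<psi> (red z)) (A (red z)) (B (red z)) z" for z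
  proof (cases "norm (red z) > R")
    case True
    from eventually_norm_red_gt[OF this] have "eventually (\<lambda>y. \<psi> (red y) = 0) (nhds z)"
      by eventually_elim (simp add: 0)
    from wirtinger_cong_ev[OF this wirtinger_const] show ?thesis using True by (simp add: 0)
  next
    case False
    with assms have "norm (red z) < D / 2" by simp
    from eventually_red[OF this] have "eventually (\<lambda>y. \<psi> (red y) = \<psi> (y - near z)) (nhds z)"
      by eventually_elim simp
    from wirtinger_cong_ev[OF this wirtinger_shift[OF w]] show ?thesis by (simp add: red_def)
  qed
  have p: "\<psi> (red (z + v)) = \<psi> (red z)" if "v \<in> \<Lambda>" for z v
  proof (cases "norm (red z) < D / 2")
    case True
    then show ?thesis using red_add[OF that] by simp
  next
    case False
    then show ?thesis using 0(1)[of "red z"] 0(1)[of "red (z + v)"] R norm_red_add[OF that, of z] by simp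
  qed
  show "mean (\<lambda>z. A (red z)) = 0" "mean (\<lambda>z. B (red z)) = 0"
    by (rule mean_stokes[OF w continuous_on_red[OF R 0(2) c(1)] continuous_on_red[OF R 0(3) c(2)]
        p[OF torus_lattice_2pi_i] p[OF torus_lattice_2pi_i_tau]]; assumption)+
qed

end

lemma DERIV_max_0_power:
  "((\<lambda>s :: real. max 0 s ^ Suc (Suc n)) has_real_derivative real (Suc (Suc n)) * max 0 s ^ Suc n) (at s)"
proof -
  consider "s > 0" | "s < 0" | "s = 0" by linarith
  then show ?thesis
  proof cases
    case 1
    have "((\<lambda>s. s ^ Suc (Suc n)) has_real_derivative real (Suc (Suc n)) * s ^ Suc n) (at s)"
      using DERIV_pow[of "Suc (Suc n)" s UNIV] by simp
    then have "((\<lambda>s. max 0 s ^ Suc (Suc n)) has_real_derivative real (Suc (Suc n)) * s ^ Suc n) (at s)"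
      by (rule has_field_derivative_transform_within_open[of _ _ _ "{0<..}"]) (use 1 in auto)
    then show ?thesis using 1 by simp
  next
    case 2
    have "((\<lambda>s. 0) has_real_derivative 0) (at s)" by simp
    then have "((\<lambda>s. max 0 s ^ Suc (Suc n)) has_real_derivative 0) (at s)"
      by (rule has_field_derivative_transform_within_open[of _ _ _ "{..<0}"]) (use 2 in auto)
    then show ?thesis using 2 by simp
  next
    case 3
    have "((\<lambda>h. max 0 h ^ Suc n) \<longlongrightarrow> max 0 0 ^ Suc n) (at (0 :: real))"
      by (intro tendsto_intros)
    then have "((\<lambda>h :: real. (max 0 (0 + h) ^ Suc (Suc n) - max 0 0 ^ Suc (Suc n)) / h) \<longlongrightarrow> 0) (at 0)"
      by (rule Lim_transform_eventually[OF tendsto_eq_rhs])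
        (auto simp: eventually_at_filter max_def intro!: always_eventually)
    then show ?thesis unfolding 3 DERIV_def by simp
  qed
qed

lemma radial_cutoff_exists:
  fixes a b :: real
  assumes "a < b"
  shows "\<exists>c H H' \<Phi>. c > 0 \<and> (\<forall>s. (H has_real_derivative H' s) (at s)) \<and> continuous_on UNIV H' \<and>
     (\<forall>s. (\<Phi> has_real_derivative H s) (at s)) \<and> (\<forall>s. s \<le> a \<or> b \<le> s \<longrightarrow> H s = 0 \<and> H' s = 0) \<and>
     (\<forall>s. H s \<ge> 0) \<and> (\<forall>s. s \<le> a \<longrightarrow> \<Phi> s = 0) \<and> (\<forall>s. b \<le> s \<longrightarrow> \<Phi> s = c) \<and> (\<forall>s. 0 \<le> \<Phi> s \<and> \<Phi> s \<le> c)"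
proof -
  define d where "d = b - a"
  define v where "v s = max 0 (s - a)" for s
  define w where "w s = max 0 (b - s)" for s
  define y where "y s = max 0 (s - b)" for s
  define H where "H s = (v s)\<^sup>2 * (w s)\<^sup>2" for s
  define H' where "H' s = 2 * v s * (w s)\<^sup>2 - 2 * (v s)\<^sup>2 * w s" for s
  define \<Phi> where "\<Phi> s = (d\<^sup>2 * v s ^ 3 / 3 - d * v s ^ 4 / 2 + v s ^ 5 / 5) -
     (d\<^sup>2 * y s ^ 3 / 3 + d * y s ^ 4 / 2 + y s ^ 5 / 5)" for s
  have d: "d > 0" using assms by (simp add: d_def)
  have sub: "((\<lambda>s. s - k) has_real_derivative 1) (at s)" "((\<lambda>s. k - s) has_real_derivative - 1) (at s)" for k s :: real
    by (auto intro!: derivative_eq_intros)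
  have dv: "((\<lambda>s. v s ^ Suc (Suc n)) has_real_derivative real (Suc (Suc n)) * v s ^ Suc n) (at s)" for n s
    using DERIV_chain2[OF DERIV_max_0_power[of n] sub(1)[where k = a and s = s]] by (simp add: v_def)
  have dy: "((\<lambda>s. y s ^ Suc (Suc n)) has_real_derivative real (Suc (Suc n)) * y s ^ Suc n) (at s)" for n s
    using DERIV_chain2[OF DERIV_max_0_power[of n] sub(1)[where k = b and s = s]] by (simp add: y_def)
  have dw: "((\<lambda>s. w s ^ Suc (Suc n)) has_real_derivative - (real (Suc (Suc n)) * w s ^ Suc n)) (at s)" for n s
    using DERIV_chain2[OF DERIV_max_0_power[of n] sub(2)[where k = b and s = s]] by (simp add: w_def)
  have D2: "((\<lambda>s. (v s)\<^sup>2) has_real_derivative 2 * v s) (at s)" "((\<lambda>s. (w s)\<^sup>2) has_real_derivative - (2 * w s)) (at s)" for s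
    using dv[of 0 s] dw[of 0 s] by (simp_all add: numeral_2_eq_2)
  have D3: "((\<lambda>s. v s ^ 3) has_real_derivative 3 * (v s)\<^sup>2) (at s)" "((\<lambda>s. y s ^ 3) has_real_derivative 3 * (y s)\<^sup>2) (at s)" for s
    using dv[of 1 s] dy[of 1 s] by (simp_all add: numeral_eq_Suc)
  have D4: "((\<lambda>s. v s ^ 4) has_real_derivative 4 * v s ^ 3) (at s)" "((\<lambda>s. y s ^ 4) has_real_derivative 4 * y s ^ 3) (at s)" for s
    using dv[of 2 s] dy[of 2 s] by (simp_all add: numeral_eq_Suc)
  have D5: "((\<lambda>s. v s ^ 5) has_real_derivative 5 * v s ^ 4) (at s)" "((\<lambda>s. y s ^ 5) has_real_derivative 5 * y s ^ 4) (at s)" for s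
    using dv[of 3 s] dy[of 3 s] by (simp_all add: numeral_eq_Suc)
  have dH: "(H has_real_derivative H' s) (at s)" for s
    unfolding H_def H'_def by (rule DERIV_cong[OF DERIV_mult[OF D2]]) (simp add: algebra_simps)
  have cH: "continuous_on UNIV H'" unfolding H'_def v_def w_def by (intro continuous_intros)
  have d\<Phi>: "(\<Phi> has_real_derivative H s) (at s)" for s
  proof -
    have "(\<Phi> has_real_derivative (d\<^sup>2 * (3 * (v s)\<^sup>2) / 3 - d * (4 * v s ^ 3) / 2 + 5 * v s ^ 4 / 5) -
       (d\<^sup>2 * (3 * (y s)\<^sup>2) / 3 + d * (4 * y s ^ 3) / 2 + 5 * y s ^ 4 / 5)) (at s)"
      unfolding \<Phi>_def
      by (intro DERIV_add DERIV_diff DERIV_cdivide DERIV_cmult D3 D4 D5)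
    moreover have "(d\<^sup>2 * (3 * (v s)\<^sup>2) / 3 - d * (4 * v s ^ 3) / 2 + 5 * v s ^ 4 / 5) -
       (d\<^sup>2 * (3 * (y s)\<^sup>2) / 3 + d * (4 * y s ^ 3) / 2 + 5 * y s ^ 4 / 5) = (v s * (d - v s))\<^sup>2 - (y s * (d + y s))\<^sup>2"
      by (simp add: power2_eq_square power3_eq_cube power4_eq_xxxx algebra_simps)
    moreover have "(v s * (d - v s))\<^sup>2 - (y s * (d + y s))\<^sup>2 = H s"
    proof -
      consider "s \<le> a" | "a < s" "s < b" | "b \<le> s" by linarith
      then show ?thesis
        by cases (use assms in \<open>auto simp: v_def w_def y_def H_def d_def max_def power_mult_distrib mult.commute power2_commute\<close>)
    qed
    ultimately show ?thesis by simp
  qed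
  have H0: "H s = 0 \<and> H' s = 0" if "s \<le> a \<or> b \<le> s" for s
    using that by (auto simp: H_def H'_def v_def w_def max_def)
  have H_nn: "H s \<ge> 0" for s by (simp add: H_def)
  have \<Phi>0: "\<Phi> s = 0" if "s \<le> a" for s
    using that assms by (simp add: \<Phi>_def v_def y_def max_def)
  have \<Phi>c: "\<Phi> s = d ^ 5 / 30" if "b \<le> s" for s
  proof -
    have v: "v s = d + y s" using that assms by (simp add: v_def y_def d_def max_def)
    show ?thesis unfolding \<Phi>_def v by (simp add: field_simps eval_nat_numeral)
  qed
  have mono: "\<Phi> s \<le> \<Phi> t" if "s \<le> t" for s t
    using DERIV_nonneg_imp_nondecreasing[OF that] d\<Phi> H_nn by blast
  have "0 \<le> \<Phi> s \<and> \<Phi> s \<le> d ^ 5 / 30" for s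
    using mono[of "min s a" s] \<Phi>0[of "min s a"] mono[of s "max s b"] \<Phi>c[of "max s b"] by simp
  then show ?thesis using d dH cH d\<Phi> H0 H_nn \<Phi>0 \<Phi>c
    by (intro exI[of _ "d ^ 5 / 30"] exI[of _ H] exI[of _ H'] exI[of _ \<Phi>]) auto
qed

text \<open>Averaging over the annulus \<open>r1 \<le> |w| \<le> r2\<close> with a radial weight \<open>H\<close> replaces integration over the
  boundary circle of the excised disc, so that Stokes' theorem is only needed for functions without
  singularities on the closed torus.\<close>

locale torus_cutoff = torus +
  fixes r1 r2 c :: real and H H' \<Phi> :: "real \<Rightarrow> real"
  assumes r: "0 < r1" "r1 < r2" "r2 < D / 2" and c: "c > 0"
    and dH: "\<And>s. (H has_real_derivative H' s) (at s)" and cH': "continuous_on UNIV H'"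
    and d\<Phi>: "\<And>s. (\<Phi> has_real_derivative H s) (at s)"
    and H0: "\<And>s. s \<le> r1\<^sup>2 \<or> r2\<^sup>2 \<le> s \<Longrightarrow> H s = 0" and H'0: "\<And>s. s \<le> r1\<^sup>2 \<or> r2\<^sup>2 \<le> s \<Longrightarrow> H' s = 0"
    and H_nonneg: "\<And>s. H s \<ge> 0"
    and \<Phi>0: "\<And>s. s \<le> r1\<^sup>2 \<Longrightarrow> \<Phi> s = 0" and \<Phi>c: "\<And>s. r2\<^sup>2 \<le> s \<Longrightarrow> \<Phi> s = c"
    and \<Phi>_bounds: "\<And>s. 0 \<le> \<Phi> s" "\<And>s. \<Phi> s \<le> c"
begin

abbreviation "U \<equiv> ball 0 D - {0 :: complex}"

definition Hn :: "complex \<Rightarrow> complex" where "Hn w = of_real (H ((norm w)\<^sup>2))"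
definition Hd :: "complex \<Rightarrow> complex" where "Hd w = of_real (H' ((norm w)\<^sup>2))"
definition \<phi> :: "complex \<Rightarrow> complex" where "\<phi> z = of_real (\<Phi> ((norm (red z))\<^sup>2))"
definition N :: "(complex \<Rightarrow> complex) \<Rightarrow> complex" where "N g = mean (\<lambda>z. Hn (red z) * g (red z))"

lemma out_of_annulus:
  assumes "norm w \<le> r1 \<or> r2 \<le> norm w" shows "Hn w = 0" "Hd w = 0"
proof -
  have "(norm w)\<^sup>2 \<le> r1\<^sup>2 \<or> r2\<^sup>2 \<le> (norm w)\<^sup>2" using assms r by (auto intro: power_mono)
  then show "Hn w = 0" "Hd w = 0" using H0 H'0 by (simp_all add: Hn_def Hd_def)
qed

lemma isCont_H: "isCont H s" using dH DERIV_isCont by blast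
lemma isCont_\<Phi>: "isCont \<Phi> s" using d\<Phi> DERIV_isCont by blast

lemma continuous_on_Hn [continuous_intros]: "continuous_on S Hn"
  unfolding Hn_def
  by (intro continuous_intros continuous_on_compose2[OF continuous_at_imp_continuous_on[of UNIV H]])
    (auto simp: isCont_H)

lemma continuous_on_Hd [continuous_intros]: "continuous_on S Hd"
  unfolding Hd_def
  by (intro continuous_intros continuous_on_compose2[OF cH']) auto

lemma eventually_out_of_annulus:
  assumes "w \<notin> U"
  shows "eventually (\<lambda>y. norm y \<le> r1 \<or> r2 \<le> norm y) (nhds w)"
proof (cases "w = 0")
  case True
  have "eventually (\<lambda>y. y \<in> ball 0 r1) (nhds w)"
    by (rule eventually_nhds_in_open) (use True r in auto)
  then show ?thesis by eventually_elim auto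
next
  case False
  have "eventually (\<lambda>y. y \<in> - cball 0 r2) (nhds w)"
    by (rule eventually_nhds_in_open) (use False assms r D_pos in auto)
  then show ?thesis by eventually_elim auto
qed

lemma continuous_on_annulus_extend:
  assumes F: "continuous_on U F" and 0: "\<And>w. norm w \<le> r1 \<or> r2 \<le> norm w \<Longrightarrow> F w = (0 :: complex)"
  shows "continuous_on UNIV F"
proof (intro continuous_at_imp_continuous_on ballI)
  fix w show "isCont F w"
  proof (cases "w \<in> U")
    case True
    then show ?thesis using F by (subst (asm) continuous_on_eq_continuous_at) (auto simp: open_Diff)
  next
    case False
    from eventually_out_of_annulus[OF this] have "eventually (\<lambda>y. F y = 0) (nhds w)"
      by eventually_elim (rule 0)
    from isCont_cong[OF this] show ?thesis by simp
  qed
qed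

lemma continuous_Hn_mult: "continuous_on U g \<Longrightarrow> continuous_on UNIV (\<lambda>w. Hn w * g w)"
  by (rule continuous_on_annulus_extend) (auto intro!: continuous_intros simp: out_of_annulus)

lemma continuous_N: "continuous_on U g \<Longrightarrow> continuous_on UNIV (\<lambda>z. Hn (red z) * g (red z))"
  by (rule continuous_on_red[OF r(3) _ continuous_Hn_mult]) (simp_all add: out_of_annulus)

lemma N_cong:
  assumes "\<And>w. w \<in> U \<Longrightarrow> g w = h w" shows "N g = N h"
proof -
  have "Hn w * g w = Hn w * h w" for w
    using assms[of w] out_of_annulus(1)[of w] r D_pos by (cases "w \<in> U") auto
  then have "(\<lambda>z. Hn (red z) * g (red z)) = (\<lambda>z. Hn (red z) * h (red z))" by blast
  then show ?thesis by (simp add: N_def)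
qed

lemma N_add: "continuous_on U g \<Longrightarrow> continuous_on U h \<Longrightarrow> N (\<lambda>w. g w + h w) = N g + N h"
  using mean_add[OF continuous_N continuous_N, of g h] by (simp add: N_def distrib_left)

lemma N_diff: "continuous_on U g \<Longrightarrow> continuous_on U h \<Longrightarrow> N (\<lambda>w. g w - h w) = N g - N h"
  using mean_diff[OF continuous_N continuous_N, of g h] by (simp add: N_def right_diff_distrib)

lemma N_cmult: "continuous_on U g \<Longrightarrow> N (\<lambda>w. k * g w) = k * N g"
  using mean_cmult[OF continuous_N, of g k] by (simp add: N_def mult.left_commute)

lemma N_cnj: "continuous_on U g \<Longrightarrow> N (\<lambda>w. cnj (g w)) = cnj (N g)"
  using mean_cnj[OF continuous_N, of g] by (simp add: N_def Hn_def)

lemma N_sum: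
  "finite I \<Longrightarrow> (\<And>i. i \<in> I \<Longrightarrow> continuous_on U (g i)) \<Longrightarrow> N (\<lambda>w. \<Sum>i\<in>I. g i w) = (\<Sum>i\<in>I. N (g i))"
  using mean_sum[of I "\<lambda>i z. Hn (red z) * g i (red z)"] continuous_N
  by (simp add: N_def sum_distrib_left)

lemma N_stokes:
  assumes k: "\<And>w. w \<in> U \<Longrightarrow> wirtinger k (a w) (b w) w" and c: "continuous_on U a" "continuous_on U b"
  shows "mean (\<lambda>z. Hd (red z) * cnj (red z) * k (red z) + Hn (red z) * a (red z)) = 0"
    "mean (\<lambda>z. Hd (red z) * red z * k (red z) + Hn (red z) * b (red z)) = 0"
proof -
  have ck: "continuous_on U k"
    using k wirtinger_imp_isCont by (blast intro: continuous_at_imp_continuous_on)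
  let ?A = "\<lambda>w. Hd w * cnj w * k w + Hn w * a w" and ?B = "\<lambda>w. Hd w * w * k w + Hn w * b w"
  have w: "wirtinger (\<lambda>w. Hn w * k w) (?A w) (?B w) w" for w
  proof (cases "w \<in> U")
    case True
    from wirtinger_mult[OF wirtinger_radial[OF dH] k[OF this]] show ?thesis
      by (simp add: Hn_def[abs_def] Hd_def)
  next
    case False
    from eventually_out_of_annulus[OF this] have ev: "eventually (\<lambda>y. Hn y * k y = 0) (nhds w)"
      by eventually_elim (simp add: out_of_annulus)
    have "norm w \<le> r1 \<or> r2 \<le> norm w" using False r D_pos by auto
    then have "?A w = 0" "?B w = 0" by (simp_all add: out_of_annulus)
    with wirtinger_cong_ev[OF ev wirtinger_const] show ?thesis by simp
  qed
  have cA: "continuous_on UNIV ?A" "continuous_on UNIV ?B"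
    by (rule continuous_on_annulus_extend; (intro continuous_intros ck c | simp add: out_of_annulus))+
  show "mean (\<lambda>z. Hd (red z) * cnj (red z) * k (red z) + Hn (red z) * a (red z)) = 0"
    "mean (\<lambda>z. Hd (red z) * red z * k (red z) + Hn (red z) * b (red z)) = 0"
    using mean_stokes_red[OF r(3) w cA] by (simp_all add: out_of_annulus)
qed

text \<open>The operator \<open>w \<partial> - cnj w \<partial>\<^bsup>-\<^esup>\<close> is the derivative along rotations, which preserve
  the weight of \<open>N\<close>.\<close>

lemma N_rotation:
  assumes g: "\<And>w. w \<in> U \<Longrightarrow> wirtinger g (a w) (b w) w" and c: "continuous_on U a" "continuous_on U b"
  shows "N (\<lambda>w. w * a w - cnj w * b w) = 0"
proof -
  have cg: "continuous_on U g"
    using g wirtinger_imp_isCont by (blast intro: continuous_at_imp_continuous_on)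
  let ?A = "\<lambda>w. Hd w * cnj w * (g w * w) + Hn w * (a w * w + g w)"
  let ?B = "\<lambda>w. Hd w * w * (g w * cnj w) + Hn w * (b w * cnj w + g w)"
  have 1: "wirtinger (\<lambda>w. g w * w) (a w * w + g w) (b w * w) w" if "w \<in> U" for w
    using wirtinger_mult[OF g[OF that] wirtinger_ident] by simp
  have 2: "wirtinger (\<lambda>w. g w * cnj w) (a w * cnj w) (b w * cnj w + g w) w" if "w \<in> U" for w
    using wirtinger_mult[OF g[OF that] wirtinger_cnj[OF wirtinger_ident]] by simp
  have m1: "mean (\<lambda>z. ?A (red z)) = 0"
    by (rule N_stokes(1)[OF 1]) (auto intro!: continuous_intros c cg)
  have m2: "mean (\<lambda>z. ?B (red z)) = 0"
    by (rule N_stokes(2)[OF 2]) (auto intro!: continuous_intros c cg)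
  have cA: "continuous_on UNIV ?A" "continuous_on UNIV ?B"
    by (rule continuous_on_annulus_extend; (intro continuous_intros cg c | simp add: out_of_annulus))+
  have "continuous_on UNIV (\<lambda>z. ?A (red z))" "continuous_on UNIV (\<lambda>z. ?B (red z))"
    by (rule continuous_on_red[OF r(3) _ cA(1)], simp add: out_of_annulus)
      (rule continuous_on_red[OF r(3) _ cA(2)], simp add: out_of_annulus)
  from mean_diff[OF this] m1 m2 have "mean (\<lambda>z. ?A (red z) - ?B (red z)) = 0" by simp
  then show ?thesis by (simp add: N_def algebra_simps)
qed

end

context torus begin

lemma red_periodic:
  assumes "\<And>z. z \<notin> \<Lambda> \<Longrightarrow> k (z + \<omega>1) = k z" "\<And>z. z \<notin> \<Lambda> \<Longrightarrow> k (z + \<omega>2) = k z" and z: "z \<notin> \<Lambda>"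
  shows "k (red z) = k z"
proof -
  have "\<forall>z. z \<notin> \<Lambda> \<longrightarrow> k (z + v) = k z" if "v \<in> \<Lambda>" for v
    using that
  proof (induction v rule: torus_lattice_induct)
    case (add1 w)
    show ?case
    proof (intro allI impI)
      fix z assume "z \<notin> \<Lambda>"
      then have "k (z + w + \<omega>1) = k z" using add1 assms(1) lattice_add_iff by metis
      then show "k (z + (w + \<omega>1)) = k z" by (simp only: add.assoc)
    qed
  next
    case (diff1 w)
    show ?case
    proof (intro allI impI)
      fix z assume z: "z \<notin> \<Lambda>"
      have "w - \<omega>1 \<in> \<Lambda>" using torus_lattice_diff[OF diff1(1) torus_lattice_2pi_i] .
      then have "z + (w - \<omega>1) \<notin> \<Lambda>" using z lattice_add_iff by metis
      from assms(1)[OF this] diff1(2) z show "k (z + (w - \<omega>1)) = k z" by simp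
    qed
  next
    case (add2 w)
    show ?case
    proof (intro allI impI)
      fix z assume "z \<notin> \<Lambda>"
      then have "k (z + w + \<omega>2) = k z" using add2 assms(2) lattice_add_iff by metis
      then show "k (z + (w + \<omega>2)) = k z" by (simp only: add.assoc)
    qed
  next
    case (diff2 w)
    show ?case
    proof (intro allI impI)
      fix z assume z: "z \<notin> \<Lambda>"
      have "w - \<omega>2 \<in> \<Lambda>" using torus_lattice_diff[OF diff2(1) torus_lattice_2pi_i_tau] .
      then have "z + (w - \<omega>2) \<notin> \<Lambda>" using z lattice_add_iff by metis
      from assms(2)[OF this] diff2(2) z show "k (z + (w - \<omega>2)) = k z" by simp
    qed
  qed simp
  from this[OF torus_lattice_minus[OF near(1)]] z show ?thesis by (simp add: red_def)
qed

lemma deriv_periodic: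
  assumes f: "f holomorphic_on - \<Lambda>" and v: "v \<in> \<Lambda>" and k: "\<And>z. z \<notin> \<Lambda> \<Longrightarrow> f (z + v) = f z + k" and z: "z \<notin> \<Lambda>"
  shows "deriv f (z + v) = deriv f z"
proof -
  have op: "open (- \<Lambda>)" using closed_lattice by (simp add: open_Compl)
  have zv: "z + v \<in> - \<Lambda>" using z v lattice_add_iff by simp
  have "(f has_field_derivative deriv f (z + v)) (at (z + v))"
    by (rule holomorphic_derivI[OF f op zv])
  then have "((\<lambda>y. f (y + v)) has_field_derivative deriv f (z + v)) (at z)"
    by (rule DERIV_shift[THEN iffD1])
  then have 1: "((\<lambda>y. f y + k) has_field_derivative deriv f (z + v)) (at z)"
    by (rule has_field_derivative_transform_within_open[OF _ op]) (use z k in auto)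
  have "((\<lambda>y. f y + k) has_field_derivative deriv f z) (at z)"
    using holomorphic_derivI[OF f op] z by (auto intro!: derivative_eq_intros)
  with 1 show ?thesis by (rule DERIV_unique)
qed

end

context torus_cutoff begin

lemma near_lattice: "z \<in> \<Lambda> \<Longrightarrow> norm (red z) = 0"
  using lattice_iff_infdist norm_red by simp

lemma eventually_near_lattice:
  assumes "z \<in> \<Lambda>" shows "eventually (\<lambda>y. norm (red y) < r1) (nhds z)"
proof -
  have "open {y. infdist y \<Lambda> < r1}" by (intro open_Collect_less continuous_intros)
  from eventually_nhds_in_open[OF this, of z] show ?thesis
    using near_lattice[OF assms] r by (simp add: norm_red)
qed

lemma \<phi>_near: "norm (red z) \<le> r1 \<Longrightarrow> \<phi> z = 0"
  using \<Phi>0[of "(norm (red z))\<^sup>2"] by (simp add: \<phi>_def power_mono)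

lemma wirtinger_\<phi>: "wirtinger \<phi> (Hn (red z) * cnj (red z)) (Hn (red z) * red z) z"
proof (cases "norm (red z) > r2")
  case True
  from eventually_norm_red_gt[OF this] have "eventually (\<lambda>y. \<phi> y = of_real c) (nhds z)"
    by eventually_elim (use \<Phi>c r in \<open>simp add: \<phi>_def power_mono\<close>)
  from wirtinger_cong_ev[OF this wirtinger_const] show ?thesis
    using True by (simp add: out_of_annulus)
next
  case False
  with r have "norm (red z) < D / 2" by simp
  from eventually_red[OF this]
  have "eventually (\<lambda>y. \<phi> y = of_real (\<Phi> ((norm (y - near z))\<^sup>2))) (nhds z)"
    by eventually_elim (simp add: \<phi>_def)
  from wirtinger_cong_ev[OF this wirtinger_shift[OF wirtinger_radial[OF d\<Phi>]]]
  show ?thesis by (simp add: Hn_def red_def)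
qed

lemma continuous_on_lattice_extend:
  assumes F: "continuous_on (- \<Lambda>) F" and 0: "\<And>z. norm (red z) \<le> r1 \<Longrightarrow> F z = (0 :: complex)"
  shows "continuous_on UNIV F"
proof (intro continuous_at_imp_continuous_on ballI)
  fix z show "isCont F z"
  proof (cases "z \<in> \<Lambda>")
    case False
    then show ?thesis using F closed_lattice
      by (subst (asm) continuous_on_eq_continuous_at) (auto simp: open_Compl)
  next
    case True
    from eventually_near_lattice[OF this] have "eventually (\<lambda>y. F y = 0) (nhds z)"
      by eventually_elim (simp add: 0)
    from isCont_cong[OF this] show ?thesis by simp
  qed
qed

lemma continuous_\<phi>: "continuous_on UNIV \<phi>"
  using wirtinger_\<phi> wirtinger_imp_isCont by (blast intro: continuous_at_imp_continuous_on)

lemma continuous_\<phi>_mult: "continuous_on (- \<Lambda>) g \<Longrightarrow> continuous_on UNIV (\<lambda>z. \<phi> z * g z)"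
  by (rule continuous_on_lattice_extend)
    (auto intro!: continuous_intros continuous_on_subset[OF continuous_\<phi>] simp: \<phi>_near)

lemma mean_stokes_global:
  assumes k: "\<And>z. z \<notin> \<Lambda> \<Longrightarrow> wirtinger k (a z) (b z) z"
    and c: "continuous_on (- \<Lambda>) a" "continuous_on (- \<Lambda>) b"
    and p: "\<And>z. z \<notin> \<Lambda> \<Longrightarrow> k (z + \<omega>1) = k z" "\<And>z. z \<notin> \<Lambda> \<Longrightarrow> k (z + \<omega>2) = k z"
  shows "N (\<lambda>w. cnj w * k w) + mean (\<lambda>z. \<phi> z * a z) = 0" "N (\<lambda>w. w * k w) + mean (\<lambda>z. \<phi> z * b z) = 0"
proof -
  have ck: "continuous_on (- \<Lambda>) k"
    using k wirtinger_imp_isCont by (blast intro: continuous_at_imp_continuous_on)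
  have "U \<subseteq> - \<Lambda>" using lattice_min_le[of _ \<tau>] by force
  then have ckU: "continuous_on U k" using ck continuous_on_subset by blast
  have red: "(\<lambda>z. Hn (red z) * (g (red z) * k (red z))) = (\<lambda>z. Hn (red z) * g (red z) * k z)" for g
  proof
    fix z
    show "Hn (red z) * (g (red z) * k (red z)) = Hn (red z) * g (red z) * k z"
    proof (cases "z \<in> \<Lambda>")
      case True
      then show ?thesis using near_lattice[of z] r by (simp add: out_of_annulus)
    next
      case False
      then show ?thesis using red_periodic[OF p] by simp
    qed
  qed
  let ?A = "\<lambda>z. Hn (red z) * cnj (red z) * k z + \<phi> z * a z" and ?B = "\<lambda>z. Hn (red z) * red z * k z + \<phi> z * b z"
  have w: "wirtinger (\<lambda>z. \<phi> z * k z) (?A z) (?B z) z" for z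
  proof (cases "z \<in> \<Lambda>")
    case False
    from wirtinger_mult[OF wirtinger_\<phi> k[OF this]] show ?thesis by simp
  next
    case True
    from eventually_near_lattice[OF this] have ev: "eventually (\<lambda>y. \<phi> y * k y = 0) (nhds z)"
      by eventually_elim (simp add: \<phi>_near)
    have "?A z = 0" "?B z = 0" using near_lattice[OF True] r by (simp_all add: out_of_annulus \<phi>_near)
    with wirtinger_cong_ev[OF ev wirtinger_const] show ?thesis by simp
  qed
  have c1: "continuous_on UNIV (\<lambda>z. Hn (red z) * (g (red z) * k (red z)))" if "continuous_on U g" for g
    using that ckU by (intro continuous_N continuous_intros)
  have cA: "continuous_on UNIV (\<lambda>z. Hn (red z) * cnj (red z) * k z)" "continuous_on UNIV (\<lambda>z. Hn (red z) * red z * k z)"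
    using c1[of cnj] c1[of "\<lambda>w. w"] unfolding red[of cnj] red[of "\<lambda>w. w"]
    by (auto intro: continuous_intros)
  have per: "\<phi> (z + v) * k (z + v) = \<phi> z * k z" if "v \<in> \<Lambda>" "\<And>z. z \<notin> \<Lambda> \<Longrightarrow> k (z + v) = k z" for z v
    using norm_red_add[OF that(1), of z] that(2)[of z] near_lattice[of z] r
    by (cases "z \<in> \<Lambda>") (simp_all add: \<phi>_def \<Phi>0)
  have "mean ?A = 0" "mean ?B = 0"
    by (rule mean_stokes[OF w continuous_on_add[OF cA(1) continuous_\<phi>_mult[OF c(1)]]
      continuous_on_add[OF cA(2) continuous_\<phi>_mult[OF c(2)]]
      per[OF torus_lattice_2pi_i p(1)] per[OF torus_lattice_2pi_i_tau p(2)]]; assumption)+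
  moreover have "mean ?A = N (\<lambda>w. cnj w * k w) + mean (\<lambda>z. \<phi> z * a z)"
    unfolding N_def red[of cnj] by (rule mean_add[OF cA(1) continuous_\<phi>_mult[OF c(1)]])
  moreover have "mean ?B = N (\<lambda>w. w * k w) + mean (\<lambda>z. \<phi> z * b z)"
    unfolding N_def red[of "\<lambda>w. w"] by (rule mean_add[OF cA(2) continuous_\<phi>_mult[OF c(2)]])
  ultimately show "N (\<lambda>w. cnj w * k w) + mean (\<lambda>z. \<phi> z * a z) = 0" "N (\<lambda>w. w * k w) + mean (\<lambda>z. \<phi> z * b z) = 0"
    by simp_all
qed

lemma mean_\<phi>: "mean \<phi> + N (\<lambda>w. w * cnj w) = of_real c"
proof -
  let ?P = "\<lambda>w. of_real c - of_real (\<Phi> ((norm w)\<^sup>2)) :: complex"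
  let ?A = "\<lambda>w. - (Hn w * cnj w * cnj w)" and ?B = "\<lambda>w. ?P w - Hn w * (w * cnj w)"
  have w: "wirtinger (\<lambda>w. ?P w * cnj w) (?A w) (?B w) w" for w
    using wirtinger_mult[OF wirtinger_diff[OF wirtinger_const wirtinger_radial[OF d\<Phi>]] wirtinger_cnj[OF wirtinger_ident], of c w]
    by (rule wirtinger_eq) (simp_all add: Hn_def)
  have c\<Phi>: "continuous_on UNIV (\<lambda>w :: complex. \<Phi> ((norm w)\<^sup>2))"
    by (intro continuous_on_compose2[OF continuous_at_imp_continuous_on[of UNIV \<Phi>]] continuous_intros)
      (auto simp: isCont_\<Phi>)
  have P0: "?P w = 0" if "norm w \<ge> r2" for w
    using \<Phi>c[of "(norm w)\<^sup>2"] that r by (simp add: power_mono)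
  have "mean (\<lambda>z. ?B (red z)) = 0"
    by (rule mean_stokes_red(2)[OF r(3) w]) (auto intro!: continuous_intros c\<Phi> simp: P0 out_of_annulus)
  then have "mean (\<lambda>z. (of_real c - \<phi> z) - Hn (red z) * (red z * cnj (red z))) = 0"
    by (simp add: \<phi>_def)
  moreover have "mean (\<lambda>z. (of_real c - \<phi> z) - Hn (red z) * (red z * cnj (red z))) =
      of_real c - mean \<phi> - N (\<lambda>w. w * cnj w)"
    unfolding N_def
    by (subst mean_diff, (intro continuous_intros continuous_\<phi> continuous_N)+, subst mean_diff)
      (intro continuous_intros continuous_\<phi> | simp add: mean_const)+
  ultimately show ?thesis by (simp add: algebra_simps)
qed

lemma N_monomial_0:
  assumes "m \<noteq> n" shows "N (\<lambda>w. w powi m * cnj (w powi n)) = 0"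
proof -
  have w: "wirtinger (\<lambda>w. w powi m * cnj (w powi n)) (of_int m * w powi (m - 1) * cnj (w powi n))
      (w powi m * cnj (of_int n * w powi (n - 1))) w" if "w \<in> U" for w
  proof -
    have "((\<lambda>w. w powi k) has_field_derivative of_int k * w powi (k - 1)) (at w)" for k :: int
      using that by (auto intro!: derivative_eq_intros)
    from wirtinger_mult[OF wirtinger_field_derivative[OF this[of m]] wirtinger_cnj[OF wirtinger_field_derivative[OF this[of n]]]]
    show ?thesis by simp
  qed
  have c: "continuous_on U (\<lambda>w. w powi k)" for k :: int by (intro continuous_intros) auto
  have "N (\<lambda>w. w * (of_int m * w powi (m - 1) * cnj (w powi n)) - cnj w * (w powi m * cnj (of_int n * w powi (n - 1)))) = 0"
    by (rule N_rotation[OF w]) (auto intro!: continuous_intros)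
  also have "N (\<lambda>w. w * (of_int m * w powi (m - 1) * cnj (w powi n)) - cnj w * (w powi m * cnj (of_int n * w powi (n - 1)))) =
      N (\<lambda>w. of_int (m - n) * (w powi m * cnj (w powi n)))"
  proof (rule N_cong)
    fix w assume "w \<in> U"
    then have *: "w powi k = w * w powi (k - 1)" for k :: int
      using power_int_add_1[of w "k - 1"] by (simp add: mult.commute)
    show "w * (of_int m * w powi (m - 1) * cnj (w powi n)) - cnj w * (w powi m * cnj (of_int n * w powi (n - 1)))
        = of_int (m - n) * (w powi m * cnj (w powi n))"
      unfolding *[of m] *[of n] by (simp add: algebra_simps)
  qed
  also have "\<dots> = of_int (m - n) * N (\<lambda>w. w powi m * cnj (w powi n))"
    by (intro N_cmult continuous_intros c)
  finally show ?thesis using assms by simp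
qed

lemma N_holomorphic_0:
  assumes "h holomorphic_on ball 0 D"
  shows "N (\<lambda>w. cnj (w powi m) * (w powi m * w * h w)) = 0"
proof -
  obtain X where X: "\<And>w. w \<in> ball 0 D \<Longrightarrow> (X has_field_derivative h w) (at w)"
    using holomorphic_convex_primitive'[OF convex_ball open_ball assms] by (auto simp: at_within_open[OF _ open_ball])
  have dp: "((\<lambda>w. w powi k) has_field_derivative of_int k * w powi (k - 1)) (at w)" if "w \<in> U" for k :: int and w
    using that by (auto intro!: derivative_eq_intros)
  let ?a = "\<lambda>w. (of_int m * w powi (m - 1) * X w + h w * w powi m) * cnj (w powi m)"
  let ?b = "\<lambda>w. w powi m * X w * cnj (of_int m * w powi (m - 1))"
  have w: "wirtinger (\<lambda>w. w powi m * X w * cnj (w powi m)) (?a w) (?b w) w" if "w \<in> U" for w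
    using wirtinger_mult[OF wirtinger_field_derivative[OF DERIV_mult[OF dp[OF that, of m] X]]
        wirtinger_cnj[OF wirtinger_field_derivative[OF dp[OF that, of m]]]] that by simp
  have c: "continuous_on U (\<lambda>w. w powi k)" for k :: int by (intro continuous_intros) auto
  have cX: "continuous_on U X" "continuous_on U h"
    using X DERIV_isCont by (blast intro: continuous_at_imp_continuous_on,
      use holomorphic_on_imp_continuous_on[OF assms] continuous_on_subset in blast)
  have "N (\<lambda>w. w * ?a w - cnj w * ?b w) = 0"
    by (rule N_rotation[OF w]) (auto intro!: continuous_intros cX)
  also have "N (\<lambda>w. w * ?a w - cnj w * ?b w) = N (\<lambda>w. cnj (w powi m) * (w powi m * w * h w))"
  proof (rule N_cong)
    fix w assume "w \<in> U"
    then have *: "w powi m = w * w powi (m - 1)"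
      using power_int_add_1[of w "m - 1"] by (simp add: mult.commute)
    show "w * ?a w - cnj w * ?b w = cnj (w powi m) * (w powi m * w * h w)"
      unfolding * by (simp add: algebra_simps)
  qed
  finally show ?thesis .
qed

end

lemma holomorphic_Taylor_remainder:
  assumes "g holomorphic_on ball 0 R"
  shows "\<exists>h. h holomorphic_on ball 0 R \<and>
    (\<forall>w\<in>ball 0 R. g w = (\<Sum>l\<le>L. (deriv ^^ l) g 0 / fact l * w ^ l) + w ^ Suc L * h w)"
proof -
  define a where "a l = (deriv ^^ l) g 0 / fact l" for l
  have g: "(\<lambda>l. a l * w ^ l) sums g w" if "w \<in> ball 0 R" for w
    using holomorphic_power_series[OF assms that] by (simp add: a_def)
  define h where "h w = (\<Sum>l. a (l + Suc L) * w ^ l)" for w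
  have h: "(\<lambda>l. a (l + Suc L) * w ^ l) sums h w \<and> g w = (\<Sum>l\<le>L. a l * w ^ l) + w ^ Suc L * h w" if w: "w \<in> ball 0 R" for w
  proof (cases "w = 0")
    case True
    have "(\<lambda>l. a (l + Suc L) * w ^ l) sums a (0 + Suc L)" unfolding True by (rule powser_sums_zero)
    moreover have "g 0 = a 0" by (simp add: a_def)
    moreover have "(\<Sum>l\<le>L. a l * 0 ^ l) = a 0"
      by (subst sum.atMost_shift) simp
    ultimately show ?thesis unfolding h_def using True by (simp add: sums_iff)
  next
    case False
    have "(\<lambda>l. a (l + Suc L) * w ^ (l + Suc L)) sums (g w - (\<Sum>l\<le>L. a l * w ^ l))"
      using sums_split_initial_segment[OF g[OF w], of "Suc L"] by (simp only: lessThan_Suc_atMost)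
    from sums_mult[OF this, of "inverse (w ^ Suc L)"]
    have "(\<lambda>l. a (l + Suc L) * w ^ l) sums (inverse (w ^ Suc L) * (g w - (\<Sum>l\<le>L. a l * w ^ l)))"
      using False by (simp add: power_add field_simps)
    then show ?thesis unfolding h_def using False by (simp add: sums_iff field_simps)
  qed
  have "h holomorphic_on ball 0 R"
    by (rule power_series_holomorphic[of 0 R "\<lambda>l. a (l + Suc L)"]) (use h in auto)
  with h show ?thesis unfolding a_def by blast
qed

lemma sum_int_interval:
  fixes F :: "int \<Rightarrow> 'a :: comm_monoid_add"
  shows "(\<Sum>n\<in>{- int K..int L}. F n) = (\<Sum>k\<in>{1..K}. F (- int k)) + (\<Sum>l\<in>{..L}. F (int l))"
proof -
  have "{- int K..int L} = (\<lambda>k. - int k) ` {1..K} \<union> int ` {..L}"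
  proof (intro Set.set_eqI iffI)
    fix n assume n: "n \<in> {- int K..int L}"
    show "n \<in> (\<lambda>k. - int k) ` {1..K} \<union> int ` {..L}"
    proof (cases "n < 0")
      case True
      then have "n = - int (nat (- n))" "nat (- n) \<in> {1..K}" using n by auto
      then show ?thesis by blast
    next
      case False
      then have "n = int (nat n)" "nat n \<in> {..L}" using n by auto
      then show ?thesis by blast
    qed
  qed auto
  moreover have "(\<Sum>n\<in>(\<lambda>k. - int k) ` {1..K} \<union> int ` {..L}. F n) =
      (\<Sum>n\<in>(\<lambda>k. - int k) ` {1..K}. F n) + (\<Sum>n\<in>int ` {..L}. F n)"
    by (rule sum.union_disjoint) auto
  ultimately show ?thesis by (simp add: sum.reindex inj_on_def)
qed

context torus_cutoff begin

lemma N_Re_nonneg: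
  assumes "continuous_on U g" "\<And>w. r1 \<le> norm w \<Longrightarrow> norm w \<le> r2 \<Longrightarrow> Re (g w) \<ge> 0"
  shows "Re (N g) \<ge> 0"
  unfolding N_def
proof (rule mean_Re_nonneg[OF continuous_N[OF assms(1)]])
  fix z
  show "Re (Hn (red z) * g (red z)) \<ge> 0"
  proof (cases "norm (red z) \<le> r1 \<or> r2 \<le> norm (red z)")
    case True
    then show ?thesis by (simp add: out_of_annulus)
  next
    case False
    then show ?thesis using assms(2)[of "red z"] H_nonneg by (simp add: Hn_def)
  qed
qed

lemma energy_identity:
  assumes f: "f holomorphic_on - \<Lambda>"
    and f1: "\<And>z. z \<notin> \<Lambda> \<Longrightarrow> f (z + \<omega>1) = f z + \<omega>1 * \<alpha>"
    and f2: "\<And>z. z \<notin> \<Lambda> \<Longrightarrow> f (z + \<omega>2) = f z + (\<omega>2 * \<alpha> - d)"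
  defines "q \<equiv> d / of_real (4 * pi * Im \<tau>)"
  shows "N (\<lambda>w. w * f w) = q * of_real c"
    and "Re (N (\<lambda>w. w * deriv f w * cnj (f w))) \<le> c * ((norm (\<alpha> + q))\<^sup>2 - (norm q)\<^sup>2)"
proof -
  define p where "p = \<alpha> + q"
  define f' where "f' = deriv f"
  define u where "u z = f z - p * z - q * cnj z" for z
  have op: "open (- \<Lambda>)" using closed_lattice by (simp add: open_Compl)
  have df: "(f has_field_derivative f' z) (at z)" if "z \<notin> \<Lambda>" for z
    unfolding f'_def using holomorphic_derivI[OF f op] that by simp
  have hf': "f' holomorphic_on - \<Lambda>" unfolding f'_def by (rule holomorphic_deriv[OF f op])
  have df': "(f' has_field_derivative deriv f' z) (at z)" if "z \<notin> \<Lambda>" for z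
    using holomorphic_derivI[OF hf' op] that by simp
  have cont: "continuous_on (- \<Lambda>) f" "continuous_on (- \<Lambda>) f'" "continuous_on (- \<Lambda>) (deriv f')"
    using f hf' holomorphic_deriv[OF hf' op] holomorphic_on_imp_continuous_on by blast+
  have UL: "U \<subseteq> - \<Lambda>" using lattice_min_le[of _ \<tau>] by force
  have contU: "continuous_on U f" "continuous_on U f'" using cont UL continuous_on_subset by blast+
  have q: "q * (4 * of_real pi * of_real (Im \<tau>)) = d" using Im_tau by (simp add: q_def)
  have u1: "u (z + \<omega>1) = u z" if "z \<notin> \<Lambda>" for z
    unfolding u_def f1[OF that] p_def by (simp add: algebra_simps)
  have u2: "u (z + \<omega>2) = u z" if "z \<notin> \<Lambda>" for z
  proof -
    have "u (z + \<omega>2) = u z - d - (q * \<omega>2 + q * cnj \<omega>2)"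
      unfolding u_def f2[OF that] p_def by (simp add: algebra_simps)
    also have "q * \<omega>2 + q * cnj \<omega>2 = - (q * (4 * of_real pi * of_real (Im \<tau>)))"
    proof -
      have "\<omega>2 + cnj \<omega>2 = - (4 * of_real pi * of_real (Im \<tau>))" by (simp add: complex_eq_iff)
      then have "q * (\<omega>2 + cnj \<omega>2) = q * - (4 * of_real pi * of_real (Im \<tau>))" by (rule arg_cong)
      then show ?thesis by (simp only: distrib_left mult_minus_right)
    qed
    finally show ?thesis by (simp add: q)
  qed
  have f'1: "f' (z + \<omega>1) = f' z" if "z \<notin> \<Lambda>" for z
    unfolding f'_def by (rule deriv_periodic[OF f torus_lattice_2pi_i f1 that])
  have f'2: "f' (z + \<omega>2) = f' z" if "z \<notin> \<Lambda>" for z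
    unfolding f'_def by (rule deriv_periodic[OF f torus_lattice_2pi_i_tau f2 that])
  have wu: "wirtinger u (f' z - p) (- q) z" if "z \<notin> \<Lambda>" for z
    unfolding u_def
    using wirtinger_diff[OF wirtinger_diff[OF wirtinger_field_derivative[OF df[OF that]]
        wirtinger_mult[OF wirtinger_const[of p] wirtinger_ident]]
      wirtinger_mult[OF wirtinger_const[of q] wirtinger_cnj[OF wirtinger_ident]]]
    by simp
  have cu: "continuous_on (- \<Lambda>) u" unfolding u_def by (intro continuous_intros cont)
  have wf': "wirtinger (\<lambda>z. cnj (u z) * f' z) (- cnj q * f' z + cnj (u z) * deriv f' z) (cnj (f' z - p) * f' z) z"
    if "z \<notin> \<Lambda>" for z
    using wirtinger_mult[OF wirtinger_cnj[OF wu[OF that]] wirtinger_field_derivative[OF df'[OF that]]] by simp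
  define X where "X = N (\<lambda>w. w * f' w * cnj (f w))"
  define Y where "Y = N (\<lambda>w. cnj w * f w)"
  define Z where "Z = N (\<lambda>w. w * f w)"
  define m where "m = N (\<lambda>w. w * cnj w)"
  define G where "G = mean (\<lambda>z. \<phi> z * f' z)"
  define T where "T = mean (\<lambda>z. \<phi> z * (cnj (f' z) * f' z))"
  have R1: "N (\<lambda>w. w * cnj w * f' w) = Y"
  proof -
    have w: "wirtinger (\<lambda>w. f w * cnj w) (f' w * cnj w) (f w) w" if "w \<in> U" for w
      using wirtinger_mult[OF wirtinger_field_derivative[OF df] wirtinger_cnj[OF wirtinger_ident], of w] that UL by auto
    have "N (\<lambda>w. w * (f' w * cnj w) - cnj w * f w) = 0"
      by (rule N_rotation[OF w]) (assumption | intro continuous_intros contU)+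
    moreover have "N (\<lambda>w. w * (f' w * cnj w) - cnj w * f w) = N (\<lambda>w. w * (f' w * cnj w)) - Y"
      unfolding Y_def by (intro N_diff continuous_intros contU)
    ultimately show ?thesis by (simp add: mult_ac)
  qed
  have R2: "N (\<lambda>w. w * w * f' w) = - Z"
  proof -
    have w: "wirtinger (\<lambda>w. f w * w) (f' w * w + f w) 0 w" if "w \<in> U" for w
      using wirtinger_mult[OF wirtinger_field_derivative[OF df] wirtinger_ident, of w] that UL by auto
    have "N (\<lambda>w. w * (f' w * w + f w) - cnj w * 0) = 0"
      by (rule N_rotation[OF w]) (assumption | intro continuous_intros contU)+
    then have "N (\<lambda>w. w * w * f' w + w * f w) = 0" by (simp add: algebra_simps)
    moreover have "N (\<lambda>w. w * w * f' w + w * f w) = N (\<lambda>w. w * w * f' w) + Z"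
      unfolding Z_def by (intro N_add continuous_intros contU)
    ultimately show ?thesis by (simp add: add_eq_0_iff)
  qed
  have R3: "N (\<lambda>w. w * w) = 0" "N (\<lambda>w. cnj w * cnj w) = 0"
    using N_monomial_0[of 2 0] N_monomial_0[of 0 2] by (simp_all add: power2_eq_square)
  have E1: "N (\<lambda>w. w * (cnj (u w) * f' w)) = X - cnj p * Y + cnj q * Z"
  proof -
    have "N (\<lambda>w. w * (cnj (u w) * f' w)) =
        N (\<lambda>w. w * f' w * cnj (f w) - cnj p * (w * cnj w * f' w) - cnj q * (w * w * f' w))"
      by (rule N_cong) (simp add: u_def algebra_simps)
    also have "\<dots> = X - cnj p * N (\<lambda>w. w * cnj w * f' w) - cnj q * N (\<lambda>w. w * w * f' w)"
      unfolding X_def by (subst N_diff N_cmult, (intro continuous_intros contU)+)+ simp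
    finally show ?thesis by (simp add: R1 R2)
  qed
  have E2: "N (\<lambda>w. cnj w * u w) = Y - p * m"
  proof -
    have "N (\<lambda>w. cnj w * u w) = N (\<lambda>w. cnj w * f w - p * (w * cnj w) - q * (cnj w * cnj w))"
      by (rule N_cong) (simp add: u_def algebra_simps)
    also have "\<dots> = Y - p * m - q * N (\<lambda>w. cnj w * cnj w)"
      unfolding Y_def m_def by (subst N_diff N_cmult, (intro continuous_intros contU)+)+ simp
    finally show ?thesis by (simp add: R3)
  qed
  have E3: "N (\<lambda>w. w * u w) = Z - q * m"
  proof -
    have "N (\<lambda>w. w * u w) = N (\<lambda>w. w * f w - p * (w * w) - q * (w * cnj w))"
      by (rule N_cong) (simp add: u_def algebra_simps)
    also have "\<dots> = Z - p * N (\<lambda>w. w * w) - q * m"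
      unfolding Z_def m_def by (subst N_diff N_cmult, (intro continuous_intros contU)+)+ simp
    finally show ?thesis by (simp add: R3)
  qed
  have M1: "mean (\<lambda>z. \<phi> z * (f' z - p)) = G - p * mean \<phi>"
  proof -
    have "mean (\<lambda>z. \<phi> z * f' z - p * \<phi> z) = G - mean (\<lambda>z. p * \<phi> z)"
      unfolding G_def by (intro mean_diff continuous_\<phi>_mult cont continuous_intros continuous_\<phi>)
    then show ?thesis by (simp add: mean_cmult[OF continuous_\<phi>] algebra_simps)
  qed
  have M2: "mean (\<lambda>z. \<phi> z * - q) = - q * mean \<phi>"
    using mean_cmult[OF continuous_\<phi>, of "- q"] by (simp add: mult.commute)
  have M3: "mean (\<lambda>z. \<phi> z * (cnj (f' z - p) * f' z)) = T - cnj p * G"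
  proof -
    have "mean (\<lambda>z. \<phi> z * (cnj (f' z) * f' z) - cnj p * (\<phi> z * f' z)) = T - mean (\<lambda>z. cnj p * (\<phi> z * f' z))"
      unfolding T_def by (intro mean_diff continuous_\<phi>_mult cont continuous_intros)
    also have "\<dots> = T - cnj p * G"
      unfolding G_def mean_cmult[OF continuous_\<phi>_mult[OF cont(2)]] ..
    finally show ?thesis by (simp add: algebra_simps)
  qed
  have S1: "X - cnj p * Y + cnj q * Z + (T - cnj p * G) = 0"
    unfolding E1[symmetric] M3[symmetric]
    by (rule mean_stokes_global(2)[OF wf'])
      (assumption | intro continuous_intros cont cu | simp add: u1 u2 f'1 f'2)+
  have S2: "Y - p * m + (G - p * mean \<phi>) = 0"
    unfolding E2[symmetric] M1[symmetric]
    by (rule mean_stokes_global(1)[OF wu])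
      (assumption | intro continuous_intros cont | simp add: u1 u2)+
  have S3: "Z - q * m + (- q * mean \<phi>) = 0"
    unfolding E3[symmetric] M2[symmetric]
    by (rule mean_stokes_global(2)[OF wu])
      (assumption | intro continuous_intros cont | simp add: u1 u2)+
  have mc: "mean \<phi> = of_real c - m" using mean_\<phi> by (simp add: m_def algebra_simps)
  have Z: "Z = q * of_real c" using S3 unfolding mc by (simp add: algebra_simps)
  then show "N (\<lambda>w. w * f w) = q * of_real c" by (simp add: Z_def)
  have YG: "Y + G = p * of_real c" using S2 unfolding mc by (simp add: algebra_simps)
  have "T = - X + cnj p * (Y + G) - cnj q * Z" using S1 by (simp add: algebra_simps)
  then have "T = - X + of_real c * (p * cnj p) - of_real c * (q * cnj q)"
    unfolding YG Z by (simp add: algebra_simps)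
  then have "T = - X + of_real (c * (norm p)\<^sup>2 - c * (norm q)\<^sup>2)"
    unfolding complex_norm_square[symmetric] by simp
  then have "Re T = - Re X + (c * (norm p)\<^sup>2 - c * (norm q)\<^sup>2)"
    by (simp only: plus_complex.sel uminus_complex.sel Re_complex_of_real)
  moreover have "Re T \<ge> 0" unfolding T_def
  proof (rule mean_Re_nonneg)
    show "continuous_on UNIV (\<lambda>z. \<phi> z * (cnj (f' z) * f' z))"
      by (intro continuous_\<phi>_mult continuous_intros cont)
    fix z
    have "\<phi> z * (cnj (f' z) * f' z) = of_real (\<Phi> ((norm (red z))\<^sup>2) * (norm (f' z))\<^sup>2)"
      unfolding \<phi>_def of_real_mult complex_norm_square by (simp add: mult.commute)
    then show "Re (\<phi> z * (cnj (f' z) * f' z)) \<ge> 0" using \<Phi>_bounds by simp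
  qed
  ultimately show "Re (N (\<lambda>w. w * deriv f w * cnj (f w))) \<le> c * ((norm (\<alpha> + q))\<^sup>2 - (norm q)\<^sup>2)"
    by (simp add: X_def f'_def p_def algebra_simps)
qed

lemma N_1: "N (\<lambda>w. 1) = of_real (c / (4 * pi * Im \<tau>))"
proof -
  have "N (\<lambda>w. w * P1 w) = 1 / of_real (4 * pi * Im \<tau>) * of_real c"
    by (rule energy_identity(1)[OF P1_holomorphic, of 0]) (simp_all add: P1_add_omega1 P1_add_omega2)
  moreover have "N (\<lambda>w. w * P1 w) = N (\<lambda>w. 1 + w * P1_reg w)"
    by (rule N_cong) (simp add: P1_eq field_simps)
  moreover have "N (\<lambda>w. 1 + w * P1_reg w) = N (\<lambda>w. 1) + N (\<lambda>w. w * P1_reg w)"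
    using holomorphic_on_imp_continuous_on[OF P1_reg_holomorphic]
    by (intro N_add continuous_intros) (auto intro: continuous_on_subset)
  moreover have "N (\<lambda>w. w * P1_reg w) = 0"
    using N_holomorphic_0[OF P1_reg_holomorphic, of 0] by simp
  ultimately show ?thesis by simp
qed

lemma N_1_pos: "Re (N (\<lambda>w. 1)) > 0"
  unfolding N_1 using c Im_tau by simp

lemma N_power_ge: "Re (N (\<lambda>w. w powi int l * cnj (w powi int l))) \<ge> r1 ^ (2 * l) * Re (N (\<lambda>w. 1))"
proof -
  have "Re (N (\<lambda>w. w ^ l * cnj (w ^ l) - of_real (r1 ^ (2 * l)) * 1)) \<ge> 0"
  proof (rule N_Re_nonneg)
    fix w :: complex assume "r1 \<le> norm w"
    then have "r1 ^ (2 * l) \<le> norm w ^ (2 * l)" using r by (intro power_mono) auto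
    moreover have "w ^ l * cnj (w ^ l) = of_real (norm w ^ (2 * l))"
      by (metis complex_norm_square norm_power power2_eq_square power_even_eq power_mult_distrib)
    ultimately show "Re (w ^ l * cnj (w ^ l) - of_real (r1 ^ (2 * l)) * 1) \<ge> 0" by simp
  qed (intro continuous_intros)
  moreover have "N (\<lambda>w. w ^ l * cnj (w ^ l) - of_real (r1 ^ (2 * l)) * 1) =
      N (\<lambda>w. w ^ l * cnj (w ^ l)) - of_real (r1 ^ (2 * l)) * N (\<lambda>w. 1)"
    by (subst N_diff N_cmult, (intro continuous_intros)+)+ simp
  ultimately show ?thesis by (simp del: of_real_power)
qed

lemma N_power_le: "Re (N (\<lambda>w. w powi (- int k) * cnj (w powi (- int k)))) \<le> Re (N (\<lambda>w. 1)) / r1 ^ (2 * k)"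
proof -
  have cont: "continuous_on U (\<lambda>w. w powi (- int k))" by (intro continuous_intros) auto
  have "Re (N (\<lambda>w. of_real (1 / r1 ^ (2 * k)) * 1 - w powi (- int k) * cnj (w powi (- int k)))) \<ge> 0"
  proof (rule N_Re_nonneg)
    fix w :: complex assume w: "r1 \<le> norm w"
    then have "w \<noteq> 0" using r by auto
    from w have "r1 ^ (2 * k) \<le> norm w ^ (2 * k)" using r by (intro power_mono) auto
    then have "1 / norm w ^ (2 * k) \<le> 1 / r1 ^ (2 * k)" using r \<open>w \<noteq> 0\<close>
      by (intro divide_left_mono mult_pos_pos zero_less_power) auto
    moreover have "w powi (- int k) * cnj (w powi (- int k)) = of_real (1 / norm w ^ (2 * k))"
    proof -
      have "w powi (- int k) * cnj (w powi (- int k)) = of_real ((norm (w powi (- int k)))\<^sup>2)"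
        by (rule complex_norm_square[symmetric])
      also have "norm (w powi (- int k)) = 1 / norm w ^ k"
        by (simp add: norm_power norm_inverse power_int_minus divide_inverse)
      finally show ?thesis by (simp add: power_divide power_mult mult.commute)
    qed
    ultimately show "Re (of_real (1 / r1 ^ (2 * k)) * 1 - w powi (- int k) * cnj (w powi (- int k))) \<ge> 0" by simp
  qed (intro continuous_intros cont)
  moreover have "N (\<lambda>w. of_real (1 / r1 ^ (2 * k)) * 1 - w powi (- int k) * cnj (w powi (- int k))) =
      of_real (1 / r1 ^ (2 * k)) * N (\<lambda>w. 1) - N (\<lambda>w. w powi (- int k) * cnj (w powi (- int k)))"
    by (subst N_diff N_cmult, (intro continuous_intros cont)+)+ simp
  ultimately show ?thesis by (simp del: of_real_power of_real_divide power_int_minus)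
qed

end

context torus_cutoff begin

lemma N_deriv_cnj_nonneg:
  assumes \<rho>: "\<rho> holomorphic_on ball 0 D"
  shows "Re (N (\<lambda>w. w * deriv \<rho> w * cnj (\<rho> w))) \<ge> 0"
proof -
  let ?Bl = "ball 0 D :: complex set"
  have h': "deriv \<rho> holomorphic_on ?Bl" by (rule holomorphic_deriv[OF \<rho> open_ball])
  have h'': "deriv (deriv \<rho>) holomorphic_on ?Bl" by (rule holomorphic_deriv[OF h' open_ball])
  have cont: "continuous_on ?Bl \<rho>" "continuous_on ?Bl (deriv \<rho>)" "continuous_on ?Bl (deriv (deriv \<rho>))"
    using \<rho> h' h'' holomorphic_on_imp_continuous_on by blast+
  let ?P = "\<lambda>w. of_real (\<Phi> ((norm w)\<^sup>2)) - of_real c :: complex"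
  let ?k = "\<lambda>w. deriv \<rho> w * cnj (\<rho> w)"
  let ?A = "\<lambda>w. Hn w * cnj w * ?k w + ?P w * (deriv (deriv \<rho>) w * cnj (\<rho> w))"
  let ?B = "\<lambda>w. Hn w * w * ?k w + ?P w * (deriv \<rho> w * cnj (deriv \<rho> w))"
  have P0: "?P w = 0" if "norm w \<ge> r2" for w
    using \<Phi>c[of "(norm w)\<^sup>2"] that r by (simp add: power_mono)
  have far: "eventually (\<lambda>y. norm y \<ge> r2) (nhds w)" if "w \<notin> ?Bl" for w :: complex
  proof -
    have "eventually (\<lambda>y. y \<in> - cball 0 r2) (nhds w)"
      by (rule eventually_nhds_in_open) (use that r D_pos in auto)
    then show ?thesis by eventually_elim auto
  qed
  have w: "wirtinger (\<lambda>w. ?P w * ?k w) (?A w) (?B w) w" for w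
  proof (cases "w \<in> ?Bl")
    case True
    have d: "(\<rho> has_field_derivative deriv \<rho> w) (at w)" "(deriv \<rho> has_field_derivative deriv (deriv \<rho>) w) (at w)"
      using holomorphic_derivI[OF \<rho> open_ball True] holomorphic_derivI[OF h' open_ball True] by auto
    from wirtinger_mult[OF wirtinger_diff[OF wirtinger_radial[OF d\<Phi>] wirtinger_const[of "of_real c"]]
        wirtinger_mult[OF wirtinger_field_derivative[OF d(2)] wirtinger_cnj[OF wirtinger_field_derivative[OF d(1)]]]]
    show ?thesis by (simp add: Hn_def)
  next
    case False
    from far[OF this] have ev: "eventually (\<lambda>y. ?P y * ?k y = 0) (nhds w)"
      by eventually_elim (simp only: P0 mult_zero_left)
    have n: "norm w \<ge> r2" using False r D_pos by auto
    have "?A w = 0" "?B w = 0" unfolding P0[OF n] using n by (simp_all add: out_of_annulus)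
    with wirtinger_cong_ev[OF ev wirtinger_const] show ?thesis by simp
  qed
  have ext: "continuous_on UNIV F" if F: "continuous_on ?Bl F" and 0: "\<And>w. norm w \<ge> r2 \<Longrightarrow> F w = 0" for F :: "complex \<Rightarrow> complex"
  proof (intro continuous_at_imp_continuous_on ballI)
    fix w show "isCont F w"
    proof (cases "w \<in> ?Bl")
      case True
      then show ?thesis using F by (simp add: continuous_on_eq_continuous_at)
    next
      case False
      from far[OF this] have "eventually (\<lambda>y. F y = 0) (nhds w)" by eventually_elim (rule 0)
      from isCont_cong[OF this] show ?thesis by simp
    qed
  qed
  have c\<Phi>: "continuous_on S (\<lambda>w :: complex. \<Phi> ((norm w)\<^sup>2))" for S
    by (intro continuous_on_compose2[OF continuous_at_imp_continuous_on[of UNIV \<Phi>]] continuous_intros)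
      (auto simp: isCont_\<Phi>)
  have P0': "?P w * x = 0" if "norm w \<ge> r2" for w x using P0[OF that] by simp
  have cA: "continuous_on UNIV ?A" "continuous_on UNIV ?B"
    by (rule ext; (intro continuous_intros cont c\<Phi> | simp only: P0' out_of_annulus(1) simp_thms mult_zero_left add_0))+
  have "mean (\<lambda>z. ?B (red z)) = 0"
    by (rule mean_stokes_red(2)[OF r(3) w cA]) (simp_all only: P0' out_of_annulus(1) simp_thms mult_zero_left add_0)
  let ?Q = "\<lambda>w. ?P w * (deriv \<rho> w * cnj (deriv \<rho> w))"
  have cQ: "continuous_on UNIV ?Q"
    by (rule ext) (intro continuous_intros cont c\<Phi>, simp only: P0')
  have cQ': "continuous_on UNIV (\<lambda>z. ?Q (red z))"
    by (rule continuous_on_red[OF r(3) _ cQ]) (simp only: P0')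
  have cU: "continuous_on U \<rho>" "continuous_on U (deriv \<rho>)" using cont continuous_on_subset by blast+
  have "0 = mean (\<lambda>z. Hn (red z) * (red z * deriv \<rho> (red z) * cnj (\<rho> (red z))) + ?Q (red z))"
    using \<open>mean (\<lambda>z. ?B (red z)) = 0\<close> by (simp only: mult.assoc)
  also have "\<dots> = N (\<lambda>w. w * deriv \<rho> w * cnj (\<rho> w)) + mean (\<lambda>z. ?Q (red z))"
    unfolding N_def by (intro mean_add cQ' continuous_N continuous_intros cU)
  finally have "N (\<lambda>w. w * deriv \<rho> w * cnj (\<rho> w)) = - 1 * mean (\<lambda>z. ?Q (red z))" by (simp add: add_eq_0_iff)
  also have "\<dots> = mean (\<lambda>z. - 1 * ?Q (red z))" by (rule mean_cmult[OF cQ', symmetric])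
  finally have "N (\<lambda>w. w * deriv \<rho> w * cnj (\<rho> w)) = mean (\<lambda>z. - 1 * ?Q (red z))" .
  moreover have "Re (mean (\<lambda>z. - 1 * ?Q (red z))) \<ge> 0"
  proof (rule mean_Re_nonneg)
    show "continuous_on UNIV (\<lambda>z. - 1 * ?Q (red z))" by (intro continuous_intros cQ')
    fix z
    have "- 1 * ?Q (red z) = of_real ((c - \<Phi> ((norm (red z))\<^sup>2)) * (norm (deriv \<rho> (red z)))\<^sup>2)"
      unfolding of_real_mult complex_norm_square by (simp add: algebra_simps)
    then show "Re (- 1 * ?Q (red z)) \<ge> 0" using \<Phi>_bounds by simp
  qed
  ultimately show ?thesis by simp
qed

lemma N_Laurent_lower_bound:
  fixes a :: "int \<Rightarrow> complex"
  assumes I: "finite I" "\<And>n. n \<in> I \<Longrightarrow> n \<le> int L" and h: "h holomorphic_on ball 0 D"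
  defines "\<rho> \<equiv> \<lambda>w. w ^ Suc L * h w"
  shows "(\<Sum>n\<in>I. of_int n * (norm (a n))\<^sup>2 * Re (N (\<lambda>w. w powi n * cnj (w powi n))))
    \<le> Re (N (\<lambda>w. w * ((\<Sum>n\<in>I. of_int n * a n * w powi (n - 1)) + deriv \<rho> w) * cnj ((\<Sum>n\<in>I. a n * w powi n) + \<rho> w)))"
proof -
  let ?P = "\<lambda>w. \<Sum>n\<in>I. a n * w powi n" and ?P' = "\<lambda>w. \<Sum>n\<in>I. of_int n * a n * w powi n"
  have h\<rho>: "\<rho> holomorphic_on ball 0 D" unfolding \<rho>_def by (intro holomorphic_intros h)
  have h': "deriv h holomorphic_on ball 0 D" by (rule holomorphic_deriv[OF h open_ball])
  have cU: "continuous_on U h" "continuous_on U (deriv h)" "continuous_on U \<rho>" "continuous_on U (deriv \<rho>)"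
    using h h' h\<rho> holomorphic_deriv[OF h\<rho> open_ball] holomorphic_on_imp_continuous_on
    by (blast intro: continuous_on_subset)+
  have cp: "continuous_on U (\<lambda>w. w powi n)" for n :: int by (intro continuous_intros) auto
  have "N (\<lambda>w. w * ((\<Sum>n\<in>I. of_int n * a n * w powi (n - 1)) + deriv \<rho> w) * cnj (?P w + \<rho> w)) =
      N (\<lambda>w. ?P' w * cnj (?P w) + ?P' w * cnj (\<rho> w) + w * deriv \<rho> w * cnj (?P w) + w * deriv \<rho> w * cnj (\<rho> w))"
  proof (rule N_cong)
    fix w assume "w \<in> U"
    then have "w * w powi (n - 1) = w powi n" for n :: int
      using power_int_add_1[of w "n - 1"] by (simp add: mult.commute)
    then have "w * (\<Sum>n\<in>I. of_int n * a n * w powi (n - 1)) = ?P' w"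
      unfolding sum_distrib_left by (intro sum.cong refl) (metis (no_types, lifting) mult.left_commute)
    then show "w * ((\<Sum>n\<in>I. of_int n * a n * w powi (n - 1)) + deriv \<rho> w) * cnj (?P w + \<rho> w) =
       ?P' w * cnj (?P w) + ?P' w * cnj (\<rho> w) + w * deriv \<rho> w * cnj (?P w) + w * deriv \<rho> w * cnj (\<rho> w)"
      by (simp only: distrib_left distrib_right complex_cnj_add add_ac)
  qed
  also have "\<dots> = N (\<lambda>w. ?P' w * cnj (?P w)) + N (\<lambda>w. ?P' w * cnj (\<rho> w)) + N (\<lambda>w. w * deriv \<rho> w * cnj (?P w))
      + N (\<lambda>w. w * deriv \<rho> w * cnj (\<rho> w))"
  proof -
    have c: "continuous_on U (\<lambda>w. ?P' w * cnj (?P w))" "continuous_on U (\<lambda>w. ?P' w * cnj (\<rho> w))"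
      "continuous_on U (\<lambda>w. w * deriv \<rho> w * cnj (?P w))" "continuous_on U (\<lambda>w. w * deriv \<rho> w * cnj (\<rho> w))"
      by (intro continuous_intros cp cU)+
    show ?thesis
      using N_add[OF continuous_on_add[OF continuous_on_add[OF c(1,2)] c(3)] c(4)]
        N_add[OF continuous_on_add[OF c(1,2)] c(3)] N_add[OF c(1,2)] by simp
  qed
  also have "N (\<lambda>w. ?P' w * cnj (\<rho> w)) = 0"
  proof -
    have "N (\<lambda>w. ?P' w * cnj (\<rho> w)) = N (\<lambda>w. \<Sum>n\<in>I. (of_int n * a n) * (w powi n * cnj (\<rho> w)))"
      by (simp add: sum_distrib_right mult.assoc)
    also have "\<dots> = (\<Sum>n\<in>I. (of_int n * a n) * N (\<lambda>w. w powi n * cnj (\<rho> w)))"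
      by (subst N_sum[OF I(1)], (intro continuous_intros cp cU)+, intro sum.cong refl N_cmult continuous_intros cp cU)
    also have "\<dots> = 0"
    proof (intro sum.neutral ballI)
      fix n assume n: "n \<in> I"
      have "N (\<lambda>w. w powi n * cnj (\<rho> w)) = N (\<lambda>w. cnj (cnj (w powi n) * (w powi n * w * (w ^ nat (int L - n) * h w))))"
      proof (rule N_cong)
        fix w assume w: "w \<in> U"
        have "w powi int (Suc L) = w powi (n + 1 + int (nat (int L - n)))" using I(2)[OF n] by simp
        also have "\<dots> = w powi n * w * w ^ nat (int L - n)" using w by (simp add: power_int_add del: int_nat_eq)
        finally have *: "w ^ Suc L = w powi n * w * w ^ nat (int L - n)" by (simp only: power_int_of_nat)
        show "w powi n * cnj (\<rho> w) = cnj (cnj (w powi n) * (w powi n * w * (w ^ nat (int L - n) * h w)))"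
          unfolding \<rho>_def * by (simp only: complex_cnj_mult complex_cnj_cnj mult_ac)
      qed
      also have "\<dots> = cnj (N (\<lambda>w. cnj (w powi n) * (w powi n * w * (w ^ nat (int L - n) * h w))))"
        by (intro N_cnj continuous_intros cp cU)
      also have "N (\<lambda>w. cnj (w powi n) * (w powi n * w * (w ^ nat (int L - n) * h w))) = 0"
        by (intro N_holomorphic_0 holomorphic_intros h)
      finally show "of_int n * a n * N (\<lambda>w. w powi n * cnj (\<rho> w)) = 0" by simp
    qed
    finally show ?thesis .
  qed
  also have "N (\<lambda>w. w * deriv \<rho> w * cnj (?P w)) = 0"
  proof -
    have "N (\<lambda>w. w * deriv \<rho> w * cnj (?P w)) = N (\<lambda>w. \<Sum>n\<in>I. cnj (a n) * (w * deriv \<rho> w * cnj (w powi n)))"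
      by (simp add: sum_distrib_left mult_ac)
    also have "\<dots> = (\<Sum>n\<in>I. cnj (a n) * N (\<lambda>w. w * deriv \<rho> w * cnj (w powi n)))"
      by (subst N_sum[OF I(1)], (intro continuous_intros cp cU)+, intro sum.cong refl N_cmult continuous_intros cp cU)
    also have "\<dots> = 0"
    proof (intro sum.neutral ballI)
      fix n assume n: "n \<in> I"
      have "N (\<lambda>w. w * deriv \<rho> w * cnj (w powi n)) =
        N (\<lambda>w. cnj (w powi n) * (w powi n * w * (w ^ nat (int L - n) * (of_nat (Suc L) * h w + w * deriv h w))))"
      proof (rule N_cong)
        fix w assume w: "w \<in> U"
        have "w powi int (Suc L) = w powi (n + 1 + int (nat (int L - n)))" using I(2)[OF n] by simp
        also have "\<dots> = w powi n * w * w ^ nat (int L - n)" using w by (simp add: power_int_add del: int_nat_eq)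
        finally have *: "w ^ Suc L = w powi n * w * w ^ nat (int L - n)" by (simp only: power_int_of_nat)
        have "(h has_field_derivative deriv h w) (at w)" using holomorphic_derivI[OF h open_ball] w by simp
        moreover have "((\<lambda>w. w ^ Suc L) has_field_derivative of_nat (Suc L) * w ^ L) (at w)"
          using DERIV_power[OF DERIV_ident, where n = "Suc L"] by simp
        ultimately have "((\<lambda>w. w ^ Suc L * h w) has_field_derivative of_nat (Suc L) * w ^ L * h w + deriv h w * w ^ Suc L) (at w)"
          by (rule DERIV_mult[rotated])
        then
        have "deriv \<rho> w = of_nat (Suc L) * w ^ L * h w + deriv h w * w ^ Suc L"
          unfolding \<rho>_def by (intro DERIV_imp_deriv) simp
        then have "w * deriv \<rho> w = w ^ Suc L * (of_nat (Suc L) * h w + w * deriv h w)"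
          by (simp add: algebra_simps)
        then show "w * deriv \<rho> w * cnj (w powi n) =
          cnj (w powi n) * (w powi n * w * (w ^ nat (int L - n) * (of_nat (Suc L) * h w + w * deriv h w)))"
          unfolding * by (simp only: mult_ac)
      qed
      also have "\<dots> = 0"
        by (intro N_holomorphic_0 holomorphic_intros h h')
      finally show "cnj (a n) * N (\<lambda>w. w * deriv \<rho> w * cnj (w powi n)) = 0" by simp
    qed
    finally show ?thesis .
  qed
  also have "N (\<lambda>w. ?P' w * cnj (?P w)) = (\<Sum>n\<in>I. of_int n * (a n * cnj (a n)) * N (\<lambda>w. w powi n * cnj (w powi n)))"
  proof -
    have "N (\<lambda>w. ?P' w * cnj (?P w)) =
        N (\<lambda>w. \<Sum>n\<in>I. \<Sum>m\<in>I. (of_int n * a n * cnj (a m)) * (w powi n * cnj (w powi m)))"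
      by (rule N_cong, unfold cnj_sum sum_product, intro sum.cong refl) (simp only: complex_cnj_mult mult_ac)
    also have "\<dots> = (\<Sum>n\<in>I. \<Sum>m\<in>I. N (\<lambda>w. (of_int n * a n * cnj (a m)) * (w powi n * cnj (w powi m))))"
      by (subst N_sum[OF I(1)], (intro continuous_intros cp)+, intro sum.cong refl N_sum I(1) continuous_intros cp)
    also have "\<dots> = (\<Sum>n\<in>I. \<Sum>m\<in>I. (of_int n * a n * cnj (a m)) * N (\<lambda>w. w powi n * cnj (w powi m)))"
      by (intro sum.cong refl N_cmult continuous_intros cp)
    also have "\<dots> = (\<Sum>n\<in>I. \<Sum>m\<in>I. if m = n then of_int n * (a n * cnj (a n)) * N (\<lambda>w. w powi n * cnj (w powi n)) else 0)"
      using N_monomial_0 by (intro sum.cong refl) auto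
    also have "\<dots> = (\<Sum>n\<in>I. of_int n * (a n * cnj (a n)) * N (\<lambda>w. w powi n * cnj (w powi n)))"
      using I(1) by (intro sum.cong refl) simp
    finally show ?thesis .
  qed
  finally have E: "Re (N (\<lambda>w. w * ((\<Sum>n\<in>I. of_int n * a n * w powi (n - 1)) + deriv \<rho> w) * cnj (?P w + \<rho> w))) =
      (\<Sum>n\<in>I. Re (of_int n * (a n * cnj (a n)) * N (\<lambda>w. w powi n * cnj (w powi n)))) + Re (N (\<lambda>w. w * deriv \<rho> w * cnj (\<rho> w)))"
    by simp
  have F: "Re (of_int n * (a n * cnj (a n)) * N (\<lambda>w. w powi n * cnj (w powi n))) =
      of_int n * (norm (a n))\<^sup>2 * Re (N (\<lambda>w. w powi n * cnj (w powi n)))" for n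
  proof -
    have "of_int n * (a n * cnj (a n)) = complex_of_real (of_int n * (norm (a n))\<^sup>2)"
      unfolding of_real_mult complex_norm_square by simp
    then show ?thesis by (simp only: Re_complex_of_real times_complex.sel Im_complex_of_real)
  qed
  show ?thesis unfolding E F using N_deriv_cnj_nonneg[OF h\<rho>] by (simp only: le_add_same_cancel1)
qed

lemma area_inequality_cutoff:
  assumes f: "f holomorphic_on - \<Lambda>"
    and f1: "\<And>z. z \<notin> \<Lambda> \<Longrightarrow> f (z + \<omega>1) = f z + \<omega>1 * \<alpha>"
    and f2: "\<And>z. z \<notin> \<Lambda> \<Longrightarrow> f (z + \<omega>2) = f z + (\<omega>2 * \<alpha> - d 1)"
    and g: "g holomorphic_on ball 0 D"
    and fg: "\<And>w. w \<in> U \<Longrightarrow> f w = (\<Sum>k=1..K. d k / w ^ k) + g w"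
  shows "(\<Sum>l\<le>L. real l * (norm ((deriv ^^ l) g 0 / fact l))\<^sup>2 * r1 ^ (2 * l))
    \<le> (\<Sum>k=1..K. real k * (norm (d k))\<^sup>2 / r1 ^ (2 * k)) + 4 * pi * Im \<tau> * (norm \<alpha>)\<^sup>2 + 2 * Re (cnj \<alpha> * d 1)"
proof -
  obtain h where h: "h holomorphic_on ball 0 D"
    and gh: "\<And>w. w \<in> ball 0 D \<Longrightarrow> g w = (\<Sum>l\<le>L. (deriv ^^ l) g 0 / fact l * w ^ l) + w ^ Suc L * h w"
    using holomorphic_Taylor_remainder[OF g] by blast
  define b where "b l = (deriv ^^ l) g 0 / fact l" for l
  define a where "a n = (if n < 0 then d (nat (- n)) else b (nat n))" for n
  define \<rho> where "\<rho> w = w ^ Suc L * h w" for w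
  let ?I = "{- int K..int L}"
  have fU: "f w = (\<Sum>n\<in>?I. a n * w powi n) + \<rho> w" if "w \<in> U" for w
  proof -
    have "(\<Sum>n\<in>?I. a n * w powi n) = (\<Sum>k=1..K. a (- int k) * w powi (- int k)) + (\<Sum>l\<le>L. a (int l) * w powi int l)"
      by (rule sum_int_interval)
    also have "(\<Sum>k=1..K. a (- int k) * w powi (- int k)) = (\<Sum>k=1..K. d k / w ^ k)"
      by (intro sum.cong) (auto simp: a_def power_int_minus divide_inverse)
    also have "(\<Sum>l\<le>L. a (int l) * w powi int l) = (\<Sum>l\<le>L. b l * w ^ l)"
      by (simp add: a_def)
    finally show ?thesis using fg[OF that] gh[of w] that by (simp add: \<rho>_def b_def)
  qed
  have opU: "open U" by (intro open_Diff) auto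
  have h\<rho>: "\<rho> holomorphic_on ball 0 D" unfolding \<rho>_def by (intro holomorphic_intros h)
  have df: "deriv f w = (\<Sum>n\<in>?I. of_int n * a n * w powi (n - 1)) + deriv \<rho> w" if w: "w \<in> U" for w
  proof -
    have "((\<lambda>w. (\<Sum>n\<in>?I. a n * w powi n) + \<rho> w) has_field_derivative
        (\<Sum>n\<in>?I. a n * (of_int n * w powi (n - 1))) + deriv \<rho> w) (at w)"
      using w holomorphic_derivI[OF h\<rho> open_ball, of w]
      by (intro DERIV_add DERIV_sum DERIV_cmult) (auto intro!: derivative_eq_intros)
    then have "(f has_field_derivative (\<Sum>n\<in>?I. a n * (of_int n * w powi (n - 1))) + deriv \<rho> w) (at w)"
      by (rule has_field_derivative_transform_within_open[OF _ opU w]) (simp add: fU)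
    then show ?thesis by (simp add: DERIV_imp_deriv mult_ac)
  qed
  define q where "q = d 1 / of_real (4 * pi * Im \<tau>)"
  define \<mu> where "\<mu> = Re (N (\<lambda>w. 1))"
  have \<mu>: "\<mu> > 0" "c = 4 * pi * Im \<tau> * \<mu>"
    using N_1_pos N_1 Im_tau by (simp_all add: \<mu>_def)
  have "(\<Sum>n\<in>?I. of_int n * (norm (a n))\<^sup>2 * Re (N (\<lambda>w. w powi n * cnj (w powi n))))
      \<le> Re (N (\<lambda>w. w * ((\<Sum>n\<in>?I. of_int n * a n * w powi (n - 1)) + deriv \<rho> w) * cnj ((\<Sum>n\<in>?I. a n * w powi n) + \<rho> w)))"
    unfolding \<rho>_def by (rule N_Laurent_lower_bound[OF _ _ h]) auto
  also have "N (\<lambda>w. w * ((\<Sum>n\<in>?I. of_int n * a n * w powi (n - 1)) + deriv \<rho> w) * cnj ((\<Sum>n\<in>?I. a n * w powi n) + \<rho> w)) =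
      N (\<lambda>w. w * deriv f w * cnj (f w))"
    by (rule N_cong) (simp only: fU df)
  also have "Re \<dots> \<le> c * ((norm (\<alpha> + q))\<^sup>2 - (norm q)\<^sup>2)"
    unfolding q_def by (rule energy_identity(2)[OF f f1 f2])
  also have "(norm (\<alpha> + q))\<^sup>2 - (norm q)\<^sup>2 = (norm \<alpha>)\<^sup>2 + 2 * Re (cnj \<alpha> * q)"
    unfolding cmod_power2 by (simp add: power2_eq_square algebra_simps)
  also have "c * \<dots> = \<mu> * (4 * pi * Im \<tau> * (norm \<alpha>)\<^sup>2 + 2 * Re (cnj \<alpha> * d 1))"
  proof -
    have "d 1 = q * of_real (4 * pi * Im \<tau>)" using Im_tau by (simp add: q_def)
    then have "cnj \<alpha> * d 1 = (cnj \<alpha> * q) * of_real (4 * pi * Im \<tau>)" by simp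
    moreover have "Re (x * of_real y) = y * Re x" for x y by simp
    ultimately have "Re (cnj \<alpha> * d 1) = 4 * pi * Im \<tau> * Re (cnj \<alpha> * q)" by (simp only:)
    then show ?thesis unfolding \<mu>(2) by (simp add: algebra_simps)
  qed
  finally have le: "(\<Sum>n\<in>?I. of_int n * (norm (a n))\<^sup>2 * Re (N (\<lambda>w. w powi n * cnj (w powi n))))
      \<le> \<mu> * (4 * pi * Im \<tau> * (norm \<alpha>)\<^sup>2 + 2 * Re (cnj \<alpha> * d 1))" .
  have "(\<Sum>l\<le>L. real l * (norm (b l))\<^sup>2 * (r1 ^ (2 * l) * \<mu>)) - (\<Sum>k=1..K. real k * (norm (d k))\<^sup>2 * (\<mu> / r1 ^ (2 * k)))
     \<le> (\<Sum>l\<le>L. real l * (norm (b l))\<^sup>2 * Re (N (\<lambda>w. w powi int l * cnj (w powi int l))))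
      - (\<Sum>k=1..K. real k * (norm (d k))\<^sup>2 * Re (N (\<lambda>w. w powi (- int k) * cnj (w powi (- int k)))))"
    unfolding \<mu>_def using N_power_ge N_power_le
    by (intro diff_mono sum_mono mult_left_mono) auto
  also have "\<dots> = (\<Sum>n\<in>?I. of_int n * (norm (a n))\<^sup>2 * Re (N (\<lambda>w. w powi n * cnj (w powi n))))"
  proof -
    have "(\<Sum>k=1..K. of_int (- int k) * (norm (a (- int k)))\<^sup>2 * Re (N (\<lambda>w. w powi (- int k) * cnj (w powi (- int k)))))
       = - (\<Sum>k=1..K. real k * (norm (d k))\<^sup>2 * Re (N (\<lambda>w. w powi (- int k) * cnj (w powi (- int k)))))"
      unfolding sum_negf[symmetric] by (intro sum.cong refl) (simp add: a_def)
    then show ?thesis unfolding sum_int_interval by (simp add: a_def)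
  qed
  also note le
  finally have "(\<Sum>l\<le>L. real l * (norm (b l))\<^sup>2 * (r1 ^ (2 * l) * \<mu>))
     \<le> (\<Sum>k=1..K. real k * (norm (d k))\<^sup>2 * (\<mu> / r1 ^ (2 * k))) + \<mu> * (4 * pi * Im \<tau> * (norm \<alpha>)\<^sup>2 + 2 * Re (cnj \<alpha> * d 1))"
    by simp
  also have "(\<Sum>l\<le>L. real l * (norm (b l))\<^sup>2 * (r1 ^ (2 * l) * \<mu>)) = \<mu> * (\<Sum>l\<le>L. real l * (norm (b l))\<^sup>2 * r1 ^ (2 * l))"
    by (simp add: sum_distrib_left mult_ac)
  also have "(\<Sum>k=1..K. real k * (norm (d k))\<^sup>2 * (\<mu> / r1 ^ (2 * k))) = \<mu> * (\<Sum>k=1..K. real k * (norm (d k))\<^sup>2 / r1 ^ (2 * k))"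
    by (simp add: sum_distrib_left mult_ac)
  finally show ?thesis using \<mu>(1) unfolding b_def[symmetric] distrib_left[symmetric] by simp
qed

end

context torus begin

lemma area_inequality:
  assumes r: "0 < r" "r < D / 2" and f: "f holomorphic_on - \<Lambda>"
    and f1: "\<And>z. z \<notin> \<Lambda> \<Longrightarrow> f (z + \<omega>1) = f z + \<omega>1 * \<alpha>"
    and f2: "\<And>z. z \<notin> \<Lambda> \<Longrightarrow> f (z + \<omega>2) = f z + (\<omega>2 * \<alpha> - d 1)"
    and g: "g holomorphic_on ball 0 D"
    and fg: "\<And>w. w \<in> ball 0 D - {0} \<Longrightarrow> f w = (\<Sum>k=1..K. d k / w ^ k) + g w"
  shows "(\<Sum>l\<le>L. real l * (norm ((deriv ^^ l) g 0 / fact l))\<^sup>2 * r ^ (2 * l))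
    \<le> (\<Sum>k=1..K. real k * (norm (d k))\<^sup>2 / r ^ (2 * k)) + 4 * pi * Im \<tau> * (norm \<alpha>)\<^sup>2 + 2 * Re (cnj \<alpha> * d 1)"
proof -
  obtain R where R: "r < R" "R < D / 2" using dense[OF r(2)] by blast
  then have "r\<^sup>2 < R\<^sup>2" using r by (intro power_strict_mono) auto
  from radial_cutoff_exists[OF this] have "\<exists>c H H' \<Phi>. torus_cutoff \<tau> r R c H H' \<Phi>"
    by (elim ex_forward)
      (use r R tau in \<open>simp add: torus_cutoff_def torus_cutoff_axioms_def torus_def\<close>)
  then obtain c H H' \<Phi> where "torus_cutoff \<tau> r R c H H' \<Phi>" by blast
  from torus_cutoff.area_inequality_cutoff[OF this f f1 f2 g fg] show ?thesis by simp
qed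

end

section \<open>Infinite matrices\<close>

definition mat_vec :: "inf_mat \<Rightarrow> (nat \<Rightarrow> complex) \<Rightarrow> nat \<Rightarrow> complex" where
  "mat_vec X a k = (\<Sum>\<^sub>\<infinity>m\<in>{1..}. X k m * a m)"

definition norm2 :: "(nat \<Rightarrow> complex) \<Rightarrow> real" where
  "norm2 a = (\<Sum>\<^sub>\<infinity>m\<in>{1..}. (norm (a m))\<^sup>2)"

definition unit1 :: "nat \<Rightarrow> complex" where "unit1 k = (if k = 1 then 1 else 0)"

definition geom_vec :: "real \<Rightarrow> (nat \<Rightarrow> complex) \<Rightarrow> bool" where
  "geom_vec \<theta> a \<longleftrightarrow> (\<exists>K. \<forall>k\<ge>1. norm (a k) \<le> K * \<theta> ^ k)"

definition bounded_mat :: "inf_mat \<Rightarrow> bool" where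
  "bounded_mat X \<longleftrightarrow> (\<exists>K. \<forall>k\<ge>1. \<forall>m\<ge>1. norm (X k m) \<le> K)"

definition geom_mat :: "real \<Rightarrow> inf_mat \<Rightarrow> bool" where
  "geom_mat \<theta> X \<longleftrightarrow> (\<exists>K. \<forall>k\<ge>1. \<forall>m\<ge>1. norm (X k m) \<le> K * \<theta> ^ k)"

definition contraction_mat :: "inf_mat \<Rightarrow> bool" where
  "contraction_mat B \<longleftrightarrow> (\<forall>L N a. (\<Sum>k=1..L. (norm (\<Sum>m=1..N. B k m * a m))\<^sup>2) \<le> (\<Sum>m=1..N. (norm (a m))\<^sup>2))"

lemma infsum_LIMSEQ:
  fixes f :: "nat \<Rightarrow> 'a :: {topological_comm_monoid_add, t2_space}"
  assumes "f summable_on {1..}"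
  shows "(\<lambda>N. \<Sum>m=1..N. f m) \<longlonglongrightarrow> infsum f {1..}"
proof -
  have "(f has_sum infsum f {1..}) {1..}" using assms by simp
  then have "(sum f \<longlongrightarrow> infsum f {1..}) (finite_subsets_at_top {1..})" by (simp add: has_sum_def)
  moreover have "filterlim (\<lambda>N. {1..N}) (finite_subsets_at_top {1..}) sequentially"
    unfolding filterlim_finite_subsets_at_top
  proof (intro allI impI)
    fix X :: "nat set" assume X: "finite X \<and> X \<subseteq> {1..}"
    then obtain n where "X \<subseteq> {..n}" using finite_nat_iff_bounded_le by blast
    then show "\<forall>\<^sub>F N in sequentially. finite {1..N} \<and> X \<subseteq> {1..N} \<and> {1..N} \<subseteq> {1..}"
      using X unfolding eventually_sequentially
      by (intro exI[of _ n] allI impI conjI subsetI) (auto dest: subsetD)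
  qed
  ultimately show ?thesis by (rule filterlim_compose)
qed

lemma infsum_le_of_partial_sums:
  fixes f :: "nat \<Rightarrow> real"
  assumes "f summable_on {1..}" "\<And>N. (\<Sum>m=1..N. f m) \<le> C"
  shows "infsum f {1..} \<le> C"
  by (rule LIMSEQ_le_const2[OF infsum_LIMSEQ[OF assms(1)]]) (use assms(2) in auto)

lemma partial_sum_le_infsum:
  fixes f :: "nat \<Rightarrow> real"
  assumes "f summable_on {1..}" "\<And>m. f m \<ge> 0"
  shows "(\<Sum>m=1..N. f m) \<le> infsum f {1..}"
  using assms by (intro finite_sum_le_infsum) auto

lemma contraction_mat_entry:
  assumes "contraction_mat B" "k \<ge> 1" "m \<ge> 1"
  shows "norm (B k m) \<le> 1"
proof -
  have "(norm (B k m))\<^sup>2 = (norm (\<Sum>j=1..m. B k j * (if j = m then 1 else 0)))\<^sup>2"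
    using assms by (simp add: if_distrib cong: if_cong)
  also have "\<dots> \<le> (\<Sum>i=1..k. (norm (\<Sum>j=1..m. B i j * (if j = m then 1 else 0)))\<^sup>2)"
    using assms by (intro member_le_sum[of k]) auto
  also have "\<dots> \<le> (\<Sum>j=1..m. (norm (if j = m then 1 else 0 :: complex))\<^sup>2)"
    by (rule assms(1)[unfolded contraction_mat_def, rule_format])
  also have "\<dots> = (\<Sum>j=1..m. if j = m then 1 else 0)" by (intro sum.cong) auto
  also have "\<dots> = 1" using assms by simp
  finally show ?thesis by (simp add: power_le_one_iff)
qed

lemma contraction_imp_bounded: "contraction_mat B \<Longrightarrow> bounded_mat B"
  unfolding bounded_mat_def using contraction_mat_entry by blast

locale geometric =
  fixes \<theta> :: real
  assumes theta: "0 < \<theta>" "\<theta> < 1"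
begin

lemma geom_summable: "(\<lambda>m. K * \<theta> ^ m) summable_on {1..}"
proof -
  have "(\<lambda>m. \<theta> ^ m) summable_on UNIV"
    using theta by (intro norm_summable_imp_summable_on) (simp add: summable_geometric)
  then have "(\<lambda>m. \<theta> ^ m) summable_on {1..}" by (rule summable_on_subset_banach) simp
  then show ?thesis by (rule summable_on_cmult_right)
qed

lemma geom_abs_summable:
  fixes f :: "nat \<Rightarrow> complex"
  assumes "\<And>m. m \<ge> 1 \<Longrightarrow> norm (f m) \<le> K * \<theta> ^ m"
  shows "(\<lambda>m. norm (f m)) summable_on {1..}" "f summable_on {1..}"
proof -
  show "(\<lambda>m. norm (f m)) summable_on {1..}"
    by (rule summable_on_comparison_test[OF geom_summable[of K]]) (use assms in auto)
  then show "f summable_on {1..}" by (rule abs_summable_summable)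
qed

lemma norm_infsum_geom_le:
  fixes f :: "nat \<Rightarrow> complex"
  assumes "\<And>m. m \<ge> 1 \<Longrightarrow> norm (f m) \<le> K * \<theta> ^ m"
  shows "norm (infsum f {1..}) \<le> infsum (\<lambda>m. K * \<theta> ^ m) {1..}"
proof -
  have "norm (infsum f {1..}) \<le> infsum (\<lambda>m. norm (f m)) {1..}"
    by (rule norm_infsum_bound) (use geom_abs_summable(1)[OF assms] in simp)
  also have "\<dots> \<le> infsum (\<lambda>m. K * \<theta> ^ m) {1..}"
    by (rule infsum_mono[OF geom_abs_summable(1)[OF assms] geom_summable]) (use assms in auto)
  finally show ?thesis .
qed

lemma geom_square_summable:
  assumes "geom_vec \<theta> a" shows "(\<lambda>m. (norm (a m))\<^sup>2) summable_on {1..}"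
proof -
  obtain K where K: "\<And>k. k \<ge> 1 \<Longrightarrow> norm (a k) \<le> K * \<theta> ^ k" using assms by (auto simp: geom_vec_def)
  have "(norm (a m))\<^sup>2 \<le> K\<^sup>2 * \<theta> ^ m" if m: "m \<ge> 1" for m
  proof -
    have "(norm (a m))\<^sup>2 \<le> (K * \<theta> ^ m)\<^sup>2" by (intro power_mono K m) auto
    also have "\<dots> = K\<^sup>2 * (\<theta> ^ m * \<theta> ^ m)" by (simp add: power2_eq_square)
    also have "\<dots> \<le> K\<^sup>2 * (1 * \<theta> ^ m)" using theta by (intro mult_left_mono mult_right_mono power_le_one) auto
    finally show ?thesis by simp
  qed
  then show ?thesis by (intro summable_on_comparison_test[OF geom_summable[of "K\<^sup>2"]]) auto
qed

lemma norm2_nonneg: "norm2 a \<ge> 0" unfolding norm2_def by (rule infsum_nonneg) simp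

lemma norm_le_norm2: "geom_vec \<theta> a \<Longrightarrow> k \<ge> 1 \<Longrightarrow> norm (a k) \<le> sqrt (norm2 a)"
proof -
  assume a: "geom_vec \<theta> a" "k \<ge> 1"
  have "(norm (a k))\<^sup>2 \<le> (\<Sum>m=1..k. (norm (a m))\<^sup>2)" using a by (intro member_le_sum) auto
  also have "\<dots> \<le> norm2 a" unfolding norm2_def by (rule partial_sum_le_infsum[OF geom_square_summable[OF a(1)]]) simp
  finally show ?thesis by (rule real_le_rsqrt)
qed

lemma geom_vec_unit1: "geom_vec \<theta> unit1"
  unfolding geom_vec_def using theta by (intro exI[of _ "1 / \<theta>"]) (auto simp: unit1_def)

lemma norm2_unit1: "norm2 unit1 = 1"
proof -
  have "norm2 unit1 = (\<Sum>\<^sub>\<infinity>m\<in>{1}. (norm (unit1 m))\<^sup>2)"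
    unfolding norm2_def by (rule infsum_cong_neutral) (auto simp: unit1_def)
  then show ?thesis by (simp add: unit1_def)
qed

lemma geom_vec_add: "geom_vec \<theta> a \<Longrightarrow> geom_vec \<theta> b \<Longrightarrow> geom_vec \<theta> (\<lambda>k. a k + b k)"
proof -
  assume "geom_vec \<theta> a" "geom_vec \<theta> b"
  then obtain K L where "\<And>k. k \<ge> 1 \<Longrightarrow> norm (a k) \<le> K * \<theta> ^ k" "\<And>k. k \<ge> 1 \<Longrightarrow> norm (b k) \<le> L * \<theta> ^ k"
    by (auto simp: geom_vec_def)
  then show ?thesis unfolding geom_vec_def
    by (intro exI[of _ "K + L"]) (auto simp: distrib_right intro!: norm_triangle_le add_mono)
qed

lemma geom_vec_cmult: "geom_vec \<theta> a \<Longrightarrow> geom_vec \<theta> (\<lambda>k. c * a k)"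
proof -
  assume "geom_vec \<theta> a"
  then obtain K where "\<And>k. k \<ge> 1 \<Longrightarrow> norm (a k) \<le> K * \<theta> ^ k" by (auto simp: geom_vec_def)
  then show ?thesis unfolding geom_vec_def
    by (intro exI[of _ "norm c * K"]) (auto simp: norm_mult mult.assoc intro!: mult_left_mono)
qed

lemma geom_vec_diff: "geom_vec \<theta> a \<Longrightarrow> geom_vec \<theta> b \<Longrightarrow> geom_vec \<theta> (\<lambda>k. a k - b k)"
  using geom_vec_add[OF _ geom_vec_cmult[of b "-1"]] by simp

lemma geom_vec_cong: "geom_vec \<theta> a \<Longrightarrow> (\<And>k. k \<ge> 1 \<Longrightarrow> b k = a k) \<Longrightarrow> geom_vec \<theta> b"
  by (simp add: geom_vec_def)

lemma mat_vec_row_bound: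
  assumes "bounded_mat X" "geom_vec \<theta> a"
  obtains K where "\<And>k m. k \<ge> 1 \<Longrightarrow> m \<ge> 1 \<Longrightarrow> norm (X k m * a m) \<le> K * \<theta> ^ m"
proof -
  obtain K where K: "\<And>k. k \<ge> 1 \<Longrightarrow> norm (a k) \<le> K * \<theta> ^ k" using assms by (auto simp: geom_vec_def)
  obtain C where C: "\<And>k m. k \<ge> 1 \<Longrightarrow> m \<ge> 1 \<Longrightarrow> norm (X k m) \<le> C" using assms by (auto simp: bounded_mat_def)
  have "norm (X k m * a m) \<le> C * K * \<theta> ^ m" if "k \<ge> 1" "m \<ge> 1" for k m
    unfolding norm_mult mult.assoc using C[OF that] K[OF that(2)] by (intro mult_mono order_trans[OF norm_ge_zero C[OF that]]) auto
  then show ?thesis by (rule that)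
qed

lemma mat_vec_summable:
  assumes "bounded_mat X" "geom_vec \<theta> a" "k \<ge> 1"
  shows "(\<lambda>m. X k m * a m) summable_on {1..}"
proof -
  obtain K where K: "\<And>k m. k \<ge> 1 \<Longrightarrow> m \<ge> 1 \<Longrightarrow> norm (X k m * a m) \<le> K * \<theta> ^ m"
    using mat_vec_row_bound[OF assms(1,2)] by blast
  show ?thesis by (rule geom_abs_summable(2)[OF K[OF assms(3)]])
qed

lemma mat_vec_cong:
  "(\<And>k. k \<ge> 1 \<Longrightarrow> a k = b k) \<Longrightarrow> mat_vec X a k = mat_vec X b k"
  unfolding mat_vec_def by (rule infsum_cong) simp

lemma mat_vec_unit1: "mat_vec X unit1 k = X k 1"
proof -
  have "mat_vec X unit1 k = (\<Sum>\<^sub>\<infinity>m\<in>{1}. X k m * unit1 m)"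
    unfolding mat_vec_def by (rule infsum_cong_neutral) (auto simp: unit1_def)
  then show ?thesis by (simp add: unit1_def)
qed

lemma mat_vec_add:
  assumes "bounded_mat X" "geom_vec \<theta> a" "geom_vec \<theta> b" "k \<ge> 1"
  shows "mat_vec X (\<lambda>k. a k + b k) k = mat_vec X a k + mat_vec X b k"
  unfolding mat_vec_def distrib_left by (intro infsum_add mat_vec_summable assms)

lemma mat_vec_cmult:
  "mat_vec X (\<lambda>k. c * a k) k = c * mat_vec X a k"
  unfolding mat_vec_def by (subst infsum_cmult_right'[symmetric]) (simp add: mult.left_commute)

lemma mat_vec_diff:
  assumes "bounded_mat X" "geom_vec \<theta> a" "geom_vec \<theta> b" "k \<ge> 1"
  shows "mat_vec X (\<lambda>k. a k - b k) k = mat_vec X a k - mat_vec X b k"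
  using mat_vec_add[OF assms(1,2) geom_vec_cmult[OF assms(3), of "-1"] assms(4)] mat_vec_cmult[of X "-1" b k] by simp

lemma mat_vec_bounded:
  assumes "bounded_mat X" "geom_vec \<theta> a"
  shows "\<exists>C. \<forall>k\<ge>1. norm (mat_vec X a k) \<le> C"
proof -
  obtain K where K: "\<And>k m. k \<ge> 1 \<Longrightarrow> m \<ge> 1 \<Longrightarrow> norm (X k m * a m) \<le> K * \<theta> ^ m"
    using mat_vec_row_bound[OF assms] by blast
  show ?thesis unfolding mat_vec_def using norm_infsum_geom_le[of "\<lambda>m. X _ m * a m", OF K] by blast
qed

lemma geom_mat_mult_bound:
  assumes "bounded_mat Y" "geom_mat \<theta> X"
  obtains K where "\<And>k m l. k \<ge> 1 \<Longrightarrow> m \<ge> 1 \<Longrightarrow> l \<ge> 1 \<Longrightarrow> norm (Y k m * X m l) \<le> K * \<theta> ^ m"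
proof -
  obtain C where C: "\<And>k m. k \<ge> 1 \<Longrightarrow> m \<ge> 1 \<Longrightarrow> norm (Y k m) \<le> C" using assms by (auto simp: bounded_mat_def)
  obtain K where K: "\<And>k m. k \<ge> 1 \<Longrightarrow> m \<ge> 1 \<Longrightarrow> norm (X k m) \<le> K * \<theta> ^ k" using assms by (auto simp: geom_mat_def)
  have "norm (Y k m * X m l) \<le> C * K * \<theta> ^ m" if "k \<ge> 1" "m \<ge> 1" "l \<ge> 1" for k m l
    unfolding norm_mult mult.assoc using C[OF that(1,2)] K[OF that(2,3)]
    by (intro mult_mono order_trans[OF norm_ge_zero C[OF that(1,2)]]) auto
  then show ?thesis by (rule that)
qed

lemma geom_mat_imp_bounded: "geom_mat \<theta> X \<Longrightarrow> bounded_mat X"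
proof -
  assume "geom_mat \<theta> X"
  then obtain K where K: "\<And>k m. k \<ge> 1 \<Longrightarrow> m \<ge> 1 \<Longrightarrow> norm (X k m) \<le> K * \<theta> ^ k" by (auto simp: geom_mat_def)
  have "norm (X k m) \<le> K" if "k \<ge> 1" "m \<ge> 1" for k m
  proof -
    have "0 \<le> K * \<theta> ^ k" using K[OF that] norm_ge_zero order_trans by blast
    then have "K \<ge> 0" using theta mult_right_le_imp_le[of 0 "\<theta> ^ k" K] by simp
    then have "K * \<theta> ^ k \<le> K * 1" using theta by (intro mult_left_mono power_le_one) auto
    then show ?thesis using K[OF that] by simp
  qed
  then show ?thesis by (auto simp: bounded_mat_def)
qed

lemma bounded_mat_mult:
  assumes "bounded_mat Y" "geom_mat \<theta> X" shows "bounded_mat (Y \<star> X)"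
proof -
  obtain K where K: "\<And>k m l. k \<ge> 1 \<Longrightarrow> m \<ge> 1 \<Longrightarrow> l \<ge> 1 \<Longrightarrow> norm (Y k m * X m l) \<le> K * \<theta> ^ m"
    using geom_mat_mult_bound[OF assms] by blast
  have "norm ((Y \<star> X) k l) \<le> infsum (\<lambda>m. K * \<theta> ^ m) {1..}" if "k \<ge> 1" "l \<ge> 1" for k l
    unfolding inf_mat_mult_def using K that by (intro norm_infsum_geom_le) auto
  then show ?thesis unfolding bounded_mat_def by blast
qed

lemma geom_mat_mult:
  assumes "geom_mat \<theta> Y" "geom_mat \<theta> X" shows "geom_mat \<theta> (Y \<star> X)"
proof -
  obtain C where C: "\<And>k m. k \<ge> 1 \<Longrightarrow> m \<ge> 1 \<Longrightarrow> norm (Y k m) \<le> C * \<theta> ^ k" using assms(1) by (auto simp: geom_mat_def)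
  obtain K where K: "\<And>k m. k \<ge> 1 \<Longrightarrow> m \<ge> 1 \<Longrightarrow> norm (X k m) \<le> K * \<theta> ^ k" using assms(2) by (auto simp: geom_mat_def)
  have "norm ((Y \<star> X) k l) \<le> infsum (\<lambda>m. K * \<theta> ^ m) {1..} * C * \<theta> ^ k" if "k \<ge> 1" "l \<ge> 1" for k l
  proof -
    have "norm (Y k m * X m l) \<le> (C * \<theta> ^ k * K) * \<theta> ^ m" if "m \<ge> 1" for m
      unfolding norm_mult mult.assoc[of _ K] using C[of k m] K[of m l] that \<open>k \<ge> 1\<close> \<open>l \<ge> 1\<close>
      by (intro mult_mono order_trans[OF norm_ge_zero C[of k m]]) auto
    from norm_infsum_geom_le[of "\<lambda>m. Y k m * X m l", OF this]
    have "norm ((Y \<star> X) k l) \<le> infsum (\<lambda>m. (C * \<theta> ^ k * K) * \<theta> ^ m) {1..}" unfolding inf_mat_mult_def .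
    also have "\<dots> = C * \<theta> ^ k * infsum (\<lambda>m. K * \<theta> ^ m) {1..}"
      unfolding mult.assoc[of _ K] by (rule infsum_cmult_right')
    finally show ?thesis by (simp add: mult_ac)
  qed
  then show ?thesis unfolding geom_mat_def by blast
qed

lemma geom_product_summable:
  fixes f :: "nat \<times> nat \<Rightarrow> complex"
  assumes "\<And>m l. m \<ge> 1 \<Longrightarrow> l \<ge> 1 \<Longrightarrow> norm (f (m, l)) \<le> K * \<theta> ^ m * \<theta> ^ l"
  shows "f summable_on {1..} \<times> {1..}"
proof -
  have K: "0 \<le> K"
  proof -
    have "0 \<le> K * \<theta> ^ 1 * \<theta> ^ 1" using assms[of 1 1] norm_ge_zero order_trans by blast
    then show ?thesis using theta by (simp add: zero_le_mult_iff)
  qed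
  have "(\<lambda>(m, l). K * \<theta> ^ m * \<theta> ^ l) summable_on {1..} \<times> {1..}"
  proof (rule summable_on_SigmaI)
    show "((\<lambda>l. case (m, l) of (m, l) \<Rightarrow> K * \<theta> ^ m * \<theta> ^ l) has_sum (K * \<theta> ^ m * infsum (\<lambda>l. 1 * \<theta> ^ l) {1..})) {1..}" for m
      using has_sum_cmult_right[OF has_sum_infsum[OF geom_summable[of 1]], of "K * \<theta> ^ m"] by simp
    show "(\<lambda>m. K * \<theta> ^ m * infsum (\<lambda>l. 1 * \<theta> ^ l) {1..}) summable_on {1..}"
      by (intro summable_on_cmult_left geom_summable)
  qed (use K theta in auto)
  then have "(\<lambda>x. norm (f x)) summable_on {1..} \<times> {1..}"
    by (rule summable_on_comparison_test) (use assms in auto)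
  then show ?thesis by (rule abs_summable_summable)
qed

lemma mat_vec_mult:
  assumes "bounded_mat Y" "geom_mat \<theta> X" "geom_vec \<theta> a" "k \<ge> 1"
  shows "mat_vec (Y \<star> X) a k = mat_vec Y (mat_vec X a) k"
proof -
  obtain K where K: "\<And>k m l. k \<ge> 1 \<Longrightarrow> m \<ge> 1 \<Longrightarrow> l \<ge> 1 \<Longrightarrow> norm (Y k m * X m l) \<le> K * \<theta> ^ m"
    using geom_mat_mult_bound[OF assms(1,2)] by blast
  obtain L where L: "\<And>k. k \<ge> 1 \<Longrightarrow> norm (a k) \<le> L * \<theta> ^ k" using assms by (auto simp: geom_vec_def)
  have "norm (Y k m * X m l * a l) \<le> K * L * \<theta> ^ m * \<theta> ^ l" if "m \<ge> 1" "l \<ge> 1" for m l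
  proof -
    have "norm (Y k m * X m l * a l) \<le> (K * \<theta> ^ m) * (L * \<theta> ^ l)"
      unfolding norm_mult[of "_ * _"] using K[OF assms(4) that] L[OF that(2)]
      by (intro mult_mono order_trans[OF norm_ge_zero K[OF assms(4) that]]) auto
    then show ?thesis by (simp add: mult_ac)
  qed
  then have "(\<lambda>(m, l). Y k m * X m l * a l) summable_on {1..} \<times> {1..}"
    by (intro geom_product_summable) auto
  from infsum_swap_banach[OF this]
  have "(\<Sum>\<^sub>\<infinity>m\<in>{1..}. \<Sum>\<^sub>\<infinity>l\<in>{1..}. Y k m * X m l * a l) = (\<Sum>\<^sub>\<infinity>l\<in>{1..}. \<Sum>\<^sub>\<infinity>m\<in>{1..}. Y k m * X m l * a l)" .
  moreover have "(\<Sum>\<^sub>\<infinity>m\<in>{1..}. Y k m * X m l * a l) = (\<Sum>\<^sub>\<infinity>m\<in>{1..}. Y k m * X m l) * a l" for l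
    by (rule infsum_cmult_left')
  moreover have "(\<Sum>\<^sub>\<infinity>l\<in>{1..}. Y k m * X m l * a l) = Y k m * (\<Sum>\<^sub>\<infinity>l\<in>{1..}. X m l * a l)" for m
    unfolding mult.assoc by (rule infsum_cmult_right')
  ultimately show ?thesis unfolding mat_vec_def inf_mat_mult_def by simp
qed

lemma contraction_norm2:
  assumes B: "contraction_mat B" and a: "geom_vec \<theta> a"
  shows "(\<Sum>k=1..L. (norm (mat_vec B a k))\<^sup>2) \<le> norm2 a"
proof (rule LIMSEQ_le_const2)
  show "(\<lambda>N. \<Sum>k=1..L. (norm (\<Sum>m=1..N. B k m * a m))\<^sup>2) \<longlonglongrightarrow> (\<Sum>k=1..L. (norm (mat_vec B a k))\<^sup>2)"
    unfolding mat_vec_def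
    by (intro tendsto_sum tendsto_power tendsto_norm infsum_LIMSEQ mat_vec_summable contraction_imp_bounded B a) simp
  have "(\<Sum>k=1..L. (norm (\<Sum>m=1..N. B k m * a m))\<^sup>2) \<le> norm2 a" for N
    using B partial_sum_le_infsum[OF geom_square_summable[OF a], of N]
    unfolding contraction_mat_def norm2_def by (meson order_trans zero_le_power2)
  then show "\<exists>N. \<forall>n\<ge>N. (\<Sum>k=1..L. (norm (\<Sum>m=1..n. B k m * a m))\<^sup>2) \<le> norm2 a" by blast
qed

lemma symmetric_swap:
  assumes B: "bounded_mat B" "\<And>k m. B k m = B m k" and a: "geom_vec \<theta> a" "geom_vec \<theta> b"
  shows "(\<Sum>\<^sub>\<infinity>k\<in>{1..}. b k * mat_vec B a k) = (\<Sum>\<^sub>\<infinity>k\<in>{1..}. a k * mat_vec B b k)"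
proof -
  obtain K where K: "\<And>k m. k \<ge> 1 \<Longrightarrow> m \<ge> 1 \<Longrightarrow> norm (B k m * a m) \<le> K * \<theta> ^ m"
    using mat_vec_row_bound[OF B(1) a(1)] by blast
  obtain L where L: "\<And>k. k \<ge> 1 \<Longrightarrow> norm (b k) \<le> L * \<theta> ^ k" using a by (auto simp: geom_vec_def)
  have "norm (b k * (B k m * a m)) \<le> L * K * \<theta> ^ k * \<theta> ^ m" if "k \<ge> 1" "m \<ge> 1" for k m
  proof -
    have "norm (b k * (B k m * a m)) \<le> (L * \<theta> ^ k) * (K * \<theta> ^ m)"
      unfolding norm_mult[of "b k"] using K[OF that] L[OF that(1)]
      by (intro mult_mono order_trans[OF norm_ge_zero L[OF that(1)]]) auto
    then show ?thesis by (simp add: mult_ac)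
  qed
  then have "(\<lambda>(k, m). b k * (B k m * a m)) summable_on {1..} \<times> {1..}"
    by (intro geom_product_summable) auto
  from infsum_swap_banach[OF this]
  have "(\<Sum>\<^sub>\<infinity>k\<in>{1..}. \<Sum>\<^sub>\<infinity>m\<in>{1..}. b k * (B k m * a m)) = (\<Sum>\<^sub>\<infinity>m\<in>{1..}. \<Sum>\<^sub>\<infinity>k\<in>{1..}. b k * (B k m * a m))" .
  also have "(\<Sum>\<^sub>\<infinity>m\<in>{1..}. \<Sum>\<^sub>\<infinity>k\<in>{1..}. b k * (B k m * a m)) = (\<Sum>\<^sub>\<infinity>m\<in>{1..}. \<Sum>\<^sub>\<infinity>k\<in>{1..}. a m * (B m k * b k))"
    using B(2) by (intro infsum_cong) (simp add: mult_ac)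
  finally show ?thesis unfolding mat_vec_def by (simp add: infsum_cmult_right')
qed

end

definition row_scale :: "complex \<Rightarrow> inf_mat \<Rightarrow> inf_mat" where
  "row_scale t B k m = t ^ k * B k m"

context geometric begin

lemma mat_vec_row_scale: "mat_vec (row_scale t B) a k = t ^ k * mat_vec B a k"
  unfolding mat_vec_def row_scale_def mult.assoc by (rule infsum_cmult_right')

lemma norm_pow_le: "norm (t :: complex) \<le> \<theta> \<Longrightarrow> norm (t ^ k) \<le> \<theta> ^ k"
  unfolding norm_power by (intro power_mono) auto

lemma geom_mat_row_scale:
  assumes "norm t \<le> \<theta>" "bounded_mat B" shows "geom_mat \<theta> (row_scale t B)"
proof -
  obtain C where C: "\<And>k m. k \<ge> 1 \<Longrightarrow> m \<ge> 1 \<Longrightarrow> norm (B k m) \<le> C" using assms(2) by (auto simp: bounded_mat_def)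
  have "norm (row_scale t B k m) \<le> C * \<theta> ^ k" if "k \<ge> 1" "m \<ge> 1" for k m
    unfolding row_scale_def norm_mult mult.commute[of C]
    using C[OF that] norm_pow_le[OF assms(1)] theta by (intro mult_mono) auto
  then show ?thesis by (auto simp: geom_mat_def)
qed

lemma geom_vec_scale:
  assumes "norm t \<le> \<theta>" "\<And>k. k \<ge> 1 \<Longrightarrow> norm (b k) \<le> C" shows "geom_vec \<theta> (\<lambda>k. t ^ k * b k)"
proof -
  have "norm (t ^ k * b k) \<le> C * \<theta> ^ k" if "k \<ge> 1" for k
    unfolding norm_mult mult.commute[of C]
    using assms(2)[OF that] norm_pow_le[OF assms(1)] theta by (intro mult_mono) auto
  then show ?thesis by (auto simp: geom_vec_def)
qed

lemma geom_vec_row_scale: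
  assumes "norm t \<le> \<theta>" "bounded_mat B" "geom_vec \<theta> a"
  shows "geom_vec \<theta> (mat_vec (row_scale t B) a)"
proof -
  obtain C where "\<forall>k\<ge>1. norm (mat_vec B a k) \<le> C" using mat_vec_bounded[OF assms(2,3)] by blast
  then have "geom_vec \<theta> (\<lambda>k. t ^ k * mat_vec B a k)" by (intro geom_vec_scale assms) auto
  then show ?thesis by (rule geom_vec_cong) (simp add: mat_vec_row_scale)
qed

lemma norm2_scale_le:
  assumes t: "norm t \<le> \<theta>" and b: "\<And>k. k \<ge> 1 \<Longrightarrow> norm (b k) \<le> C" and le: "\<And>L. (\<Sum>k=1..L. (norm (b k))\<^sup>2) \<le> S"
  shows "norm2 (\<lambda>k. t ^ k * b k) \<le> \<theta>\<^sup>2 * S"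
  unfolding norm2_def
proof (rule infsum_le_of_partial_sums[OF geom_square_summable[OF geom_vec_scale[OF t b]]])
  fix L
  have "(norm (t ^ k * b k))\<^sup>2 \<le> \<theta>\<^sup>2 * (norm (b k))\<^sup>2" if "k \<ge> 1" for k
  proof -
    have "norm (t ^ k) \<le> \<theta> ^ k" by (rule norm_pow_le[OF t])
    also have "\<dots> \<le> \<theta> ^ 1" using theta that by (intro power_decreasing) auto
    finally have "(norm (t ^ k))\<^sup>2 \<le> \<theta>\<^sup>2" by (intro power_mono) auto
    then show ?thesis unfolding norm_mult power_mult_distrib by (rule mult_right_mono) simp
  qed
  then have "(\<Sum>k=1..L. (norm (t ^ k * b k))\<^sup>2) \<le> (\<Sum>k=1..L. \<theta>\<^sup>2 * (norm (b k))\<^sup>2)" by (intro sum_mono) auto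
  also have "\<dots> \<le> \<theta>\<^sup>2 * S" unfolding sum_distrib_left[symmetric] using le by (intro mult_left_mono) auto
  finally show "(\<Sum>k=1..L. (norm (t ^ k * b k))\<^sup>2) \<le> \<theta>\<^sup>2 * S" .
qed auto

lemma norm2_row_scale_le:
  assumes "norm t \<le> \<theta>" "contraction_mat B" "geom_vec \<theta> a"
  shows "norm2 (mat_vec (row_scale t B) a) \<le> \<theta>\<^sup>2 * norm2 a"
proof -
  obtain C where "\<And>k. k \<ge> 1 \<Longrightarrow> norm (mat_vec B a k) \<le> C"
    using mat_vec_bounded[OF contraction_imp_bounded[OF assms(2)] assms(3)] by blast
  from norm2_scale_le[OF assms(1) this contraction_norm2[OF assms(2,3)]]
  show ?thesis by (simp add: mat_vec_row_scale[abs_def])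
qed

lemma mat_vec_norm_le:
  assumes "\<And>m. m \<ge> 1 \<Longrightarrow> norm (X k m) \<le> C" "\<And>m. m \<ge> 1 \<Longrightarrow> norm (a m) \<le> L * \<theta> ^ m"
  shows "norm (mat_vec X a k) \<le> L * (\<Sum>\<^sub>\<infinity>m\<in>{1..}. C * \<theta> ^ m)"
proof -
  have "norm (X k m * a m) \<le> (L * C) * \<theta> ^ m" if "m \<ge> 1" for m
  proof -
    have "norm (X k m * a m) \<le> C * (L * \<theta> ^ m)"
      unfolding norm_mult using assms(1,2)[OF that] order_trans[OF norm_ge_zero assms(1)[OF that]] by (intro mult_mono) auto
    then show ?thesis by (simp add: mult_ac)
  qed
  from norm_infsum_geom_le[OF this] have "norm (mat_vec X a k) \<le> (\<Sum>\<^sub>\<infinity>m\<in>{1..}. (L * C) * \<theta> ^ m)"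
    unfolding mat_vec_def .
  also have "\<dots> = L * (\<Sum>\<^sub>\<infinity>m\<in>{1..}. C * \<theta> ^ m)" unfolding mult.assoc by (rule infsum_cmult_right')
  finally show ?thesis .
qed

lemma geom_vec_sum: "(\<And>n :: nat. geom_vec \<theta> (v n)) \<Longrightarrow> geom_vec \<theta> (\<lambda>k. \<Sum>n<N. v n k)"
proof (induction N)
  case 0
  show ?case unfolding geom_vec_def by (intro exI[of _ 0]) simp
next
  case (Suc N)
  then show ?case using geom_vec_add[of "\<lambda>k. \<Sum>n<N. v n k" "v N"] by simp
qed

lemma mat_vec_sum:
  assumes "bounded_mat X" "\<And>n :: nat. geom_vec \<theta> (v n)" "k \<ge> 1"
  shows "mat_vec X (\<lambda>k. \<Sum>n<N. v n k) k = (\<Sum>n<N. mat_vec X (v n) k)"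
proof (induction N)
  case 0
  show ?case by (simp add: mat_vec_def)
next
  case (Suc N)
  then show ?case using mat_vec_add[OF assms(1) geom_vec_sum[OF assms(2)] assms(2,3)] by simp
qed

lemma mat_vec_sums:
  assumes X: "bounded_mat X" and v: "\<And>n k. k \<ge> 1 \<Longrightarrow> norm (v n k) \<le> C * \<rho> ^ n * \<theta> ^ k" and \<rho>: "0 \<le> \<rho>" "\<rho> < 1" and k: "k \<ge> 1"
  shows "(\<lambda>n. mat_vec X (v n) k) sums mat_vec X (\<lambda>k. \<Sum>n. v n k) k" "geom_vec \<theta> (\<lambda>k. \<Sum>n. v n k)"
    "(\<lambda>n. v n k) sums (\<Sum>n. v n k)"
proof -
  have vg: "geom_vec \<theta> (v n)" for n using v by (auto simp: geom_vec_def)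
  have sg: "summable (\<lambda>n. C * \<rho> ^ n * \<theta> ^ k)" for k
    using \<rho> by (intro summable_mult summable_mult2 summable_geometric) auto
  have sv1: "summable (\<lambda>n. norm (v n k))" if "k \<ge> 1" for k
    by (rule summable_comparison_test[OF _ sg[of k]]) (use v[OF that] in simp)
  have sv2: "summable (\<lambda>n. v n k)" if "k \<ge> 1" for k using sv1[OF that] by (rule summable_norm_cancel)
  show "(\<lambda>n. v n k) sums (\<Sum>n. v n k)" using sv2[OF k] by (rule summable_sums)
  have tail: "norm ((\<Sum>n. v n k) - (\<Sum>n<N. v n k)) \<le> (C * \<rho> ^ N / (1 - \<rho>)) * \<theta> ^ k" if k: "k \<ge> 1" for N k
  proof -
    have s': "summable (\<lambda>n. norm (v (n + N) k))" using sv1[OF k] by (rule summable_iff_shift[THEN iffD2])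
    have "(\<Sum>n. v n k) - (\<Sum>n<N. v n k) = (\<Sum>n. v (n + N) k)"
      using suminf_minus_initial_segment[OF sv2[OF k], of N] by simp
    then have "norm ((\<Sum>n. v n k) - (\<Sum>n<N. v n k)) \<le> (\<Sum>n. norm (v (n + N) k))"
      using summable_norm[OF s'] by simp
    also have "\<dots> \<le> (\<Sum>n. (C * \<rho> ^ N * \<theta> ^ k) * \<rho> ^ n)"
    proof (rule suminf_le[OF _ s'])
      show "norm (v (n + N) k) \<le> (C * \<rho> ^ N * \<theta> ^ k) * \<rho> ^ n" for n
        using v[OF k, of "n + N"] by (simp add: power_add mult_ac)
      show "summable (\<lambda>n. (C * \<rho> ^ N * \<theta> ^ k) * \<rho> ^ n)"
        using \<rho> by (intro summable_mult summable_geometric) auto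
    qed
    also have "\<dots> = (C * \<rho> ^ N * \<theta> ^ k) * (1 / (1 - \<rho>))"
      using \<rho> by (subst suminf_mult) (auto simp: summable_geometric suminf_geometric)
    finally show ?thesis by simp
  qed
  show g: "geom_vec \<theta> (\<lambda>k. \<Sum>n. v n k)"
    unfolding geom_vec_def using tail[of _ 0] by (intro exI[of _ "C * \<rho> ^ 0 / (1 - \<rho>)"]) simp
  obtain C' where C': "\<And>k m. k \<ge> 1 \<Longrightarrow> m \<ge> 1 \<Longrightarrow> norm (X k m) \<le> C'" using X by (auto simp: bounded_mat_def)
  define G where "G = (\<Sum>\<^sub>\<infinity>m\<in>{1..}. C' * \<theta> ^ m)"
  have b: "norm (mat_vec X (\<lambda>k. \<Sum>n. v n k) k - (\<Sum>n<N. mat_vec X (v n) k)) \<le> (C * \<rho> ^ N / (1 - \<rho>)) * G" for N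
  proof -
    have "mat_vec X (\<lambda>k. \<Sum>n. v n k) k - (\<Sum>n<N. mat_vec X (v n) k) = mat_vec X (\<lambda>k. (\<Sum>n. v n k) - (\<Sum>n<N. v n k)) k"
      using mat_vec_diff[OF X g geom_vec_sum[OF vg] k] mat_vec_sum[OF X vg k] by simp
    then show ?thesis unfolding G_def using mat_vec_norm_le[of X k C', OF C'[OF k] tail] by simp
  qed
  have "(\<lambda>N. (C * \<rho> ^ N / (1 - \<rho>)) * G) \<longlonglongrightarrow> (C * 0 / (1 - \<rho>)) * G"
    using \<rho> by (intro tendsto_intros LIMSEQ_power_zero) auto
  then have l: "(\<lambda>N. (C * \<rho> ^ N / (1 - \<rho>)) * G) \<longlonglongrightarrow> 0" by simp
  have "(\<lambda>N. mat_vec X (\<lambda>k. \<Sum>n. v n k) k - (\<Sum>n<N. mat_vec X (v n) k)) \<longlonglongrightarrow> 0"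
    by (rule Lim_null_comparison[OF always_eventually[OF allI[OF b]] l])
  from tendsto_diff[OF tendsto_const[of "mat_vec X (\<lambda>k. \<Sum>n. v n k) k"] this]
  show "(\<lambda>n. mat_vec X (v n) k) sums mat_vec X (\<lambda>k. \<Sum>n. v n k) k" by (simp add: sums_def)
qed

end

locale sewing_system = geometric +
  fixes t :: complex and B1 B2 :: inf_mat
  assumes t: "norm t \<le> \<theta>" and contr: "contraction_mat B1" "contraction_mat B2"
    and symm: "\<And>k m. B1 k m = B1 m k" "\<And>k m. B2 k m = B2 m k"
begin

abbreviation "P \<equiv> row_scale t B1"
abbreviation "Q \<equiv> row_scale t B2"
abbreviation "PQ \<equiv> \<lambda>a. mat_vec P (mat_vec Q a)"

lemma bounded: "bounded_mat B1" "bounded_mat B2" "bounded_mat P" "bounded_mat Q"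
  using contraction_imp_bounded[OF contr(1)] contraction_imp_bounded[OF contr(2)] geom_mat_row_scale[OF t] geom_mat_imp_bounded
  by blast+

lemma geom: "geom_mat \<theta> P" "geom_mat \<theta> Q"
  using geom_mat_row_scale[OF t] bounded by blast+

lemma geom_vec_P: "geom_vec \<theta> a \<Longrightarrow> geom_vec \<theta> (mat_vec P a)"
  and geom_vec_Q: "geom_vec \<theta> a \<Longrightarrow> geom_vec \<theta> (mat_vec Q a)"
  by (rule geom_vec_row_scale[OF t bounded(1)], assumption) (rule geom_vec_row_scale[OF t bounded(2)], assumption)

lemma geom_vec_PQ_power: "geom_vec \<theta> a \<Longrightarrow> geom_vec \<theta> ((PQ ^^ n) a)"
  by (induction n) (auto intro: geom_vec_P geom_vec_Q)

lemma norm2_PQ_le: "geom_vec \<theta> a \<Longrightarrow> norm2 (PQ a) \<le> \<theta>\<^sup>2 * (\<theta>\<^sup>2 * norm2 a)"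
  using norm2_row_scale_le[OF t contr(1) geom_vec_Q] norm2_row_scale_le[OF t contr(2)]
  by (meson mult_left_mono order_trans zero_le_power2)

lemma bounded_inf_mat_power: "bounded_mat (inf_mat_power (P \<star> Q) n)"
proof (induction n)
  case 0
  show ?case unfolding bounded_mat_def by (auto simp: inf_mat_one_def intro!: exI[of _ 1])
next
  case (Suc n)
  then show ?case using bounded_mat_mult[OF _ geom_mat_mult[OF geom]] by simp
qed

lemma inf_mat_power_PQ:
  "geom_vec \<theta> a \<Longrightarrow> k \<ge> 1 \<Longrightarrow> mat_vec (inf_mat_power (P \<star> Q) n) a k = (PQ ^^ n) a k"
proof (induction n arbitrary: a)
  case 0
  have "mat_vec inf_mat_one a k = (\<Sum>\<^sub>\<infinity>m\<in>{k}. inf_mat_one k m * a m)"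
    unfolding mat_vec_def by (rule infsum_cong_neutral) (use 0 in \<open>auto simp: inf_mat_one_def\<close>)
  moreover have "inf_mat_one k k = 1" by (simp add: inf_mat_one_def)
  ultimately show ?case by simp
next
  case (Suc n)
  have "mat_vec (inf_mat_power (P \<star> Q) (Suc n)) a k = mat_vec (inf_mat_power (P \<star> Q) n) (mat_vec (P \<star> Q) a) k"
    using mat_vec_mult[OF bounded_inf_mat_power geom_mat_mult[OF geom] Suc(2,3)] by simp
  also have "\<dots> = mat_vec (inf_mat_power (P \<star> Q) n) (PQ a) k"
    by (rule mat_vec_cong) (rule mat_vec_mult[OF bounded(3) geom(2) Suc(2)])
  also have "\<dots> = (PQ ^^ n) (PQ a) k" by (rule Suc(1)[OF geom_vec_P[OF geom_vec_Q[OF Suc(2)]] Suc(3)])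
  finally show ?case by (simp only: funpow_Suc_right o_apply)
qed

definition sol :: "nat \<Rightarrow> complex" where "sol k = inv_one_minus (P \<star> Q) k 1"

lemma norm_PQ_power_unit1:
  assumes "k \<ge> 1" shows "norm ((PQ ^^ n) unit1 k) \<le> 1 / \<theta> * (\<theta>\<^sup>2) ^ n * \<theta> ^ k"
proof -
  have n2: "norm2 ((PQ ^^ n) unit1) \<le> ((\<theta>\<^sup>2) ^ n)\<^sup>2" for n
  proof (induction n)
    case (Suc n)
    have "norm2 ((PQ ^^ Suc n) unit1) \<le> \<theta>\<^sup>2 * (\<theta>\<^sup>2 * norm2 ((PQ ^^ n) unit1))"
      using norm2_PQ_le[OF geom_vec_PQ_power[OF geom_vec_unit1]] by simp
    also have "\<dots> \<le> \<theta>\<^sup>2 * (\<theta>\<^sup>2 * ((\<theta>\<^sup>2) ^ n)\<^sup>2)" using Suc by (intro mult_left_mono) auto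
    also have "\<dots> = ((\<theta>\<^sup>2) ^ Suc n)\<^sup>2" by (simp add: power2_eq_square)
    finally show ?case .
  qed (simp add: norm2_unit1)
  show ?thesis
  proof (cases n)
    case 0
    then show ?thesis using theta assms by (simp add: unit1_def)
  next
    case (Suc n')
    let ?v = "(PQ ^^ n') unit1"
    have v: "geom_vec \<theta> ?v" by (rule geom_vec_PQ_power[OF geom_vec_unit1])
    have "(norm (mat_vec B1 (mat_vec Q ?v) k))\<^sup>2 \<le> (\<Sum>i=1..k. (norm (mat_vec B1 (mat_vec Q ?v) i))\<^sup>2)"
      using assms by (intro member_le_sum) auto
    also have "\<dots> \<le> norm2 (mat_vec Q ?v)" by (rule contraction_norm2[OF contr(1) geom_vec_Q[OF v]])
    also have "\<dots> \<le> \<theta>\<^sup>2 * norm2 ?v" by (rule norm2_row_scale_le[OF t contr(2) v])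
    also have "\<dots> \<le> \<theta>\<^sup>2 * ((\<theta>\<^sup>2) ^ n')\<^sup>2" using n2[of n'] by (intro mult_left_mono) auto
    also have "\<dots> = (\<theta> * (\<theta>\<^sup>2) ^ n')\<^sup>2" by (simp add: power_mult_distrib)
    finally have "norm (mat_vec B1 (mat_vec Q ?v) k) \<le> \<theta> * (\<theta>\<^sup>2) ^ n'"
      by (rule power2_le_imp_le) (use theta in simp)
    then have "norm (t ^ k * mat_vec B1 (mat_vec Q ?v) k) \<le> \<theta> ^ k * (\<theta> * (\<theta>\<^sup>2) ^ n')"
      unfolding norm_mult using norm_pow_le[OF t] theta by (intro mult_mono) auto
    then show ?thesis using theta Suc by (simp add: mat_vec_row_scale power2_eq_square mult_ac)
  qed
qed

lemma sol_eq: "k \<ge> 1 \<Longrightarrow> sol k = (\<Sum>n. (PQ ^^ n) unit1 k)"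
  unfolding sol_def inv_one_minus_def
  by (simp add: inf_mat_power_PQ[OF geom_vec_unit1, symmetric] mat_vec_unit1)

lemma theta2: "0 \<le> \<theta>\<^sup>2" "\<theta>\<^sup>2 < 1"
  using theta by (simp_all add: power_less_one_iff)

lemma geom_vec_sol: "geom_vec \<theta> sol"
  by (rule geom_vec_cong[OF mat_vec_sums(2)[OF bounded(1) norm_PQ_power_unit1 theta2 order.refl]]) (assumption | rule sol_eq)+

lemma sol_fixpoint:
  assumes k: "k \<ge> 1" shows "sol k = unit1 k + PQ sol k"
proof -
  let ?v = "\<lambda>n. (PQ ^^ n) unit1"
  have g: "geom_vec \<theta> (?v n)" for n by (rule geom_vec_PQ_power[OF geom_vec_unit1])
  have 1: "(\<lambda>n. mat_vec (P \<star> Q) (?v n) k) sums mat_vec (P \<star> Q) (\<lambda>k. \<Sum>n. ?v n k) k"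
    by (rule mat_vec_sums(1)[OF geom_mat_imp_bounded[OF geom_mat_mult[OF geom]] norm_PQ_power_unit1 theta2 k])
  have 2: "mat_vec (P \<star> Q) (?v n) k = ?v (Suc n) k" for n
    using mat_vec_mult[OF bounded(3) geom(2) g k] by simp
  have 3: "mat_vec (P \<star> Q) (\<lambda>k. \<Sum>n. ?v n k) k = PQ sol k"
  proof -
    have "mat_vec (P \<star> Q) (\<lambda>k. \<Sum>n. ?v n k) k = mat_vec (P \<star> Q) sol k"
      by (rule mat_vec_cong) (rule sol_eq[symmetric])
    then show ?thesis using mat_vec_mult[OF bounded(3) geom(2) geom_vec_sol k] by simp
  qed
  have "(\<lambda>n. ?v (Suc n) k) sums PQ sol k" using 1 unfolding 2 3 .
  from \<open>(\<lambda>n. ?v (Suc n) k) sums PQ sol k\<close>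
  have "(\<lambda>n. ?v n k) sums (PQ sol k + ?v 0 k)" by (rule sums_Suc)
  with sol_eq[OF k] show ?thesis by (simp add: sums_iff)
qed

lemma fixpoint_unique:
  assumes a: "geom_vec \<theta> a" and fp: "\<And>k. k \<ge> 1 \<Longrightarrow> a k = PQ a k" and k: "k \<ge> 1"
  shows "a k = 0"
proof -
  have "norm2 a = norm2 (PQ a)" unfolding norm2_def by (rule infsum_cong) (simp add: fp)
  then have "norm2 a \<le> (\<theta>\<^sup>2 * \<theta>\<^sup>2) * norm2 a" using norm2_PQ_le[OF a] by (simp add: mult.assoc)
  moreover have "\<theta>\<^sup>2 * \<theta>\<^sup>2 < 1 * 1" using theta2 by (intro mult_strict_mono') auto
  moreover from calculation have "(1 - \<theta>\<^sup>2 * \<theta>\<^sup>2) * norm2 a \<le> 0" by (simp add: algebra_simps)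
  ultimately have "norm2 a = 0" using norm2_nonneg[of a] by (simp add: mult_le_0_iff)
  then show ?thesis using norm_le_norm2[OF a k] by simp
qed

lemma affine_fixpoint:
  assumes a: "geom_vec \<theta> a" and fp: "\<And>k. k \<ge> 1 \<Longrightarrow> a k = c * unit1 k + PQ a k" and k: "k \<ge> 1"
  shows "a k = c * sol k"
proof -
  let ?d = "\<lambda>k. a k - c * sol k"
  have g: "geom_vec \<theta> ?d" by (intro geom_vec_diff geom_vec_cmult a geom_vec_sol)
  have "?d k = PQ ?d k" if k: "k \<ge> 1" for k
  proof -
    have "PQ ?d k = mat_vec P (\<lambda>k. mat_vec Q a k - c * mat_vec Q sol k) k"
      by (rule mat_vec_cong)
        (simp add: mat_vec_diff[OF bounded(4) a geom_vec_cmult[OF geom_vec_sol]] mat_vec_cmult)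
    also have "\<dots> = PQ a k - c * PQ sol k"
      by (simp add: mat_vec_diff[OF bounded(3) geom_vec_Q[OF a] geom_vec_cmult[OF geom_vec_Q[OF geom_vec_sol]] k] mat_vec_cmult)
    finally show ?thesis using fp[OF k] sol_fixpoint[OF k] by (simp add: algebra_simps)
  qed
  from fixpoint_unique[OF g this k] show ?thesis by simp
qed

end

lemma (in sewing_system) swapped: "sewing_system \<theta> t B2 B1"
  by unfold_locales (use t contr symm in auto)

lemma (in sewing_system) sol_swap: "sewing_system.sol t B2 B1 1 = sol 1"
proof -
  interpret S: sewing_system \<theta> t B2 B1 by (rule swapped)
  show ?thesis
  proof (cases "t = 0")
    case True
    have "mat_vec (row_scale t B) a 1 = 0" for B a unfolding mat_vec_row_scale True by simp
    then show ?thesis using sol_fixpoint[of 1] S.sol_fixpoint[of 1] by simp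
  next
    case False
    let ?x = sol and ?y = S.sol and ?u = "mat_vec Q sol" and ?w = "mat_vec P S.sol"
    have g: "geom_vec \<theta> ?u" "geom_vec \<theta> ?w" "geom_vec \<theta> ?x" "geom_vec \<theta> ?y"
      by (intro geom_vec_Q geom_vec_P geom_vec_sol S.geom_vec_sol)+
    define b where "b k = unit1 k / t + mat_vec B1 ?u k" for k
    define b' where "b' k = unit1 k / t + mat_vec B2 ?w k" for k
    have te: "t ^ k * (unit1 k / t) = unit1 k" for k using False by (simp add: unit1_def)
    have x: "?x k = t ^ k * b k" if "k \<ge> 1" for k
      using sol_fixpoint[OF that] by (simp only: b_def mat_vec_row_scale distrib_left te)
    have y: "?y k = t ^ k * b' k" if "k \<ge> 1" for k
      using S.sol_fixpoint[OF that] by (simp only: b'_def mat_vec_row_scale distrib_left te)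
    have summ: "(\<lambda>k. a k * c k) summable_on {1..}" if ac: "geom_vec \<theta> a" "\<exists>C. \<forall>k\<ge>1. norm (c k) \<le> C" for a c
    proof -
      obtain K C where K: "\<And>k. k \<ge> 1 \<Longrightarrow> norm (a k) \<le> K * \<theta> ^ k" and C: "\<And>k. k \<ge> 1 \<Longrightarrow> norm (c k) \<le> C"
        using ac unfolding geom_vec_def by blast
      have "norm (a k * c k) \<le> K * C * \<theta> ^ k" if "k \<ge> 1" for k
      proof -
        have "norm (a k * c k) \<le> (K * \<theta> ^ k) * C" unfolding norm_mult
          using K[OF that] C[OF that] order_trans[OF norm_ge_zero K[OF that]] by (intro mult_mono) auto
        then show ?thesis by (simp add: mult_ac)
      qed
      then show ?thesis by (rule geom_abs_summable(2))
    qed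
    have unit_sum: "(\<Sum>\<^sub>\<infinity>k\<in>{1..}. a k * (unit1 k / t)) = a 1 / t" for a
    proof -
      have "(\<Sum>\<^sub>\<infinity>k\<in>{1..}. a k * (unit1 k / t)) = (\<Sum>\<^sub>\<infinity>k\<in>{1}. a k * (unit1 k / t))"
        by (rule infsum_cong_neutral) (auto simp: unit1_def)
      then show ?thesis by (simp add: unit1_def)
    qed
    have bd: "\<exists>C. \<forall>k\<ge>1. norm (unit1 k / t) \<le> C"
      by (intro exI[of _ "1 / norm t"]) (auto simp: unit1_def norm_divide)
    have 1: "(\<Sum>\<^sub>\<infinity>k\<in>{1..}. ?y k * b k) = ?y 1 / t + (\<Sum>\<^sub>\<infinity>k\<in>{1..}. ?y k * mat_vec B1 ?u k)"
      unfolding b_def distrib_left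
      by (subst infsum_add[OF summ[OF g(4) bd] summ[OF g(4) mat_vec_bounded[OF bounded(1) g(1)]]]) (simp only: unit_sum)
    have 2: "(\<Sum>\<^sub>\<infinity>k\<in>{1..}. ?x k * b' k) = ?x 1 / t + (\<Sum>\<^sub>\<infinity>k\<in>{1..}. ?x k * mat_vec B2 ?w k)"
      unfolding b'_def distrib_left
      by (subst infsum_add[OF summ[OF g(3) bd] summ[OF g(3) mat_vec_bounded[OF bounded(2) g(2)]]]) (simp only: unit_sum)
    have 3: "(\<Sum>\<^sub>\<infinity>k\<in>{1..}. ?y k * b k) = (\<Sum>\<^sub>\<infinity>k\<in>{1..}. ?x k * b' k)"
      by (rule infsum_cong) (simp add: x y)
    have "(\<Sum>\<^sub>\<infinity>k\<in>{1..}. ?y k * mat_vec B1 ?u k) = (\<Sum>\<^sub>\<infinity>k\<in>{1..}. ?u k * mat_vec B1 ?y k)"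
      by (rule symmetric_swap[OF bounded(1) symm(1) g(1,4)])
    also have "\<dots> = (\<Sum>\<^sub>\<infinity>k\<in>{1..}. ?w k * mat_vec B2 ?x k)"
      by (rule infsum_cong) (simp add: mat_vec_row_scale)
    also have "\<dots> = (\<Sum>\<^sub>\<infinity>k\<in>{1..}. ?x k * mat_vec B2 ?w k)"
      by (rule symmetric_swap[OF bounded(2) symm(2) g(3,2)])
    finally have "?y 1 / t = ?x 1 / t" using 1 2 3 by simp
    then show ?thesis using False by simp
  qed
qed

section \<open>Positivity of the period matrix\<close>

definition moment_mat :: "complex \<Rightarrow> inf_mat" where
  "moment_mat \<tau> k l = (-1) ^ (k + 1) * (fact (k + l - 1) / (fact (k - 1) * fact (l - 1))) * eisenstein_E (k + l) \<tau>"

definition scaled_mat :: "real \<Rightarrow> complex \<Rightarrow> inf_mat" where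
  "scaled_mat r \<tau> k l = of_real (r ^ (k + l) / sqrt (real k * real l)) * moment_mat \<tau> k l"

lemma moment_mat_commute: "moment_mat \<tau> k l = moment_mat \<tau> l k"
proof (cases "even (k + l)")
  case True
  then have "(-1 :: complex) ^ (k + 1) = (-1) ^ (l + 1)" by (auto simp: minus_one_power_iff)
  then show ?thesis by (simp add: moment_mat_def add.commute mult.commute)
qed (simp add: moment_mat_def eisenstein_E_def add.commute)

lemma scaled_mat_commute: "scaled_mat r \<tau> k l = scaled_mat r \<tau> l k"
  by (simp add: scaled_mat_def moment_mat_commute[of \<tau> k l] add.commute mult.commute)

context torus begin

text \<open>The principal part of \<open>P_pole k\<close> at the lattice points is \<open>1 / z\<^sup>k\<close>.\<close>

definition P_pole :: "nat \<Rightarrow> complex \<Rightarrow> complex" where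
  "P_pole k z = (-1) ^ (k - 1) / fact (k - 1) * (deriv ^^ (k - 1)) P1 z"

definition P_reg :: "nat \<Rightarrow> complex \<Rightarrow> complex" where
  "P_reg k z = (-1) ^ (k - 1) / fact (k - 1) * (deriv ^^ (k - 1)) P1_reg z"

lemma open_compl_lattice: "open (- \<Lambda>)"
  using closed_lattice by (simp add: open_Compl)

lemma P_pole_1: "P_pole 1 = P1" by (simp add: P_pole_def fun_eq_iff)

lemma P_pole_holomorphic: "P_pole k holomorphic_on - \<Lambda>"
  unfolding P_pole_def by (intro holomorphic_intros holomorphic_higher_deriv P1_holomorphic open_compl_lattice)

lemma P_reg_holomorphic: "P_reg k holomorphic_on ball 0 D"
  unfolding P_reg_def by (intro holomorphic_intros holomorphic_higher_deriv P1_reg_holomorphic open_ball)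

lemma P_pole_deriv:
  assumes "k \<ge> 1" "z \<notin> \<Lambda>" shows "(P_pole k has_field_derivative - of_nat k * P_pole (Suc k) z) (at z)"
proof -
  have "((deriv ^^ (k - 1)) P1 has_field_derivative (deriv ^^ k) P1 z) (at z)"
    using holomorphic_derivI[OF holomorphic_higher_deriv[OF P1_holomorphic open_compl_lattice, of "k - 1"] open_compl_lattice, of z] assms
    by (simp flip: funpow.simps(2) o_apply[of deriv] add: Suc_diff_le)
  from DERIV_cmult[OF this, of "(-1) ^ (k - 1) / fact (k - 1)"]
  have "(P_pole k has_field_derivative (-1) ^ (k - 1) / fact (k - 1) * (deriv ^^ k) P1 z) (at z)"
    unfolding P_pole_def by simp
  moreover have "(-1) ^ (k - 1) / fact (k - 1) * (deriv ^^ k) P1 z = - of_nat k * P_pole (Suc k) z"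
    using assms(1) by (cases k) (simp_all add: P_pole_def del: of_nat_Suc)
  ultimately show ?thesis by simp
qed

lemma higher_deriv_P1_periodic:
  "z \<notin> \<Lambda> \<Longrightarrow> (deriv ^^ Suc n) P1 (z + \<omega>1) = (deriv ^^ Suc n) P1 z \<and> (deriv ^^ Suc n) P1 (z + \<omega>2) = (deriv ^^ Suc n) P1 z"
proof (induction n arbitrary: z)
  case 0
  then show ?case
    using deriv_periodic[OF P1_holomorphic torus_lattice_2pi_i, of 0 z] P1_add_omega1
      deriv_periodic[OF P1_holomorphic torus_lattice_2pi_i_tau, of "- 1" z] P1_add_omega2 by simp
next
  case (Suc n)
  note hol = holomorphic_higher_deriv[OF P1_holomorphic open_compl_lattice, of "Suc n"]
  show ?case
    using deriv_periodic[OF hol torus_lattice_2pi_i, of 0 z] deriv_periodic[OF hol torus_lattice_2pi_i_tau, of 0 z]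
      Suc.IH Suc.prems by simp
qed

lemma P_pole_periodic:
  assumes "z \<notin> \<Lambda>" "k \<ge> 1"
  shows "P_pole k (z + \<omega>1) = P_pole k z" "P_pole k (z + \<omega>2) = P_pole k z - (if k = 1 then 1 else 0)"
proof -
  consider "k = 1" | n where "k = Suc (Suc n)" using assms(2) by (metis One_nat_def Suc_le_D not0_implies_Suc)
  then have "P_pole k (z + \<omega>1) = P_pole k z \<and> P_pole k (z + \<omega>2) = P_pole k z - (if k = 1 then 1 else 0)"
  proof cases
    case 1
    then show ?thesis using P1_add_omega1 P1_add_omega2[OF assms(1)] by (simp only: P_pole_1) simp
  next
    case 2
    then show ?thesis using higher_deriv_P1_periodic[OF assms(1), of n] by (simp add: P_pole_def del: funpow.simps)
  qed
  then show "P_pole k (z + \<omega>1) = P_pole k z" "P_pole k (z + \<omega>2) = P_pole k z - (if k = 1 then 1 else 0)" by auto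
qed

lemma higher_deriv_P1_eq:
  assumes "z \<in> ball 0 D - {0}"
  shows "(deriv ^^ n) P1 z = (-1) ^ n * fact n / z ^ Suc n + (deriv ^^ n) P1_reg z"
  using assms
proof (induction n arbitrary: z)
  case 0
  then show ?case by (simp add: P1_eq)
next
  case (Suc n)
  have op: "open (ball 0 D - {0 :: complex})" by (intro open_Diff) auto
  have z: "z \<noteq> 0" using Suc by auto
  have "((deriv ^^ n) P1_reg has_field_derivative (deriv ^^ Suc n) P1_reg z) (at z)"
    using holomorphic_derivI[OF holomorphic_higher_deriv[OF P1_reg_holomorphic open_ball, of n] open_ball, of z] Suc by simp
  moreover have "((\<lambda>z. (-1) ^ n * fact n / z ^ Suc n) has_field_derivative (-1) ^ Suc n * fact (Suc n) / z ^ Suc (Suc n)) (at z)"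
  proof -
    have "((\<lambda>z. z powi (- int (Suc n))) has_field_derivative of_int (- int (Suc n)) * z powi (- int (Suc n) - 1)) (at z)"
      using z by (auto intro!: derivative_eq_intros)
    moreover have "z powi (- int (Suc n) - 1) = 1 / z ^ Suc (Suc n)"
    proof -
      have "- int (Suc n) - 1 = - int (Suc (Suc n))" by simp
      then show ?thesis by (simp only: power_int_minus power_int_of_nat divide_inverse mult_1)
    qed
    moreover have "(\<lambda>z :: complex. z powi (- int (Suc n))) = (\<lambda>z. 1 / z ^ Suc n)"
      by (simp only: power_int_minus power_int_of_nat divide_inverse mult_1)
    ultimately have "((\<lambda>z. 1 / z ^ Suc n) has_field_derivative - of_nat (Suc n) * (1 / z ^ Suc (Suc n))) (at z)"
      by simp
    from DERIV_cmult[OF this, of "(-1) ^ n * fact n"]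
    have "((\<lambda>z. (-1) ^ n * fact n * (1 / z ^ Suc n)) has_field_derivative
        (-1) ^ n * fact n * (- of_nat (Suc n) * (1 / z ^ Suc (Suc n)))) (at z)" .
    moreover have "(-1) ^ n * fact n * (- of_nat (Suc n) * (1 / z ^ Suc (Suc n))) = (-1) ^ Suc n * fact (Suc n) / z ^ Suc (Suc n)"
      by (simp del: of_nat_Suc)
    ultimately show ?thesis by simp
  qed
  ultimately have "((\<lambda>z. (-1) ^ n * fact n / z ^ Suc n + (deriv ^^ n) P1_reg z) has_field_derivative
      (-1) ^ Suc n * fact (Suc n) / z ^ Suc (Suc n) + (deriv ^^ Suc n) P1_reg z) (at z)"
    by (rule DERIV_add[rotated])
  then have "((deriv ^^ n) P1 has_field_derivative
      (-1) ^ Suc n * fact (Suc n) / z ^ Suc (Suc n) + (deriv ^^ Suc n) P1_reg z) (at z)"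
    by (rule has_field_derivative_transform_within_open[OF _ op Suc(2)]) (simp add: Suc(1))
  from DERIV_imp_deriv[OF this] show ?case by simp
qed

lemma P_pole_eq:
  assumes "z \<in> ball 0 D - {0}" "k \<ge> 1" shows "P_pole k z = 1 / z ^ k + P_reg k z"
proof -
  have "(-1) ^ (k - 1) * ((-1) ^ (k - 1) :: complex) = 1" by (simp flip: power_mult_distrib)
  then have "(-1) ^ (k - 1) / fact (k - 1) * ((-1) ^ (k - 1) * fact (k - 1) / z ^ k) = 1 / z ^ k"
    by (simp add: field_simps)
  then show ?thesis using higher_deriv_P1_eq[OF assms(1), of "k - 1"] assms(2)
    by (simp add: P_pole_def P_reg_def distrib_left)
qed

lemma P_reg_coeff:
  assumes "k \<ge> 1" "l \<ge> 1" shows "(deriv ^^ l) (P_reg k) 0 / fact l = - moment_mat \<tau> k l / of_nat l"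
proof -
  have "(deriv ^^ l) (P_reg k) 0 = (-1) ^ (k - 1) / fact (k - 1) * (deriv ^^ l) ((deriv ^^ (k - 1)) P1_reg) 0"
    unfolding P_reg_def
    by (rule higher_deriv_cmult[OF holomorphic_higher_deriv[OF P1_reg_holomorphic open_ball] _ open_ball]) (use D_pos in auto)
  also have "(deriv ^^ l) ((deriv ^^ (k - 1)) P1_reg) 0 = (deriv ^^ (k + l - 1)) P1_reg 0"
    using assms(1) by (simp add: funpow_add[symmetric, THEN fun_cong, unfolded o_apply] add.commute)
  also have "\<dots> = - eisenstein_E (k + l) \<tau> * fact (k + l - 1)"
    using P1_reg_deriv[of "k + l - 1"] assms by (simp add: field_simps)
  finally have eq: "(deriv ^^ l) (P_reg k) 0 / fact l =
     - ((-1) ^ (k - 1) / fact (k - 1) * (eisenstein_E (k + l) \<tau> * fact (k + l - 1)) / fact l)"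
    by simp
  have pm: "(-1 :: complex) ^ (k - 1) = (-1) ^ (k + 1)" using assms(1) by (cases k) auto
  have fl: "(fact l :: complex) = of_nat l * fact (l - 1)" using assms(2) by (simp add: fact_reduce)
  show ?thesis unfolding eq unfolding pm fl moment_mat_def by (simp add: field_simps)
qed

lemma area_inequality_finite:
  fixes a :: "nat \<Rightarrow> complex"
  assumes r: "0 < r" "r < D / 2" and K: "K \<ge> 1"
  shows "(\<Sum>l=1..L. (norm ((if l = 1 then \<alpha> * of_real r else 0) - (\<Sum>k=1..K. scaled_mat r \<tau> l k * a k)))\<^sup>2)
    \<le> (\<Sum>k=1..K. (norm (a k))\<^sup>2) + 4 * pi * Im \<tau> * (norm \<alpha>)\<^sup>2 + 2 * r * Re (cnj \<alpha> * a 1)"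
proof -
  define d where "d k = a k * of_real (r ^ k / sqrt (real k))" for k
  define f where "f z = \<alpha> * z + (\<Sum>k=1..K. d k * P_pole k z)" for z
  define g where "g z = \<alpha> * z + (\<Sum>k=1..K. d k * P_reg k z)" for z
  have f_hol: "f holomorphic_on - \<Lambda>" unfolding f_def by (intro holomorphic_intros P_pole_holomorphic)
  have g_hol: "g holomorphic_on ball 0 D" unfolding g_def by (intro holomorphic_intros P_reg_holomorphic)
  have f1: "f (z + \<omega>1) = f z + \<omega>1 * \<alpha>" if "z \<notin> \<Lambda>" for z
    using P_pole_periodic(1)[OF that] unfolding f_def by (simp add: algebra_simps)
  have f2: "f (z + \<omega>2) = f z + (\<omega>2 * \<alpha> - d 1)" if "z \<notin> \<Lambda>" for z
  proof -
    have "(\<Sum>k=1..K. d k * P_pole k (z + \<omega>2)) = (\<Sum>k=1..K. d k * P_pole k z - (if k = 1 then d k else 0))"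
    proof (intro sum.cong refl)
      fix k assume "k \<in> {1..K}"
      then have "k \<ge> 1" by simp
      show "d k * P_pole k (z + \<omega>2) = d k * P_pole k z - (if k = 1 then d k else 0)"
        unfolding P_pole_periodic(2)[OF that \<open>k \<ge> 1\<close>] by (simp add: right_diff_distrib)
    qed
    also have "\<dots> = (\<Sum>k=1..K. d k * P_pole k z) - d 1" using K by (simp add: sum_subtractf)
    finally show ?thesis unfolding f_def by (simp add: algebra_simps)
  qed
  have fg: "f z = (\<Sum>k=1..K. d k / z ^ k) + g z" if "z \<in> ball 0 D - {0}" for z
    using P_pole_eq[OF that] unfolding f_def g_def by (simp add: distrib_left sum.distrib)
  have coeff: "(deriv ^^ l) g 0 / fact l = (if l = 1 then \<alpha> else 0) - (\<Sum>k=1..K. d k * moment_mat \<tau> k l) / of_nat l"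
    if l: "l \<ge> 1" for l
  proof -
    have "(deriv ^^ l) (\<lambda>z. \<Sum>k=1..K. d k * P_reg k z) 0 = (\<Sum>k=1..K. d k * (deriv ^^ l) (P_reg k) 0)"
    proof -
      have "(deriv ^^ l) (\<lambda>z. \<Sum>k=1..K. d k * P_reg k z) 0 = (\<Sum>k=1..K. (deriv ^^ l) (\<lambda>z. d k * P_reg k z) 0)" for K
      proof (induction K)
        case 0 show ?case using l by simp
      next
        case (Suc K)
        have "(deriv ^^ l) (\<lambda>z. (\<Sum>k=1..K. d k * P_reg k z) + d (Suc K) * P_reg (Suc K) z) 0 =
           (deriv ^^ l) (\<lambda>z. \<Sum>k=1..K. d k * P_reg k z) 0 + (deriv ^^ l) (\<lambda>z. d (Suc K) * P_reg (Suc K) z) 0"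
          by (rule higher_deriv_add[of _ "ball 0 D"]) (use D_pos in \<open>auto intro!: holomorphic_intros P_reg_holomorphic\<close>)
        with Suc show ?case by simp
      qed
      also have "(\<Sum>k=1..K. (deriv ^^ l) (\<lambda>z. d k * P_reg k z) 0) = (\<Sum>k=1..K. d k * (deriv ^^ l) (P_reg k) 0)"
        by (intro sum.cong refl higher_deriv_cmult[of _ "ball 0 D"]) (use D_pos in \<open>auto intro!: P_reg_holomorphic\<close>)
      finally show ?thesis .
    qed
    moreover have "(deriv ^^ l) g 0 = (deriv ^^ l) (\<lambda>z. \<alpha> * z) 0 + (deriv ^^ l) (\<lambda>z. \<Sum>k=1..K. d k * P_reg k z) 0"
      unfolding g_def by (rule higher_deriv_add[of _ "ball 0 D"]) (use D_pos in \<open>auto intro!: holomorphic_intros P_reg_holomorphic\<close>)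
    moreover have "(deriv ^^ l) (\<lambda>z. \<alpha> * z) 0 = (if l = 1 then \<alpha> else 0)"
      using l by (simp add: higher_deriv_linear)
    ultimately have "(deriv ^^ l) g 0 / fact l = (if l = 1 then \<alpha> else 0) / fact l + (\<Sum>k=1..K. d k * ((deriv ^^ l) (P_reg k) 0 / fact l))"
      by (simp add: add_divide_distrib sum_divide_distrib)
    also have "(\<Sum>k=1..K. d k * ((deriv ^^ l) (P_reg k) 0 / fact l)) = (\<Sum>k=1..K. d k * (- moment_mat \<tau> k l / of_nat l))"
      using P_reg_coeff[OF _ l] by (intro sum.cong refl) simp
    finally show ?thesis by (simp add: sum_divide_distrib sum_negf)
  qed
  have norm_eq: "real l * (norm ((deriv ^^ l) g 0 / fact l))\<^sup>2 * r ^ (2 * l) =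
      (norm ((if l = 1 then \<alpha> * of_real r else 0) - (\<Sum>k=1..K. scaled_mat r \<tau> l k * a k)))\<^sup>2" if l: "l \<ge> 1" for l
  proof -
    have "of_real (sqrt (real l) * r ^ l) * ((deriv ^^ l) g 0 / fact l) =
       (if l = 1 then \<alpha> * of_real r else 0) - (\<Sum>k=1..K. of_real (sqrt (real l) * r ^ l / real l) * (d k * moment_mat \<tau> k l))"
      unfolding coeff[OF l] by (simp add: right_diff_distrib sum_distrib_left sum_divide_distrib)
    also have "(\<Sum>k=1..K. of_real (sqrt (real l) * r ^ l / real l) * (d k * moment_mat \<tau> k l)) = (\<Sum>k=1..K. scaled_mat r \<tau> l k * a k)"
    proof (intro sum.cong refl)
      fix k assume "k \<in> {1..K}"
      have "sqrt (real l) / real l = 1 / sqrt (real l)" using real_div_sqrt[of "real l"] l by (simp add: field_simps)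
      moreover have "sqrt (real l) * r ^ l / real l * (r ^ k / sqrt (real k)) = sqrt (real l) / real l * (r ^ l * r ^ k / sqrt (real k))"
        by simp
      ultimately have "sqrt (real l) * r ^ l / real l * (r ^ k / sqrt (real k)) = r ^ (l + k) / sqrt (real l * real k)"
        by (simp add: power_add real_sqrt_mult)
      moreover have "complex_of_real x * (a k * of_real y * m) = of_real (x * y) * m * a k" for x y m
        by simp
      ultimately show "of_real (sqrt (real l) * r ^ l / real l) * (d k * moment_mat \<tau> k l) = scaled_mat r \<tau> l k * a k"
        unfolding d_def scaled_mat_def moment_mat_commute[of \<tau> l k] by (simp only:)
    qed
    finally have "(norm (of_real (sqrt (real l) * r ^ l) * ((deriv ^^ l) g 0 / fact l)))\<^sup>2 =
      (norm ((if l = 1 then \<alpha> * of_real r else 0) - (\<Sum>k=1..K. scaled_mat r \<tau> l k * a k)))\<^sup>2" by simp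
    moreover have "(norm (of_real (sqrt (real l) * r ^ l) * ((deriv ^^ l) g 0 / fact l)))\<^sup>2 =
        real l * (norm ((deriv ^^ l) g 0 / fact l))\<^sup>2 * r ^ (2 * l)"
      unfolding norm_mult norm_of_real power_mult_distrib
      by (simp add: power_mult_distrib power_mult mult.commute)
    ultimately show ?thesis by simp
  qed
  have "(\<Sum>l=1..L. (norm ((if l = 1 then \<alpha> * of_real r else 0) - (\<Sum>k=1..K. scaled_mat r \<tau> l k * a k)))\<^sup>2) =
      (\<Sum>l=1..L. real l * (norm ((deriv ^^ l) g 0 / fact l))\<^sup>2 * r ^ (2 * l))"
    by (intro sum.cong refl norm_eq[symmetric]) auto
  also have "\<dots> \<le> (\<Sum>l\<le>L. real l * (norm ((deriv ^^ l) g 0 / fact l))\<^sup>2 * r ^ (2 * l))"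
    using r by (intro sum_mono2) auto
  also have "\<dots> \<le> (\<Sum>k=1..K. real k * (norm (d k))\<^sup>2 / r ^ (2 * k)) + 4 * pi * Im \<tau> * (norm \<alpha>)\<^sup>2 + 2 * Re (cnj \<alpha> * d 1)"
    by (rule area_inequality[OF r f_hol f1 f2 g_hol fg])
  also have "(\<Sum>k=1..K. real k * (norm (d k))\<^sup>2 / r ^ (2 * k)) = (\<Sum>k=1..K. (norm (a k))\<^sup>2)"
  proof (intro sum.cong refl)
    fix k assume "k \<in> {1..K}"
    then show "real k * (norm (d k))\<^sup>2 / r ^ (2 * k) = (norm (a k))\<^sup>2"
      using r by (simp add: d_def norm_mult norm_divide norm_power power_mult_distrib power_divide power_mult[symmetric] mult.commute)
  qed
  also have "2 * Re (cnj \<alpha> * d 1) = 2 * r * Re (cnj \<alpha> * a 1)"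
    by (simp add: d_def algebra_simps)
  finally show ?thesis .
qed

lemma contraction_scaled_mat:
  assumes "0 < r" "r < D / 2" shows "contraction_mat (scaled_mat r \<tau>)"
  unfolding contraction_mat_def
proof (intro allI)
  fix L K :: nat and a :: "nat \<Rightarrow> complex"
  show "(\<Sum>k=1..L. (norm (\<Sum>m=1..K. scaled_mat r \<tau> k m * a m))\<^sup>2) \<le> (\<Sum>m=1..K. (norm (a m))\<^sup>2)"
    using area_inequality_finite[OF assms, where K = K and L = L and \<alpha> = 0 and a = a] by (cases "K = 0") (simp_all cong: if_cong)
qed

lemma area_inequality_infinite:
  assumes r: "0 < r" "r < D / 2" and th: "0 < \<theta>" "\<theta> < 1" and a: "geom_vec \<theta> a"
  shows "(\<Sum>l=1..L. (norm ((if l = 1 then \<alpha> * of_real r else 0) - mat_vec (scaled_mat r \<tau>) a l))\<^sup>2)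
    \<le> norm2 a + 4 * pi * Im \<tau> * (norm \<alpha>)\<^sup>2 + 2 * r * Re (cnj \<alpha> * a 1)"
proof -
  interpret geometric \<theta> using th by unfold_locales
  let ?B = "scaled_mat r \<tau>"
  have 1: "(\<lambda>K. \<Sum>l=1..L. (norm ((if l = 1 then \<alpha> * of_real r else 0) - (\<Sum>k=1..K. ?B l k * a k)))\<^sup>2)
      \<longlonglongrightarrow> (\<Sum>l=1..L. (norm ((if l = 1 then \<alpha> * of_real r else 0) - mat_vec ?B a l))\<^sup>2)"
    unfolding mat_vec_def
    by (intro tendsto_intros infsum_LIMSEQ mat_vec_summable contraction_imp_bounded contraction_scaled_mat r a) simp
  have 2: "(\<lambda>K. (\<Sum>k=1..K. (norm (a k))\<^sup>2) + 4 * pi * Im \<tau> * (norm \<alpha>)\<^sup>2 + 2 * r * Re (cnj \<alpha> * a 1))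
      \<longlonglongrightarrow> norm2 a + 4 * pi * Im \<tau> * (norm \<alpha>)\<^sup>2 + 2 * r * Re (cnj \<alpha> * a 1)"
    unfolding norm2_def by (intro tendsto_add tendsto_const infsum_LIMSEQ geom_square_summable a)
  show ?thesis
    by (rule LIMSEQ_le[OF 1 2]) (use area_inequality_finite[OF r] in blast)
qed

end

lemma (in sewing_system) inf_mat_power_summable:
  assumes "k \<ge> 1" shows "summable (\<lambda>n. inf_mat_power (P \<star> Q) n k 1)"
proof -
  have "summable (\<lambda>n. (PQ ^^ n) unit1 k)"
    using mat_vec_sums(3)[OF bounded(1) norm_PQ_power_unit1 theta2 assms] by (rule sums_summable)
  then show ?thesis
    using inf_mat_power_PQ[OF geom_vec_unit1 assms] by (simp add: mat_vec_unit1)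
qed

definition gauge_mat :: "complex \<Rightarrow> inf_mat \<Rightarrow> inf_mat" where
  "gauge_mat g X k l = g ^ l / g ^ k * X k l"

lemma gauge_mat_mult: "g \<noteq> 0 \<Longrightarrow> gauge_mat g X \<star> gauge_mat g Y = gauge_mat g (X \<star> Y)"
  unfolding inf_mat_mult_def gauge_mat_def fun_eq_iff
  by (subst infsum_cmult_right'[symmetric]) (simp add: mult_ac)

lemma inf_mat_power_gauge: "g \<noteq> 0 \<Longrightarrow> inf_mat_power (gauge_mat g X) n = gauge_mat g (inf_mat_power X n)"
proof (induction n)
  case 0
  then show ?case by (auto simp: gauge_mat_def inf_mat_one_def fun_eq_iff)
qed (simp add: gauge_mat_mult)

lemma inv_one_minus_gauge:
  assumes "g \<noteq> 0" "summable (\<lambda>n. inf_mat_power X n k l)"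
  shows "inv_one_minus (gauge_mat g X) k l = g ^ l / g ^ k * inv_one_minus X k l"
  unfolding inv_one_minus_def inf_mat_power_gauge[OF assms(1)] gauge_mat_def
  by (rule suminf_mult[OF assms(2)])

lemma A_mat_eq:
  assumes "s ^ 2 = \<epsilon>" "r > 0"
  shows "A_mat \<epsilon> \<tau> k l = (s / of_real r) ^ (k + l) * scaled_mat r \<tau> k l"
proof (cases "even (k + l)")
  case True
  then have "\<epsilon> ^ ((k + l) div 2) = s ^ (k + l)"
    unfolding assms(1)[symmetric] power_mult[symmetric] by simp
  then show ?thesis using assms(2)
    by (simp add: A_mat_def scaled_mat_def moment_mat_def power_divide)
qed (simp add: A_mat_def scaled_mat_def moment_mat_def eisenstein_E_def)

locale sewn_tori = T1: torus \<tau>1 + T2: torus \<tau>2 for \<tau>1 \<tau>2 :: complex +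
  fixes \<epsilon> :: complex and r1 r2 :: real
  assumes r: "0 < r1" "r1 < lattice_min \<tau>1 / 2" "0 < r2" "r2 < lattice_min \<tau>2 / 2" and eps: "norm \<epsilon> < r1 * r2"
begin

definition t :: complex where "t = \<epsilon> / of_real (r1 * r2)"

definition \<theta> :: real where "\<theta> = max (norm t) (1 / 2)"

abbreviation "B1 \<equiv> scaled_mat r1 \<tau>1"
abbreviation "B2 \<equiv> scaled_mat r2 \<tau>2"

lemma norm_t: "norm t < 1"
  using r eps by (simp add: t_def norm_divide norm_mult)

lemma eps_eq: "\<epsilon> = t * of_real r1 * of_real r2"
  using r by (simp add: t_def)

sublocale S: sewing_system \<theta> t B1 B2
  by unfold_locales
    (use norm_t T1.contraction_scaled_mat T2.contraction_scaled_mat r scaled_mat_commute in \<open>auto simp: \<theta>_def\<close>)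

lemma A_mat_entries:
  "inv_one_minus (A_mat \<epsilon> \<tau>1 \<star> A_mat \<epsilon> \<tau>2) 1 1 = S.sol 1"
  "\<epsilon> * (A_mat \<epsilon> \<tau>2 \<star> inv_one_minus (A_mat \<epsilon> \<tau>1 \<star> A_mat \<epsilon> \<tau>2)) 1 1 = (of_real r1 * t)\<^sup>2 * mat_vec B2 S.sol 1"
proof -
  let ?X = "A_mat \<epsilon> \<tau>1 \<star> A_mat \<epsilon> \<tau>2"
  have "inv_one_minus ?X 1 1 = S.sol 1 \<and> \<epsilon> * (A_mat \<epsilon> \<tau>2 \<star> inv_one_minus ?X) 1 1 = (of_real r1 * t)\<^sup>2 * mat_vec B2 S.sol 1"
  proof (cases "\<epsilon> = 0")
    case True
    then have t0: "t = 0" unfolding t_def by simp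
    have A0: "A_mat \<epsilon> \<tau> k l = 0" if "k \<ge> 1" "l \<ge> 1" for \<tau> k l
      using that True by (auto simp: A_mat_def div_eq_0_iff)
    have X0: "?X k l = 0" if "k \<ge> 1" for k l
      unfolding inf_mat_mult_def by (rule infsum_0) (use A0 that in auto)
    have "inf_mat_power ?X (Suc n) 1 1 = 0" for n
      unfolding inf_mat_power.simps inf_mat_mult_def[of "inf_mat_power ?X n"]
      by (rule infsum_0) (use X0 in auto)
    then have "inf_mat_power ?X n 1 1 = (if n = 0 then 1 else 0)" for n
      by (cases n) (auto simp: inf_mat_one_def)
    then have "inv_one_minus ?X 1 1 = 1"
      unfolding inv_one_minus_def by (simp only: suminf_split_head sums_single[THEN sums_unique, symmetric, of 0 "\<lambda>_. 1"])
    moreover have "S.sol 1 = 1"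
      using S.sol_fixpoint[of 1] by (simp add: S.mat_vec_row_scale t0 unit1_def)
    ultimately show ?thesis using True t0 by simp
  next
    case False
    define s where "s = csqrt \<epsilon>"
    have s: "s\<^sup>2 = \<epsilon>" by (simp add: s_def)
    define g1 where "g1 = s / of_real r1"
    define g2 where "g2 = s / of_real r2"
    have "s \<noteq> 0" using False s by auto
    then have g: "g1 \<noteq> 0" "g2 \<noteq> 0" "g1 * g2 = t"
      using r s by (auto simp: g1_def g2_def t_def power2_eq_square)
    have A: "A_mat \<epsilon> \<tau>1 k l = g1 ^ (k + l) * B1 k l" "A_mat \<epsilon> \<tau>2 k l = g2 ^ (k + l) * B2 k l" for k l
      unfolding g1_def g2_def by (rule A_mat_eq[OF s r(1)], rule A_mat_eq[OF s r(3)])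
    have X: "?X = gauge_mat g2 (S.P \<star> S.Q)"
    proof (intro ext)
      fix k l
      have "?X k l = (\<Sum>\<^sub>\<infinity>m\<in>{1..}. g2 ^ l / g2 ^ k * (S.P k m * S.Q m l))"
        unfolding inf_mat_mult_def A row_scale_def g(3)[symmetric]
        by (intro infsum_cong) (use g(1,2) in \<open>simp add: power_add power_mult_distrib field_simps\<close>)
      then show "?X k l = gauge_mat g2 (S.P \<star> S.Q) k l"
        unfolding gauge_mat_def inf_mat_mult_def[of S.P] by (simp only: infsum_cmult_right')
    qed
    have inv: "inv_one_minus ?X m 1 = g2 ^ 1 / g2 ^ m * S.sol m" if "m \<ge> 1" for m
      unfolding X S.sol_def by (rule inv_one_minus_gauge[OF g(2) S.inf_mat_power_summable[OF that]])
    have "(A_mat \<epsilon> \<tau>2 \<star> inv_one_minus ?X) 1 1 = (\<Sum>\<^sub>\<infinity>m\<in>{1..}. g2\<^sup>2 * (B2 1 m * S.sol m))"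
      unfolding inf_mat_mult_def[of "A_mat \<epsilon> \<tau>2"]
    proof (rule infsum_cong)
      fix m :: nat assume "m \<in> {1..}"
      then have "inv_one_minus ?X m 1 = g2 ^ 1 / g2 ^ m * S.sol m" by (intro inv) simp
      then show "A_mat \<epsilon> \<tau>2 1 m * inv_one_minus ?X m 1 = g2\<^sup>2 * (B2 1 m * S.sol m)"
        using g(2) by (simp only: A(2)) (simp add: power_add power2_eq_square field_simps)
    qed
    also have "\<dots> = g2\<^sup>2 * mat_vec B2 S.sol 1" unfolding mat_vec_def by (rule infsum_cmult_right')
    finally have "\<epsilon> * (A_mat \<epsilon> \<tau>2 \<star> inv_one_minus ?X) 1 1 = \<epsilon> * g2\<^sup>2 * mat_vec B2 S.sol 1" by simp
    moreover have "\<epsilon> * g2\<^sup>2 = (of_real r1 * t)\<^sup>2"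
      using r unfolding g2_def power_divide s t_def by (simp add: power2_eq_square)
    moreover have "inv_one_minus ?X 1 1 = S.sol 1" using inv[of 1] g by simp
    ultimately show ?thesis by simp
  qed
  then show "inv_one_minus (A_mat \<epsilon> \<tau>1 \<star> A_mat \<epsilon> \<tau>2) 1 1 = S.sol 1"
    "\<epsilon> * (A_mat \<epsilon> \<tau>2 \<star> inv_one_minus (A_mat \<epsilon> \<tau>1 \<star> A_mat \<epsilon> \<tau>2)) 1 1 = (of_real r1 * t)\<^sup>2 * mat_vec B2 S.sol 1"
    by auto
qed

lemma swapped: "sewn_tori \<tau>2 \<tau>1 \<epsilon> r2 r1"
  by unfold_locales (use T1.tau T2.tau r eps in \<open>auto simp: mult.commute\<close>)

end

sublocale sewn_tori \<subseteq> W: sewn_tori \<tau>2 \<tau>1 \<epsilon> r2 r1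
  by (rule swapped)

context sewn_tori begin

lemma W_t: "W.t = t" by (simp add: W.t_def t_def mult.commute)

lemma W_theta: "W.\<theta> = \<theta>" by (simp add: W.\<theta>_def \<theta>_def W_t)

lemma W_sol_1: "W.S.sol 1 = S.sol 1"
  using S.sol_swap by (simp add: W_t)

lemma F_eps_entries:
  defines "\<Omega> \<equiv> F_eps (\<tau>1, \<tau>2, \<epsilon>)"
  shows "\<Omega> $ 1 $ 1 = \<tau>1 + (of_real r1 * t)\<^sup>2 * mat_vec B2 S.sol 1 / (2 * of_real pi * \<i>)"
    "\<Omega> $ 2 $ 2 = \<tau>2 + (of_real r2 * t)\<^sup>2 * mat_vec B1 W.S.sol 1 / (2 * of_real pi * \<i>)"
    "\<Omega> $ 1 $ 2 = - \<epsilon> * S.sol 1 / (2 * of_real pi * \<i>)" "\<Omega> $ 2 $ 1 = - \<epsilon> * S.sol 1 / (2 * of_real pi * \<i>)"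
  using A_mat_entries W.A_mat_entries
  by (simp_all add: \<Omega>_def F_eps_def Let_def vector_2 W_t)

text \<open>The polar (\<open>avec\<close>) and regular (\<open>bvec\<close>) coefficients at the two punctures of the 1-form with
  periods \<open>2 \<pi> \<i> \<alpha>1\<close> and \<open>2 \<pi> \<i> \<alpha>2\<close> along the a-cycles. The relation \<open>z\<^sub>1 z\<^sub>2 = \<epsilon>\<close> exchanges the two
  kinds, which is the content of \<open>avec1_eq\<close> and \<open>avec2_eq\<close>.\<close>

definition avec1 :: "complex \<Rightarrow> complex \<Rightarrow> nat \<Rightarrow> complex" where
  "avec1 \<alpha>1 \<alpha>2 k = \<alpha>2 * of_real r2 * t * W.S.sol k - \<alpha>1 * of_real r1 * t * mat_vec S.Q S.sol k"

definition avec2 :: "complex \<Rightarrow> complex \<Rightarrow> nat \<Rightarrow> complex" where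
  "avec2 \<alpha>1 \<alpha>2 k = \<alpha>1 * of_real r1 * t * S.sol k - \<alpha>2 * of_real r2 * t * mat_vec S.P W.S.sol k"

definition bvec1 :: "complex \<Rightarrow> complex \<Rightarrow> nat \<Rightarrow> complex" where
  "bvec1 \<alpha>1 \<alpha>2 k = (if k = 1 then \<alpha>1 * of_real r1 else 0) - mat_vec B1 (avec1 \<alpha>1 \<alpha>2) k"

definition bvec2 :: "complex \<Rightarrow> complex \<Rightarrow> nat \<Rightarrow> complex" where
  "bvec2 \<alpha>1 \<alpha>2 k = (if k = 1 then \<alpha>2 * of_real r2 else 0) - mat_vec B2 (avec2 \<alpha>1 \<alpha>2) k"

lemma geom_vec_W_sol: "geom_vec \<theta> W.S.sol" using W.S.geom_vec_sol by (simp only: W_theta)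

lemma geom_vec_avec: "geom_vec \<theta> (avec1 \<alpha>1 \<alpha>2)" "geom_vec \<theta> (avec2 \<alpha>1 \<alpha>2)"
  unfolding avec1_def avec2_def
  by (intro S.geom_vec_diff S.geom_vec_cmult S.geom_vec_P S.geom_vec_Q S.geom_vec_sol geom_vec_W_sol)+

lemma avec1_eq:
  assumes k: "k \<ge> 1" shows "avec1 \<alpha>1 \<alpha>2 k = t ^ k * bvec2 \<alpha>1 \<alpha>2 k"
proof -
  have M: "mat_vec S.Q (avec2 \<alpha>1 \<alpha>2) k =
      \<alpha>1 * of_real r1 * t * mat_vec S.Q S.sol k - \<alpha>2 * of_real r2 * t * mat_vec S.Q (mat_vec S.P W.S.sol) k"
    unfolding avec2_def
    by (simp add: S.mat_vec_diff[OF S.bounded(4) S.geom_vec_cmult[OF S.geom_vec_sol] S.geom_vec_cmult[OF S.geom_vec_P[OF geom_vec_W_sol]] k]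
        S.mat_vec_cmult)
  have X: "W.S.sol k = unit1 k + mat_vec S.Q (mat_vec S.P W.S.sol) k"
    using W.S.sol_fixpoint[OF k] by (simp only: W_t)
  have B: "t ^ k * bvec2 \<alpha>1 \<alpha>2 k = \<alpha>2 * of_real r2 * t * unit1 k - mat_vec S.Q (avec2 \<alpha>1 \<alpha>2) k"
    by (simp add: bvec2_def right_diff_distrib S.mat_vec_row_scale unit1_def)
  show ?thesis unfolding avec1_def B M by (subst X) (simp add: algebra_simps)
qed

lemma avec2_eq:
  assumes k: "k \<ge> 1" shows "avec2 \<alpha>1 \<alpha>2 k = t ^ k * bvec1 \<alpha>1 \<alpha>2 k"
proof -
  have M: "mat_vec S.P (avec1 \<alpha>1 \<alpha>2) k =
      \<alpha>2 * of_real r2 * t * mat_vec S.P W.S.sol k - \<alpha>1 * of_real r1 * t * mat_vec S.P (mat_vec S.Q S.sol) k"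
    unfolding avec1_def
    by (simp add: S.mat_vec_diff[OF S.bounded(3) S.geom_vec_cmult[OF geom_vec_W_sol] S.geom_vec_cmult[OF S.geom_vec_Q[OF S.geom_vec_sol]] k]
        S.mat_vec_cmult)
  have X: "S.sol k = unit1 k + mat_vec S.P (mat_vec S.Q S.sol) k"
    using S.sol_fixpoint[OF k] .
  have B: "t ^ k * bvec1 \<alpha>1 \<alpha>2 k = \<alpha>1 * of_real r1 * t * unit1 k - mat_vec S.P (avec1 \<alpha>1 \<alpha>2) k"
    by (simp add: bvec1_def right_diff_distrib S.mat_vec_row_scale unit1_def)
  show ?thesis unfolding avec2_def B M by (subst X) (simp add: algebra_simps)
qed

lemma bvec_bounded: "\<exists>C. \<forall>k\<ge>1. norm (bvec1 \<alpha>1 \<alpha>2 k) \<le> C" "\<exists>C. \<forall>k\<ge>1. norm (bvec2 \<alpha>1 \<alpha>2 k) \<le> C"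
proof -
  obtain C1 C2 where C: "\<And>k. k \<ge> 1 \<Longrightarrow> norm (mat_vec B1 (avec1 \<alpha>1 \<alpha>2) k) \<le> C1"
    "\<And>k. k \<ge> 1 \<Longrightarrow> norm (mat_vec B2 (avec2 \<alpha>1 \<alpha>2) k) \<le> C2"
    using S.mat_vec_bounded[OF S.bounded(1) geom_vec_avec(1)] S.mat_vec_bounded[OF S.bounded(2) geom_vec_avec(2)] by blast
  have "norm (bvec1 \<alpha>1 \<alpha>2 k) \<le> norm (\<alpha>1 * of_real r1) + C1" if "k \<ge> 1" for k
  proof -
    have "norm (bvec1 \<alpha>1 \<alpha>2 k) \<le> norm (if k = 1 then \<alpha>1 * of_real r1 else 0) + norm (mat_vec B1 (avec1 \<alpha>1 \<alpha>2) k)"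
      unfolding bvec1_def by (rule norm_triangle_ineq4)
    also have "\<dots> \<le> norm (\<alpha>1 * of_real r1) + C1" using C(1)[OF that] by (intro add_mono) auto
    finally show ?thesis .
  qed
  moreover have "norm (bvec2 \<alpha>1 \<alpha>2 k) \<le> norm (\<alpha>2 * of_real r2) + C2" if "k \<ge> 1" for k
  proof -
    have "norm (bvec2 \<alpha>1 \<alpha>2 k) \<le> norm (if k = 1 then \<alpha>2 * of_real r2 else 0) + norm (mat_vec B2 (avec2 \<alpha>1 \<alpha>2) k)"
      unfolding bvec2_def by (rule norm_triangle_ineq4)
    also have "\<dots> \<le> norm (\<alpha>2 * of_real r2) + C2" using C(2)[OF that] by (intro add_mono) auto
    finally show ?thesis .
  qed
  ultimately show "\<exists>C. \<forall>k\<ge>1. norm (bvec1 \<alpha>1 \<alpha>2 k) \<le> C" "\<exists>C. \<forall>k\<ge>1. norm (bvec2 \<alpha>1 \<alpha>2 k) \<le> C" by blast+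
qed

lemma avec_1:
  defines "\<Omega> \<equiv> F_eps (\<tau>1, \<tau>2, \<epsilon>)"
  shows "2 * of_real pi * \<i> * (\<Omega> $ 1 $ 1 * \<alpha>1 + \<Omega> $ 1 $ 2 * \<alpha>2) = 2 * of_real pi * \<i> * \<tau>1 * \<alpha>1 - of_real r1 * avec1 \<alpha>1 \<alpha>2 1"
    "2 * of_real pi * \<i> * (\<Omega> $ 2 $ 1 * \<alpha>1 + \<Omega> $ 2 $ 2 * \<alpha>2) = 2 * of_real pi * \<i> * \<tau>2 * \<alpha>2 - of_real r2 * avec2 \<alpha>1 \<alpha>2 1"
proof -
  have pi: "2 * of_real pi * \<i> \<noteq> 0" by simp
  show "2 * of_real pi * \<i> * (\<Omega> $ 1 $ 1 * \<alpha>1 + \<Omega> $ 1 $ 2 * \<alpha>2) = 2 * of_real pi * \<i> * \<tau>1 * \<alpha>1 - of_real r1 * avec1 \<alpha>1 \<alpha>2 1"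
    unfolding \<Omega>_def F_eps_entries avec1_def W_sol_1 S.mat_vec_row_scale using pi
    by (subst eps_eq) (simp add: field_simps power2_eq_square)
  show "2 * of_real pi * \<i> * (\<Omega> $ 2 $ 1 * \<alpha>1 + \<Omega> $ 2 $ 2 * \<alpha>2) = 2 * of_real pi * \<i> * \<tau>2 * \<alpha>2 - of_real r2 * avec2 \<alpha>1 \<alpha>2 1"
    unfolding \<Omega>_def F_eps_entries avec2_def S.mat_vec_row_scale using pi
    by (subst eps_eq) (simp add: field_simps power2_eq_square)
qed

lemma F_eps_siegel: "F_eps (\<tau>1, \<tau>2, \<epsilon>) \<in> siegel_H2"
proof -
  let ?\<Omega> = "F_eps (\<tau>1, \<tau>2, \<epsilon>)"
  have "v \<bullet> ((\<chi> i j. Im (?\<Omega> $ i $ j)) *v v) > 0" if v: "v \<noteq> 0" for v :: "real^2"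
  proof -
    define x y where "x = v $ 1" and "y = v $ 2"
    define a1 a2 where "a1 = avec1 (of_real x) (of_real y)" and "a2 = avec2 (of_real x) (of_real y)"
    define b1 b2 where "b1 = bvec1 (of_real x) (of_real y)" and "b2 = bvec2 (of_real x) (of_real y)"
    define E1 where "E1 = 4 * pi * Im \<tau>1 * x\<^sup>2 + 2 * r1 * (x * Re (a1 1))"
    define E2 where "E2 = 4 * pi * Im \<tau>2 * y\<^sup>2 + 2 * r2 * (y * Re (a2 1))"
    have le1: "(\<Sum>l=1..L. (norm (b1 l))\<^sup>2) \<le> norm2 a1 + E1" for L
      using T1.area_inequality_infinite[OF r(1,2) S.theta geom_vec_avec(1)[of "of_real x" "of_real y"], where L = L and \<alpha> = "of_real x"]
      by (simp add: b1_def bvec1_def a1_def E1_def)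
    have le2: "(\<Sum>l=1..L. (norm (b2 l))\<^sup>2) \<le> norm2 a2 + E2" for L
      using T2.area_inequality_infinite[OF r(3,4) S.theta geom_vec_avec(2)[of "of_real x" "of_real y"], where L = L and \<alpha> = "of_real y"]
      by (simp add: b2_def bvec2_def a2_def E2_def)
    have n2: "norm2 a2 \<le> \<theta>\<^sup>2 * (norm2 a1 + E1)"
    proof -
      obtain C where "\<And>k. k \<ge> 1 \<Longrightarrow> norm (b1 k) \<le> C" using bvec_bounded(1) unfolding b1_def by blast
      from S.norm2_scale_le[OF S.t this le1] have "norm2 (\<lambda>k. t ^ k * b1 k) \<le> \<theta>\<^sup>2 * (norm2 a1 + E1)" .
      moreover have "norm2 a2 = norm2 (\<lambda>k. t ^ k * b1 k)"
        unfolding norm2_def by (rule infsum_cong) (simp add: a2_def b1_def avec2_eq)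
      ultimately show ?thesis by simp
    qed
    have n1: "norm2 a1 \<le> \<theta>\<^sup>2 * (norm2 a2 + E2)"
    proof -
      obtain C where "\<And>k. k \<ge> 1 \<Longrightarrow> norm (b2 k) \<le> C" using bvec_bounded(2) unfolding b2_def by blast
      from S.norm2_scale_le[OF S.t this le2] have "norm2 (\<lambda>k. t ^ k * b2 k) \<le> \<theta>\<^sup>2 * (norm2 a2 + E2)" .
      moreover have "norm2 a1 = norm2 (\<lambda>k. t ^ k * b2 k)"
        unfolding norm2_def by (rule infsum_cong) (simp add: a1_def b2_def avec1_eq)
      ultimately show ?thesis by simp
    qed
    define n where "n = norm2 a1 + norm2 a2"
    have nn: "n \<ge> 0" unfolding n_def using S.norm2_nonneg[of a1] S.norm2_nonneg[of a2] by simp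
    have "n \<le> \<theta>\<^sup>2 * (n + (E1 + E2))" using n1 n2 by (simp add: n_def algebra_simps)
    then have E: "(1 - \<theta>\<^sup>2) * n \<le> \<theta>\<^sup>2 * (E1 + E2)" by (simp add: algebra_simps)
    have th: "0 < \<theta>\<^sup>2" "0 < 1 - \<theta>\<^sup>2" using S.theta S.theta2 by auto
    have "E1 + E2 > 0"
    proof (rule ccontr)
      assume "\<not> E1 + E2 > 0"
      then have E0: "E1 + E2 \<le> 0" by simp
      then have "\<theta>\<^sup>2 * (E1 + E2) \<le> 0" using th by (simp add: mult_le_0_iff)
      with E have "(1 - \<theta>\<^sup>2) * n \<le> 0" by linarith
      then have n0: "n = 0" using th nn by (simp add: mult_le_0_iff)
      then have m0: "norm2 a1 = 0" "norm2 a2 = 0"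
        using S.norm2_nonneg[of a1] S.norm2_nonneg[of a2] unfolding n_def by linarith+
      have "a1 k = 0" "a2 k = 0" if "k \<ge> 1" for k
      proof -
        have "norm (a1 k) \<le> sqrt (norm2 a1)" "norm (a2 k) \<le> sqrt (norm2 a2)"
          unfolding a1_def a2_def
          by (rule S.norm_le_norm2[OF geom_vec_avec(1) that], rule S.norm_le_norm2[OF geom_vec_avec(2) that])
        then show "a1 k = 0" "a2 k = 0" unfolding m0 by simp_all
      qed
      then have z: "mat_vec B1 a1 1 = 0" "mat_vec B2 a2 1 = 0"
        unfolding mat_vec_def by (auto intro!: infsum_0)
      have "b1 1 = of_real (x * r1)" "b2 1 = of_real (y * r2)"
        using z unfolding b1_def b2_def bvec1_def bvec2_def a1_def a2_def by simp_all
      then have "(x * r1)\<^sup>2 + (y * r2)\<^sup>2 \<le> 0"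
        using le1[of 1] le2[of 1] m0 E0 by (simp add: norm_mult power_mult_distrib)
      then have "(x * r1)\<^sup>2 = 0" "(y * r2)\<^sup>2 = 0"
        using zero_le_power2[of "x * r1"] zero_le_power2[of "y * r2"] by linarith+
      then have "x = 0" "y = 0" using r by auto
      then show False using v by (simp add: x_def y_def vec_eq_iff forall_2)
    qed
    moreover have "4 * pi * (v \<bullet> ((\<chi> i j. Im (?\<Omega> $ i $ j)) *v v)) = E1 + E2"
    proof -
      have I: "2 * pi * (Im (?\<Omega> $ 1 $ 1) * x + Im (?\<Omega> $ 1 $ 2) * y) = 2 * pi * Im \<tau>1 * x + r1 * Re (a1 1)"
        "2 * pi * (Im (?\<Omega> $ 2 $ 1) * x + Im (?\<Omega> $ 2 $ 2) * y) = 2 * pi * Im \<tau>2 * y + r2 * Re (a2 1)"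
        using avec_1[of "of_real x" "of_real y", THEN arg_cong[where f = Re]]
        by (simp_all add: a1_def a2_def algebra_simps)
      have "4 * pi * (v \<bullet> ((\<chi> i j. Im (?\<Omega> $ i $ j)) *v v)) =
         2 * x * (2 * pi * (Im (?\<Omega> $ 1 $ 1) * x + Im (?\<Omega> $ 1 $ 2) * y)) +
         2 * y * (2 * pi * (Im (?\<Omega> $ 2 $ 1) * x + Im (?\<Omega> $ 2 $ 2) * y))"
        by (simp add: inner_vec_def sum_2 matrix_vector_mult_def x_def y_def algebra_simps)
      also have "\<dots> = E1 + E2" unfolding I E1_def E2_def by (simp add: power2_eq_square algebra_simps)
      finally show ?thesis .
    qed
    ultimately have "0 < (4 * pi) * (v \<bullet> ((\<chi> i j. Im (?\<Omega> $ i $ j)) *v v))" by (simp only:)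
    then show ?thesis by (rule zero_less_mult_pos) simp
  qed
  moreover have "transpose ?\<Omega> = ?\<Omega>"
    using F_eps_entries by (simp add: transpose_def vec_eq_iff forall_2)
  ultimately show ?thesis by (simp add: siegel_H2_def)
qed

end

lemma sewn_tori_exists:
  assumes "(\<tau>1, \<tau>2, \<epsilon>) \<in> D_eps"
  obtains r1 r2 where "sewn_tori \<tau>1 \<tau>2 \<epsilon> r1 r2"
proof -
  let ?D1 = "lattice_min \<tau>1" and ?D2 = "lattice_min \<tau>2"
  have tau: "\<tau>1 \<in> upper_half_plane" "\<tau>2 \<in> upper_half_plane" and e: "norm \<epsilon> < 1/4 * ?D1 * ?D2"
    using assms by (auto simp: D_eps_def)
  have D: "?D1 > 0" "?D2 > 0" using lattice_min_pos tau by auto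
  define x where "x = 4 * norm \<epsilon> / (?D1 * ?D2)"
  have x: "0 \<le> x" "x < 1" using e D by (auto simp: x_def divide_simps)
  define q where "q = sqrt ((1 + x) / 2)"
  have q: "0 < q" "q < 1" "q * q = (1 + x) / 2" using x by (auto simp: q_def)
  have "norm \<epsilon> = x * (?D1 * ?D2 / 4)" using D by (simp add: x_def)
  also have "\<dots> < (q * q) * (?D1 * ?D2 / 4)" using q x D by (intro mult_strict_right_mono) auto
  finally have "norm \<epsilon> < (?D1 / 2 * q) * (?D2 / 2 * q)" by (simp add: mult_ac)
  moreover have "?D1 / 2 * q < ?D1 / 2 * 1" "?D2 / 2 * q < ?D2 / 2 * 1"
    using D q by (intro mult_strict_left_mono; simp)+
  ultimately have "sewn_tori \<tau>1 \<tau>2 \<epsilon> (?D1 / 2 * q) (?D2 / 2 * q)"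
    by unfold_locales (use D q tau in auto)
  then show ?thesis by (rule that)
qed

section \<open>The 1-forms on the sewn surface\<close>

lemma sums_infsum_Suc:
  fixes f :: "nat \<Rightarrow> complex"
  assumes "f summable_on {1..}" shows "(\<lambda>n. f (Suc n)) sums infsum f {1..}"
proof -
  have "(\<Sum>m=1..N. f m) = (\<Sum>n<N. f (Suc n))" for N
    by (rule sum.reindex_bij_witness[of _ Suc "\<lambda>m. m - 1"]) auto
  then show ?thesis using infsum_LIMSEQ[OF assms] by (simp add: sums_def)
qed

context torus begin

lemma lattice_periodic_on:
  assumes S: "\<And>z w. z \<in> S \<Longrightarrow> w \<in> \<Lambda> \<Longrightarrow> z + w \<in> S"
    and k: "\<And>z. z \<in> S \<Longrightarrow> k (z + \<omega>1) = k z" "\<And>z. z \<in> S \<Longrightarrow> k (z + \<omega>2) = k z"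
    and w: "w \<in> \<Lambda>" and z: "z \<in> S"
  shows "k (z + w) = k z"
  using w z
proof (induction w arbitrary: z rule: torus_lattice_induct)
  case (add1 w)
  then show ?case using k(1)[OF S[OF add1(3,1)]] by (simp only: add.assoc)
next
  case (diff1 w)
  have "z + (w - \<omega>1) \<in> S" by (rule S[OF diff1(3) torus_lattice_diff[OF diff1(1) torus_lattice_2pi_i]])
  from k(1)[OF this] diff1(2)[OF diff1(3)] show ?case by simp
next
  case (add2 w)
  then show ?case using k(2)[OF S[OF add2(3,1)]] by (simp only: add.assoc)
next
  case (diff2 w)
  have "z + (w - \<omega>2) \<in> S" by (rule S[OF diff2(3) torus_lattice_diff[OF diff2(1) torus_lattice_2pi_i_tau]])
  from k(2)[OF this] diff2(2)[OF diff2(3)] show ?case by simp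
qed simp

lemma punctured_plane_add: "z \<in> punctured_plane \<tau> \<rho> \<Longrightarrow> w \<in> \<Lambda> \<Longrightarrow> z + w \<in> punctured_plane \<tau> \<rho>"
  by (simp add: punctured_plane_eq infdist_lattice_add)

lemma punctured_plane_subset: "0 \<le> \<rho> \<Longrightarrow> punctured_plane \<tau> \<rho> \<subseteq> - \<Lambda>"
  using lattice_iff_infdist by (force simp: punctured_plane_eq)

lemma P_pole_bound:
  assumes "0 < \<rho>" "x \<in> punctured_plane \<tau> \<rho>"
  shows "\<exists>\<delta> M \<sigma>. 0 < \<delta> \<and> \<rho> < \<sigma> \<and> 0 \<le> M \<and> (\<forall>y\<in>ball x \<delta>. \<forall>k\<ge>1. norm (P_pole k y) \<le> M / \<sigma> ^ k)"
proof -
  have m: "infdist x \<Lambda> > \<rho>" using assms by (simp add: punctured_plane_eq)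
  define \<delta> where "\<delta> = (infdist x \<Lambda> - \<rho>) / 3"
  define \<sigma> where "\<sigma> = \<rho> + \<delta>"
  have d: "\<delta> > 0" "\<rho> < \<sigma>" "infdist x \<Lambda> = \<sigma> + 2 * \<delta>" using m by (simp_all add: \<delta>_def \<sigma>_def field_simps)
  let ?K = "cball x (\<delta> + \<sigma>) \<inter> {z. infdist z \<Lambda> \<ge> \<delta>}"
  have "compact ?K"
    by (intro compact_Int_closed compact_cball closed_Collect_le continuous_intros)
  moreover have KL: "?K \<subseteq> - \<Lambda>" using d lattice_iff_infdist by force
  have "continuous_on ?K P1"
    using holomorphic_on_imp_continuous_on[OF P1_holomorphic] KL continuous_on_subset by blast
  ultimately have "bounded (P1 ` ?K)" by (intro compact_imp_bounded compact_continuous_image)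
  then obtain M where M: "\<And>z. z \<in> ?K \<Longrightarrow> norm (P1 z) \<le> M" unfolding bounded_iff by blast
  define M' where "M' = max M 0"
  have "norm (P_pole k y) \<le> (M' * \<sigma>) / \<sigma> ^ k" if y: "y \<in> ball x \<delta>" and k: "k \<ge> 1" for y k
  proof -
    have sub: "cball y \<sigma> \<subseteq> ?K"
    proof
      fix z assume z: "z \<in> cball y \<sigma>"
      have "dist x z \<le> dist x y + dist y z" by (rule dist_triangle)
      then have "z \<in> cball x (\<delta> + \<sigma>)" using y z by simp
      moreover have "infdist x \<Lambda> \<le> infdist z \<Lambda> + dist x z" by (rule infdist_triangle)
      then have "infdist z \<Lambda> \<ge> \<delta>" using \<open>dist x z \<le> dist x y + dist y z\<close> y z d by simp
      ultimately show "z \<in> ?K" by simp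
    qed
    have "norm ((deriv ^^ (k - 1)) P1 y) \<le> fact (k - 1) * M' / \<sigma> ^ (k - 1)"
    proof (rule Cauchy_inequality)
      show "P1 holomorphic_on ball y \<sigma>"
        using holomorphic_on_subset[OF P1_holomorphic] sub KL ball_subset_cball by (meson order_trans)
      show "continuous_on (cball y \<sigma>) P1"
        using holomorphic_on_imp_continuous_on[OF P1_holomorphic] sub KL continuous_on_subset by (meson order_trans)
      show "0 < \<sigma>" using d assms by simp
      show "norm (P1 z) \<le> M'" if "norm (y - z) = \<sigma>" for z
      proof -
        have "z \<in> cball y \<sigma>" using that by (simp add: dist_norm)
        then show ?thesis using M[of z] sub unfolding M'_def by fastforce
      qed
    qed
    then have "norm (P_pole k y) \<le> M' / \<sigma> ^ (k - 1)"
      by (simp add: P_pole_def norm_mult norm_divide norm_power field_simps)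
    also have "M' / \<sigma> ^ (k - 1) = (M' * \<sigma>) / \<sigma> ^ k"
      using k d assms by (cases k) auto
    finally show ?thesis .
  qed
  then show ?thesis using d assms by (intro exI[of _ \<delta>] exI[of _ "M' * \<sigma>"] exI[of _ \<sigma>]) (auto simp: M'_def)
qed

definition polar_sum :: "real \<Rightarrow> complex \<Rightarrow> (nat \<Rightarrow> complex) \<Rightarrow> complex \<Rightarrow> complex" where
  "polar_sum r \<alpha> a z = \<alpha> * z + (\<Sum>n. a (Suc n) * of_real (r ^ Suc n / sqrt (real (Suc n))) * P_pole (Suc n) z)"

lemma polar_sum_deriv:
  assumes r: "0 < r" and q: "0 < q" and a: "\<And>k. k \<ge> 1 \<Longrightarrow> norm (a k) \<le> C * q ^ k"
  shows "\<exists>F'. \<forall>z\<in>punctured_plane \<tau> (r * q).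
    (\<lambda>n. a (Suc n) * of_real (r ^ Suc n / sqrt (real (Suc n))) * P_pole (Suc n) z) sums (polar_sum r \<alpha> a z - \<alpha> * z) \<and>
    (polar_sum r \<alpha> a has_field_derivative F' z) (at z)"
proof -
  let ?S = "punctured_plane \<tau> (r * q)"
  let ?f = "\<lambda>n z. a (Suc n) * of_real (r ^ Suc n / sqrt (real (Suc n))) * P_pole (Suc n) z"
  let ?f' = "\<lambda>n z. a (Suc n) * of_real (r ^ Suc n / sqrt (real (Suc n))) * (- of_nat (Suc n) * P_pole (Suc (Suc n)) z)"
  have rq: "0 < r * q" using r q by simp
  have C: "C \<ge> 0"
  proof -
    have "0 \<le> C * q ^ 1" using a[of 1] norm_ge_zero order_trans by blast
    then show ?thesis using q by (simp add: zero_le_mult_iff)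
  qed
  have SL: "?S \<subseteq> - \<Lambda>" using punctured_plane_subset rq by simp
  have "\<exists>g g'. \<forall>x\<in>?S. ((\<lambda>n. ?f n x) sums g x) \<and> ((\<lambda>n. ?f' n x) sums g' x) \<and> (g has_field_derivative g' x) (at x)"
  proof (rule series_and_derivative_comparison_local[OF open_punctured_plane])
    fix n z assume "z \<in> ?S"
    then have "z \<notin> \<Lambda>" using SL by auto
    then show "(?f n has_field_derivative ?f' n z) (at z)" by (intro DERIV_cmult P_pole_deriv) auto
  next
    fix x assume "x \<in> ?S"
    from P_pole_bound[OF rq this] obtain \<delta> M \<sigma> where b: "0 < \<delta>" "r * q < \<sigma>" "0 \<le> M"
      "\<And>y k. y \<in> ball x \<delta> \<Longrightarrow> k \<ge> 1 \<Longrightarrow> norm (P_pole k y) \<le> M / \<sigma> ^ k" by blast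
    have bound: "norm (?f n y) \<le> C * M * (r * q / \<sigma>) ^ Suc n" if "y \<in> ball x \<delta>" for y n
    proof -
      have "norm (of_real (r ^ Suc n / sqrt (real (Suc n))) :: complex) \<le> r ^ Suc n / 1"
      proof -
        have "norm (of_real (r ^ Suc n / sqrt (real (Suc n))) :: complex) = r ^ Suc n / sqrt (real (Suc n))"
          unfolding norm_of_real using r by (intro abs_of_nonneg) auto
        also have "\<dots> \<le> r ^ Suc n / 1" by (rule divide_left_mono) (use r in auto)
        finally show ?thesis .
      qed
      then have "norm (?f n y) \<le> (C * q ^ Suc n) * r ^ Suc n * (M / \<sigma> ^ Suc n)"
        unfolding norm_mult using a[of "Suc n"] b(4)[OF that, of "Suc n"] C q r b(3)
        by (intro mult_mono mult_nonneg_nonneg) auto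
      then show ?thesis by (simp add: power_mult_distrib power_divide mult_ac)
    qed
    have "summable (\<lambda>n. C * M * (r * q / \<sigma>) * (r * q / \<sigma>) ^ n)"
      using b rq by (intro summable_mult summable_geometric) auto
    then have "summable (\<lambda>n. C * M * (r * q / \<sigma>) ^ Suc n)" by (simp add: mult.assoc)
    then show "\<exists>d h. 0 < d \<and> summable h \<and> (\<forall>\<^sub>F n in sequentially. \<forall>y\<in>ball x d \<inter> ?S. norm (?f n y) \<le> h n)"
      using b(1) bound by (intro exI[of _ \<delta>] exI[of _ "\<lambda>n. C * M * (r * q / \<sigma>) ^ Suc n"]) (auto intro!: always_eventually)
  qed
  then obtain g g' where g: "\<And>x. x \<in> ?S \<Longrightarrow> (\<lambda>n. ?f n x) sums g x" "\<And>x. x \<in> ?S \<Longrightarrow> (g has_field_derivative g' x) (at x)"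
    by blast
  have eq: "polar_sum r \<alpha> a z = \<alpha> * z + g z" if "z \<in> ?S" for z
    using sums_unique[OF g(1)[OF that]] by (simp add: polar_sum_def)
  have "(polar_sum r \<alpha> a has_field_derivative \<alpha> + g' z) (at z)" if "z \<in> ?S" for z
  proof (rule has_field_derivative_transform_within_open[OF _ open_punctured_plane that])
    show "((\<lambda>z. \<alpha> * z + g z) has_field_derivative \<alpha> + g' z) (at z)"
      using g(2)[OF that] by (auto intro!: derivative_eq_intros)
  qed (use eq in auto)
  then show ?thesis using g(1) eq by (intro exI[of _ "\<lambda>z. \<alpha> + g' z"]) auto
qed

context
  fixes r q C :: real and \<alpha> :: complex and a :: "nat \<Rightarrow> complex"
  assumes r: "0 < r" and q: "0 < q" and a: "\<And>k. k \<ge> 1 \<Longrightarrow> norm (a k) \<le> C * q ^ k"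
begin

lemma polar_sum_sums:
  "z \<in> punctured_plane \<tau> (r * q) \<Longrightarrow>
    (\<lambda>n. a (Suc n) * of_real (r ^ Suc n / sqrt (real (Suc n))) * P_pole (Suc n) z) sums (polar_sum r \<alpha> a z - \<alpha> * z)"
  using polar_sum_deriv[OF r q a, of \<alpha>] by blast

lemma polar_sum_holomorphic: "polar_sum r \<alpha> a holomorphic_on punctured_plane \<tau> (r * q)"
  using polar_sum_deriv[OF r q a, of \<alpha>] open_punctured_plane by (auto simp: holomorphic_on_open)

lemma polar_sum_add:
  assumes z: "z \<in> punctured_plane \<tau> (r * q)"
  shows "polar_sum r \<alpha> a (z + \<omega>1) = polar_sum r \<alpha> a z + \<alpha> * \<omega>1"
    "polar_sum r \<alpha> a (z + \<omega>2) = polar_sum r \<alpha> a z + (\<alpha> * \<omega>2 - of_real r * a 1)"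
proof -
  have zL: "z \<notin> \<Lambda>" using z punctured_plane_subset[of "r * q"] r q by auto
  have "(\<lambda>n. a (Suc n) * of_real (r ^ Suc n / sqrt (real (Suc n))) * P_pole (Suc n) z) sums (polar_sum r \<alpha> a (z + \<omega>1) - \<alpha> * (z + \<omega>1))"
    using polar_sum_sums[OF punctured_plane_add[OF z torus_lattice_2pi_i]] P_pole_periodic(1)[OF zL] by simp
  from sums_unique2[OF this polar_sum_sums[OF z]]
  show "polar_sum r \<alpha> a (z + \<omega>1) = polar_sum r \<alpha> a z + \<alpha> * \<omega>1" by (simp add: algebra_simps)
  let ?c = "\<lambda>n. a (Suc n) * of_real (r ^ Suc n / sqrt (real (Suc n)))"
  have "(\<lambda>n. ?c n * P_pole (Suc n) z - (if n = 0 then ?c n else 0)) sums (polar_sum r \<alpha> a (z + \<omega>2) - \<alpha> * (z + \<omega>2))"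
  proof (rule sums_cong[THEN iffD1, OF _ polar_sum_sums[OF punctured_plane_add[OF z torus_lattice_2pi_i_tau]]])
    fix n
    show "?c n * P_pole (Suc n) (z + \<omega>2) = ?c n * P_pole (Suc n) z - (if n = 0 then ?c n else 0)"
      using P_pole_periodic(2)[OF zL, of "Suc n"] by (simp add: right_diff_distrib)
  qed
  moreover have "(\<lambda>n. ?c n * P_pole (Suc n) z - (if n = 0 then ?c n else 0)) sums (polar_sum r \<alpha> a z - \<alpha> * z - ?c 0)"
    by (intro sums_diff polar_sum_sums[OF z] sums_single)
  ultimately have "polar_sum r \<alpha> a (z + \<omega>2) - \<alpha> * (z + \<omega>2) = polar_sum r \<alpha> a z - \<alpha> * z - ?c 0"
    by (rule sums_unique2)
  then show "polar_sum r \<alpha> a (z + \<omega>2) = polar_sum r \<alpha> a z + (\<alpha> * \<omega>2 - of_real r * a 1)"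
    by (simp add: algebra_simps)
qed

lemma polar_sum_add_const:
  assumes w: "w = \<omega>1 \<or> w = \<omega>2"
  shows "\<exists>c. \<forall>z\<in>punctured_plane \<tau> (r * q). polar_sum r \<alpha> a (z + w) = polar_sum r \<alpha> a z + c"
  using w polar_sum_add by blast

lemma deriv_polar_sum_periodic:
  assumes w: "w \<in> \<Lambda>" and z: "z \<in> punctured_plane \<tau> (r * q)"
  shows "deriv (polar_sum r \<alpha> a) (z + w) = deriv (polar_sum r \<alpha> a) z"
proof -
  let ?S = "punctured_plane \<tau> (r * q)" and ?F = "polar_sum r \<alpha> a"
  have gen: "deriv ?F (z + v) = deriv ?F z" if v: "v \<in> \<Lambda>" "v = \<omega>1 \<or> v = \<omega>2" and z: "z \<in> ?S" for v z
  proof -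
    obtain c where c: "\<And>z. z \<in> ?S \<Longrightarrow> ?F (z + v) = ?F z + c" using polar_sum_add_const[OF v(2)] by blast
    have "(?F has_field_derivative deriv ?F (z + v)) (at (z + v))"
      by (rule holomorphic_derivI[OF polar_sum_holomorphic open_punctured_plane punctured_plane_add[OF z v(1)]])
    then have "((\<lambda>y. ?F (y + v)) has_field_derivative deriv ?F (z + v)) (at z)" by (rule DERIV_shift[THEN iffD1])
    then have 1: "((\<lambda>y. ?F y + c) has_field_derivative deriv ?F (z + v)) (at z)"
      by (rule has_field_derivative_transform_within_open[OF _ open_punctured_plane z]) (simp add: c)
    have "((\<lambda>y. ?F y + c) has_field_derivative deriv ?F z) (at z)"
      using holomorphic_derivI[OF polar_sum_holomorphic open_punctured_plane z] by (auto intro!: derivative_eq_intros)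
    with 1 show ?thesis by (rule DERIV_unique)
  qed
  show ?thesis
    by (rule lattice_periodic_on[OF punctured_plane_add gen gen w z])
      (use torus_lattice_2pi_i torus_lattice_2pi_i_tau in auto)
qed

lemma has_period_polar_sum:
  assumes rq: "r * q < D / 2"
  shows "has_period (deriv (polar_sum r \<alpha> a)) (punctured_plane \<tau> (r * q)) \<omega>1 (\<alpha> * \<omega>1)"
    "has_period (deriv (polar_sum r \<alpha> a)) (punctured_plane \<tau> (r * q)) \<omega>2 (\<alpha> * \<omega>2 - of_real r * a 1)"
proof -
  let ?S = "punctured_plane \<tau> (r * q)" and ?F = "polar_sum r \<alpha> a"
  have gen: "has_period (deriv ?F) ?S w c" if h: "w \<in> \<Lambda>" "\<And>z. z \<in> ?S \<Longrightarrow> ?F (z + w) = ?F z + c" for w c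
  proof -
    obtain g where g: "valid_path g" "path_image g \<subseteq> ?S" "pathfinish g = pathstart g + w"
      using connected_punctured_plane[OF rq h(1)] by blast
    have "(deriv ?F has_contour_integral (?F (pathfinish g) - ?F (pathstart g))) g"
      by (rule contour_integral_primitive[OF _ g(1,2)])
        (use holomorphic_derivI[OF polar_sum_holomorphic open_punctured_plane] in blast)
    moreover have "pathstart g \<in> ?S" using g(2) pathstart_in_path_image by blast
    ultimately have "(deriv ?F has_contour_integral c) g" using h(2) g(3) by simp
    with g show ?thesis unfolding has_period_def by blast
  qed
  show "has_period (deriv ?F) ?S \<omega>1 (\<alpha> * \<omega>1)" "has_period (deriv ?F) ?S \<omega>2 (\<alpha> * \<omega>2 - of_real r * a 1)"
    using gen[OF torus_lattice_2pi_i polar_sum_add(1)] gen[OF torus_lattice_2pi_i_tau polar_sum_add(2)] by auto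
qed

lemma polar_sum_expansion:
  assumes q1: "q < 1" and rD: "r < D / 2"
  shows "\<exists>c. \<forall>z. r * q < norm z \<and> norm z < r \<longrightarrow>
     polar_sum r \<alpha> a z = c + (\<Sum>\<^sub>\<infinity>k\<in>{1..}. a k / of_real (sqrt (real k)) * (of_real r / z) ^ k)
       + (\<Sum>\<^sub>\<infinity>l\<in>{1..}. ((if l = 1 then \<alpha> * of_real r else 0) - mat_vec (scaled_mat r \<tau>) a l) / of_real (sqrt (real l)) * (z / of_real r) ^ l)"
proof -
  let ?B = "scaled_mat r \<tau>"
  let ?c = "\<lambda>k. a k * of_real (r ^ k / sqrt (real k))"
  define c0 where "c0 = (\<Sum>\<^sub>\<infinity>k\<in>{1..}. ?c k * P_reg k 0)"
  have B1: "norm (?B k l) \<le> 1" if "k \<ge> 1" "l \<ge> 1" for k l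
    by (rule contraction_mat_entry[OF contraction_scaled_mat[OF r rD] that])
  have C: "C \<ge> 0"
  proof -
    have "0 \<le> C * q ^ 1" using a[of 1] norm_ge_zero order_trans by blast
    then show ?thesis using q by (simp add: zero_le_mult_iff)
  qed
  show ?thesis
  proof (intro exI[of _ c0] allI impI)
    fix z :: complex assume z: "r * q < norm z \<and> norm z < r"
    define p where "p = norm z / r"
    define \<theta> where "\<theta> = max p q"
    have "0 < r * q" using r q by simp
    then have nz: "0 < norm z" using z by linarith
    then have p: "0 < p" "p < 1" using z r by (auto simp: p_def)
    interpret geometric \<theta> using p q q1 by unfold_locales (auto simp: \<theta>_def)
    have z0: "z \<noteq> 0" using p by (auto simp: p_def)
    have zb: "z \<in> ball 0 D - {0}" using z z0 rD D_pos by auto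
    have zS: "z \<in> punctured_plane \<tau> (r * q)"
      using z rD infdist_lattice_near[OF torus_lattice_0, of z] by (simp add: punctured_plane_eq)
    have a\<theta>: "norm (a k) \<le> C * \<theta> ^ k" if "k \<ge> 1" for k
      using a[OF that] C q power_mono[of q \<theta> k] by (intro order_trans[OF a[OF that]] mult_left_mono) (auto simp: \<theta>_def)
    have ag: "geom_vec \<theta> a" using a\<theta> by (auto simp: geom_vec_def)
    have sq: "norm (1 / of_real (sqrt (real k)) :: complex) \<le> 1" if "k \<ge> 1" for k
      using that by (simp add: norm_divide)
    have p\<theta>: "norm ((z / of_real r) ^ l) \<le> \<theta> ^ l" for l
      unfolding norm_power using r p by (intro power_mono) (auto simp: norm_divide p_def \<theta>_def)
    define T where "T = (\<lambda>(k, l). - (a k * ?B l k) * (1 / of_real (sqrt (real l))) * (z / of_real r) ^ l)"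
    have Tb: "norm (T (k, l)) \<le> C * \<theta> ^ k * \<theta> ^ l" if "k \<ge> 1" "l \<ge> 1" for k l
    proof -
      have "norm (T (k, l)) = norm (a k) * norm (?B l k) * norm (1 / of_real (sqrt (real l)) :: complex) * norm ((z / of_real r) ^ l)"
        unfolding T_def prod.case norm_mult norm_minus_cancel ..
      also have "\<dots> \<le> (C * \<theta> ^ k) * 1 * 1 * \<theta> ^ l"
        using a\<theta>[OF that(1)] B1[OF that(2,1)] sq[OF that(2)] p\<theta>[of l] C theta
        by (intro mult_mono mult_nonneg_nonneg) auto
      finally show ?thesis by simp
    qed
    have Ts: "T summable_on {1..} \<times> {1..}" by (rule geom_product_summable[OF Tb])
    have P_reg_sum: "?c k * P_reg k z = ?c k * P_reg k 0 + (\<Sum>\<^sub>\<infinity>l\<in>{1..}. T (k, l))" if k: "k \<ge> 1" for k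
    proof -
      have "(\<lambda>l. (deriv ^^ l) (P_reg k) 0 / fact l * (z - 0) ^ l) sums P_reg k z"
        by (rule holomorphic_power_series[OF P_reg_holomorphic]) (use zb in auto)
      from sums_mult[OF this, of "?c k"]
      have 1: "(\<lambda>l. ?c k * ((deriv ^^ l) (P_reg k) 0 / fact l * z ^ l)) sums (?c k * P_reg k z)" by simp
      then have "(\<lambda>l. ?c k * ((deriv ^^ Suc l) (P_reg k) 0 / fact (Suc l) * z ^ Suc l)) sums (?c k * P_reg k z - ?c k * P_reg k 0)"
        by (subst sums_Suc_iff) simp
      moreover have "?c k * ((deriv ^^ Suc l) (P_reg k) 0 / fact (Suc l) * z ^ Suc l) = T (k, Suc l)" for l
      proof -
        have "sqrt (real (Suc l)) * sqrt (real (Suc l)) = real (Suc l)" by simp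
        then have s: "of_real (sqrt (real (Suc l))) * of_real (sqrt (real (Suc l))) = (of_nat (Suc l) :: complex)"
          by (metis of_real_mult of_real_of_nat_eq)
        have gen: "- (a k * (of_real (r ^ (k + L) / sqrt (real k * real L)) * m)) * (1 / of_real (sqrt (real L))) * (z / of_real r) ^ L
            = - (a k * of_real (r ^ k) / of_real (sqrt (real k)) * m) / (of_real (sqrt (real L)) * of_real (sqrt (real L))) * z ^ L" for L m
          using r by (simp add: real_sqrt_mult power_add power_divide field_simps)
        have "T (k, Suc l) = - (a k * (of_real (r ^ (k + Suc l) / sqrt (real k * real (Suc l))) * moment_mat \<tau> k (Suc l))) * (1 / of_real (sqrt (real (Suc l)))) * (z / of_real r) ^ Suc l"
          by (simp only: T_def prod.case scaled_mat_commute[of r \<tau> "Suc l" k]) (simp only: scaled_mat_def)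
        also have "\<dots> = - (a k * of_real (r ^ k) / of_real (sqrt (real k)) * moment_mat \<tau> k (Suc l)) / (of_real (sqrt (real (Suc l))) * of_real (sqrt (real (Suc l)))) * z ^ Suc l"
          by (rule gen)
        also have "\<dots> = ?c k * (- moment_mat \<tau> k (Suc l) / of_nat (Suc l) * z ^ Suc l)"
          unfolding s by (simp del: of_nat_Suc power_Suc)
        finally show ?thesis using P_reg_coeff[OF k, of "Suc l"] by (simp only: le_add1 plus_1_eq_Suc)
      qed
      ultimately have "(\<lambda>l. T (k, Suc l)) sums (?c k * P_reg k z - ?c k * P_reg k 0)" by (simp only:)
      moreover have "(\<lambda>l. T (k, Suc l)) sums (\<Sum>\<^sub>\<infinity>l\<in>{1..}. T (k, l))"
        by (rule sums_infsum_Suc[OF geom_abs_summable(2)[where K = "C * \<theta> ^ k"]]) (rule Tb[OF k])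
      ultimately show ?thesis using sums_unique2 by (metis add_diff_cancel_left' diff_add_cancel)
    qed
    have P_pole_sum: "?c k * P_pole k z = ?c k * P_reg k 0 + ?c k * (1 / z ^ k) + (\<Sum>\<^sub>\<infinity>l\<in>{1..}. T (k, l))" if "k \<ge> 1" for k
    proof -
      have "?c k * P_pole k z = ?c k * (1 / z ^ k) + ?c k * P_reg k z" unfolding P_pole_eq[OF zb that] by (rule distrib_left)
      then show ?thesis unfolding P_reg_sum[OF that] by (simp only: add_ac)
    qed
    have cb: "norm (?c k) \<le> C * (r * \<theta>) ^ k" if "k \<ge> 1" for k
    proof -
      have "norm (?c k) = norm (a k) * norm (1 / of_real (sqrt (real k)) :: complex) * r ^ k"
        using r by (simp add: norm_mult norm_divide norm_power)
      also have "\<dots> \<le> (C * \<theta> ^ k) * 1 * r ^ k"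
        using a\<theta>[OF that] sq[OF that] C theta r by (intro mult_mono mult_nonneg_nonneg) auto
      finally show ?thesis by (simp add: power_mult_distrib mult_ac)
    qed
    have pol_s: "(\<lambda>k. a k / of_real (sqrt (real k)) * (of_real r / z) ^ k) summable_on {1..}"
    proof -
      define q' where "q' = q * r / norm z"
      have q': "0 < q'" "q' < 1" using z r q z0 by (auto simp: q'_def divide_simps mult.commute)
      interpret Q: geometric q' using q' by unfold_locales
      have "norm (a k / of_real (sqrt (real k)) * (of_real r / z) ^ k) \<le> C * q' ^ k" if "k \<ge> 1" for k
      proof -
        have "norm (a k / of_real (sqrt (real k)) * (of_real r / z) ^ k) = norm (a k) * norm (1 / of_real (sqrt (real k)) :: complex) * (r / norm z) ^ k"
          using r by (simp add: norm_mult norm_divide norm_power)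
        also have "\<dots> \<le> (C * q ^ k) * 1 * (r / norm z) ^ k"
          using a[OF that] sq[OF that] C q r by (intro mult_mono mult_nonneg_nonneg) auto
        finally show ?thesis by (simp add: q'_def power_mult_distrib power_divide mult_ac)
      qed
      then show ?thesis by (rule Q.geom_abs_summable(2))
    qed
    have ct: "?c k * (1 / z ^ k) = a k / of_real (sqrt (real k)) * (of_real r / z) ^ k" for k
      by (simp add: power_divide)
    have T2: "(\<lambda>k. \<Sum>\<^sub>\<infinity>l\<in>{1..}. T (k, l)) summable_on {1..}"
      using summable_on_Sigma_banach[of "\<lambda>k l. T (k, l)" "{1..}" "\<lambda>_. {1..}"] Ts by simp
    have R0: "(\<lambda>k. ?c k * P_reg k 0) summable_on {1..}"
    proof -
      have Pf1: "(\<lambda>n. ?c (Suc n) * P_pole (Suc n) z) sums (polar_sum r \<alpha> a z - \<alpha> * z)"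
        by (rule polar_sum_sums[OF zS])
      obtain \<delta> M \<sigma> where b: "0 < \<delta>" "r * q < \<sigma>" "0 \<le> M" "\<And>y k. y \<in> ball z \<delta> \<Longrightarrow> k \<ge> 1 \<Longrightarrow> norm (P_pole k y) \<le> M / \<sigma> ^ k"
        using P_pole_bound[OF _ zS] r q by (metis mult_pos_pos)
      define q' where "q' = r * q / \<sigma>"
      have "0 < r * q" using r q by simp
      moreover from this have "0 < \<sigma>" using b(2) by linarith
      ultimately have q': "0 < q'" "q' < 1" using b(2) unfolding q'_def by (auto simp: divide_less_eq intro: divide_pos_pos)
      interpret Q: geometric q' using q' by unfold_locales
      have "norm (?c k * P_pole k z) \<le> (C * M) * q' ^ k" if "k \<ge> 1" for k
      proof -
        have "norm (?c k) = norm (a k) * norm (1 / of_real (sqrt (real k)) :: complex) * r ^ k"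
          using r by (simp add: norm_mult norm_divide norm_power)
        also have "\<dots> \<le> (C * q ^ k) * 1 * r ^ k"
          using a[OF that] sq[OF that] C q r by (intro mult_mono mult_nonneg_nonneg) auto
        finally have "norm (?c k * P_pole k z) \<le> ((C * q ^ k) * 1 * r ^ k) * (M / \<sigma> ^ k)"
          unfolding norm_mult[of "?c k"] using b(4)[of z k] that b(1) C q r by (intro mult_mono mult_nonneg_nonneg) auto
        then show ?thesis by (simp add: q'_def power_mult_distrib power_divide mult_ac)
      qed
      then have s1: "(\<lambda>k. ?c k * P_pole k z) summable_on {1..}" by (rule Q.geom_abs_summable(2))
      have "(\<lambda>k. ?c k * P_pole k z + (- 1) * (?c k * (1 / z ^ k)) + (- 1) * (\<Sum>\<^sub>\<infinity>l\<in>{1..}. T (k, l))) summable_on {1..}"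
        by (intro summable_on_add summable_on_cmult_right s1 T2) (use pol_s in \<open>simp only: ct\<close>)
      moreover have "?c k * P_pole k z + (- 1) * (?c k * (1 / z ^ k)) + (- 1) * (\<Sum>\<^sub>\<infinity>l\<in>{1..}. T (k, l)) = ?c k * P_reg k 0" if "k \<in> {1..}" for k
        using P_pole_sum[of k] that by simp
      ultimately show ?thesis using summable_on_cong by (metis (no_types, lifting))
    qed
    have "(\<Sum>\<^sub>\<infinity>k\<in>{1..}. ?c k * P_pole k z) = (\<Sum>\<^sub>\<infinity>k\<in>{1..}. ?c k * P_reg k 0 + ?c k * (1 / z ^ k) + (\<Sum>\<^sub>\<infinity>l\<in>{1..}. T (k, l)))"
      by (rule infsum_cong) (rule P_pole_sum, simp)
    also have "\<dots> = c0 + (\<Sum>\<^sub>\<infinity>k\<in>{1..}. ?c k * (1 / z ^ k)) + (\<Sum>\<^sub>\<infinity>k\<in>{1..}. \<Sum>\<^sub>\<infinity>l\<in>{1..}. T (k, l))"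
      unfolding c0_def
      by (subst infsum_add, intro summable_on_add R0, use pol_s in \<open>simp only: ct\<close>, rule T2, subst infsum_add[OF R0])
        (use pol_s in \<open>simp_all only: ct\<close>)
    also have "(\<Sum>\<^sub>\<infinity>k\<in>{1..}. \<Sum>\<^sub>\<infinity>l\<in>{1..}. T (k, l)) = (\<Sum>\<^sub>\<infinity>l\<in>{1..}. \<Sum>\<^sub>\<infinity>k\<in>{1..}. T (k, l))"
      using infsum_swap_banach[of "\<lambda>k l. T (k, l)" "{1..}" "{1..}"] Ts by simp
    also have "\<dots> = (\<Sum>\<^sub>\<infinity>l\<in>{1..}. - mat_vec ?B a l / of_real (sqrt (real l)) * (z / of_real r) ^ l)"
    proof (rule infsum_cong)
      fix l :: nat
      have "(\<Sum>\<^sub>\<infinity>k\<in>{1..}. T (k, l)) = (\<Sum>\<^sub>\<infinity>k\<in>{1..}. (- (1 / of_real (sqrt (real l))) * (z / of_real r) ^ l) * (?B l k * a k))"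
        by (simp add: T_def mult_ac)
      also have "\<dots> = (- (1 / of_real (sqrt (real l))) * (z / of_real r) ^ l) * mat_vec ?B a l"
        unfolding mat_vec_def by (rule infsum_cmult_right')
      finally show "(\<Sum>\<^sub>\<infinity>k\<in>{1..}. T (k, l)) = - mat_vec ?B a l / of_real (sqrt (real l)) * (z / of_real r) ^ l" by simp
    qed
    finally have main: "(\<Sum>\<^sub>\<infinity>k\<in>{1..}. ?c k * P_pole k z) = c0 + (\<Sum>\<^sub>\<infinity>k\<in>{1..}. ?c k * (1 / z ^ k))
      + (\<Sum>\<^sub>\<infinity>l\<in>{1..}. - mat_vec ?B a l / of_real (sqrt (real l)) * (z / of_real r) ^ l)" .
    have mvs: "(\<lambda>l. - mat_vec ?B a l / of_real (sqrt (real l)) * (z / of_real r) ^ l) summable_on {1..}"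
    proof -
      obtain K where K: "\<And>k. k \<ge> 1 \<Longrightarrow> norm (mat_vec ?B a k) \<le> K"
        using mat_vec_bounded[OF contraction_imp_bounded[OF contraction_scaled_mat[OF r rD]] ag] by blast
      have "norm (- mat_vec ?B a l / of_real (sqrt (real l)) * (z / of_real r) ^ l) \<le> K * \<theta> ^ l" if "l \<ge> 1" for l
      proof -
        have "norm (- mat_vec ?B a l / of_real (sqrt (real l)) * (z / of_real r) ^ l) =
            norm (mat_vec ?B a l) * norm (1 / of_real (sqrt (real l)) :: complex) * norm ((z / of_real r) ^ l)"
          by (simp add: norm_mult norm_divide)
        also have "\<dots> \<le> K * 1 * \<theta> ^ l"
          using K[OF that] sq[OF that] p\<theta>[of l] theta order_trans[OF norm_ge_zero K[OF that]]
          by (intro mult_mono mult_nonneg_nonneg) auto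
        finally show ?thesis by simp
      qed
      then show ?thesis by (rule geom_abs_summable(2))
    qed
    have lin: "((\<lambda>l. (if l = 1 then \<alpha> * of_real r else 0) / of_real (sqrt (real l)) * (z / of_real r) ^ l) has_sum \<alpha> * z) {1..}"
    proof -
      have "((\<lambda>l. (if l = 1 then \<alpha> * of_real r else 0) / of_real (sqrt (real l)) * (z / of_real r) ^ l) has_sum
         (\<Sum>l\<in>{1}. (if l = 1 then \<alpha> * of_real r else 0) / of_real (sqrt (real l)) * (z / of_real r) ^ l)) {1}"
        by (rule has_sum_finite) simp
      moreover have "(\<Sum>l\<in>{1}. (if l = 1 then \<alpha> * of_real r else 0) / of_real (sqrt (real l)) * (z / of_real r) ^ l) = \<alpha> * z"
        using r by simp
      ultimately show ?thesis by (subst has_sum_cong_neutral[where T = "{1}"]) auto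
    qed
    have "(\<Sum>\<^sub>\<infinity>l\<in>{1..}. ((if l = 1 then \<alpha> * of_real r else 0) - mat_vec ?B a l) / of_real (sqrt (real l)) * (z / of_real r) ^ l)
      = (\<Sum>\<^sub>\<infinity>l\<in>{1..}. (if l = 1 then \<alpha> * of_real r else 0) / of_real (sqrt (real l)) * (z / of_real r) ^ l
          + - mat_vec ?B a l / of_real (sqrt (real l)) * (z / of_real r) ^ l)"
      by (rule infsum_cong) (simp add: diff_divide_distrib left_diff_distrib)
    also have "\<dots> = \<alpha> * z + (\<Sum>\<^sub>\<infinity>l\<in>{1..}. - mat_vec ?B a l / of_real (sqrt (real l)) * (z / of_real r) ^ l)"
      using infsum_add[OF has_sum_imp_summable[OF lin] mvs] infsumI[OF lin] by simp
    finally have reg: "(\<Sum>\<^sub>\<infinity>l\<in>{1..}. ((if l = 1 then \<alpha> * of_real r else 0) - mat_vec ?B a l) / of_real (sqrt (real l)) * (z / of_real r) ^ l)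
      = \<alpha> * z + (\<Sum>\<^sub>\<infinity>l\<in>{1..}. - mat_vec ?B a l / of_real (sqrt (real l)) * (z / of_real r) ^ l)" .
    have PfS: "(\<lambda>k. ?c k * P_pole k z) summable_on {1..}"
    proof -
      have "(\<lambda>k. ?c k * P_reg k 0 + ?c k * (1 / z ^ k) + (\<Sum>\<^sub>\<infinity>l\<in>{1..}. T (k, l))) summable_on {1..}"
        by (intro summable_on_add R0 T2) (use pol_s in \<open>simp only: ct\<close>)
      moreover have "?c k * P_reg k 0 + ?c k * (1 / z ^ k) + (\<Sum>\<^sub>\<infinity>l\<in>{1..}. T (k, l)) = ?c k * P_pole k z" if "k \<in> {1..}" for k
        using P_pole_sum[of k] that by simp
      ultimately show ?thesis using summable_on_cong by (metis (no_types, lifting))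
    qed
    have "polar_sum r \<alpha> a z - \<alpha> * z = (\<Sum>\<^sub>\<infinity>k\<in>{1..}. ?c k * P_pole k z)"
      using sums_unique2[OF polar_sum_sums[OF zS] sums_infsum_Suc[OF PfS]] .
    then show "polar_sum r \<alpha> a z = c0 + (\<Sum>\<^sub>\<infinity>k\<in>{1..}. a k / of_real (sqrt (real k)) * (of_real r / z) ^ k)
       + (\<Sum>\<^sub>\<infinity>l\<in>{1..}. ((if l = 1 then \<alpha> * of_real r else 0) - mat_vec ?B a l) / of_real (sqrt (real l)) * (z / of_real r) ^ l)"
      unfolding main reg ct by (simp add: algebra_simps)
  qed
qed

end

end

context sewn_tori begin

lemma eps_radius: "norm \<epsilon> / r2 = r1 * norm t" "norm \<epsilon> / r1 = r2 * norm t"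
  using r by (simp_all add: t_def norm_divide norm_mult)

lemma avec_bound: "\<exists>C. \<forall>k\<ge>1. norm (avec1 \<alpha>1 \<alpha>2 k) \<le> C * norm t ^ k" "\<exists>C. \<forall>k\<ge>1. norm (avec2 \<alpha>1 \<alpha>2 k) \<le> C * norm t ^ k"
proof -
  obtain C1 C2 where "\<And>k. k \<ge> 1 \<Longrightarrow> norm (bvec1 \<alpha>1 \<alpha>2 k) \<le> C1" "\<And>k. k \<ge> 1 \<Longrightarrow> norm (bvec2 \<alpha>1 \<alpha>2 k) \<le> C2"
    using bvec_bounded by metis
  then have "norm (avec1 \<alpha>1 \<alpha>2 k) \<le> C2 * norm t ^ k" "norm (avec2 \<alpha>1 \<alpha>2 k) \<le> C1 * norm t ^ k" if "k \<ge> 1" for k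
    unfolding avec1_eq[OF that] avec2_eq[OF that] norm_mult norm_power
    using that by (subst mult.commute, intro mult_right_mono; simp)+
  then show "\<exists>C. \<forall>k\<ge>1. norm (avec1 \<alpha>1 \<alpha>2 k) \<le> C * norm t ^ k" "\<exists>C. \<forall>k\<ge>1. norm (avec2 \<alpha>1 \<alpha>2 k) \<le> C * norm t ^ k" by blast+
qed

abbreviation "F1 \<alpha>1 \<alpha>2 \<equiv> T1.polar_sum r1 \<alpha>1 (avec1 \<alpha>1 \<alpha>2)"
abbreviation "F2 \<alpha>1 \<alpha>2 \<equiv> T2.polar_sum r2 \<alpha>2 (avec2 \<alpha>1 \<alpha>2)"

context
  assumes eps0: "\<epsilon> \<noteq> 0"
begin

lemma t_nonzero: "t \<noteq> 0" and norm_t_pos: "0 < norm t"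
  using eps0 r by (simp_all add: t_def)

lemma polar_sum_glue:
  "\<exists>c. \<forall>z. r1 * norm t < norm z \<and> norm z < r1 \<longrightarrow> F1 \<alpha>1 \<alpha>2 z = F2 \<alpha>1 \<alpha>2 (\<epsilon> / z) + c"
proof -
  obtain C1 C2 where C: "\<And>k. k \<ge> 1 \<Longrightarrow> norm (avec1 \<alpha>1 \<alpha>2 k) \<le> C1 * norm t ^ k"
    "\<And>k. k \<ge> 1 \<Longrightarrow> norm (avec2 \<alpha>1 \<alpha>2 k) \<le> C2 * norm t ^ k" using avec_bound by metis
  obtain c1 where c1: "\<And>z. r1 * norm t < norm z \<and> norm z < r1 \<Longrightarrow> F1 \<alpha>1 \<alpha>2 z = c1 +
      (\<Sum>\<^sub>\<infinity>k\<in>{1..}. avec1 \<alpha>1 \<alpha>2 k / of_real (sqrt (real k)) * (of_real r1 / z) ^ k) +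
      (\<Sum>\<^sub>\<infinity>l\<in>{1..}. bvec1 \<alpha>1 \<alpha>2 l / of_real (sqrt (real l)) * (z / of_real r1) ^ l)"
    using T1.polar_sum_expansion[OF r(1) norm_t_pos C(1) norm_t r(2), of \<alpha>1] unfolding bvec1_def[symmetric] by blast
  obtain c2 where c2: "\<And>z. r2 * norm t < norm z \<and> norm z < r2 \<Longrightarrow> F2 \<alpha>1 \<alpha>2 z = c2 +
      (\<Sum>\<^sub>\<infinity>k\<in>{1..}. avec2 \<alpha>1 \<alpha>2 k / of_real (sqrt (real k)) * (of_real r2 / z) ^ k) +
      (\<Sum>\<^sub>\<infinity>l\<in>{1..}. bvec2 \<alpha>1 \<alpha>2 l / of_real (sqrt (real l)) * (z / of_real r2) ^ l)"
    using T2.polar_sum_expansion[OF r(3) norm_t_pos C(2) norm_t r(4), of \<alpha>2] unfolding bvec2_def[symmetric] by blast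
  have "F1 \<alpha>1 \<alpha>2 z = F2 \<alpha>1 \<alpha>2 (\<epsilon> / z) + (c1 - c2)" if z: "r1 * norm t < norm z" "norm z < r1" for z
  proof -
    have "0 < r1 * norm t" using r norm_t_pos by simp
    then have z0: "0 < norm z" "z \<noteq> 0" using z by auto
    have ne: "norm (\<epsilon> / z) = norm t * r1 * r2 / norm z" using r by (subst eps_eq) (simp add: norm_mult norm_divide)
    have "r2 * norm t < norm (\<epsilon> / z)" "norm (\<epsilon> / z) < r2"
      unfolding ne using z z0 r norm_t_pos by (auto simp: divide_simps mult_ac)
    then have f2: "F2 \<alpha>1 \<alpha>2 (\<epsilon> / z) = c2 +
        (\<Sum>\<^sub>\<infinity>k\<in>{1..}. avec2 \<alpha>1 \<alpha>2 k / of_real (sqrt (real k)) * (of_real r2 / (\<epsilon> / z)) ^ k) +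
        (\<Sum>\<^sub>\<infinity>l\<in>{1..}. bvec2 \<alpha>1 \<alpha>2 l / of_real (sqrt (real l)) * (\<epsilon> / z / of_real r2) ^ l)" using c2 by blast
    have e: "of_real r2 / (\<epsilon> / z) = (z / of_real r1) / t" "\<epsilon> / z / of_real r2 = t * (of_real r1 / z)"
      using r z0 t_nonzero by (subst eps_eq, simp add: field_simps)+
    have "(\<Sum>\<^sub>\<infinity>k\<in>{1..}. avec2 \<alpha>1 \<alpha>2 k / of_real (sqrt (real k)) * (of_real r2 / (\<epsilon> / z)) ^ k)
        = (\<Sum>\<^sub>\<infinity>l\<in>{1..}. bvec1 \<alpha>1 \<alpha>2 l / of_real (sqrt (real l)) * (z / of_real r1) ^ l)"
      unfolding e power_divide[of "z / of_real r1" t] using t_nonzero by (intro infsum_cong) (simp add: avec2_eq)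
    moreover have "(\<Sum>\<^sub>\<infinity>l\<in>{1..}. bvec2 \<alpha>1 \<alpha>2 l / of_real (sqrt (real l)) * (\<epsilon> / z / of_real r2) ^ l)
        = (\<Sum>\<^sub>\<infinity>k\<in>{1..}. avec1 \<alpha>1 \<alpha>2 k / of_real (sqrt (real k)) * (of_real r1 / z) ^ k)"
      unfolding e power_mult_distrib[of t] by (intro infsum_cong) (simp add: avec1_eq)
    ultimately show ?thesis using f2 c1[of z] z by simp
  qed
  then show ?thesis by blast
qed

lemma F1_holomorphic: "F1 \<alpha>1 \<alpha>2 holomorphic_on punctured_plane \<tau>1 (r1 * norm t)"
  using avec_bound(1)[of \<alpha>1 \<alpha>2] T1.polar_sum_holomorphic[OF r(1) norm_t_pos, of "avec1 \<alpha>1 \<alpha>2"] by blast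

lemma F2_holomorphic: "F2 \<alpha>1 \<alpha>2 holomorphic_on punctured_plane \<tau>2 (r2 * norm t)"
  using avec_bound(2)[of \<alpha>1 \<alpha>2] T2.polar_sum_holomorphic[OF r(3) norm_t_pos, of "avec2 \<alpha>1 \<alpha>2"] by blast

lemma annulus_in_punctured_plane2:
  assumes "r2 * norm t < norm z" "norm z < r2"
  shows "z \<in> punctured_plane \<tau>2 (r2 * norm t)"
  using assms r T2.infdist_lattice_near[OF torus_lattice_0, of z] by (simp add: T2.punctured_plane_eq)

lemma deriv_polar_sum_glue:
  assumes z: "r1 * norm t < norm z" "norm z < r1"
  shows "deriv (F1 \<alpha>1 \<alpha>2) z = deriv (F2 \<alpha>1 \<alpha>2) (\<epsilon> / z) * (- \<epsilon> / z\<^sup>2)"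
proof -
  obtain c where c: "\<And>z. r1 * norm t < norm z \<and> norm z < r1 \<Longrightarrow> F1 \<alpha>1 \<alpha>2 z = F2 \<alpha>1 \<alpha>2 (\<epsilon> / z) + c"
    using polar_sum_glue by blast
  have "0 < r1 * norm t" using r norm_t_pos by simp
  then have z0: "0 < norm z" "z \<noteq> 0" using z by auto
  have ne: "norm (\<epsilon> / z) = norm t * r1 * r2 / norm z" using r by (subst eps_eq) (simp add: norm_mult norm_divide)
  have w: "r2 * norm t < norm (\<epsilon> / z)" "norm (\<epsilon> / z) < r2"
    unfolding ne using z z0 r norm_t_pos by (auto simp: divide_simps mult_ac)
  have d2: "(F2 \<alpha>1 \<alpha>2 has_field_derivative deriv (F2 \<alpha>1 \<alpha>2) (\<epsilon> / z)) (at (\<epsilon> / z))"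
    by (rule holomorphic_derivI[OF F2_holomorphic T2.open_punctured_plane annulus_in_punctured_plane2[OF w]])
  have "((\<lambda>z. \<epsilon> / z) has_field_derivative - \<epsilon> / z\<^sup>2) (at z)"
    using z0 by (auto intro!: derivative_eq_intros simp: power2_eq_square)
  from DERIV_chain2[OF d2 this]
  have "((\<lambda>z. F2 \<alpha>1 \<alpha>2 (\<epsilon> / z) + c) has_field_derivative deriv (F2 \<alpha>1 \<alpha>2) (\<epsilon> / z) * (- \<epsilon> / z\<^sup>2) + 0) (at z)"
    by (intro DERIV_add DERIV_const)
  then have "(F1 \<alpha>1 \<alpha>2 has_field_derivative deriv (F2 \<alpha>1 \<alpha>2) (\<epsilon> / z) * (- \<epsilon> / z\<^sup>2) + 0) (at z)"
  proof (rule has_field_derivative_transform_within_open)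
    show "open ({z. r1 * norm t < norm z} \<inter> {z. norm z < r1})"
      by (intro open_Int open_Collect_less continuous_intros)
  qed (use z c in auto)
  then show ?thesis using DERIV_imp_deriv by simp
qed

end

end

lemma sewn_period_matrix_F_eps:
  fixes \<tau> :: "2 \<Rightarrow> complex" and r :: "2 \<Rightarrow> real"
  assumes "sewn_tori (\<tau> 1) (\<tau> 2) \<epsilon> (r 1) (r 2)" and e0: "\<epsilon> \<noteq> 0"
  shows "sewn_period_matrix \<tau> \<epsilon> r (F_eps (\<tau> 1, \<tau> 2, \<epsilon>))"
proof -
  interpret sewn_tori "\<tau> 1" "\<tau> 2" \<epsilon> "r 1" "r 2" by fact
  define \<alpha> :: "2 \<Rightarrow> 2 \<Rightarrow> complex" where "\<alpha> j i = (if i = j then 1 else 0)" for j i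
  define \<nu> where "\<nu> j i = (if i = 1 then deriv (F1 (\<alpha> j 1) (\<alpha> j 2)) else deriv (F2 (\<alpha> j 1) (\<alpha> j 2)))" for j i :: 2
  let ?S1 = "punctured_plane (\<tau> 1) (r 1 * norm t)" and ?S2 = "punctured_plane (\<tau> 2) (r 2 * norm t)"
  note tp = norm_t_pos[OF e0]
  have \<nu>: "\<nu> j 1 = deriv (F1 (\<alpha> j 1) (\<alpha> j 2))" "\<nu> j 2 = deriv (F2 (\<alpha> j 1) (\<alpha> j 2))" for j by (simp_all add: \<nu>_def)
  have form: "sewn_form \<tau> \<epsilon> r (\<nu> j)" for j
    unfolding sewn_form_def \<nu> eps_radius
  proof (intro conjI ballI allI impI)
    show "deriv (F1 (\<alpha> j 1) (\<alpha> j 2)) holomorphic_on ?S1" "deriv (F2 (\<alpha> j 1) (\<alpha> j 2)) holomorphic_on ?S2"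
      by (rule holomorphic_deriv[OF F1_holomorphic[OF e0] T1.open_punctured_plane],
          rule holomorphic_deriv[OF F2_holomorphic[OF e0] T2.open_punctured_plane])
    show "deriv (F1 (\<alpha> j 1) (\<alpha> j 2)) (z + w) = deriv (F1 (\<alpha> j 1) (\<alpha> j 2)) z"
      if "w \<in> torus_lattice (\<tau> 1)" "z \<in> ?S1" for z w
      using avec_bound(1)[of "\<alpha> j 1" "\<alpha> j 2"]
        T1.deriv_polar_sum_periodic[OF r(1) tp _ that, of "avec1 (\<alpha> j 1) (\<alpha> j 2)"] by blast
    show "deriv (F2 (\<alpha> j 1) (\<alpha> j 2)) (z + w) = deriv (F2 (\<alpha> j 1) (\<alpha> j 2)) z"
      if "w \<in> torus_lattice (\<tau> 2)" "z \<in> ?S2" for z w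
      using avec_bound(2)[of "\<alpha> j 1" "\<alpha> j 2"]
        T2.deriv_polar_sum_periodic[OF r(3) tp _ that, of "avec2 (\<alpha> j 1) (\<alpha> j 2)"] by blast
    show "deriv (F1 (\<alpha> j 1) (\<alpha> j 2)) z = deriv (F2 (\<alpha> j 1) (\<alpha> j 2)) (\<epsilon> / z) * (- \<epsilon> / z\<^sup>2)"
      if "r 1 * norm t < norm z \<and> norm z < r 1" for z
      by (rule deriv_polar_sum_glue[OF e0]) (use that in auto)
  qed
  have lt: "r 1 * norm t < lattice_min (\<tau> 1) / 2" "r 2 * norm t < lattice_min (\<tau> 2) / 2"
  proof -
    have "r 1 * norm t < r 1 * 1" "r 2 * norm t < r 2 * 1"
      by (rule mult_strict_left_mono[OF norm_t], use r in simp)+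
    then show "r 1 * norm t < lattice_min (\<tau> 1) / 2" "r 2 * norm t < lattice_min (\<tau> 2) / 2" using r by linarith+
  qed
  have per1: "has_period (\<nu> j 1) ?S1 (2 * of_real pi * \<i>) (\<alpha> j 1 * (2 * of_real pi * \<i>))"
    "has_period (\<nu> j 1) ?S1 (2 * of_real pi * \<i> * \<tau> 1)
       (\<alpha> j 1 * (2 * of_real pi * \<i> * \<tau> 1) - of_real (r 1) * avec1 (\<alpha> j 1) (\<alpha> j 2) 1)" for j
    unfolding \<nu> using avec_bound(1)[of "\<alpha> j 1" "\<alpha> j 2"]
      T1.has_period_polar_sum[OF r(1) tp _ lt(1), of "avec1 (\<alpha> j 1) (\<alpha> j 2)"] by blast+
  have per2: "has_period (\<nu> j 2) ?S2 (2 * of_real pi * \<i>) (\<alpha> j 2 * (2 * of_real pi * \<i>))"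
    "has_period (\<nu> j 2) ?S2 (2 * of_real pi * \<i> * \<tau> 2)
       (\<alpha> j 2 * (2 * of_real pi * \<i> * \<tau> 2) - of_real (r 2) * avec2 (\<alpha> j 1) (\<alpha> j 2) 1)" for j
    unfolding \<nu> using avec_bound(2)[of "\<alpha> j 1" "\<alpha> j 2"]
      T2.has_period_polar_sum[OF r(3) tp _ lt(2), of "avec2 (\<alpha> j 1) (\<alpha> j 2)"] by blast+
  let ?\<Omega> = "F_eps (\<tau> 1, \<tau> 2, \<epsilon>)"
  have \<Omega>: "\<alpha> j 1 * (2 * of_real pi * \<i> * \<tau> 1) - of_real (r 1) * avec1 (\<alpha> j 1) (\<alpha> j 2) 1 = 2 * of_real pi * \<i> * ?\<Omega> $ 1 $ j"
    "\<alpha> j 2 * (2 * of_real pi * \<i> * \<tau> 2) - of_real (r 2) * avec2 (\<alpha> j 1) (\<alpha> j 2) 1 = 2 * of_real pi * \<i> * ?\<Omega> $ 2 $ j" for j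
    using avec_1[of "\<alpha> j 1" "\<alpha> j 2"] exhaust_2[of j] by (auto simp: \<alpha>_def mult.commute)
  have a: "\<alpha> j i * (2 * of_real pi * \<i>) = (if i = j then 2 * of_real pi * \<i> else 0)" for i j by (simp add: \<alpha>_def)
  show ?thesis
    unfolding sewn_period_matrix_def Let_def
  proof (intro exI[of _ \<nu>] allI conjI form)
    fix j i :: 2
    show "has_period (\<nu> j i) (punctured_plane (\<tau> i) (norm \<epsilon> / r (if i = 1 then 2 else 1))) (2 * of_real pi * \<i>)
        (if i = j then 2 * of_real pi * \<i> else 0)"
      using per1(1)[of j, unfolded a] per2(1)[of j, unfolded a] exhaust_2[of i] by (auto simp: eps_radius)
    show "has_period (\<nu> j i) (punctured_plane (\<tau> i) (norm \<epsilon> / r (if i = 1 then 2 else 1))) (2 * of_real pi * \<i> * \<tau> i)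
        (2 * of_real pi * \<i> * ?\<Omega> $ i $ j)"
      using per1(2)[of j, unfolded \<Omega>] per2(2)[of j, unfolded \<Omega>] exhaust_2[of i] by (auto simp: eps_radius)
  qed
qed

section \<open>Modular transformations\<close>

context torus begin

lemma lattice_coordinates: "\<exists>x y. z = of_real x * \<omega>1 + of_real y * \<omega>2"
proof -
  define u where "u = z / \<omega>1"
  define x where "x = Re u - Im u / Im \<tau> * Re \<tau>"
  define y where "y = Im u / Im \<tau>"
  have u: "u = of_real x + of_real y * \<tau>"
    using Im_tau by (simp add: complex_eq_iff x_def y_def)
  have "z = u * \<omega>1" by (simp add: u_def)
  also have "\<dots> = of_real x * \<omega>1 + of_real y * \<omega>2" unfolding u by (simp add: algebra_simps)
  finally show ?thesis by blast
qed

lemma compact_fundamental_domain: "compact ((\<lambda>(x, y). of_real x * \<omega>1 + of_real y * \<omega>2) ` ({0..1 :: real} \<times> {0..1 :: real}))"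
  by (intro compact_continuous_image compact_Times compact_Icc)
    (auto simp: case_prod_unfold intro!: continuous_intros)

lemma reduce_to_fundamental_domain:
  "\<exists>w\<in>\<Lambda>. z - w \<in> (\<lambda>(x, y). of_real x * \<omega>1 + of_real y * \<omega>2) ` ({0..1 :: real} \<times> {0..1 :: real})"
proof -
  obtain x y where z: "z = of_real x * \<omega>1 + of_real y * \<omega>2" using lattice_coordinates by blast
  define w where "w = \<omega>1 * (of_int \<lfloor>y\<rfloor> * \<tau> + of_int \<lfloor>x\<rfloor>)"
  have "w \<in> \<Lambda>" unfolding w_def torus_lattice_def by blast
  moreover have "z - w = of_real (frac x) * \<omega>1 + of_real (frac y) * \<omega>2"
    by (simp add: z w_def frac_def algebra_simps)
  then have "z - w \<in> (\<lambda>(x, y). of_real x * \<omega>1 + of_real y * \<omega>2) ` ({0..1} \<times> {0..1})"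
    by (intro image_eqI[of _ _ "(frac x, frac y)"]) (auto simp: less_imp_le frac_lt_1)
  ultimately show ?thesis by blast
qed

lemma doubly_periodic_entire_constant:
  assumes f: "f holomorphic_on UNIV" and p: "\<And>z w. w \<in> \<Lambda> \<Longrightarrow> f (z + w) = f z"
  shows "\<exists>c. \<forall>z. f z = c"
proof -
  let ?K = "(\<lambda>(x, y). of_real x * \<omega>1 + of_real y * \<omega>2) ` ({0..1 :: real} \<times> {0..1 :: real})"
  have "range f \<subseteq> f ` ?K"
  proof clarify
    fix z
    obtain w where "w \<in> \<Lambda>" "z - w \<in> ?K" using reduce_to_fundamental_domain by blast
    then have "f z = f (z - w)" using p[of w "z - w"] by simp
    then show "f z \<in> f ` ?K" using \<open>z - w \<in> ?K\<close> by (simp only:) (rule imageI)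
  qed
  moreover have "compact (f ` ?K)"
    by (intro compact_continuous_image compact_fundamental_domain)
      (use holomorphic_on_imp_continuous_on[OF f] continuous_on_subset in blast)
  ultimately have "bounded (range f)" using compact_imp_bounded bounded_subset by blast
  from Liouville_theorem[OF f this] show ?thesis by (auto simp: constant_on_def)
qed

lemma P1_add_lattice:
  "z \<notin> \<Lambda> \<Longrightarrow> P1 (z + \<omega>1 * (of_int m * \<tau> + of_int n)) = P1 z - of_int m"
proof -
  assume z: "z \<notin> \<Lambda>"
  have inL: "\<omega>1 * (of_int m * \<tau> + of_int n) \<in> \<Lambda>" for m n unfolding torus_lattice_def by blast
  have 1: "P1 (z + \<omega>1 * of_int n) = P1 z" for z n
  proof (induction n rule: int_induct[where k = 0])
    case (step1 i)
    have "z + \<omega>1 * of_int (i + 1) = (z + \<omega>1 * of_int i) + \<omega>1" by (simp add: distrib_left)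
    then show ?case using step1 by (simp only: P1_add_omega1)
  next
    case (step2 i)
    have "z + \<omega>1 * of_int i = (z + \<omega>1 * of_int (i - 1)) + \<omega>1" by (simp add: right_diff_distrib)
    then show ?case using step2 by (simp only: P1_add_omega1)
  qed simp
  have 2: "P1 (z + \<omega>2 * of_int m) = P1 z - of_int m"
  proof (induction m rule: int_induct[where k = 0])
    case (step1 i)
    have n: "z + \<omega>2 * of_int i \<notin> \<Lambda>" using z lattice_add_iff[OF inL[of i 0], of z] by (simp add: mult_ac)
    have "z + \<omega>2 * of_int (i + 1) = (z + \<omega>2 * of_int i) + \<omega>2" by (simp add: distrib_left)
    then show ?case using step1 by (simp only: P1_add_omega2[OF n]) simp
  next
    case (step2 i)
    have n: "z + \<omega>2 * of_int (i - 1) \<notin> \<Lambda>" using z lattice_add_iff[OF inL[of "i - 1" 0], of z] by (simp add: mult_ac)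
    have "z + \<omega>2 * of_int i = (z + \<omega>2 * of_int (i - 1)) + \<omega>2" by (simp add: right_diff_distrib)
    then have "P1 (z + \<omega>2 * of_int i) = P1 (z + \<omega>2 * of_int (i - 1)) - 1" by (simp only: P1_add_omega2[OF n])
    then have "P1 (z + \<omega>2 * of_int (i - 1)) = P1 (z + \<omega>2 * of_int i) + 1" by (simp only: diff_add_cancel)
    then show ?case by (simp only: step2(2)) simp
  qed simp
  show ?thesis using 1[of "z + \<omega>2 * of_int m" n] 2 by (simp add: algebra_simps)
qed

end

locale torus_moebius = torus +
  fixes g :: "int^2^2"
  assumes g: "g \<in> carrier SL2Z"
begin

abbreviation "\<tau>' \<equiv> moebius_act g \<tau>"
abbreviation "j \<equiv> aut_factor g \<tau>"

sublocale T': torus \<tau>' by unfold_locales (rule moebius_upper_half_plane[OF g tau])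

lemma j_nonzero: "j \<noteq> 0" by (rule aut_factor_nonzero[OF g tau])

lemma det_g: "of_int (g$1$1) * of_int (g$2$2) - of_int (g$1$2) * of_int (g$2$1) = (1 :: complex)"
proof -
  have "g$1$1 * g$2$2 - g$1$2 * g$2$1 = 1" using g by (simp add: SL2Z_simps)
  then show ?thesis by (simp flip: of_int_mult of_int_diff)
qed

lemma tau'_j: "\<tau>' * j = of_int (g$1$1) * \<tau> + of_int (g$1$2)"
  using j_nonzero by (simp add: moebius_act_def)

lemma inverse_j: "1 / j = of_int (- g$2$1) * \<tau>' + of_int (g$1$1)"
proof -
  have "(of_int (- g$2$1) * \<tau>' + of_int (g$1$1)) * j = - of_int (g$2$1) * (\<tau>' * j) + of_int (g$1$1) * j"
    by (simp add: algebra_simps)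
  also have "\<dots> = of_int (g$1$1) * of_int (g$2$2) - of_int (g$1$2) * of_int (g$2$1)"
    unfolding tau'_j by (simp add: aut_factor_def algebra_simps)
  finally show ?thesis using j_nonzero by (simp add: det_g field_simps)
qed

lemma tau_div_j: "\<tau> / j = of_int (g$2$2) * \<tau>' + of_int (- g$1$2)"
proof -
  have "(of_int (g$2$2) * \<tau>' + of_int (- g$1$2)) * j = of_int (g$2$2) * (\<tau>' * j) - of_int (g$1$2) * j"
    by (simp add: algebra_simps)
  also have "\<dots> = (of_int (g$1$1) * of_int (g$2$2) - of_int (g$1$2) * of_int (g$2$1)) * \<tau>"
    unfolding tau'_j by (simp add: aut_factor_def algebra_simps)
  finally show ?thesis using j_nonzero by (simp add: det_g field_simps)
qed

lemma lattice'_mult_j: "w \<in> torus_lattice \<tau>' \<Longrightarrow> w * j \<in> \<Lambda>"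
  using lattice_moebius_subset[OF g tau] by blast

lemma div_j_notin: "z \<notin> \<Lambda> \<Longrightarrow> z / j \<notin> torus_lattice \<tau>'"
  using lattice'_mult_j[of "z / j"] j_nonzero by auto

lemma D'_eq: "lattice_min \<tau>' = D / norm j" by (rule lattice_min_moebius[OF g tau])

lemma div_j_ball: "z \<in> ball 0 D \<Longrightarrow> z / j \<in> ball 0 (lattice_min \<tau>')"
  using j_nonzero by (simp add: D'_eq norm_divide divide_strict_right_mono)

text \<open>The difference of the two functions has no poles, so its derivative is an entire doubly
  periodic function.\<close>

definition P1_diff :: "complex \<Rightarrow> complex" where "P1_diff z = T'.P1 (z / j) / j - P1 z"
definition P1_reg_diff :: "complex \<Rightarrow> complex" where "P1_reg_diff z = T'.P1_reg (z / j) / j - P1_reg z"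

lemma P1_diff_holomorphic: "P1_diff holomorphic_on - \<Lambda>"
proof -
  have "(\<lambda>z. T'.P1 (z / j)) holomorphic_on - \<Lambda>"
    by (rule holomorphic_on_compose_gen[OF _ T'.P1_holomorphic, unfolded o_def])
      (use div_j_notin j_nonzero in \<open>auto intro!: holomorphic_intros\<close>)
  then show ?thesis unfolding P1_diff_def using j_nonzero by (intro holomorphic_intros P1_holomorphic) auto
qed

lemma P1_reg_diff_holomorphic: "P1_reg_diff holomorphic_on ball 0 D"
proof -
  have "(\<lambda>z. T'.P1_reg (z / j)) holomorphic_on ball 0 D"
    by (rule holomorphic_on_compose_gen[OF _ T'.P1_reg_holomorphic, unfolded o_def])
      (use j_nonzero div_j_ball in \<open>auto intro!: holomorphic_intros simp del: mem_ball\<close>)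
  then show ?thesis unfolding P1_reg_diff_def using j_nonzero by (intro holomorphic_intros P1_reg_holomorphic) auto
qed

lemma P1_diff_eq_reg: "z \<noteq> 0 \<Longrightarrow> P1_diff z = P1_reg_diff z"
  using P1_eq[of z] T'.P1_eq[of "z / j"] j_nonzero by (simp add: P1_diff_def P1_reg_diff_def diff_divide_distrib add_divide_distrib)

lemma P1_diff_add:
  assumes "z \<notin> \<Lambda>"
  shows "P1_diff (z + \<omega>1) = P1_diff z + of_int (g$2$1) / j" "P1_diff (z + \<omega>2) = P1_diff z + (1 - of_int (g$2$2) / j)"
proof -
  have 1: "(z + \<omega>1) / j = z / j + \<omega>1 * (of_int (- g$2$1) * \<tau>' + of_int (g$1$1))"
    unfolding inverse_j[symmetric] by (simp add: add_divide_distrib)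
  have 2: "(z + \<omega>2) / j = z / j + \<omega>1 * (of_int (g$2$2) * \<tau>' + of_int (- g$1$2))"
    unfolding tau_div_j[symmetric] by (simp add: add_divide_distrib)
  show "P1_diff (z + \<omega>1) = P1_diff z + of_int (g$2$1) / j"
    unfolding P1_diff_def 1 T'.P1_add_lattice[OF div_j_notin[OF assms]] P1_add_omega1 by (simp add: diff_divide_distrib add_divide_distrib)
  show "P1_diff (z + \<omega>2) = P1_diff z + (1 - of_int (g$2$2) / j)"
    unfolding P1_diff_def 2 T'.P1_add_lattice[OF div_j_notin[OF assms]] P1_add_omega2[OF assms] by (simp add: diff_divide_distrib)
qed

lemma deriv_P1_diff_periodic:
  assumes z: "z \<notin> \<Lambda>" and w: "w \<in> \<Lambda>" shows "deriv P1_diff (z + w) = deriv P1_diff z"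
proof (rule lattice_periodic_on[where S = "- \<Lambda>", OF _ _ _ w])
  show "deriv P1_diff (z + \<omega>1) = deriv P1_diff z" "deriv P1_diff (z + \<omega>2) = deriv P1_diff z" if "z \<in> - \<Lambda>" for z
    by (rule deriv_periodic[OF P1_diff_holomorphic torus_lattice_2pi_i P1_diff_add(1)], assumption, use that in simp)
      (rule deriv_periodic[OF P1_diff_holomorphic torus_lattice_2pi_i_tau P1_diff_add(2)], assumption, use that in simp)
qed (use z lattice_add_iff in auto)

definition \<kappa> :: complex where "\<kappa> = of_int (g$2$1) / (\<omega>1 * j)"

lemma deriv_P1_diff_const: "\<exists>c. (\<forall>z. z \<notin> \<Lambda> \<longrightarrow> deriv P1_diff z = c) \<and> (\<forall>z\<in>ball 0 D. deriv P1_reg_diff z = c)"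
proof -
  have rr': "deriv P1_reg_diff holomorphic_on ball 0 D" by (rule holomorphic_deriv[OF P1_reg_diff_holomorphic open_ball])
  define W where "W z = (if z \<in> \<Lambda> then deriv P1_reg_diff 0 else deriv P1_diff z)" for z
  have VU: "deriv P1_diff z = deriv P1_reg_diff z" if "z \<in> ball 0 D - {0}" for z
  proof (rule deriv_cong_ev)
    have "eventually (\<lambda>y. y \<in> - {0}) (nhds z)" using that by (intro eventually_nhds_in_open) auto
    then show "eventually (\<lambda>y. P1_diff y = P1_reg_diff y) (nhds z)" by eventually_elim (simp add: P1_diff_eq_reg)
  qed simp
  have near: "W z = deriv P1_reg_diff (z - w)" if w: "w \<in> \<Lambda>" and z: "z \<in> ball w D" for w z
  proof (cases "z = w")
    case True
    then show ?thesis using w by (simp add: W_def)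
  next
    case False
    have zw: "z - w \<in> ball 0 D - {0}" using z False by (auto simp: dist_norm norm_minus_commute)
    then have n: "z - w \<notin> \<Lambda>" using lattice_min_le[of "z - w" \<tau>] by force
    then have "z \<notin> \<Lambda>" using lattice_add_iff[OF w, of "z - w"] by simp
    then show ?thesis using deriv_P1_diff_periodic[OF n w] VU[OF zw] by (simp add: W_def)
  qed
  have "W holomorphic_on UNIV"
  proof (rule holomorphic_on_UN_open[where I = "insert 0 \<Lambda>" and A = "\<lambda>w. - \<Lambda> \<union> ball w D", THEN holomorphic_on_subset])
    fix w assume "w \<in> insert 0 \<Lambda>"
    then have w: "w \<in> \<Lambda>" using torus_lattice_0 by auto
    show "W holomorphic_on - \<Lambda> \<union> ball w D"
    proof (rule holomorphic_on_Un)
      show "W holomorphic_on - \<Lambda>"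
        by (rule holomorphic_transform[OF holomorphic_deriv[OF P1_diff_holomorphic open_compl_lattice]]) (simp add: W_def)
      have "(\<lambda>z. deriv P1_reg_diff (z - w)) holomorphic_on ball w D"
        by (rule holomorphic_on_compose_gen[OF _ rr', unfolded o_def])
          (auto intro!: holomorphic_intros simp: dist_norm norm_minus_commute)
      then show "W holomorphic_on ball w D" by (rule holomorphic_transform) (simp add: near[OF w])
    qed (use open_compl_lattice in auto)
    show "open (- \<Lambda> \<union> ball w D)" using open_compl_lattice by auto
  next
    show "UNIV \<subseteq> (\<Union>w\<in>insert 0 \<Lambda>. - \<Lambda> \<union> ball w D)" using D_pos by auto
  qed
  moreover have "W (z + w) = W z" if "w \<in> \<Lambda>" for z w
    using deriv_P1_diff_periodic[OF _ that, of z] lattice_add_iff[OF that, of z] by (auto simp: W_def)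
  ultimately obtain c where c: "\<And>z. W z = c" using doubly_periodic_entire_constant by metis
  have "deriv P1_diff z = c" if "z \<notin> \<Lambda>" for z using c[of z] that by (simp add: W_def)
  moreover have "deriv P1_reg_diff z = c" if "z \<in> ball 0 D" for z using near[OF torus_lattice_0, of z] that c[of z] by simp
  ultimately show ?thesis by blast
qed

lemma deriv_P1_diff_eq: "\<forall>z. z \<notin> \<Lambda> \<longrightarrow> deriv P1_diff z = \<kappa>" "\<forall>z\<in>ball 0 D. deriv P1_reg_diff z = \<kappa>"
proof -
  obtain c where c: "\<And>z. z \<notin> \<Lambda> \<Longrightarrow> deriv P1_diff z = c" "\<And>z. z \<in> ball 0 D \<Longrightarrow> deriv P1_reg_diff z = c"
    using deriv_P1_diff_const by blast
  obtain p where p: "valid_path p" "path_image p \<subseteq> punctured_plane \<tau> (D / 4)" "pathfinish p = pathstart p + \<omega>1"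
    using connected_punctured_plane[OF _ torus_lattice_2pi_i, of "D / 4"] D_pos by auto
  have p': "path_image p \<subseteq> - \<Lambda>"
    using p(2) lattice_iff_infdist D_pos by (force simp: punctured_plane_eq)
  have 1: "((\<lambda>_. c) has_contour_integral P1_diff (pathfinish p) - P1_diff (pathstart p)) p"
  proof (rule contour_integral_primitive[OF _ p(1) p'])
    fix z assume "z \<in> - \<Lambda>"
    then show "(P1_diff has_field_derivative c) (at z within - \<Lambda>)"
      using holomorphic_derivI[OF P1_diff_holomorphic open_compl_lattice, of z] c(1)[of z] by simp
  qed
  have 2: "((\<lambda>_. c) has_contour_integral c * pathfinish p - c * pathstart p) p"
    by (rule contour_integral_primitive[OF _ p(1) subset_UNIV, where f = "\<lambda>z. c * z"]) (auto intro!: derivative_eq_intros)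
  have "pathstart p \<notin> \<Lambda>" using p' pathstart_in_path_image[of p] by auto
  from P1_diff_add(1)[OF this] has_contour_integral_unique[OF 1 2]
  have "c * \<omega>1 = of_int (g$2$1) / j" unfolding p(3) by (simp add: algebra_simps)
  then have "c = \<kappa>" using j_nonzero by (simp add: \<kappa>_def field_simps)
  with c show "\<forall>z. z \<notin> \<Lambda> \<longrightarrow> deriv P1_diff z = \<kappa>" "\<forall>z\<in>ball 0 D. deriv P1_reg_diff z = \<kappa>" by auto
qed

lemma eisenstein_moebius:
  assumes "k \<ge> 2"
  shows "eisenstein_E k \<tau>' = j ^ k * (eisenstein_E k \<tau> - (if k = 2 then \<kappa> else 0))"
proof -
  obtain n where n: "k = Suc (Suc n)" using assms by (metis One_nat_def Suc_1 Suc_le_D Suc_le_mono)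
  have "(deriv ^^ Suc n) P1_reg_diff 0 = (deriv ^^ n) (deriv P1_reg_diff) 0" by (simp add: funpow_Suc_right del: funpow.simps)
  also have "\<dots> = (deriv ^^ n) (\<lambda>_. \<kappa>) 0"
  proof (rule higher_deriv_cong_ev)
    have "eventually (\<lambda>y. y \<in> ball 0 D) (nhds 0)" using D_pos by (intro eventually_nhds_in_open) auto
    then show "eventually (\<lambda>y. deriv P1_reg_diff y = \<kappa>) (nhds 0)" by eventually_elim (use deriv_P1_diff_eq(2) in blast)
  qed simp
  finally have 1: "(deriv ^^ Suc n) P1_reg_diff 0 = (if n = 0 then \<kappa> else 0)" by simp
  have h1: "(\<lambda>z. T'.P1_reg (1 / j * z)) holomorphic_on ball 0 D"
    by (rule holomorphic_on_compose_gen[OF _ T'.P1_reg_holomorphic, unfolded o_def])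
      (use j_nonzero div_j_ball in \<open>auto intro!: holomorphic_intros simp del: mem_ball\<close>)
  have "(deriv ^^ Suc n) P1_reg_diff 0 = (deriv ^^ Suc n) (\<lambda>z. 1 / j * T'.P1_reg (1 / j * z) - P1_reg z) 0"
    by (simp add: P1_reg_diff_def[abs_def])
  also have "\<dots> = (deriv ^^ Suc n) (\<lambda>z. 1 / j * T'.P1_reg (1 / j * z)) 0 - (deriv ^^ Suc n) P1_reg 0"
    by (rule higher_deriv_diff[OF _ P1_reg_holomorphic open_ball]) (use D_pos h1 in \<open>auto intro!: holomorphic_intros simp: j_nonzero\<close>)
  also have "(deriv ^^ Suc n) (\<lambda>z. 1 / j * T'.P1_reg (1 / j * z)) 0 = 1 / j * (deriv ^^ Suc n) (\<lambda>z. T'.P1_reg (1 / j * z)) 0"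
    by (rule higher_deriv_cmult[OF h1 _ open_ball]) (use D_pos in auto)
  also have "(deriv ^^ Suc n) (\<lambda>z. T'.P1_reg (1 / j * z)) 0 = (1 / j) ^ Suc n * (deriv ^^ Suc n) T'.P1_reg (1 / j * 0)"
    by (rule higher_deriv_compose_linear[OF T'.P1_reg_holomorphic open_ball[of 0 D] open_ball])
      (use D_pos div_j_ball in \<open>auto simp del: mem_ball simp: centre_in_ball\<close>)
  finally have 2: "(deriv ^^ Suc n) P1_reg_diff 0 = (1 / j) ^ k * (deriv ^^ Suc n) T'.P1_reg 0 - (deriv ^^ Suc n) P1_reg 0"
    by (simp add: n del: funpow.simps)
  have "(if n = 0 then \<kappa> else 0) / fact (Suc n) = (1 / j) ^ k * ((deriv ^^ Suc n) T'.P1_reg 0 / fact (Suc n)) - (deriv ^^ Suc n) P1_reg 0 / fact (Suc n)"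
    unfolding 1[symmetric] 2 by (simp add: diff_divide_distrib del: funpow.simps fact_Suc)
  then have "(if n = 0 then \<kappa> else 0) / fact (Suc n) = eisenstein_E k \<tau> - (1 / j) ^ k * eisenstein_E k \<tau>'"
    unfolding T'.P1_reg_deriv P1_reg_deriv n by simp
  moreover have "(if n = 0 then \<kappa> else 0) / fact (Suc n) = (if k = 2 then \<kappa> else 0)" by (simp add: n)
  ultimately have "(1 / j) ^ k * eisenstein_E k \<tau>' = eisenstein_E k \<tau> - (if k = 2 then \<kappa> else 0)" by (simp add: algebra_simps)
  then have "j ^ k * ((1 / j) ^ k * eisenstein_E k \<tau>') = j ^ k * (eisenstein_E k \<tau> - (if k = 2 then \<kappa> else 0))" by (rule arg_cong)
  then show ?thesis using j_nonzero by (simp add: power_divide)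
qed

lemma moment_mat_moebius:
  assumes "k \<ge> 1" "l \<ge> 1"
  shows "moment_mat \<tau>' k l = j ^ (k + l) * (moment_mat \<tau> k l - (if k = 1 \<and> l = 1 then \<kappa> else 0))"
proof -
  have e: "eisenstein_E (k + l) \<tau>' = j ^ (k + l) * (eisenstein_E (k + l) \<tau> - (if k + l = 2 then \<kappa> else 0))"
    by (rule eisenstein_moebius) (use assms in simp)
  have i: "k + l = 2 \<longleftrightarrow> k = 1 \<and> l = 1" using assms by auto
  show ?thesis unfolding moment_mat_def e i by (auto simp: algebra_simps)
qed

end

locale moebius_sewn_tori = sewn_tori \<tau>1 \<tau>2 \<epsilon> r1 r2 + M: torus_moebius \<tau>1 g
  for \<tau>1 \<tau>2 \<epsilon> :: complex and r1 r2 :: real and g :: "int^2^2"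
begin

abbreviation "j \<equiv> aut_factor g \<tau>1"
abbreviation "u \<equiv> j / of_real (norm j)"

lemma u_nonzero: "u \<noteq> 0" and norm_u: "norm u = 1"
  using M.j_nonzero by (simp_all add: norm_divide)

sublocale N: sewn_tori "moebius_act g \<tau>1" \<tau>2 "\<epsilon> / j" "r1 / norm j" r2
proof unfold_locales
  have j: "norm j > 0" using M.j_nonzero by simp
  show "0 < r1 / norm j" "0 < r2" "r2 < lattice_min \<tau>2 / 2" using r j by auto
  show "r1 / norm j < lattice_min (moebius_act g \<tau>1) / 2"
    using divide_strict_right_mono[OF r(2) j] by (simp add: M.D'_eq)
  show "norm (\<epsilon> / j) < r1 / norm j * r2"
    using divide_strict_right_mono[OF eps j] by (simp add: norm_divide)
qed

lemma N_t: "N.t = t / u"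
  using M.j_nonzero by (simp add: N.t_def t_def)

lemma N_theta: "N.\<theta> = \<theta>"
  unfolding N.\<theta>_def \<theta>_def N_t norm_divide[of t u] norm_u by simp

lemma N_B1:
  assumes "k \<ge> 1" "l \<ge> 1"
  shows "N.B1 k l = u ^ (k + l) * (B1 k l - (if k = 1 \<and> l = 1 then of_real (r1\<^sup>2) * M.\<kappa> else 0))"
proof -
  have "N.B1 k l = of_real (r1 ^ (k + l) / sqrt (real k * real l)) * (u ^ (k + l)) *
      (moment_mat \<tau>1 k l - (if k = 1 \<and> l = 1 then M.\<kappa> else 0))"
    unfolding scaled_mat_def M.moment_mat_moebius[OF assms] by (simp add: power_divide mult_ac)
  also have "\<dots> = u ^ (k + l) * (B1 k l - of_real (r1 ^ (k + l) / sqrt (real k * real l)) * (if k = 1 \<and> l = 1 then M.\<kappa> else 0))"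
    unfolding scaled_mat_def by (simp only: algebra_simps)
  also have "of_real (r1 ^ (k + l) / sqrt (real k * real l)) * (if k = 1 \<and> l = 1 then M.\<kappa> else 0)
      = (if k = 1 \<and> l = 1 then of_real (r1\<^sup>2) * M.\<kappa> else 0)"
    by (auto simp: power2_eq_square)
  finally show ?thesis .
qed

definition K :: complex where "K = t * of_real (r1\<^sup>2) * M.\<kappa>"

lemma N_P:
  assumes w: "geom_vec \<theta> w" "\<And>k. k \<ge> 1 \<Longrightarrow> w' k = w k / u ^ k" and k: "k \<ge> 1"
  shows "mat_vec N.S.P w' k = mat_vec S.P w k - unit1 k * (K * w 1)"
proof -
  let ?e = "\<lambda>m :: nat. if m = 1 then - (unit1 k * (of_real (r1\<^sup>2) * M.\<kappa> * w 1)) else 0"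
  have e: "(?e has_sum - unit1 k * (of_real (r1\<^sup>2) * M.\<kappa> * w 1)) {1..}"
  proof -
    have "(?e has_sum (\<Sum>m\<in>{1}. ?e m)) {1}" by (rule has_sum_finite) simp
    then show ?thesis by (subst has_sum_cong_neutral[where T = "{1}"]) auto
  qed
  have "N.B1 k m * w' m = u ^ k * (B1 k m * w m + ?e m)" if "m \<in> {1..}" for m
  proof -
    have gen: "v ^ (k + m) * (b - x) * (y / v ^ m) = v ^ k * (b * y + - (x * y))" if "v \<noteq> 0" for v b x y :: complex
      using that by (simp add: power_add algebra_simps)
    have m: "m \<ge> 1" using that by simp
    have "- ((if k = 1 \<and> m = 1 then of_real (r1\<^sup>2) * M.\<kappa> else 0) * w m) = ?e m" by (auto simp: unit1_def)
    then show ?thesis unfolding N_B1[OF k m] w(2)[OF m] gen[OF u_nonzero] by (simp only:)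
  qed
  then have "mat_vec N.B1 w' k = (\<Sum>\<^sub>\<infinity>m\<in>{1..}. u ^ k * (B1 k m * w m + ?e m))"
    unfolding mat_vec_def by (rule infsum_cong)
  also have "\<dots> = u ^ k * (\<Sum>\<^sub>\<infinity>m\<in>{1..}. B1 k m * w m + ?e m)" by (rule infsum_cmult_right')
  also have "(\<Sum>\<^sub>\<infinity>m\<in>{1..}. B1 k m * w m + ?e m) = mat_vec B1 w k - unit1 k * (of_real (r1\<^sup>2) * M.\<kappa> * w 1)"
    unfolding mat_vec_def
    using infsum_add[OF S.mat_vec_summable[OF S.bounded(1) w(1) k] has_sum_imp_summable[OF e]] infsumI[OF e] by simp
  finally have m: "mat_vec N.B1 w' k = u ^ k * (mat_vec B1 w k - unit1 k * (of_real (r1\<^sup>2) * M.\<kappa> * w 1))" .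
  have "mat_vec N.S.P w' k = t ^ k * (mat_vec B1 w k - unit1 k * (of_real (r1\<^sup>2) * M.\<kappa> * w 1))"
    unfolding N.S.mat_vec_row_scale m N_t power_divide[of t u] using u_nonzero by (simp del: of_real_power divide_eq_0_iff)
  then show ?thesis by (auto simp: S.mat_vec_row_scale unit1_def K_def algebra_simps)
qed

lemma N_Q: "mat_vec N.S.Q a k = mat_vec S.Q a k / u ^ k"
  unfolding N.S.mat_vec_row_scale S.mat_vec_row_scale N_t power_divide[of t u] by simp

definition C :: complex where "C = 1 - K * mat_vec S.Q N.S.sol 1"

lemma geom_vec_N_sol: "geom_vec \<theta> N.S.sol" "geom_vec \<theta> N.W.S.sol"
  using N.S.geom_vec_sol N.geom_vec_W_sol by (simp_all only: N_theta)

lemma N_sol: "k \<ge> 1 \<Longrightarrow> N.S.sol k = C * S.sol k"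
proof (rule S.affine_fixpoint[OF geom_vec_N_sol(1)])
  fix k :: nat assume k: "k \<ge> 1"
  show "N.S.sol k = C * unit1 k + S.PQ N.S.sol k"
    unfolding C_def using N.S.sol_fixpoint[OF k] N_P[OF S.geom_vec_Q[OF geom_vec_N_sol(1)] N_Q k]
    by (simp add: algebra_simps)
qed

lemma C_eq: "C = 1 - K * C * mat_vec S.Q S.sol 1"
proof -
  have "mat_vec S.Q N.S.sol 1 = mat_vec S.Q (\<lambda>k. C * S.sol k) 1" by (rule S.mat_vec_cong) (rule N_sol)
  then show ?thesis using C_def by (simp add: S.mat_vec_cmult)
qed

text \<open>The perturbation of \<open>B1\<close> has rank one, so that the solution of the perturbed system is a
  combination of solutions of the original one.\<close>

lemma N_W_sol:
  shows "u * N.W.S.sol 1 = u * S.sol 1 * C"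
    "mat_vec N.S.P N.W.S.sol 1 = u * (mat_vec S.P W.S.sol 1 - K * (S.sol 1)\<^sup>2 * C)"
proof -
  define \<eta> where "\<eta> k = u ^ k * N.W.S.sol k" for k
  define \<zeta> where "\<zeta> k = \<eta> k + K * \<eta> 1 * mat_vec S.Q S.sol k" for k
  have sol\<eta>: "N.W.S.sol k = \<eta> k / u ^ k" for k using u_nonzero by (simp add: \<eta>_def)
  have g: "geom_vec \<theta> \<eta>"
    using geom_vec_N_sol(2) unfolding geom_vec_def \<eta>_def norm_mult norm_power norm_u by simp
  have gQ: "geom_vec \<theta> (mat_vec S.Q S.sol)" by (rule S.geom_vec_Q[OF S.geom_vec_sol])
  have g\<zeta>: "geom_vec \<theta> \<zeta>" unfolding \<zeta>_def by (intro S.geom_vec_add S.geom_vec_cmult g gQ)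
  have P\<eta>: "mat_vec N.S.P N.W.S.sol k = mat_vec S.P \<eta> k - K * \<eta> 1 * unit1 k" if "k \<ge> 1" for k
    using N_P[OF g sol\<eta> that] by (simp add: mult_ac)
  have P\<zeta>: "mat_vec S.P \<zeta> k = mat_vec S.P \<eta> k + K * \<eta> 1 * S.PQ S.sol k" if "k \<ge> 1" for k
    unfolding \<zeta>_def
    by (simp add: S.mat_vec_add[OF S.bounded(3) g S.geom_vec_cmult[OF gQ] that] S.mat_vec_cmult)
  have N1: "mat_vec N.S.P N.W.S.sol k = mat_vec S.P \<zeta> k - K * \<eta> 1 * S.sol k" if "k \<ge> 1" for k
    using P\<eta>[OF that] P\<zeta>[OF that] S.sol_fixpoint[OF that] by (simp add: algebra_simps)
  have \<zeta>: "\<zeta> k = u * W.S.sol k" if "k \<ge> 1" for k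
  proof (rule W.S.affine_fixpoint[OF _ _ that])
    show "geom_vec W.\<theta> \<zeta>" using g\<zeta> by (simp only: W_theta)
    fix k :: nat assume k: "k \<ge> 1"
    have "N.W.S.sol k = unit1 k + mat_vec N.S.Q (mat_vec N.S.P N.W.S.sol) k"
      using N.W.S.sol_fixpoint[OF k] by (simp only: N.W_t)
    also have "mat_vec N.S.Q (mat_vec N.S.P N.W.S.sol) k = mat_vec S.Q (mat_vec N.S.P N.W.S.sol) k / u ^ k" by (rule N_Q)
    also have "mat_vec S.Q (mat_vec N.S.P N.W.S.sol) k = mat_vec S.Q (\<lambda>k. mat_vec S.P \<zeta> k - K * \<eta> 1 * S.sol k) k"
      by (rule S.mat_vec_cong) (rule N1)
    also have "\<dots> = mat_vec S.Q (mat_vec S.P \<zeta>) k - K * \<eta> 1 * mat_vec S.Q S.sol k"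
      by (simp add: S.mat_vec_diff[OF S.bounded(4) S.geom_vec_P[OF g\<zeta>] S.geom_vec_cmult[OF S.geom_vec_sol] k] S.mat_vec_cmult)
    finally have "\<eta> k = u ^ k * unit1 k + (mat_vec S.Q (mat_vec S.P \<zeta>) k - K * \<eta> 1 * mat_vec S.Q S.sol k)"
      unfolding \<eta>_def[of k] using u_nonzero by (simp add: distrib_left del: divide_eq_0_iff)
    moreover have "u ^ k * unit1 k = u * unit1 k" by (simp add: unit1_def)
    ultimately have "\<zeta> k = u * unit1 k + mat_vec S.Q (mat_vec S.P \<zeta>) k"
      unfolding \<zeta>_def[of k] by simp
    then show "\<zeta> k = u * unit1 k + W.S.PQ \<zeta> k" by (simp only: W_t)
  qed
  have "C * (1 + K * mat_vec S.Q S.sol 1) = 1" using C_eq by (simp add: algebra_simps)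
  moreover have "\<eta> 1 * (1 + K * mat_vec S.Q S.sol 1) = u * S.sol 1"
    using \<zeta>[of 1] unfolding \<zeta>_def W_sol_1 by (simp add: algebra_simps)
  moreover have "\<eta> 1 * (C * (1 + K * mat_vec S.Q S.sol 1)) = \<eta> 1 * (1 + K * mat_vec S.Q S.sol 1) * C"
    by (simp only: mult_ac)
  ultimately have \<eta>1: "\<eta> 1 = u * S.sol 1 * C" by (simp only: mult_1_right)
  then show "u * N.W.S.sol 1 = u * S.sol 1 * C" by (simp add: \<eta>_def)
  have "mat_vec S.P \<zeta> 1 = mat_vec S.P (\<lambda>k. u * W.S.sol k) 1" by (rule S.mat_vec_cong) (rule \<zeta>)
  then have "mat_vec N.S.P N.W.S.sol 1 = u * mat_vec S.P W.S.sol 1 - K * (u * S.sol 1 * C) * S.sol 1"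
    using N1[of 1] unfolding \<eta>1 by (simp only: S.mat_vec_cmult order.refl)
  then show "mat_vec N.S.P N.W.S.sol 1 = u * (mat_vec S.P W.S.sol 1 - K * (S.sol 1)\<^sup>2 * C)"
    by (simp only: right_diff_distrib power2_eq_square mult_ac)
qed

lemma F_eps_moebius:
  defines "\<Omega> \<equiv> F_eps (\<tau>1, \<tau>2, \<epsilon>)" and "\<Omega>' \<equiv> F_eps (moebius_act g \<tau>1, \<tau>2, \<epsilon> / j)"
  defines "X \<equiv> of_int (g$2$1) * \<Omega> $ 1 $ 1 + of_int (g$2$2)"
  shows "X \<noteq> 0" "\<Omega>' $ 1 $ 1 * X = of_int (g$1$1) * \<Omega> $ 1 $ 1 + of_int (g$1$2)"
    "\<Omega>' $ 1 $ 2 * X = \<Omega> $ 1 $ 2" "\<Omega>' $ 2 $ 1 * X = \<Omega> $ 1 $ 2" "\<Omega> $ 2 $ 1 = \<Omega> $ 1 $ 2"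
    "\<Omega>' $ 2 $ 2 * X = \<Omega> $ 2 $ 2 * X - of_int (g$2$1) * (\<Omega> $ 1 $ 2)\<^sup>2"
proof -
  have nonzero_divide_mult: "a / v * v = a" if "v \<noteq> 0" for a v :: complex using that by simp
  define p :: complex where "p = 2 * of_real pi * \<i>"
  define c :: complex where "c = of_int (g$2$1)"
  define \<beta> where "\<beta> = mat_vec B2 S.sol 1"
  define b where "b = mat_vec B1 W.S.sol 1"
  define s where "s = S.sol 1"
  have p: "p \<noteq> 0" by (simp add: p_def)
  note j = M.j_nonzero
  have j_eq: "j = c * \<tau>1 + of_int (g$2$2)" by (simp add: aut_factor_def c_def)
  have \<kappa>: "M.\<kappa> = c / (p * j)" by (simp add: M.\<kappa>_def p_def c_def)
  have K: "K = t * (of_real r1)\<^sup>2 * c / (p * j)" by (simp add: K_def \<kappa>)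
  have E: "\<Omega> $ 1 $ 1 = \<tau>1 + (of_real r1 * t)\<^sup>2 * \<beta> / p" "\<Omega> $ 2 $ 2 = \<tau>2 + (of_real r2 * t)\<^sup>2 * b / p"
    "\<Omega> $ 1 $ 2 = - \<epsilon> * s / p" "\<Omega> $ 2 $ 1 = - \<epsilon> * s / p"
    using F_eps_entries by (simp_all add: \<Omega>_def p_def \<beta>_def b_def s_def)
  have CX: "C * X = j"
  proof -
    have "K * C * mat_vec S.Q S.sol 1 = c * (\<Omega> $ 1 $ 1 - \<tau>1) * C / j"
      unfolding E K S.mat_vec_row_scale \<beta>_def[symmetric] by (simp add: power2_eq_square)
    then have "C = 1 - c * (\<Omega> $ 1 $ 1 - \<tau>1) * C / j" using C_eq by simp
    then have "C * j = (1 - c * (\<Omega> $ 1 $ 1 - \<tau>1) * C / j) * j" by simp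
    then have "C * j + c * (\<Omega> $ 1 $ 1 - \<tau>1) * C = j" using j by (simp add: left_diff_distrib)
    then show ?thesis unfolding X_def c_def[symmetric] by (simp add: j_eq algebra_simps)
  qed
  then show "X \<noteq> 0" using j by auto
  have tj: "of_real (r1 / norm j) * N.t = of_real r1 * t / j"
    using j by (simp add: N_t)
  have \<beta>': "mat_vec B2 N.S.sol 1 = C * \<beta>"
  proof -
    have "mat_vec B2 N.S.sol 1 = mat_vec B2 (\<lambda>k. C * S.sol k) 1" by (rule S.mat_vec_cong) (rule N_sol)
    then show ?thesis by (simp add: S.mat_vec_cmult \<beta>_def)
  qed
  have E1: "\<Omega>' $ 1 $ 1 = moebius_act g \<tau>1 + C * (\<Omega> $ 1 $ 1 - \<tau>1) / j\<^sup>2"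
    unfolding \<Omega>'_def N.F_eps_entries tj \<beta>' E p_def[symmetric] by (simp add: power_divide mult_ac)
  have "\<Omega>' $ 1 $ 1 * X = moebius_act g \<tau>1 * X + (C * X) * (\<Omega> $ 1 $ 1 - \<tau>1) / j\<^sup>2"
    unfolding E1 by (simp add: distrib_right)
  also have "\<dots> = moebius_act g \<tau>1 * X + (\<Omega> $ 1 $ 1 - \<tau>1) / j"
    unfolding CX using j by (simp add: power2_eq_square)
  finally have "\<Omega>' $ 1 $ 1 * X * j = (moebius_act g \<tau>1 * j) * X + (\<Omega> $ 1 $ 1 - \<tau>1)"
    using j by (simp add: distrib_right)
  also have "\<dots> = (of_int (g$1$1) * \<Omega> $ 1 $ 1 + of_int (g$1$2)) * j
      + (\<Omega> $ 1 $ 1 - \<tau>1) * (1 - (of_int (g$1$1) * of_int (g$2$2) - of_int (g$1$2) * of_int (g$2$1)))"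
    unfolding M.tau'_j unfolding j_eq X_def c_def by (simp add: algebra_simps)
  also have "\<dots> = (of_int (g$1$1) * \<Omega> $ 1 $ 1 + of_int (g$1$2)) * j" unfolding M.det_g by simp
  finally show "\<Omega>' $ 1 $ 1 * X = of_int (g$1$1) * \<Omega> $ 1 $ 1 + of_int (g$1$2)" using j by simp
  have sol1: "N.S.sol 1 = C * s" using N_sol[of 1] by (simp add: s_def)
  have off: "(- (\<epsilon> / j) * (C * s) / p) * X = - \<epsilon> * s / p"
  proof -
    have "(- (\<epsilon> / j) * (C * s) / p) * X = (- \<epsilon> * s / p) * (C * X) / j" by (simp add: mult_ac)
    then show ?thesis unfolding CX using j by simp
  qed
  show "\<Omega>' $ 1 $ 2 * X = \<Omega> $ 1 $ 2" "\<Omega>' $ 2 $ 1 * X = \<Omega> $ 1 $ 2"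
    unfolding \<Omega>'_def N.F_eps_entries sol1 E p_def[symmetric] by (rule off)+
  show "\<Omega> $ 2 $ 1 = \<Omega> $ 1 $ 2" unfolding E ..
  have "N.t * mat_vec N.B1 N.W.S.sol 1 = u * (t * b - K * s\<^sup>2 * C)"
    using N_W_sol(2) unfolding N.S.mat_vec_row_scale S.mat_vec_row_scale b_def s_def power_one_right .
  then have "(of_real r2 * N.t)\<^sup>2 * mat_vec N.B1 N.W.S.sol 1 = (of_real r2)\<^sup>2 * N.t * (u * (t * b - K * s\<^sup>2 * C))"
    by (simp only: power2_eq_square mult_ac)
  also have "\<dots> = (of_real r2)\<^sup>2 * (N.t * u) * (t * b - K * s\<^sup>2 * C)" by (simp only: mult_ac)
  also have "N.t * u = t" unfolding N_t by (rule nonzero_divide_mult[OF u_nonzero])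
  finally have M: "(of_real r2 * N.t)\<^sup>2 * mat_vec N.B1 N.W.S.sol 1 = (of_real r2)\<^sup>2 * t * (t * b - K * s\<^sup>2 * C)" .
  have "\<epsilon>\<^sup>2 = (t * of_real r1 * of_real r2)\<^sup>2" by (rule arg_cong[OF eps_eq])
  then have q: "(\<Omega> $ 1 $ 2)\<^sup>2 = (t * of_real r1 * of_real r2)\<^sup>2 * s\<^sup>2 / p\<^sup>2"
    unfolding E(3) power_divide power_mult_distrib[of "- \<epsilon>" s] power2_minus by (simp only:)
  have alg: "y\<^sup>2 * T * (T * b - T * x\<^sup>2 * c / (p * J) * s\<^sup>2 * C) / p = (y * T)\<^sup>2 * b / p - c * ((T * x * y)\<^sup>2 * s\<^sup>2 / p\<^sup>2) * (C / J)"
    if "J \<noteq> 0" for x y T J :: complex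
    using p that by (simp add: field_simps power2_eq_square)
  have \<Omega>22': "\<Omega>' $ 2 $ 2 = \<Omega> $ 2 $ 2 - c * (\<Omega> $ 1 $ 2)\<^sup>2 * (C / j)"
    unfolding \<Omega>'_def N.F_eps_entries M q E(2) K p_def[symmetric] alg[OF j] by (simp only: add_diff_eq)
  have "\<Omega>' $ 2 $ 2 * X = \<Omega> $ 2 $ 2 * X - c * (\<Omega> $ 1 $ 2)\<^sup>2 * (C * X) / j"
    unfolding \<Omega>22' by (simp add: algebra_simps)
  then show "\<Omega>' $ 2 $ 2 * X = \<Omega> $ 2 $ 2 * X - of_int (g$2$1) * (\<Omega> $ 1 $ 2)\<^sup>2"
    unfolding CX c_def using j by simp
qed

end

section \<open>Equivariance\<close>

lemma (in sewn_tori) F_eps_swap: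
  "F_eps (\<tau>2, \<tau>1, \<epsilon>) $ 1 $ 1 = F_eps (\<tau>1, \<tau>2, \<epsilon>) $ 2 $ 2" "F_eps (\<tau>2, \<tau>1, \<epsilon>) $ 2 $ 2 = F_eps (\<tau>1, \<tau>2, \<epsilon>) $ 1 $ 1"
  "F_eps (\<tau>2, \<tau>1, \<epsilon>) $ 1 $ 2 = F_eps (\<tau>1, \<tau>2, \<epsilon>) $ 1 $ 2" "F_eps (\<tau>2, \<tau>1, \<epsilon>) $ 2 $ 1 = F_eps (\<tau>1, \<tau>2, \<epsilon>) $ 2 $ 1"
  using F_eps_entries W.F_eps_entries by (simp_all only: W_t S.sol_swap)

lemma matrix_add_rdistrib:
  fixes A :: "'a::semiring_1^'n^'m" shows "(A + B) ** C = A ** C + B ** C"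
  by (simp add: matrix_matrix_mult_def vec_eq_iff distrib_right sum.distrib)

lemma matrix_inv_right:
  fixes A :: "'a::semiring_1^'n^'m"
  assumes "invertible A" shows "A ** matrix_inv A = mat 1"
  using someI_ex[OF assms[unfolded invertible_def]] unfolding matrix_inv_def by blast

definition block :: "(2 \<Rightarrow> 4) \<Rightarrow> (2 \<Rightarrow> 4) \<Rightarrow> int^4^4 \<Rightarrow> complex^2^2" where
  "block f g M = (\<chi> i j. of_int (M $ f i $ g j))"

definition siegel_num :: "int^4^4 \<Rightarrow> complex^2^2 \<Rightarrow> complex^2^2" where
  "siegel_num M \<Omega> = block siegel_lo siegel_lo M ** \<Omega> + block siegel_lo siegel_hi M"

definition siegel_den :: "int^4^4 \<Rightarrow> complex^2^2 \<Rightarrow> complex^2^2" where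
  "siegel_den M \<Omega> = block siegel_hi siegel_lo M ** \<Omega> + block siegel_hi siegel_hi M"

lemma siegel_act_eq: "siegel_act M \<Omega> = siegel_num M \<Omega> ** matrix_inv (siegel_den M \<Omega>)"
  by (simp add: siegel_act_def siegel_num_def siegel_den_def block_def)

lemma block_mult: "block f g (M ** N) = block f siegel_lo M ** block siegel_lo g N + block f siegel_hi M ** block siegel_hi g N"
  by (simp add: block_def vec_eq_iff matrix_matrix_mult_def sum_2 sum_4 siegel_lo_def siegel_hi_def)

lemma block_mult_num_den:
  "block f siegel_lo (M ** N) ** \<Omega> + block f siegel_hi (M ** N) =
     block f siegel_lo M ** siegel_num N \<Omega> + block f siegel_hi M ** siegel_den N \<Omega>"
  by (simp add: block_mult siegel_num_def siegel_den_def matrix_add_ldistrib matrix_add_rdistrib matrix_mul_assoc add_ac)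

definition F_eps_intertwines :: "int^4^4 \<Rightarrow> (complex \<times> complex \<times> complex \<Rightarrow> complex \<times> complex \<times> complex) \<Rightarrow> bool" where
  "F_eps_intertwines M f \<longleftrightarrow> (\<forall>x\<in>D_eps. f x \<in> D_eps \<and> invertible (siegel_den M (F_eps x)) \<and>
     F_eps (f x) ** siegel_den M (F_eps x) = siegel_num M (F_eps x))"

lemma F_eps_intertwines_siegel_act:
  assumes "F_eps_intertwines M f" "x \<in> D_eps"
  shows "F_eps (f x) = siegel_act M (F_eps x)"
proof -
  let ?d = "siegel_den M (F_eps x)"
  have i: "invertible ?d" and e: "F_eps (f x) ** ?d = siegel_num M (F_eps x)"
    using assms by (auto simp: F_eps_intertwines_def)
  show ?thesis unfolding siegel_act_eq e[symmetric] matrix_mul_assoc[symmetric] matrix_inv_right[OF i] by simp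
qed

text \<open>The cocycle relation of the automorphy factor.\<close>

lemma F_eps_intertwines_mult:
  assumes M: "F_eps_intertwines M f" and N: "F_eps_intertwines N h"
  shows "F_eps_intertwines (M ** N) (f \<circ> h)"
  unfolding F_eps_intertwines_def
proof (intro ballI conjI)
  fix x assume x: "x \<in> D_eps"
  let ?y = "h x"
  have y: "?y \<in> D_eps" and iN: "invertible (siegel_den N (F_eps x))"
    and eN: "F_eps ?y ** siegel_den N (F_eps x) = siegel_num N (F_eps x)"
    using N x by (auto simp: F_eps_intertwines_def)
  have z: "f ?y \<in> D_eps" and iM: "invertible (siegel_den M (F_eps ?y))"
    and eM: "F_eps (f ?y) ** siegel_den M (F_eps ?y) = siegel_num M (F_eps ?y)"
    using M y by (auto simp: F_eps_intertwines_def)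
  have d: "siegel_den (M ** N) (F_eps x) = siegel_den M (F_eps ?y) ** siegel_den N (F_eps x)"
    unfolding siegel_den_def[of "M ** N"] block_mult_num_den eN[symmetric]
    by (simp add: siegel_den_def[of M] matrix_add_rdistrib matrix_mul_assoc)
  have n: "siegel_num (M ** N) (F_eps x) = siegel_num M (F_eps ?y) ** siegel_den N (F_eps x)"
    unfolding siegel_num_def[of "M ** N"] block_mult_num_den eN[symmetric]
    by (simp add: siegel_num_def[of M] matrix_add_rdistrib matrix_mul_assoc)
  show "(f \<circ> h) x \<in> D_eps" using z by simp
  show "invertible (siegel_den (M ** N) (F_eps x))" unfolding d by (rule invertible_mult[OF iM iN])
  show "F_eps ((f \<circ> h) x) ** siegel_den (M ** N) (F_eps x) = siegel_num (M ** N) (F_eps x)"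
    unfolding d n eM[symmetric] by (simp add: matrix_mul_assoc)
qed

lemma wr_act_D_eps:
  assumes "g \<in> carrier SL2Z" "h \<in> carrier SL2Z" "s \<in> {0, 1}" "x \<in> D_eps"
  shows "wr_act ((g, h), s) x \<in> D_eps"
  by (rule wr_act_closed) (use assms in \<open>auto simp: SL2Z_wr_Z2_simps\<close>)

lemma one_SL2Z: "mat 1 \<in> carrier SL2Z" by (simp add: SL2Z_def)

lemma F_eps_intertwines_beta: "F_eps_intertwines beta (wr_act ((mat 1, mat 1), 1))"
  unfolding F_eps_intertwines_def
proof (intro ballI conjI)
  fix x assume x: "x \<in> D_eps"
  then show "wr_act ((mat 1, mat 1), 1) x \<in> D_eps" by (intro wr_act_D_eps one_SL2Z) auto
  obtain \<tau>1 \<tau>2 \<epsilon> where x': "x = (\<tau>1, \<tau>2, \<epsilon>)" by (metis surj_pair)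
  obtain r1 r2 where "sewn_tori \<tau>1 \<tau>2 \<epsilon> r1 r2" using sewn_tori_exists x x' by blast
  then interpret sewn_tori \<tau>1 \<tau>2 \<epsilon> r1 r2 .
  have d: "siegel_den beta \<Omega> $ 1 $ 1 = 0" "siegel_den beta \<Omega> $ 1 $ 2 = 1" "siegel_den beta \<Omega> $ 2 $ 1 = 1" "siegel_den beta \<Omega> $ 2 $ 2 = 0" for \<Omega>
    by (simp_all add: siegel_den_def block_def siegel_lo_def siegel_hi_def beta_def nth_vector_4 matrix_matrix_mult_def sum_2)
  have n: "siegel_num beta \<Omega> $ 1 $ k = \<Omega> $ 2 $ k" "siegel_num beta \<Omega> $ 2 $ k = \<Omega> $ 1 $ k" for \<Omega> and k :: 2
    using exhaust_2[of k]
    by (auto simp: siegel_num_def block_def siegel_lo_def siegel_hi_def beta_def nth_vector_4 matrix_matrix_mult_def sum_2)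
  show "invertible (siegel_den beta (F_eps x))" by (simp add: invertible_det_nz det_2 d)
  show "F_eps (wr_act ((mat 1, mat 1), 1) x) ** siegel_den beta (F_eps x) = siegel_num beta (F_eps x)"
    by (simp add: vec_eq_iff forall_2 matrix_matrix_mult_def sum_2 d n x' F_eps_swap F_eps_entries(3,4))
qed

lemma F_eps_intertwines_Gamma1:
  assumes g: "g \<in> carrier SL2Z"
  shows "F_eps_intertwines (sp_embed g (mat 1)) (wr_act ((g, mat 1), 0))"
  unfolding F_eps_intertwines_def
proof (intro ballI conjI)
  fix x assume x: "x \<in> D_eps"
  then show "wr_act ((g, mat 1), 0) x \<in> D_eps" by (intro wr_act_D_eps one_SL2Z g) auto
  obtain \<tau>1 \<tau>2 \<epsilon> where x': "x = (\<tau>1, \<tau>2, \<epsilon>)" by (metis surj_pair)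
  obtain r1 r2 where s: "sewn_tori \<tau>1 \<tau>2 \<epsilon> r1 r2" using sewn_tori_exists x x' by blast
  interpret S: sewn_tori \<tau>1 \<tau>2 \<epsilon> r1 r2 by (rule s)
  interpret moebius_sewn_tori \<tau>1 \<tau>2 \<epsilon> r1 r2 g by unfold_locales (rule g)
  let ?\<Omega> = "F_eps (\<tau>1, \<tau>2, \<epsilon>)" and ?\<Omega>' = "F_eps (moebius_act g \<tau>1, \<tau>2, \<epsilon> / aut_factor g \<tau>1)"
  let ?M = "sp_embed g (mat 1)"
  define X where "X = of_int (g$2$1) * ?\<Omega> $ 1 $ 1 + of_int (g$2$2)"
  note F = F_eps_moebius[folded X_def]
  have d: "siegel_den ?M ?\<Omega> $ 1 $ 1 = X" "siegel_den ?M ?\<Omega> $ 1 $ 2 = of_int (g$2$1) * ?\<Omega> $ 1 $ 2"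
    "siegel_den ?M ?\<Omega> $ 2 $ 1 = 0" "siegel_den ?M ?\<Omega> $ 2 $ 2 = 1"
    by (simp_all add: X_def siegel_den_def block_def siegel_lo_def siegel_hi_def sp_embed_def nth_vector_4 matrix_matrix_mult_def sum_2 mat_def)
  have n: "siegel_num ?M ?\<Omega> $ 1 $ 1 = of_int (g$1$1) * ?\<Omega> $ 1 $ 1 + of_int (g$1$2)"
    "siegel_num ?M ?\<Omega> $ 1 $ 2 = of_int (g$1$1) * ?\<Omega> $ 1 $ 2"
    "siegel_num ?M ?\<Omega> $ 2 $ 1 = ?\<Omega> $ 2 $ 1" "siegel_num ?M ?\<Omega> $ 2 $ 2 = ?\<Omega> $ 2 $ 2"
    by (simp_all add: siegel_num_def block_def siegel_lo_def siegel_hi_def sp_embed_def nth_vector_4 matrix_matrix_mult_def sum_2 mat_def)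
  show "invertible (siegel_den ?M (F_eps x))" using F(1) by (simp add: invertible_det_nz det_2 d x')
  have e12: "?\<Omega>' $ 1 $ 1 * (of_int (g$2$1) * ?\<Omega> $ 1 $ 2) + ?\<Omega>' $ 1 $ 2 = of_int (g$1$1) * ?\<Omega> $ 1 $ 2"
  proof -
    have "(?\<Omega>' $ 1 $ 1 * (of_int (g$2$1) * ?\<Omega> $ 1 $ 2) + ?\<Omega>' $ 1 $ 2) * X =
        (?\<Omega>' $ 1 $ 1 * X) * (of_int (g$2$1) * ?\<Omega> $ 1 $ 2) + ?\<Omega>' $ 1 $ 2 * X" by (simp only: algebra_simps)
    also have "\<dots> = of_int (g$1$1) * ?\<Omega> $ 1 $ 2 * X
        + (1 - (of_int (g$1$1) * of_int (g$2$2) - of_int (g$1$2) * of_int (g$2$1))) * ?\<Omega> $ 1 $ 2"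
      unfolding F(2,3) unfolding X_def by (simp add: algebra_simps)
    also have "\<dots> = of_int (g$1$1) * ?\<Omega> $ 1 $ 2 * X" unfolding M.det_g by simp
    finally show ?thesis using F(1) by simp
  qed
  have e22: "?\<Omega>' $ 2 $ 1 * (of_int (g$2$1) * ?\<Omega> $ 1 $ 2) + ?\<Omega>' $ 2 $ 2 = ?\<Omega> $ 2 $ 2"
  proof -
    have "(?\<Omega>' $ 2 $ 1 * (of_int (g$2$1) * ?\<Omega> $ 1 $ 2) + ?\<Omega>' $ 2 $ 2) * X =
        (?\<Omega>' $ 2 $ 1 * X) * (of_int (g$2$1) * ?\<Omega> $ 1 $ 2) + ?\<Omega>' $ 2 $ 2 * X" by (simp only: algebra_simps)
    also have "\<dots> = ?\<Omega> $ 2 $ 2 * X" unfolding F(4,6) by (simp add: power2_eq_square)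
    finally show ?thesis using F(1) by simp
  qed
  have "wr_act ((g, mat 1), 0) x = (moebius_act g \<tau>1, \<tau>2, \<epsilon> / aut_factor g \<tau>1)" by (simp add: x')
  then show "F_eps (wr_act ((g, mat 1), 0) x) ** siegel_den ?M (F_eps x) = siegel_num ?M (F_eps x)"
    by (simp add: x' vec_eq_iff forall_2 matrix_matrix_mult_def sum_2 d n F(2,4,5) e12 e22)
qed

lemma F_eps_intertwines_cong:
  assumes "F_eps_intertwines M f" "M = N" "\<And>x. x \<in> D_eps \<Longrightarrow> f x = h x"
  shows "F_eps_intertwines N h"
  using assms by (auto simp: F_eps_intertwines_def)

lemma F_eps_intertwines_wr_embed:
  assumes "x \<in> carrier SL2Z_wr_Z2"
  shows "F_eps_intertwines (wr_embed x) (wr_act x)"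
proof -
  obtain g h s where x: "x = ((g, h), s)" and gh: "g \<in> carrier SL2Z" "h \<in> carrier SL2Z" and s: "s = 0 \<or> s = 1"
    using assms by (cases x) (auto simp: SL2Z_wr_Z2_simps)
  let ?b = "wr_act ((mat 1, mat 1), 1)"
  have "F_eps_intertwines (sp_embed g (mat 1) ** (beta ** (sp_embed h (mat 1) ** beta)))
      (wr_act ((g, mat 1), 0) \<circ> (?b \<circ> (wr_act ((h, mat 1), 0) \<circ> ?b)))"
    by (intro F_eps_intertwines_mult F_eps_intertwines_beta F_eps_intertwines_Gamma1 gh)
  then have 0: "F_eps_intertwines (sp_embed g h) (wr_act ((g, h), 0))"
  proof (rule F_eps_intertwines_cong)
    have "beta ** (sp_embed h (mat 1) ** beta) = (beta ** sp_embed h (mat 1)) ** beta" by (simp add: matrix_mul_assoc)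
    also have "\<dots> = sp_embed (mat 1) h ** (beta ** beta)" by (simp only: beta_sp_embed matrix_mul_assoc)
    also have "\<dots> = sp_embed (mat 1) h" by (simp add: beta_beta)
    finally show "sp_embed g (mat 1) ** (beta ** (sp_embed h (mat 1) ** beta)) = sp_embed g h"
      by (simp add: sp_embed_mult)
    show "(wr_act ((g, mat 1), 0) \<circ> (?b \<circ> (wr_act ((h, mat 1), 0) \<circ> ?b))) x = wr_act ((g, h), 0) x" for x
      by (cases x) (simp add: mult.commute)
  qed
  show ?thesis
  proof (cases "s = 0")
    case True
    with 0 show ?thesis by (simp add: x)
  next
    case False
    with s have "s = 1" by simp
    from F_eps_intertwines_mult[OF 0 F_eps_intertwines_beta] show ?thesis
      unfolding x \<open>s = 1\<close> by (rule F_eps_intertwines_cong) auto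
  qed
qed

lemma F_eps_equivariant:
  assumes "\<gamma> \<in> carrier G_eps" "x \<in> D_eps"
  shows "F_eps (G_act \<gamma> x) = siegel_act \<gamma> (F_eps x)"
proof -
  obtain y where y: "y \<in> carrier SL2Z_wr_Z2" "\<gamma> = wr_embed y" using assms(1) wr_embed_image by blast
  show ?thesis
    unfolding y(2) G_act_wr_embed[OF y(1)]
    by (rule F_eps_intertwines_siegel_act[OF F_eps_intertwines_wr_embed[OF y(1)] assms(2)])
qed

theorem theorem4p6:
  shows "G_eps \<cong> SL2Z_wr_Z2 \<and>
    F_eps \<in> D_eps \<rightarrow> siegel_H2 \<and>
    (\<forall>\<tau> :: 2 \<Rightarrow> complex. \<forall>\<epsilon>. \<forall>r :: 2 \<Rightarrow> real.
       (\<tau> 1, \<tau> 2, \<epsilon>) \<in> D_eps \<and> \<epsilon> \<noteq> 0 \<and>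
       (\<forall>i. 0 < r i \<and> r i < 1/2 * lattice_min (\<tau> i)) \<and> norm \<epsilon> < r 1 * r 2
       \<longrightarrow> sewn_period_matrix \<tau> \<epsilon> r (F_eps (\<tau> 1, \<tau> 2, \<epsilon>))) \<and>
    (\<forall>\<gamma>\<in>carrier G_eps. \<forall>x\<in>D_eps. F_eps (G_act \<gamma> x) = siegel_act \<gamma> (F_eps x))"
proof (intro conjI allI ballI impI)
  show "G_eps \<cong> SL2Z_wr_Z2"
    using group.iso_sym[OF group_SL2Z_wr_Z2, of G_eps] wr_embed_iso by (auto simp: is_iso_def)
  show "F_eps \<in> D_eps \<rightarrow> siegel_H2"
  proof
    fix x assume x: "x \<in> D_eps"
    obtain \<tau>1 \<tau>2 \<epsilon> where x': "x = (\<tau>1, \<tau>2, \<epsilon>)" by (metis surj_pair)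
    obtain r1 r2 where "sewn_tori \<tau>1 \<tau>2 \<epsilon> r1 r2" using sewn_tori_exists x x' by blast
    then show "F_eps x \<in> siegel_H2" unfolding x' by (rule sewn_tori.F_eps_siegel)
  qed
  fix \<tau> :: "2 \<Rightarrow> complex" and \<epsilon> and r :: "2 \<Rightarrow> real"
  assume h: "(\<tau> 1, \<tau> 2, \<epsilon>) \<in> D_eps \<and> \<epsilon> \<noteq> 0 \<and>
       (\<forall>i. 0 < r i \<and> r i < 1/2 * lattice_min (\<tau> i)) \<and> norm \<epsilon> < r 1 * r 2"
  then have "sewn_tori (\<tau> 1) (\<tau> 2) \<epsilon> (r 1) (r 2)"
    by unfold_locales (auto simp: D_eps_def)
  then show "sewn_period_matrix \<tau> \<epsilon> r (F_eps (\<tau> 1, \<tau> 2, \<epsilon>))"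
    using h by (intro sewn_period_matrix_F_eps) auto
qed (rule F_eps_equivariant)

end
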